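(* Let $K$ be a totally real number field, $\mathcal A$ a definite quaternion algebra over $K$, $\mathcal H$ a maximal $\mathcal O_K$-order in $\mathcal A$ of class number $1$ with $\operatorname{discrd}\mathcal H=\mathfrak D=\mathfrak p_1\cdots\mathfrak p_k$, and $\mathcal G\subseteq\mathcal H$ an $\mathcal H$-perceptive suborder of the kind $\mathfrak q$, i.e. $[\mathcal H:\mathcal G]_{\mathcal O_K}=\mathfrak q$ is a prime ideal not dividing $\mathfrak D$. Then for every totally positive $\alpha\in\mathcal O_K$, $$r_{\mathcal G}(\alpha)=2\#\mathcal G^1\sigma_{\mathfrak D}(\alpha)-\#\mathcal G^1\sigma_{\mathfrak q\mathfrak D}(\alpha).$$
   Context: Definite quaternion algebra: totally definite; $\operatorname{nrd}$ the reduced norm. Orders: finitely generated $\mathcal O_K$-submodules spanning $\mathcal A$ that are subrings with $1$. $\mathcal H^1,\mathcal G^1$: elements of reduced norm $1$. Class number: number of classes of lattices with right order $\mathcal H$ under $L\sim\mathbf xL$. For a maximal order, $\operatorname{discrd}\mathcal H$ equals the product of finite primes at which $\mathcal A$ ramifies. The $\mathcal O_K$-index $[\mathcal H:\mathcal G]_{\mathcal O_K}$ for $\mathcal G\subseteq\mathcal H$ is $I_1\cdots I_n$ where $\mathcal H/\mathcal G\cong\bigoplus\mathcal O_K/I_i$. $\mathcal G$ is $\mathcal H$-perceptive if every orbit $\mathcal H^1\mathbf q$, $\mathbf q\in\mathcal H$, meets $\mathcal G$. $r_{\mathcal G}(\alpha)=\#\{\mathbf q\in\mathcal G:\operatorname{nrd}\mathbf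 q=\alpha\}$. For an ideal $\mathfrak E$ with prime factors $\mathfrak p_1,\dots,\mathfrak p_r$, $\sigma_{\mathfrak E}(\alpha)=\sum\operatorname{Nm}(\delta\mathcal O_K)$ over ideals $\delta\mathcal O_K\mid\alpha\mathcal O_K$ divisible by no $\mathfrak p_i$; $\operatorname{Nm}$ is the absolute norm. *)

theory Defs
  imports "HOL-Analysis.Analysis" "HOL-Algebra.Ideal_Product" "HOL-Algebra.QuotRing"
begin

section \<open>Number fields\<close>

text \<open>
  A number field is a type \<open>'k\<close> of characteristic \<open>0\<close> that is finite-dimensional over the rationals.
\<close>

definition number_field :: "'k::field_char_0 itself \<Rightarrow> bool" where
  "number_field _ \<longleftrightarrow>
     (\<exists>B::'k set. finite B \<and> module.span (\<lambda>r x. of_rat r * x) B = UNIV)"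

definition field_embedding :: "('k::field \<Rightarrow> 'l::field) \<Rightarrow> bool" where
  "field_embedding \<sigma> \<longleftrightarrow>
     \<sigma> 1 = 1 \<and> (\<forall>x y. \<sigma> (x + y) = \<sigma> x + \<sigma> y) \<and> (\<forall>x y. \<sigma> (x * y) = \<sigma> x * \<sigma> y)"

definition totally_real :: "'k::field_char_0 itself \<Rightarrow> bool" where
  "totally_real _ \<longleftrightarrow> (\<forall>\<sigma> :: 'k \<Rightarrow> complex. field_embedding \<sigma> \<longrightarrow> range \<sigma> \<subseteq> \<real>)"

definition totally_positive :: "'k::field_char_0 \<Rightarrow> bool" where
  "totally_positive x \<longleftrightarrow> (\<forall>\<sigma> :: 'k \<Rightarrow> real. field_embedding \<sigma> \<longrightarrow> \<sigma> x > 0)"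

definition OK :: "'k::field_char_0 ring" where
  "OK = \<lparr>carrier = {x. algebraic_int x}, mult = (*), one = 1, ring.zero = 0, add = (+)\<rparr>"

definition ideal_dvd :: "'k::field_char_0 set \<Rightarrow> 'k set \<Rightarrow> bool" where
  "ideal_dvd I J \<longleftrightarrow> (\<exists>L. ideal L OK \<and> J = ideal_prod OK I L)"

definition ideal_list_prod :: "'k::field_char_0 set list \<Rightarrow> 'k set" where
  "ideal_list_prod Is = foldr (ideal_prod OK) Is (carrier OK)"

text \<open>As usual for rings of integers, the zero ideal is not counted as a prime.\<close>

definition prime_of_OK :: "'k::field_char_0 set \<Rightarrow> bool" where
  "prime_of_OK P \<longleftrightarrow> primeideal P OK \<and> P \<noteq> {0}"

definition ideal_norm :: "'k::field_char_0 set \<Rightarrow> nat" where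
  "ideal_norm I = card (carrier (OK Quot I))"

text \<open>The sum runs over principal ideals only, each counted once.\<close>

definition ideal_sigma :: "'k::field_char_0 set \<Rightarrow> 'k \<Rightarrow> nat" where
  "ideal_sigma E \<alpha> =
     (\<Sum>I\<in>{PIdl\<^bsub>OK\<^esub> \<delta> | \<delta>. \<delta> \<in> carrier OK \<and> ideal_dvd (PIdl\<^bsub>OK\<^esub> \<delta>) (PIdl\<^bsub>OK\<^esub> \<alpha>) \<and>
            (\<forall>P. prime_of_OK P \<and> ideal_dvd P E \<longrightarrow> \<not> ideal_dvd P (PIdl\<^bsub>OK\<^esub> \<delta>))}.
        ideal_norm I)"


section \<open>Quaternion algebras\<close>

text \<open>
  Throughout, \<open>s\<close> is the scalar multiplication of a \<open>'k\<close>-algebra on the ring \<open>'a\<close>.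
\<close>

definition quaternion_basis ::
  "('k::field_char_0 \<Rightarrow> 'a::ring_1 \<Rightarrow> 'a) \<Rightarrow> 'k \<Rightarrow> 'k \<Rightarrow> 'a \<Rightarrow> 'a \<Rightarrow> bool" where
  "quaternion_basis s a b i j \<longleftrightarrow>
     a \<noteq> 0 \<and> b \<noteq> 0 \<and> i * i = s a 1 \<and> j * j = s b 1 \<and> j * i = - (i * j) \<and>
     (\<forall>q. \<exists>!(t, x, y, z). q = s t 1 + s x i + s y j + s z (i * j))"

locale quaternion_algebra = vector_space s
  for s :: "'k::field_char_0 \<Rightarrow> 'a::ring_1 \<Rightarrow> 'a" +
  assumes scale_mult_left: "s c x * y = s c (x * y)"
    and scale_mult_right: "x * s c y = s c (x * y)"
    and ex_quaternion_basis: "\<exists>a b i j. quaternion_basis s a b i j"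

definition standard_involution :: "('k::field_char_0 \<Rightarrow> 'a::ring_1 \<Rightarrow> 'a) \<Rightarrow> ('a \<Rightarrow> 'a) \<Rightarrow> bool" where
  "standard_involution s c \<longleftrightarrow>
     (\<forall>x y. c (x + y) = c x + c y) \<and> (\<forall>k x. c (s k x) = s k (c x)) \<and> c 1 = 1 \<and>
     (\<forall>x. c (c x) = x) \<and> (\<forall>x y. c (x * y) = c y * c x) \<and> (\<forall>x. \<exists>n. x * c x = s n 1)"

text \<open>
  A quaternion algebra has exactly one standard involution; see \<open>standard_involution_unique\<close>
  and \<open>standard_involution_exists\<close> below.
\<close>

definition quat_conj :: "('k::field_char_0 \<Rightarrow> 'a::ring_1 \<Rightarrow> 'a) \<Rightarrow> 'a \<Rightarrow> 'a" where
  "quat_conj s = (THE c. standard_involution s c)"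

definition nrd :: "('k::field_char_0 \<Rightarrow> 'a::ring_1 \<Rightarrow> 'a) \<Rightarrow> 'a \<Rightarrow> 'k" where
  "nrd s q = (THE n. q * quat_conj s q = s n 1)"

definition trd :: "('k::field_char_0 \<Rightarrow> 'a::ring_1 \<Rightarrow> 'a) \<Rightarrow> 'a \<Rightarrow> 'k" where
  "trd s q = (THE t. q + quat_conj s q = s t 1)"

text \<open>
  Multiplication of the quaternion algebra \<open>(a, b / R)\<close> in coordinates \<open>t + x i + y j + z i j\<close>.
\<close>

fun quat_mult :: "'r::comm_ring \<Rightarrow> 'r \<Rightarrow> 'r \<times> 'r \<times> 'r \<times> 'r \<Rightarrow> 'r \<times> 'r \<times> 'r \<times> 'r \<Rightarrow> 'r \<times> 'r \<times> 'r \<times> 'r" where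
  "quat_mult a b (t, x, y, z) (t', x', y', z') =
     (t * t' + a * x * x' + b * y * y' - a * b * z * z',
      t * x' + x * t' - b * y * z' + b * z * y',
      t * y' + y * t' + a * x * z' - a * z * x',
      t * z' + z * t' + x * y' - y * x')"

text \<open>
  If the algebra is \<open>(a, b / K)\<close>, then its base change along \<open>\<sigma> : K \<rightarrow> \<real>\<close> is
  \<open>(\<sigma> a, \<sigma> b / \<real>)\<close>; total definiteness says that all of these are division algebras.
\<close>

definition totally_definite :: "('k::field_char_0 \<Rightarrow> 'a::ring_1 \<Rightarrow> 'a) \<Rightarrow> bool" where
  "totally_definite s \<longleftrightarrow>
     (\<exists>a b i j. quaternion_basis s a b i j \<and>
        (\<forall>\<sigma> :: 'k \<Rightarrow> real. field_embedding \<sigma> \<longrightarrow>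
           (\<forall>u. u \<noteq> (0, 0, 0, 0) \<longrightarrow> (\<exists>v. quat_mult (\<sigma> a) (\<sigma> b) u v = (1, 0, 0, 0)))))"


section \<open>Lattices and orders\<close>

definition lattice :: "('k::field_char_0 \<Rightarrow> 'a::ring_1 \<Rightarrow> 'a) \<Rightarrow> 'a set \<Rightarrow> bool" where
  "lattice s L \<longleftrightarrow>
     (\<exists>B. finite B \<and> L = {\<Sum>b\<in>B. s (c b) b | c. \<forall>b\<in>B. c b \<in> carrier OK}) \<and>
     module.span s L = UNIV"

definition quat_order :: "('k::field_char_0 \<Rightarrow> 'a::ring_1 \<Rightarrow> 'a) \<Rightarrow> 'a set \<Rightarrow> bool" where
  "quat_order s R \<longleftrightarrow> lattice s R \<and> 1 \<in> R \<and> (\<forall>x\<in>R. \<forall>y\<in>R. x * y \<in> R)"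

definition maximal_order :: "('k::field_char_0 \<Rightarrow> 'a::ring_1 \<Rightarrow> 'a) \<Rightarrow> 'a set \<Rightarrow> bool" where
  "maximal_order s H \<longleftrightarrow> quat_order s H \<and> (\<forall>R. quat_order s R \<and> H \<subseteq> R \<longrightarrow> R = H)"

definition right_order :: "'a::ring_1 set \<Rightarrow> 'a set" where
  "right_order L = {x. \<forall>l\<in>L. l * x \<in> L}"

definition class_number :: "('k::field_char_0 \<Rightarrow> 'a::ring_1 \<Rightarrow> 'a) \<Rightarrow> 'a set \<Rightarrow> nat" where
  "class_number s H =
     card ({L. lattice s L \<and> right_order L = H} //
           {(L, M). \<exists>x. (\<exists>y. x * y = 1 \<and> y * x = 1) \<and> M = (\<lambda>l. x * l) ` L})"

definition disc :: "('k::field_char_0 \<Rightarrow> 'a::ring_1 \<Rightarrow> 'a) \<Rightarrow> 'a set \<Rightarrow> 'k set" where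
  "disc s R = Idl\<^bsub>OK\<^esub> {det (\<chi> m n. trd s (e m * e n)) | e :: 4 \<Rightarrow> 'a. range e \<subseteq> R}"

text \<open>
  The reduced discriminant is the square root of the discriminant; it is unique
  because ideals of \<open>OK\<close> factor uniquely.
\<close>

definition is_discrd :: "('k::field_char_0 \<Rightarrow> 'a::ring_1 \<Rightarrow> 'a) \<Rightarrow> 'a set \<Rightarrow> 'k set \<Rightarrow> bool" where
  "is_discrd s R D \<longleftrightarrow> ideal D OK \<and> ideal_prod OK D D = disc s R"

definition add_coset :: "'a::ring_1 set \<Rightarrow> 'a \<Rightarrow> 'a set" where
  "add_coset G x = (\<lambda>g. x + g) ` G"

text \<open>
  \<open>is_OK_index s H G J\<close> says that \<open>[H : G] = J\<close>. The witness \<open>\<Phi>\<close> is an \<open>OK\<close>-linear bijection from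
  \<open>H / G\<close> onto the direct sum of the \<open>OK / I\<^sub>n\<close>; the scalar \<open>r\<close> acts on \<open>OK / I\<^sub>n\<close> as
  multiplication by its residue class.
\<close>

definition is_OK_index ::
  "('k::field_char_0 \<Rightarrow> 'a::ring_1 \<Rightarrow> 'a) \<Rightarrow> 'a set \<Rightarrow> 'a set \<Rightarrow> 'k set \<Rightarrow> bool" where
  "is_OK_index s H G J \<longleftrightarrow>
     (\<exists>Is \<Phi>. (\<forall>I\<in>set Is. ideal I OK) \<and>
        bij_betw \<Phi> (add_coset G ` H) (\<Pi>\<^sub>E n\<in>{..<length Is}. carrier (OK Quot (Is ! n))) \<and>
        (\<forall>x\<in>H. \<forall>y\<in>H. \<forall>n<length Is.
           \<Phi> (add_coset G (x + y)) n = \<Phi> (add_coset G x) n \<oplus>\<^bsub>OK Quot (Is ! n)\<^esub> \<Phi> (add_coset G y) n) \<and>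
        (\<forall>r\<in>carrier OK. \<forall>x\<in>H. \<forall>n<length Is.
           \<Phi> (add_coset G (s r x)) n =
             ((Is ! n) +>\<^bsub>OK\<^esub> r) \<otimes>\<^bsub>OK Quot (Is ! n)\<^esub> \<Phi> (add_coset G x) n) \<and>
        J = ideal_list_prod Is)"

definition norm_one :: "('k::field_char_0 \<Rightarrow> 'a::ring_1 \<Rightarrow> 'a) \<Rightarrow> 'a set \<Rightarrow> 'a set" where
  "norm_one s R = {q \<in> R. nrd s q = 1}"

definition perceptive :: "('k::field_char_0 \<Rightarrow> 'a::ring_1 \<Rightarrow> 'a) \<Rightarrow> 'a set \<Rightarrow> 'a set \<Rightarrow> bool" where
  "perceptive s H G \<longleftrightarrow> (\<forall>q\<in>H. \<exists>u\<in>norm_one s H. u * q \<in> G)"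

definition rep_count :: "('k::field_char_0 \<Rightarrow> 'a::ring_1 \<Rightarrow> 'a) \<Rightarrow> 'a set \<Rightarrow> 'k \<Rightarrow> nat" where
  "rep_count s G \<alpha> = card {q \<in> G. nrd s q = \<alpha>}"


section \<open>The standard involution in coordinates\<close>

definition of_coords :: "('k::field_char_0 \<Rightarrow> 'a::ring_1 \<Rightarrow> 'a) \<Rightarrow> 'a \<Rightarrow> 'a \<Rightarrow> 'k \<times> 'k \<times> 'k \<times> 'k \<Rightarrow> 'a" where
  "of_coords s i j = (\<lambda>(t, x, y, z). s t 1 + s x i + s y j + s z (i * j))"

context quaternion_algebra
begin

lemma scale_one_inject: "s m 1 = s n 1 \<longleftrightarrow> m = n"
  using scale_right_imp_eq[of "1::'a" m n] by auto

lemma of_coords_bij: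
  assumes "quaternion_basis s a b i j"
  shows "bij (of_coords s i j)"
proof -
  have "\<exists>!u. q = of_coords s i j u" for q
    using assms unfolding quaternion_basis_def of_coords_def
    by (simp add: case_prod_unfold)
  thus ?thesis unfolding bij_def inj_def surj_def by metis
qed

lemma of_coords_mult:
  assumes "quaternion_basis s a b i j"
  shows "of_coords s i j u * of_coords s i j v = of_coords s i j (quat_mult a b u v)"
proof -
  note B = assms[unfolded quaternion_basis_def]
  have ii: "i * i = s a 1" and jj: "j * j = s b 1" and ji: "j * i = - (i * j)"
    using B by blast+
  have iij: "i * (i * j) = s a j" by (metis ii mult.assoc mult_1 scale_mult_left)
  have iji: "(i * j) * i = - s a j"
    by (metis iij ji mult.assoc mult_minus_right)
  have ijj: "(i * j) * j = s b i" by (metis jj mult.assoc mult_1_right scale_mult_right)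
  have jij: "j * (i * j) = - s b i" by (metis ijj ji mult.assoc mult_minus_left)
  have ijij: "(i * j) * (i * j) = - s (a * b) 1"
  proof -
    have "(i * j) * (i * j) = i * (j * (i * j))" by (simp add: mult.assoc)
    also have "\<dots> = - s b (i * i)" by (simp add: jij scale_mult_right)
    finally show ?thesis by (simp add: ii mult.commute)
  qed
  obtain t x y z where u: "u = (t, x, y, z)" by (cases u)
  obtain t' x' y' z' where v: "v = (t', x', y', z')" by (cases v)
  show ?thesis
    unfolding u v of_coords_def prod.case quat_mult.simps
    by (simp only: distrib_left distrib_right scale_mult_left scale_mult_right mult_1 mult_1_right
        ii jj ji iij iji ijj jij ijij scale_minus_right scale_scale scale_left_distrib
        scale_left_diff_distrib)
       (simp add: algebra_simps)
qed

lemma standard_involution_exists: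
  assumes B: "quaternion_basis s a b i j"
  shows "\<exists>c. standard_involution s c \<and>
    (\<forall>t x y z. c (of_coords s i j (t, x, y, z)) = of_coords s i j (t, -x, -y, -z))"
proof -
  define F where "F = of_coords s i j"
  define g where "g = (\<lambda>(t::'k, x::'k, y::'k, z::'k). (t, -x, -y, -z))"
  define c where "c = (\<lambda>q. F (g (inv_into UNIV F q)))"
  have bij: "bij F" unfolding F_def by (rule of_coords_bij[OF B])
  have surj: "\<exists>u. q = F u" for q using bij by (metis bij_pointE)
  have cF: "c (F u) = F (g u)" for u unfolding c_def using bij by (simp add: bij_is_inj)
  have Fadd: "F (t, x, y, z) + F (t', x', y', z') = F (t + t', x + x', y + y', z + z')"
    for t x y z t' x' y' z'
    by (simp add: F_def of_coords_def scale_left_distrib)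
  have Fscale: "s k (F (t, x, y, z)) = F (k * t, k * x, k * y, k * z)" for k t x y z
    by (simp add: F_def of_coords_def scale_right_distrib)
  have Fmult: "F u * F v = F (quat_mult a b u v)" for u v
    unfolding F_def by (rule of_coords_mult[OF B])
  have F1: "s n 1 = F (n, 0, 0, 0)" for n by (simp add: F_def of_coords_def)
  have "standard_involution s c"
    unfolding standard_involution_def
  proof (intro conjI allI)
    fix p q k
    obtain t x y z where p: "p = F (t, x, y, z)" using surj[of p] by auto
    obtain t' x' y' z' where q: "q = F (t', x', y', z')" using surj[of q] by auto
    show "c (p + q) = c p + c q" by (simp add: p q Fadd cF g_def)
    show "c (s k p) = s k (c p)" by (simp add: p Fscale cF g_def)
    show "c (c p) = p" by (simp add: p cF g_def)
    show "c (p * q) = c q * c p"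
      by (simp add: p q Fmult cF g_def) (rule arg_cong[of _ _ F], simp add: algebra_simps)
    have "p * c p = F (t * t - a * x * x - b * y * y + a * b * z * z, 0, 0, 0)"
      unfolding p cF g_def prod.case Fmult
      by (rule arg_cong[of _ _ F]) (simp add: algebra_simps)
    thus "\<exists>n. p * c p = s n 1" unfolding F1 by blast
    show "c 1 = 1" using cF[of "(1, 0, 0, 0)"] F1[of 1] by (simp add: g_def)
  qed
  thus ?thesis using cF unfolding g_def F_def by auto
qed

lemma standard_involution_unique:
  assumes "standard_involution s c" "standard_involution s d"
  shows "c = d"
proof
  fix x
  have main: "\<exists>t n. f x = s t 1 - x \<and> x * x = s t x - s n 1" if f: "standard_involution s f" for f
  proof -
    note D = f[unfolded standard_involution_def]
    obtain n where n: "x * f x = s n 1" using D by blast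
    obtain m where m: "(1 + x) * f (1 + x) = s m 1" using D by blast
    have "(1 + x) * f (1 + x) = 1 + f x + x + x * f x" using D by (simp add: algebra_simps)
    hence "f x = s m 1 - s n 1 - s 1 1 - x" using m n by (simp add: algebra_simps)
    hence fx: "f x = s (m - n - 1) 1 - x" by (simp add: scale_left_diff_distrib)
    have "x * f x = s (m - n - 1) x - x * x" by (simp add: fx right_diff_distrib scale_mult_right)
    thus ?thesis using fx n by (metis add_diff_cancel_left' diff_add_cancel)
  qed
  obtain t n where 1: "c x = s t 1 - x" "x * x = s t x - s n 1" using main[OF assms(1)] by blast
  obtain t' n' where 2: "d x = s t' 1 - x" "x * x = s t' x - s n' 1" using main[OF assms(2)] by blast
  show "c x = d x"
  proof (cases "t = t'")
    case True thus ?thesis using 1 2 by simp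
  next
    case False
    have "s (t - t') x = s (n - n') 1"
      using 1(2) 2(2) by (simp add: scale_left_diff_distrib algebra_simps)
    hence "s (inverse (t - t')) (s (t - t') x) = s (inverse (t - t')) (s (n - n') 1)" by simp
    hence x: "x = s (inverse (t - t') * (n - n')) 1" using False by simp
    have "f x = x" if f: "standard_involution s f" for f
      using f x unfolding standard_involution_def by metis
    hence "c x = x" "d x = x" using assms by blast+
    thus ?thesis by (rule trans[OF _ sym])
  qed
qed

lemma quat_conj_of_coords:
  assumes "quaternion_basis s a b i j"
  shows "quat_conj s (of_coords s i j (t, x, y, z)) = of_coords s i j (t, -x, -y, -z)"
proof -
  obtain c where c: "standard_involution s c"
    "\<forall>t x y z. c (of_coords s i j (t, x, y, z)) = of_coords s i j (t, -x, -y, -z)"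
    using standard_involution_exists[OF assms] by blast
  have "quat_conj s = c" unfolding quat_conj_def
    using c(1) standard_involution_unique by blast
  thus ?thesis using c(2) by simp
qed

lemma nrd_of_coords:
  assumes "quaternion_basis s a b i j"
  shows "nrd s (of_coords s i j (t, x, y, z)) = t\<^sup>2 - a * x\<^sup>2 - b * y\<^sup>2 + a * b * z\<^sup>2"
proof -
  have "of_coords s i j (t, x, y, z) * quat_conj s (of_coords s i j (t, x, y, z)) =
        of_coords s i j (t\<^sup>2 - a * x\<^sup>2 - b * y\<^sup>2 + a * b * z\<^sup>2, 0, 0, 0)"
    unfolding quat_conj_of_coords[OF assms] of_coords_mult[OF assms]
    by (rule arg_cong[of _ _ "of_coords s i j"]) (simp add: power2_eq_square algebra_simps)
  also have "\<dots> = s (t\<^sup>2 - a * x\<^sup>2 - b * y\<^sup>2 + a * b * z\<^sup>2) 1" by (simp add: of_coords_def)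
  finally show ?thesis unfolding nrd_def by (simp add: scale_one_inject)
qed

lemma trd_of_coords:
  assumes "quaternion_basis s a b i j"
  shows "trd s (of_coords s i j (t, x, y, z)) = 2 * t"
proof -
  have "s t 1 + s t 1 = s (2 * t) 1" by (metis mult_2 scale_left_distrib)
  hence "of_coords s i j (t, x, y, z) + quat_conj s (of_coords s i j (t, x, y, z)) = s (2 * t) 1"
    unfolding quat_conj_of_coords[OF assms]
    by (simp add: of_coords_def)
  thus ?thesis unfolding trd_def by (simp add: scale_one_inject)
qed

end

end

theory Submission
  imports Defs "HOL-Computational_Algebra.Fundamental_Theorem_Algebra"
begin

text \<open>
  Class number one makes every left ideal \<open>I\<close> of \<open>H\<close> with \<open>P H \<subset> I \<subset> H\<close> principal, so every prime \<open>P\<close>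
  of \<open>K\<close> is generated by a reduced norm; hence every nonzero integer is a unit times a totally positive
  number, and a counting argument on the unit group then shows that totally positive units are squares.
  Therefore \<open>r\<^sub>H \<alpha>\<close> is \<open>#H\<^sup>1\<close> times the number of principal left ideals of norm \<open>\<alpha>\<close>. That number satisfies
  the Hecke recurrence, with \<open>Nm P + 1\<close> maximal left ideals over \<open>P\<close> if \<open>P\<close> does not divide the discriminant
  and one otherwise; so it is \<open>\<sigma>\<^sub>D \<alpha>\<close>.

  The suborder \<open>G\<close> contains a unique maximal left ideal \<open>J\<^sub>0\<close> of \<open>H\<close> over the prime \<open>Q\<close> and consists of the \<open>x \<in> H\<close>
  with \<open>J\<^sub>0 x \<subseteq> J\<^sub>0\<close>. Perceptivity says that \<open>H\<^sup>1\<close> permutes the \<open>Nm Q + 1\<close> maximal left ideals over \<open>Q\<close>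
  transitively, with stabilizer \<open>G\<^sup>1\<close>. Counting the pairs \<open>(u, x)\<close> with \<open>u \<in> H\<^sup>1\<close>, \<open>nrd x = \<alpha>\<close> and \<open>u x \<in> G\<close> gives
  \<open>(Nm Q + 1) r\<^sub>G \<alpha> = r\<^sub>H \<alpha> + Nm Q * r\<^sub>H (\<alpha> / \<pi>)\<close> for a totally positive generator \<open>\<pi>\<close> of \<open>Q\<close>, where the last
  term is absent if \<open>\<pi>\<close> does not divide \<open>\<alpha>\<close>.
\<close>

text \<open>The coefficients 2 and -1 arise as follows. Let N be the norm of Q, g the order of the
  norm one group of G, and \<beta> = \<alpha> / \<pi>. Transitivity gives (N + 1) g elements of norm
  one in H, so the final count reads r_G(\<alpha>) = g (\<sigma>_D(\<alpha>) + N
  \<sigma>_D(\<beta>)). Among the divisors counted by \<sigma>_D(\<alpha>), those contained in Q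
  contribute N \<sigma>_D(\<beta>) and the others \<sigma>_QD(\<alpha>); eliminating \<beta> gives
  the formula. The obstacle is that class number one speaks about H, whereas principal primes and
  signs of units concern K. To use it at a prime P, a left ideal strictly between P H and H must
  exist; it comes from a nontrivial zero of the norm form modulo P, found in three variables over a
  finite residue field. Localization is avoided: H / P H is shown to be large enough by a Nakayama
  argument with global coefficients. Either it has two maximal left ideals and then carries matrix
  units, or it has one and then its trace form degenerates; this dichotomy ties the number of left
  ideals to the discriminant.\<close>

section \<open>Nakayama elimination and algebraic integers\<close>

text \<open>Nakayama's lemma by Gaussian elimination. Elements of \<open>1 + P\<close> are nonzero
  because \<open>-1 \<notin> P\<close>, hence invertible in the field. The coefficient of
  \<open>f b0\<close> in its own relation stays in \<open>1 + P\<close>, so \<open>f b0\<close> can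
  be eliminated from the other relations, which keep their shape.\<close>

lemma (in vector_space) nakayama_elim:
  assumes "finite B"
    and P: "0 \<in> P" "\<And>x y. x \<in> P \<Longrightarrow> y \<in> P \<Longrightarrow> x + y \<in> P" "\<And>x. x \<in> P \<Longrightarrow> - x \<in> P"
      "\<And>x y. x \<in> P \<Longrightarrow> y \<in> P \<Longrightarrow> x * y \<in> P"
    and one: "-1 \<notin> P"
    and S: "subspace S"
    and c: "c - 1 \<in> P"
    and p: "\<And>b b'. b \<in> B \<Longrightarrow> b' \<in> B \<Longrightarrow> p b b' \<in> P"
    and rel: "\<And>b. b \<in> B \<Longrightarrow> scale c (f b) - (\<Sum>b'\<in>B. scale (p b b') (f b')) \<in> S"
    and "b \<in> B"
  shows "f b \<in> S"
  using assms(1) c p rel \<open>b \<in> B\<close>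
proof (induction B arbitrary: c p b rule: finite_induct)
  case empty
  then show ?case by simp
next
  case (insert b0 B)
  have nz: "d \<noteq> 0" if "d - 1 \<in> P" for d using that one by auto
  have mul: "d * e - 1 \<in> P" if "d - 1 \<in> P" "e - 1 \<in> P" for d e
  proof -
    have "d * e - 1 = (d - 1) * (e - 1) + (d - 1) + (e - 1)" by (simp add: algebra_simps)
    with that P show ?thesis by metis
  qed
  have scl: "d * x \<in> P" if "d - 1 \<in> P" "x \<in> P" for d x
  proof -
    have "d * x = (d - 1) * x + x" by (simp add: algebra_simps)
    with that P show ?thesis by metis
  qed
  define d where "d = c - p b0 b0"
  have d: "d - 1 \<in> P"
  proof -
    have "d - 1 = (c - 1) + - p b0 b0" unfolding d_def by simp
    thus ?thesis using P insert.prems by (metis insertI1)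
  qed
  have r0: "scale d (f b0) - (\<Sum>b'\<in>B. scale (p b0 b') (f b')) \<in> S"
    using insert.prems(3)[of b0] insert.hyps
    by (simp add: d_def scale_left_diff_distrib algebra_simps)
  \<comment> \<open>Cross-multiplication with the pivot \<open>d\<close> replaces division, so the
    new coefficients remain in \<open>P\<close> and the new leading one in
    \<open>1 + P\<close>.\<close>
  have IH: "f b \<in> S" if "b \<in> B" for b
  proof (rule insert.IH[of "d * c" "\<lambda>b b'. d * p b b' + p b b0 * p b0 b'"])
    show "d * c - 1 \<in> P" using d insert.prems(1) by (rule mul)
    show "d * p b b' + p b b0 * p b0 b' \<in> P" if "b \<in> B" "b' \<in> B" for b b'
      using that insert.prems(2) P scl[OF d] by simp
    show "b \<in> B" by fact
    fix b assume b: "b \<in> B"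
    have "scale d (scale c (f b) - (\<Sum>b'\<in>insert b0 B. scale (p b b') (f b')))
       + scale (p b b0) (scale d (f b0) - (\<Sum>b'\<in>B. scale (p b0 b') (f b'))) \<in> S"
      using S insert.prems(3)[of b] b r0 by (intro subspace_add subspace_scale) auto
    also have "scale d (scale c (f b) - (\<Sum>b'\<in>insert b0 B. scale (p b b') (f b')))
       + scale (p b b0) (scale d (f b0) - (\<Sum>b'\<in>B. scale (p b0 b') (f b')))
       = scale (d * c) (f b) - (\<Sum>b'\<in>B. scale (d * p b b' + p b b0 * p b0 b') (f b'))"
      using insert.hyps
      by (simp add: scale_right_diff_distrib scale_right_distrib scale_left_distrib sum.distrib
          scale_sum_right algebra_simps)
    finally show "scale (d * c) (f b) - (\<Sum>b'\<in>B. scale (d * p b b' + p b b0 * p b0 b') (f b')) \<in> S" .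
  qed
  show ?case
  proof (cases "b = b0")
    case True
    have "(\<Sum>b'\<in>B. scale (p b0 b') (f b')) \<in> S"
      using S IH by (intro subspace_sum subspace_scale) auto
    hence "scale d (f b0) \<in> S" using r0 S by (metis subspace_add diff_add_cancel)
    hence "scale (inverse d) (scale d (f b0)) \<in> S" by (rule subspace_scale[OF S])
    thus ?thesis using nz[OF d] True by simp
  next
    case False thus ?thesis using IH insert.prems(4) by simp
  qed
qed

interpretation Zm: module "\<lambda>(n::int) (x::'a::ring_1). of_int n * x"
  by standard (simp_all add: algebra_simps)

text \<open>Nakayama in place of a characteristic polynomial. For \<open>y = inverse x\<close> the
  set \<open>P\<close> is y Z[y], and the relations read w = y * (integer combination of
  \<open>W\<close>). If \<open>-1 \<notin> P\<close>, every \<open>w\<close> would vanish. So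
  \<open>1 + y * g y = 0\<close> for an integer polynomial \<open>g\<close>, and reversing the
  coefficients gives a monic equation for \<open>x\<close>.\<close>

lemma algebraic_int_eigenvalue:
  fixes x :: "'k::field_char_0" and scale :: "'k \<Rightarrow> 'b::ab_group_add \<Rightarrow> 'b"
  assumes vs: "vector_space scale" and W: "finite W" "w \<in> W" "w \<noteq> 0"
    and c: "\<And>w. w \<in> W \<Longrightarrow> scale x w = (\<Sum>w'\<in>W. scale (of_int (c w w')) w')"
  shows "algebraic_int x"
proof (cases "x = 0")
  case False
  interpret V: vector_space scale by (rule vs)
  define y where "y = inverse x"
  define P where "P = {poly (map_poly of_int (pCons 0 g)) y | g. True}"
  have ip: "poly (map_poly of_int (g + h)) y = poly (map_poly of_int g) y + poly (map_poly of_int h) y"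
    "poly (map_poly of_int (g * h)) y = poly (map_poly of_int g) y * poly (map_poly of_int h) y"
    "poly (map_poly of_int (- g)) y = - poly (map_poly of_int g) y" for g h :: "int poly"
  proof -
    have add: "poly (map_poly of_int (g + h)) y = poly (map_poly of_int g) y + poly (map_poly of_int h) y" for g h :: "int poly"
      by (induction g h rule: poly_induct2) (auto simp: map_poly_pCons algebra_simps)
    show "poly (map_poly of_int (g + h)) y = poly (map_poly of_int g) y + poly (map_poly of_int h) y"
      by (rule add)
    show "poly (map_poly of_int (g * h)) y = poly (map_poly of_int g) y * poly (map_poly of_int h) y" 
    proof (induction g)
      case (pCons a g)
      have "poly (map_poly of_int (smult a h)) y = of_int a * poly (map_poly of_int h) y" for a
        by (induction h) (auto simp: map_poly_pCons algebra_simps)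
      with pCons show ?case by (simp add: map_poly_pCons add algebra_simps)
    qed simp
    show "poly (map_poly of_int (- g)) y = - poly (map_poly of_int g) y"
      by (induction g) (auto simp: map_poly_pCons algebra_simps)
  qed
  have PI: "y * poly (map_poly of_int g) y \<in> P" for g
    unfolding P_def by (rule CollectI, rule exI[of _ g]) (simp add: map_poly_pCons)
  have PD: "\<exists>g. a = y * poly (map_poly of_int g) y" if "a \<in> P" for a
    using that unfolding P_def by (auto simp: map_poly_pCons)
  have "- 1 \<in> P"
  proof (rule ccontr)
    assume "- 1 \<notin> P"
    have "w \<in> {0}"
    proof (rule V.nakayama_elim[where P = P and B = W and f = "\<lambda>w. w" and c = 1
          and p = "\<lambda>w w'. y * of_int (c w w')"])
      show "0 \<in> P" using PI[of 0] by simp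
      show "a + b \<in> P" if ab: "a \<in> P" "b \<in> P" for a b
      proof -
        obtain g h where "a = y * poly (map_poly of_int g) y" "b = y * poly (map_poly of_int h) y"
          using ab[THEN PD] by blast
        thus ?thesis using PI[of "g + h"] by (simp add: ip algebra_simps)
      qed
      show "a * b \<in> P" if ab: "a \<in> P" "b \<in> P" for a b
      proof -
        obtain g h where "a = y * poly (map_poly of_int g) y" "b = y * poly (map_poly of_int h) y"
          using ab[THEN PD] by blast
        thus ?thesis using PI[of "g * pCons 0 h"] by (simp add: ip algebra_simps map_poly_pCons)
      qed
      show "- a \<in> P" if "a \<in> P" for a
        using PD[OF that] PI[of "- _"] by (auto simp: ip)
      show "y * of_int (c b b') \<in> P" for b b'
        using PI[of "[:c b b':]"] by (simp add: map_poly_pCons)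
      show "scale 1 w - (\<Sum>w'\<in>W. scale (y * of_int (c w w')) w') \<in> {0}" if "w \<in> W" for w
      proof -
        have "(\<Sum>w'\<in>W. scale (y * of_int (c w w')) w') = scale y (scale x w)"
          unfolding c[OF that] by (simp add: V.scale_sum_right)
        thus ?thesis using False by (simp add: y_def)
      qed
      show "(1::'k) - 1 \<in> P" using PI[of 0] by simp
    qed (use W \<open>- 1 \<notin> P\<close> in auto)
    thus False using W by simp
  qed
  then obtain g where g: "-1 = y * poly (map_poly of_int g) y" using PD by blast
  define h where "h = (map_poly of_int (pCons 1 g :: int poly) :: 'k poly)"
  have "poly h y = 0" unfolding h_def by (simp add: map_poly_pCons g[symmetric])
  have h0: "coeff h 0 = 1" by (simp add: h_def coeff_map_poly)
  show ?thesis
  proof (rule algebraic_int.intros)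
    show "lead_coeff (reflect_poly h) = 1" using h0 by (simp add: coeff_reflect_poly degree_reflect_poly_eq)
    show "\<forall>i. coeff (reflect_poly h) i \<in> \<int>" by (auto simp: coeff_reflect_poly h_def coeff_map_poly)
    have "poly (reflect_poly h) x = x ^ degree h * poly h (inverse x)"
      using False by (simp add: poly_reflect_poly_nz)
    thus "poly (reflect_poly h) x = 0" using \<open>poly h y = 0\<close> y_def by simp
  qed
qed simp

lemma algebraic_int_stable:
  fixes x :: "'k::field_char_0"
  assumes W: "finite W" "w \<in> W" "w \<noteq> 0" and st: "\<And>w. w \<in> W \<Longrightarrow> x * w \<in> Zm.span W"
  shows "algebraic_int x"
proof -
  have "\<exists>u. x * w = (\<Sum>w'\<in>W. of_int (u w') * w')" if "w \<in> W" for w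
    using st[OF that] unfolding Zm.span_finite[OF W(1)] by auto
  then obtain c where "\<And>w. w \<in> W \<Longrightarrow> x * w = (\<Sum>w'\<in>W. of_int (c w w') * w')" by metis
  thus ?thesis using algebraic_int_eigenvalue[OF vector_space_over_itself.vector_space_axioms W, of x c] by simp
qed

lemma algebraic_int_powers:
  fixes x :: "'k::field_char_0"
  assumes "algebraic_int x"
  obtains m c where "m > 0" "x ^ m = (\<Sum>k<m. of_int (c k) * x ^ k)"
proof -
  from assms obtain p where p: "lead_coeff p = 1" "\<forall>i. coeff p i \<in> \<int>" "poly p x = 0"
    unfolding algebraic_int.simps by blast
  define m where "m = degree p"
  from p(2) have "\<forall>i. \<exists>c. coeff p i = of_int c" unfolding Ints_def by blast
  then obtain c where c: "\<And>i. coeff p i = of_int (c i)" by metis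
  have "m > 0"
  proof (rule ccontr)
    assume "\<not> m > 0"
    hence d: "degree p = 0" by (simp add: m_def)
    obtain a where "p = [:a:]" using degree_eq_zeroE[OF d] .
    thus False using p(1,3) by simp
  qed
  have "(\<Sum>k<m. coeff p k * x ^ k) + coeff p m * x ^ m = 0"
    using p(3) unfolding poly_altdef m_def lessThan_Suc_atMost[symmetric] sum.lessThan_Suc .
  hence "x ^ m = - (\<Sum>k<m. coeff p k * x ^ k)"
    using p(1) unfolding m_def by (metis add_eq_0_iff mult_1)
  also have "\<dots> = (\<Sum>k<m. of_int (- c k) * x ^ k)"
    by (simp add: c sum_negf)
  finally have "x ^ m = (\<Sum>k<m. of_int (- c k) * x ^ k)" .
  with \<open>m > 0\<close> show ?thesis by (rule that)
qed

text \<open>The monomials \<open>x ^ i * y ^ j\<close> with \<open>i < m\<close>,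
  \<open>j < n\<close> generate a group that both \<open>x\<close> and \<open>y\<close> map into
  itself, hence so do their sum and product.\<close>

lemma algebraic_int_add_mult:
  fixes x y :: "'k::field_char_0"
  assumes "algebraic_int x" "algebraic_int y"
  shows "algebraic_int (x + y)" "algebraic_int (x * y)"
proof -
  obtain m c where m: "m > 0" "x ^ m = (\<Sum>k<m. of_int (c k) * x ^ k)"
    using assms(1) by (rule algebraic_int_powers)
  obtain n d where n: "n > 0" "y ^ n = (\<Sum>k<n. of_int (d k) * y ^ k)"
    using assms(2) by (rule algebraic_int_powers)
  define W where "W = (\<lambda>(i, j). x ^ i * y ^ j) ` ({..<m} \<times> {..<n})"
  have fin: "finite W" unfolding W_def by simp
  have WI: "x ^ i * y ^ j \<in> Zm.span W" if "i < m" "j < n" for i j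
    using that by (intro Zm.span_base) (auto simp: W_def)
  have x: "x * v \<in> Zm.span W" if "v \<in> Zm.span W" for v
    using that
  proof (induction rule: Zm.span_induct_alt)
    case (step k w z)
    from step obtain i j where w: "w = x ^ i * y ^ j" "i < m" "j < n" by (auto simp: W_def)
    have "x * w \<in> Zm.span W"
    proof (cases "Suc i < m")
      case True thus ?thesis using WI[of "Suc i" j] w by (simp add: mult.assoc)
    next
      case False
      hence "m = Suc i" using w by simp
      hence "x * w = x ^ m * y ^ j" using w by simp
      also have "\<dots> = (\<Sum>k<m. of_int (c k) * (x ^ k * y ^ j))"
        unfolding m(2) by (simp add: sum_distrib_right mult.assoc)
      also have "\<dots> \<in> Zm.span W" using WI w by (intro Zm.span_sum Zm.span_scale) auto
      finally show ?thesis .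
    qed
    hence "of_int k * (x * w) + x * z \<in> Zm.span W"
      using step by (intro Zm.span_add Zm.span_scale) auto
    thus ?case by (simp add: algebra_simps)
  qed (simp add: Zm.span_zero)
  have y: "y * v \<in> Zm.span W" if "v \<in> Zm.span W" for v
    using that
  proof (induction rule: Zm.span_induct_alt)
    case (step k w z)
    from step obtain i j where w: "w = x ^ i * y ^ j" "i < m" "j < n" by (auto simp: W_def)
    have "y * w \<in> Zm.span W"
    proof (cases "Suc j < n")
      case True thus ?thesis using WI[of i "Suc j"] w by (simp add: algebra_simps)
    next
      case False
      hence "n = Suc j" using w by simp
      hence "y * w = y ^ n * x ^ i" using w by simp
      also have "\<dots> = (\<Sum>k<n. of_int (d k) * (x ^ i * y ^ k))"
        unfolding n(2) by (simp add: sum_distrib_left sum_distrib_right algebra_simps)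
      also have "\<dots> \<in> Zm.span W" using WI w by (intro Zm.span_sum Zm.span_scale) auto
      finally show ?thesis .
    qed
    hence "of_int k * (y * w) + y * z \<in> Zm.span W"
      using step by (intro Zm.span_add Zm.span_scale) auto
    thus ?case by (simp add: algebra_simps)
  qed (simp add: Zm.span_zero)
  have one: "1 \<in> W" unfolding W_def using m n by (auto intro!: image_eqI[of _ _ "(0, 0)"])
  show "algebraic_int (x + y)"
    by (rule algebraic_int_stable[OF fin one])
       (simp_all add: distrib_right Zm.span_add x y Zm.span_base)
  show "algebraic_int (x * y)"
    by (rule algebraic_int_stable[OF fin one]) (simp_all add: mult.assoc x y Zm.span_base)
qed

abbreviation Oring :: "'k::field_char_0 set" where "Oring \<equiv> {x. algebraic_int x}"

lemma algebraic_int_diff: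
  fixes x y :: "'k::field_char_0"
  shows "algebraic_int x \<Longrightarrow> algebraic_int y \<Longrightarrow> algebraic_int (x - y)"
  using algebraic_int_add_mult(1)[of x "- y"] by auto

lemma algebraic_int_power:
  fixes x :: "'k::field_char_0"
  shows "algebraic_int x \<Longrightarrow> algebraic_int (x ^ n)"
  by (induction n) (simp_all add: algebraic_int_add_mult)

lemma algebraic_int_sum:
  fixes f :: "'b \<Rightarrow> 'k::field_char_0"
  shows "(\<And>i. i \<in> A \<Longrightarrow> algebraic_int (f i)) \<Longrightarrow> algebraic_int (sum f A)"
  by (induction A rule: infinite_finite_induct) (simp_all add: algebraic_int_add_mult)

lemma algebraic_int_prod:
  fixes f :: "'b \<Rightarrow> 'k::field_char_0"
  shows "(\<And>i. i \<in> A \<Longrightarrow> algebraic_int (f i)) \<Longrightarrow> algebraic_int (prod f A)"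
  by (induction A rule: infinite_finite_induct) (simp_all add: algebraic_int_add_mult)

lemma algebraic_int_of_square:
  fixes x :: "'k::field_char_0"
  assumes "algebraic_int (x * x)" shows "algebraic_int x"
proof -
  have c: "coeff [:0, 0, 1::'k:] i \<in> \<int>" for i
    by (simp add: coeff_pCons split: nat.split)
  show ?thesis
    by (rule algebraic_int_root[OF assms, of "[:0, 0, 1:]"]) (simp_all add: c)
qed

lemma cring_OK: "cring (OK :: 'k::field_char_0 ring)"
proof (rule cringI)
  show "abelian_group (OK :: 'k ring)"
  proof (rule abelian_groupI)
    fix x :: 'k assume "x \<in> carrier OK"
    thus "\<exists>y\<in>carrier OK. y \<oplus>\<^bsub>OK\<^esub> x = \<zero>\<^bsub>OK\<^esub>"
      by (intro bexI[of _ "- x"]) (auto simp: OK_def)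
  qed (auto simp: OK_def algebra_simps algebraic_int_add_mult)
  show "comm_monoid (OK :: 'k ring)"
    by (rule comm_monoidI) (auto simp: OK_def algebra_simps algebraic_int_add_mult)
qed (auto simp: OK_def algebra_simps)

lemma OK_simps [simp]:
  "carrier OK = Oring" "mult OK = (*)" "one OK = 1" "ring.zero OK = 0" "add OK = (+)"
  by (simp_all add: OK_def)

section \<open>Rational linear algebra in a number field\<close>

interpretation Qm: vector_space "\<lambda>(r::rat) (x::'a::field_char_0). of_rat r * x"
  by standard (simp_all add: algebra_simps of_rat_add of_rat_mult)

interpretation QP: vector_space_pair "\<lambda>(r::rat) (x::'a::field_char_0). of_rat r * x"
  "\<lambda>(r::rat) (x::'b::field_char_0). of_rat r * x" ..

abbreviation rpoly :: "rat poly \<Rightarrow> 'a::field_char_0 poly" where "rpoly \<equiv> map_poly of_rat"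

lemma number_field_basis:
  assumes "number_field TYPE('k::field_char_0)"
  obtains B :: "'k::field_char_0 set" where "finite B" "Qm.span B = UNIV"
  using assms unfolding number_field_def by blast

subsection \<open>Field embeddings\<close>

context
  fixes \<sigma> :: "'k::field_char_0 \<Rightarrow> 'l::field_char_0"
  assumes \<sigma>: "field_embedding \<sigma>"
begin

lemma emb_1: "\<sigma> 1 = 1" and emb_add: "\<sigma> (x + y) = \<sigma> x + \<sigma> y" and emb_mult: "\<sigma> (x * y) = \<sigma> x * \<sigma> y"
  using \<sigma> unfolding field_embedding_def by auto

lemma emb_0: "\<sigma> 0 = 0" using emb_add[of 0 0] by simp

lemma emb_minus: "\<sigma> (- x) = - \<sigma> x"
  using emb_add[of "- x" x] by (simp add: emb_0 eq_neg_iff_add_eq_0)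

lemma emb_diff: "\<sigma> (x - y) = \<sigma> x - \<sigma> y" using emb_add[of x "- y"] by (simp add: emb_minus)

lemma emb_eq_0: "\<sigma> x = 0 \<longleftrightarrow> x = 0"
proof
  assume "\<sigma> x = 0"
  show "x = 0"
  proof (rule ccontr)
    assume "x \<noteq> 0"
    hence "\<sigma> (x * inverse x) = 1" by (simp add: emb_1)
    thus False using \<open>\<sigma> x = 0\<close> by (simp add: emb_mult)
  qed
qed (simp add: emb_0)

lemma emb_inverse: "\<sigma> (inverse x) = inverse (\<sigma> x)"
proof (cases "x = 0")
  case False
  hence "\<sigma> x * \<sigma> (inverse x) = 1" by (simp add: emb_1 flip: emb_mult)
  thus ?thesis by (metis inverse_unique)
qed (simp add: emb_0)

lemma emb_divide: "\<sigma> (x / y) = \<sigma> x / \<sigma> y" by (simp add: divide_inverse emb_mult emb_inverse)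

lemma emb_power: "\<sigma> (x ^ n) = \<sigma> x ^ n" by (induction n) (simp_all add: emb_1 emb_mult)

lemma emb_sum: "\<sigma> (sum f A) = (\<Sum>a\<in>A. \<sigma> (f a))"
  by (induction A rule: infinite_finite_induct) (simp_all add: emb_0 emb_add)

lemma emb_of_nat: "\<sigma> (of_nat n) = of_nat n" by (induction n) (simp_all add: emb_0 emb_1 emb_add)

lemma emb_of_int: "\<sigma> (of_int n) = of_int n"
  by (cases n rule: int_cases2) (simp_all add: emb_of_nat emb_minus)

lemma emb_of_rat: "\<sigma> (of_rat r) = of_rat r"
proof -
  obtain a b where "quotient_of r = (a, b)" by (cases "quotient_of r")
  hence "r = of_int a / of_int b" by (rule quotient_of_div)
  thus ?thesis by (simp add: of_rat_divide emb_divide emb_of_int)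
qed

lemma emb_rpoly: "\<sigma> (poly (rpoly g) x) = poly (rpoly g) (\<sigma> x)"
  by (induction g) (simp_all add: map_poly_pCons emb_0 emb_add emb_mult emb_of_rat)

lemma emb_algebraic_int:
  assumes "algebraic_int x" shows "algebraic_int (\<sigma> x)"
proof -
  obtain m c where m: "m > 0" "x ^ m = (\<Sum>k<m. of_int (c k) * x ^ k)"
    using assms by (rule algebraic_int_powers)
  have "\<sigma> x ^ m = (\<Sum>k<m. of_int (c k) * \<sigma> x ^ k)"
    unfolding emb_power[symmetric] m(2) by (simp add: emb_sum emb_mult emb_of_int)
  hence st: "\<sigma> x * w \<in> Zm.span ((\<lambda>k. \<sigma> x ^ k) ` {..<m})" if "w \<in> (\<lambda>k. \<sigma> x ^ k) ` {..<m}" for w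
  proof -
    from that obtain k where k: "k < m" "w = \<sigma> x ^ k" by auto
    show ?thesis
    proof (cases "Suc k < m")
      case True
      have "\<sigma> x * w = \<sigma> x ^ Suc k" using k by simp
      thus ?thesis using True by (metis Zm.span_base imageI lessThan_iff)
    next
      case False
      hence "\<sigma> x * w = \<sigma> x ^ m" using k by (metis Suc_lessI power_Suc)
      also have "\<dots> = (\<Sum>k<m. of_int (c k) * \<sigma> x ^ k)" by fact
      also have "\<dots> \<in> Zm.span ((\<lambda>k. \<sigma> x ^ k) ` {..<m})"
        by (intro Zm.span_sum Zm.span_scale Zm.span_base) auto
      finally show ?thesis .
    qed
  qed
  have "1 \<in> (\<lambda>k. \<sigma> x ^ k) ` {..<m}" using m(1) by (auto intro!: image_eqI[of _ _ 0])
  from algebraic_int_stable[OF _ this _ st] show ?thesis by simp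
qed

end

lemma emb_eqI:
  fixes \<sigma> \<tau> :: "'k::field_char_0 \<Rightarrow> 'l::field_char_0"
  assumes "field_embedding \<sigma>" "field_embedding \<tau>" "Qm.span B = UNIV" "\<And>b. b \<in> B \<Longrightarrow> \<sigma> b = \<tau> b"
  shows "\<sigma> = \<tau>"
proof
  fix x :: 'k
  have "x \<in> Qm.span B" using assms(3) by simp
  thus "\<sigma> x = \<tau> x"
    by (induction rule: Qm.span_induct_alt)
       (simp_all add: emb_0 emb_add emb_mult emb_of_rat assms)
qed

lemma rpoly_eval:
  "degree g \<le> n \<Longrightarrow> poly (rpoly g) x = (\<Sum>k\<le>n. of_rat (coeff g k) * x ^ k)"
proof -
  assume n: "degree g \<le> n"
  have "poly (rpoly g) x = (\<Sum>k\<le>degree g. of_rat (coeff g k) * x ^ k)"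
    unfolding poly_altdef by (simp add: coeff_map_poly degree_map_poly)
  also have "\<dots> = (\<Sum>k\<le>n. of_rat (coeff g k) * x ^ k)"
    using n by (intro sum.mono_neutral_left) (auto simp: coeff_eq_0)
  finally show ?thesis .
qed

text \<open>The powers up to the size of a spanning set are linearly dependent. The degree bound is
  uniform in \<open>x\<close>, which later leaves only finitely many minimal polynomials.\<close>

lemma number_field_algebraic:
  assumes "number_field TYPE('k::field_char_0)"
  obtains n where "\<And>x::'k. \<exists>g. g \<noteq> 0 \<and> degree g \<le> n \<and> poly (rpoly g) x = 0"
proof -
  obtain B :: "'k set" where B: "finite B" "Qm.span B = UNIV"
    using number_field_basis[OF assms] .
  show ?thesis
  proof (rule that[of "card B"])
    fix x :: 'k
    define n where "n = card B"
    have ex: "\<exists>u::nat \<Rightarrow> rat. (\<exists>k\<le>n. u k \<noteq> 0) \<and> (\<Sum>k\<le>n. of_rat (u k) * x ^ k) = 0"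
    proof (cases "inj_on (\<lambda>k. x ^ k) {..n}")
      case True
      define S where "S = (\<lambda>k. x ^ k) ` {..n}"
      have "card S = Suc n" unfolding S_def by (simp add: card_image True)
      moreover have "finite S" unfolding S_def by simp
      ultimately have "Qm.dependent S"
        using Qm.independent_span_bound[OF B(1), of S] B(2) by (auto simp: n_def)
      then obtain u where u: "\<exists>v\<in>S. u v \<noteq> 0" "(\<Sum>v\<in>S. of_rat (u v) * v) = 0"
        using Qm.dependent_finite[OF \<open>finite S\<close>] by auto
      have "(\<Sum>k\<le>n. of_rat (u (x ^ k)) * x ^ k) = 0"
        using u(2) unfolding S_def sum.reindex[OF True] by simp
      thus ?thesis using u(1) by (intro exI[of _ "\<lambda>k. u (x ^ k)"]) (auto simp: S_def)
    next
      \<comment> \<open>Coinciding powers make the set of powers too small for the dimension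
        argument; the relation \<open>x ^ i - x ^ j = 0\<close> is then written down
        directly.\<close>
      case False
      then obtain i j where ij: "i \<le> n" "j \<le> n" "i \<noteq> j" "x ^ i = x ^ j" unfolding inj_on_def by auto
      have "(\<Sum>k\<le>n. of_rat (if k = i then 1 else if k = j then - 1 else 0) * x ^ k)
        = (\<Sum>k\<le>n. (if k = i then x ^ i else 0)) - (\<Sum>k\<le>n. (if k = j then x ^ j else 0))"
        unfolding sum_subtractf[symmetric] using ij by (intro sum.cong) (auto simp: of_rat_minus)
      also have "\<dots> = 0" using ij by simp
      finally show ?thesis using ij
        by (intro exI[of _ "\<lambda>k. if k = i then 1 else if k = j then - 1 else 0"]) auto
    qed
    then obtain u :: "nat \<Rightarrow> rat" where u: "\<exists>k\<le>n. u k \<noteq> 0" "(\<Sum>k\<le>n. of_rat (u k) * x ^ k) = 0" by blast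
    define g where "g = (\<Sum>k\<le>n. monom (u k) k)"
    have cg: "coeff g k = u k" if "k \<le> n" for k
      using that by (simp add: g_def coeff_sum)
    have dg: "degree g \<le> n" unfolding g_def
      by (intro degree_sum_le) (auto intro: order_trans[OF degree_monom_le])
    have "poly (rpoly g) x = 0"
      using u(2) by (simp add: rpoly_eval[OF dg] cg)
    moreover have "g \<noteq> 0" using u(1) cg by fastforce
    ultimately show "\<exists>g. g \<noteq> 0 \<and> degree g \<le> card B \<and> poly (rpoly g) x = 0" using dg n_def by blast
  qed
qed

text \<open>An embedding is determined by its values on a finite spanning set, and each value is a
  root of a fixed rational polynomial.\<close>

lemma finite_embeddings:
  assumes "number_field TYPE('k::field_char_0)"
  shows "finite {\<sigma> :: 'k \<Rightarrow> 'l::field_char_0. field_embedding \<sigma>}"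
proof -
  obtain B :: "'k set" where B: "finite B" "Qm.span B = UNIV"
    using number_field_basis[OF assms] .
  obtain n where n: "\<And>x::'k. \<exists>g. g \<noteq> 0 \<and> degree g \<le> n \<and> poly (rpoly g) x = 0"
    using number_field_algebraic[OF assms] by metis
  obtain g where g: "\<And>x::'k. g x \<noteq> 0 \<and> poly (rpoly (g x)) x = 0"
    using n by metis
  define R where "R = (\<lambda>x::'k. {y::'l. poly (rpoly (g x)) y = 0})"
  have nz: "rpoly (g x) \<noteq> (0 :: 'l poly)" for x using g[of x] by (subst map_poly_eq_0_iff) auto
  have "finite (PiE B R)" unfolding R_def using B nz by (intro finite_PiE poly_roots_finite) auto
  moreover have "(\<lambda>\<sigma>. restrict \<sigma> B) ` {\<sigma>. field_embedding \<sigma>} \<subseteq> PiE B R"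
    using g by (auto simp: R_def emb_rpoly[symmetric] emb_0)
  ultimately have "finite ((\<lambda>\<sigma>. restrict \<sigma> B) ` {\<sigma> :: 'k \<Rightarrow> 'l. field_embedding \<sigma>})"
    by (rule finite_subset[rotated])
  moreover have "inj_on (\<lambda>\<sigma>. restrict \<sigma> B) {\<sigma> :: 'k \<Rightarrow> 'l. field_embedding \<sigma>}"
  proof (rule inj_onI)
    fix \<sigma> \<tau> :: "'k \<Rightarrow> 'l"
    assume "\<sigma> \<in> {\<sigma>. field_embedding \<sigma>}" "\<tau> \<in> {\<sigma>. field_embedding \<sigma>}" and e: "restrict \<sigma> B = restrict \<tau> B"
    moreover have "\<sigma> b = \<tau> b" if "b \<in> B" for b using fun_cong[OF e, of b] that by simp
    ultimately show "\<sigma> = \<tau>" using emb_eqI[OF _ _ B(2)] by blast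
  qed
  ultimately show ?thesis by (rule finite_imageD)
qed

subsection \<open>Embeddings as common eigenvalues\<close>

text \<open>
  A nonzero \<open>\<rat>\<close>-linear functional \<open>f\<close> on \<open>K\<close> that is a common eigenvector of all the operators
  \<open>f \<mapsto> (\<lambda>y. f (x * y))\<close> has an embedding as its system of eigenvalues. \<open>op_act x p\<close> is the
  polynomial \<open>p\<close> in the operator belonging to \<open>x\<close>.
\<close>

definition op_act :: "'k::field_char_0 \<Rightarrow> complex poly \<Rightarrow> ('k \<Rightarrow> complex) \<Rightarrow> 'k \<Rightarrow> complex" where
  "op_act x p f = (\<lambda>y. \<Sum>k\<le>degree p. coeff p k * f (x ^ k * y))"

definition qlin :: "('k::field_char_0 \<Rightarrow> complex) \<Rightarrow> bool" where
  "qlin f \<longleftrightarrow> (\<forall>a b. f (a + b) = f a + f b) \<and> (\<forall>r a. f (of_rat r * a) = of_rat r * f a)"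

lemma op_act_bound: "degree p \<le> n \<Longrightarrow> op_act x p f y = (\<Sum>k\<le>n. coeff p k * f (x ^ k * y))"
  unfolding op_act_def by (intro sum.mono_neutral_left) (auto simp: coeff_eq_0)

lemma op_act_0: "op_act x 0 f y = 0" by (simp add: op_act_def)

lemma op_act_pCons: "op_act x (pCons a p) f y = a * f y + op_act x p f (x * y)"
proof -
  have "op_act x (pCons a p) f y = (\<Sum>k\<le>Suc (degree p). coeff (pCons a p) k * f (x ^ k * y))"
    by (rule op_act_bound) (rule degree_pCons_le)
  also have "\<dots> = a * f y + op_act x p f (x * y)"
    unfolding sum.atMost_Suc_shift op_act_def by (simp add: algebra_simps)
  finally show ?thesis .
qed

lemma op_act_add: "op_act x (p + q) f y = op_act x p f y + op_act x q f y"
proof -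
  define n where "n = max (degree p) (degree q)"
  have "degree (p + q) \<le> n" "degree p \<le> n" "degree q \<le> n"
    unfolding n_def using degree_add_le_max by auto
  thus ?thesis by (simp add: op_act_bound algebra_simps sum.distrib)
qed

lemma op_act_smult: "op_act x (smult c p) f y = c * op_act x p f y"
proof -
  have "op_act x (smult c p) f y = (\<Sum>k\<le>degree p. coeff (smult c p) k * f (x ^ k * y))"
    by (rule op_act_bound) (rule degree_smult_le)
  thus ?thesis by (simp add: op_act_def sum_distrib_left mult.assoc)
qed

lemma op_act_mult: "op_act x (p * q) f y = op_act x p (op_act x q f) y"
  by (induction p arbitrary: y)
     (simp_all add: op_act_0 op_act_pCons op_act_add op_act_smult)

lemma op_act_rat:
  assumes "qlin f" shows "op_act x (rpoly g) f y = f (poly (rpoly g) x * y)"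
proof (induction g arbitrary: y)
  case 0
  have "f 0 = 0" using assms unfolding qlin_def by (metis add_cancel_right_right)
  then show ?case by (simp add: op_act_0)
next
  case (pCons a g)
  have "f (of_rat a * y + poly (rpoly g) x * (x * y)) = of_rat a * f y + f (poly (rpoly g) x * (x * y))"
    using assms unfolding qlin_def by simp
  then show ?case using pCons by (simp add: map_poly_pCons op_act_pCons algebra_simps)
qed

lemma qlin_op_act:
  assumes "qlin f" shows "qlin (op_act x p f)"
  unfolding qlin_def
proof (intro conjI allI)
  note f = assms[unfolded qlin_def]
  show "op_act x p f (a + b) = op_act x p f a + op_act x p f b" for a b
    unfolding op_act_def distrib_left[of "x ^ _"] sum.distrib[symmetric] using f
    by (intro sum.cong) (auto simp: distrib_left)
  show "op_act x p f (of_rat r * a) = of_rat r * op_act x p f a" for r a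
    unfolding op_act_def sum_distrib_left mult.left_commute[of "x ^ _" "of_rat r"] using f
    by (intro sum.cong) auto
qed

lemma op_act_eigen:
  "(\<And>y. f (s * y) = c * f y) \<Longrightarrow> op_act x p f (s * y) = c * op_act x p f y"
  unfolding op_act_def sum_distrib_left mult.left_commute[of "x ^ _" s]
  by (intro sum.cong) auto

text \<open>Take a nonzero polynomial of least degree that annihilates \<open>f\<close> and split
  off a linear factor \<open>[:- \<mu>, 1:]\<close>. By minimality the cofactor does not annihilate
  \<open>f\<close>, and what it produces is an eigenvector for \<mu>.\<close>

lemma op_act_eigen_step:
  assumes f: "qlin f" "f y0 \<noteq> 0" and g: "g \<noteq> 0" "poly (rpoly g) x = 0"
  obtains h \<mu> y where "op_act x h f y \<noteq> 0" "\<And>y. op_act x h f (x * y) = \<mu> * op_act x h f y"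
proof -
  define Q where "Q p \<longleftrightarrow> p \<noteq> 0 \<and> (\<forall>y. op_act x p f y = 0)" for p
  have "f 0 = 0" using f(1) unfolding qlin_def by (metis add_cancel_right_right)
  hence "Q (rpoly g)" unfolding Q_def using g f(1) by (simp add: op_act_rat map_poly_eq_0_iff)
  then obtain p where p: "Q p" and min: "\<And>q. Q q \<Longrightarrow> degree p \<le> degree q"
    using ex_has_least_nat[of Q "rpoly g" degree] by blast
  have "degree p \<noteq> 0"
  proof
    assume "degree p = 0"
    then obtain a where "p = [:a:]" by (rule degree_eq_zeroE)
    thus False using p f(2) unfolding Q_def by (auto simp: op_act_def)
  qed
  hence "\<not> constant (poly p)" by (simp add: constant_degree)
  then obtain \<mu> where "poly p \<mu> = 0" using fundamental_theorem_of_algebra by blast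
  then obtain q where q: "p = [:- \<mu>, 1:] * q" by (auto simp: poly_eq_0_iff_dvd)
  have "q \<noteq> 0" using p q unfolding Q_def by auto
  have "degree p = Suc (degree q)" unfolding q using \<open>q \<noteq> 0\<close> by (subst degree_mult_eq) auto
  hence "\<not> Q q" using min by fastforce
  then obtain y where y: "op_act x q f y \<noteq> 0" using \<open>q \<noteq> 0\<close> unfolding Q_def by blast
  show ?thesis
  proof (rule that[OF y])
    fix y
    have "0 = op_act x [:- \<mu>, 1:] (op_act x q f) y"
      using p unfolding Q_def q op_act_mult by simp
    also have "\<dots> = - \<mu> * op_act x q f y + op_act x q f (x * y)" by (simp add: op_act_pCons op_act_0)
    finally show "op_act x q f (x * y) = \<mu> * op_act x q f y" by simp
  qed
qed

text \<open>The operators commute, so each new eigenvector obtained from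
  \<open>op_act_eigen_step\<close> keeps the eigenvalues already secured, in particular \<mu> at
  \<open>x\<close>. An eigenvector for a spanning set is one for all of K, and its system of
  eigenvalues is additive and multiplicative.\<close>

lemma embedding_of_eigenvector:
  assumes nf: "number_field TYPE('k::field_char_0)"
    and f: "qlin f" "f y0 \<noteq> 0" and x: "\<And>y. f (x * y) = \<mu> * f (y::'k)"
  obtains \<sigma> :: "'k::field_char_0 \<Rightarrow> complex" where "field_embedding \<sigma>" "\<sigma> x = \<mu>"
proof -
  obtain B :: "'k set" where B: "finite B" "Qm.span B = UNIV"
    using number_field_basis[OF nf] .
  obtain n where n: "\<And>x::'k. \<exists>g. g \<noteq> 0 \<and> degree g \<le> n \<and> poly (rpoly g) x = 0"
    using number_field_algebraic[OF nf] by metis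
  have "\<exists>f. qlin f \<and> (\<exists>y. f y \<noteq> 0) \<and> (\<forall>y. f (x * y) = \<mu> * f y) \<and> (\<forall>b\<in>B. \<exists>c. \<forall>y. f (b * y) = c * f y)"
    using B(1)
  proof (induction B rule: finite_induct)
    case empty
    show ?case using f x by blast
  next
    case (insert b B)
    then obtain f y0 where f: "qlin f" "f y0 \<noteq> 0" "\<forall>y. f (x * y) = \<mu> * f y"
      "\<forall>b\<in>B. \<exists>c. \<forall>y. f (b * y) = c * f y" by blast
    obtain g where g: "g \<noteq> 0" "poly (rpoly g) b = 0" using n by blast
    obtain h \<nu> y where h: "op_act b h f y \<noteq> 0" "\<And>y. op_act b h f (b * y) = \<nu> * op_act b h f y"
      using op_act_eigen_step[OF f(1,2) g] by metis
    have "\<exists>c. \<forall>y. op_act b h f (b' * y) = c * op_act b h f y" if "b' \<in> insert b B" for b'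
    proof (cases "b' = b")
      case True thus ?thesis using h(2) by blast
    next
      case False
      hence "b' \<in> B" using that by simp
      from bspec[OF f(4) this] obtain c where c: "\<forall>y. f (b' * y) = c * f y" ..
      show ?thesis by (intro exI[of _ c] allI op_act_eigen) (simp add: c)
    qed
    moreover have "op_act b h f (x * y) = \<mu> * op_act b h f y" for y
      by (rule op_act_eigen) (simp add: f(3))
    ultimately show ?case using qlin_op_act[OF f(1)] h(1)
      by (intro exI[of _ "op_act b h f"]) auto
  qed
  then obtain f y0 where f: "qlin f" "f y0 \<noteq> 0" "\<forall>y. f (x * y) = \<mu> * f y"
    "\<forall>b\<in>B. \<exists>c. \<forall>y. f (b * y) = c * f y" by blast
  have f0: "f 0 = 0" using f(1) unfolding qlin_def by (metis add_cancel_right_right)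
  have "\<exists>c. \<forall>y. f (z * y) = c * f y" for z
  proof -
    have "z \<in> Qm.span B" using B(2) by simp
    thus ?thesis
    proof (induction rule: Qm.span_induct_alt)
      case base
      show ?case using f0 by (intro exI[of _ 0]) simp
    next
      case (step r b z)
      from bspec[OF f(4) step(1)] obtain c where c: "\<forall>y. f (b * y) = c * f y" ..
      from step(2) obtain d where "\<forall>y. f (z * y) = d * f y" ..
      with c
      have "\<forall>y. f ((of_rat r * b + z) * y) = (of_rat r * c + d) * f y"
        using f(1) unfolding qlin_def by (simp add: distrib_right mult.assoc)
      thus ?case by (rule exI)
    qed
  qed
  then obtain \<sigma> where \<sigma>: "\<And>z y. f (z * y) = \<sigma> z * f y" by metis
  have cancel: "a = b" if "a * f y0 = b * f y0" for a b using that f(2) by simp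
  show ?thesis
  proof (rule that[of \<sigma>])
    show "field_embedding \<sigma>"
      unfolding field_embedding_def
    proof (intro conjI allI)
      show "\<sigma> 1 = 1" by (rule cancel) (simp flip: \<sigma>)
      show "\<sigma> (a + b) = \<sigma> a + \<sigma> b" for a b
        by (rule cancel) (use f(1) in \<open>simp add: distrib_right qlin_def flip: \<sigma>\<close>)
      show "\<sigma> (a * b) = \<sigma> a * \<sigma> b" for a b
        by (rule cancel) (metis \<sigma> mult.assoc)
    qed
    show "\<sigma> x = \<mu>" by (rule cancel) (metis \<sigma> f(3))
  qed
qed

text \<open>Conjugates are exactly the values of embeddings: with \<open>g\<close> of least degree
  and \<open>g = (X - \<mu>) * q\<close>, the polynomial \<open>q\<close> maps a suitable functional
  to an eigenvector for \<mu>, because \<open>g\<close> annihilates every functional.\<close>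

lemma embedding_at_root:
  assumes nf: "number_field TYPE('k::field_char_0)"
    and g: "g \<noteq> 0" "poly (rpoly g) (x::'k) = 0"
    and min: "\<And>h. h \<noteq> 0 \<Longrightarrow> poly (rpoly h) x = 0 \<Longrightarrow> degree g \<le> degree h"
    and \<mu>: "poly (rpoly g) (\<mu>::complex) = 0"
  obtains \<sigma> :: "'k::field_char_0 \<Rightarrow> complex" where "field_embedding \<sigma>" "\<sigma> x = \<mu>"
proof -
  obtain q where q: "rpoly g = [:- \<mu>, 1:] * q" using \<mu> by (auto simp: poly_eq_0_iff_dvd)
  have "rpoly g \<noteq> (0::complex poly)" using g by (subst map_poly_eq_0_iff) auto
  hence "q \<noteq> 0" using q by auto
  define d where "d = degree q"
  have dg: "degree g = Suc d"
  proof -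
    have "degree g = degree (rpoly g :: complex poly)" by (subst degree_map_poly) auto
    also have "\<dots> = Suc d" unfolding q d_def using \<open>q \<noteq> 0\<close> by (subst degree_mult_eq) auto
    finally show ?thesis .
  qed
  have indep: "u k = 0" if "(\<Sum>k\<le>d. of_rat (u k) * x ^ k) = 0" "k \<le> d" for u k
  proof (rule ccontr)
    assume u: "u k \<noteq> 0"
    define h where "h = (\<Sum>k\<le>d. monom (u k) k)"
    have ch: "coeff h k = u k" if "k \<le> d" for k
      using that by (simp add: h_def coeff_sum)
    have dh: "degree h \<le> d" unfolding h_def
      by (intro degree_sum_le) (auto intro: order_trans[OF degree_monom_le])
    have "poly (rpoly h) x = 0" using that(1) by (simp add: rpoly_eval[OF dh] ch)
    moreover have "h \<noteq> 0" using u ch that(2) by fastforce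
    ultimately show False using min[of h] dh dg by simp
  qed
  have inj: "inj_on (\<lambda>k. x ^ k) {..d}"
  proof (rule inj_onI, rule ccontr)
    fix i j assume ij: "i \<in> {..d}" "j \<in> {..d}" "x ^ i = x ^ j" "i \<noteq> j"
    have "(\<Sum>k\<le>d. of_rat (if k = i then 1 else if k = j then - 1 else 0) * x ^ k)
        = (\<Sum>k\<le>d. (if k = i then x ^ i else 0)) - (\<Sum>k\<le>d. (if k = j then x ^ j else 0))"
      unfolding sum_subtractf[symmetric] using ij by (intro sum.cong) (auto simp: of_rat_minus)
    also have "\<dots> = 0" using ij by simp
    finally show False using indep[of "\<lambda>k. if k = i then 1 else if k = j then - 1 else 0" i] ij by auto
  qed
  define S where "S = (\<lambda>k. x ^ k) ` {..d}"
  have "Qm.independent S"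
  proof
    assume "Qm.dependent S"
    moreover have fS: "finite S" unfolding S_def by simp
    ultimately obtain u where u: "\<exists>v\<in>S. u v \<noteq> 0" "(\<Sum>v\<in>S. of_rat (u v) * v) = 0"
      unfolding Qm.dependent_finite[OF fS] by blast
    have "(\<Sum>k\<le>d. of_rat (u (x ^ k)) * x ^ k) = 0"
      using u(2) unfolding S_def sum.reindex[OF inj] by simp
    from indep[OF this] have "\<forall>k\<le>d. u (x ^ k) = 0" by blast
    thus False using u(1) by (auto simp: S_def)
  qed
  \<comment> \<open>The functional picks out the coefficient of \<open>x ^ d\<close>. Then
    \<open>op_act x q f 1\<close> is the leading coefficient of \<open>q\<close>, hence
    nonzero.\<close>
  then obtain f :: "'k \<Rightarrow> complex" where fl: "Vector_Spaces.linear (\<lambda>r x. of_rat r * x) (\<lambda>r x. of_rat r * x) f"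
    and fS: "\<And>v. v \<in> S \<Longrightarrow> f v = (if v = x ^ d then 1 else 0)"
    using QP.linear_independent_extend[of S "\<lambda>v. if v = x ^ d then 1 else 0"] by blast
  have ql: "qlin f" unfolding qlin_def
    using QP.linear_add[OF fl] QP.linear_scale[OF fl] by blast
  have fx: "f (x ^ k) = (if k = d then 1 else 0)" if "k \<le> d" for k
    using fS[of "x ^ k"] that inj unfolding S_def inj_on_def by auto
  have "op_act x q f 1 = (\<Sum>k\<le>d. if k = d then coeff q k else 0)"
    unfolding op_act_def d_def[symmetric] using fx by (intro sum.cong) auto
  also have "\<dots> = coeff q d" by simp
  finally have nz: "op_act x q f 1 \<noteq> 0" using \<open>q \<noteq> 0\<close> by (simp add: d_def)
  have f0: "f 0 = 0" using ql unfolding qlin_def by (metis add_cancel_right_right)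
  have "op_act x q f (x * y) = \<mu> * op_act x q f y" for y
  proof -
    have "0 = op_act x (rpoly g) f y" unfolding op_act_rat[OF ql] g(2) by (simp add: f0)
    also have "\<dots> = op_act x [:- \<mu>, 1:] (op_act x q f) y" unfolding q op_act_mult ..
    also have "\<dots> = - \<mu> * op_act x q f y + op_act x q f (x * y)" by (simp add: op_act_pCons op_act_0)
    finally show ?thesis by simp
  qed
  from embedding_of_eigenvector[OF nf qlin_op_act[OF ql] nz this] that show ?thesis by blast
qed

subsection \<open>Discreteness and finite generation of the ring of integers\<close>

text \<open>Roots are split off one at a time: multiplying by X - z preserves integrality of the
  coefficients and enlarges their bound by a factor of at most \<open>1 + C\<close>.\<close>

lemma monic_coeffs_bound:
  fixes p :: "complex poly"
  assumes "lead_coeff p = 1" "\<And>z. poly p z = 0 \<Longrightarrow> algebraic_int z \<and> cmod z \<le> C" "C \<ge> 0"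
  shows "algebraic_int (coeff p i) \<and> cmod (coeff p i) \<le> (1 + C) ^ degree p"
  using assms(1,2)
proof (induction "degree p" arbitrary: p i)
  case 0
  then obtain a where "p = [:a:]" using degree_eq_zeroE[of p] by metis
  with 0 have "p = 1" by (simp add: one_pCons)
  thus ?case by (cases i) simp_all
next
  case (Suc d)
  have "\<not> constant (poly p)" using Suc(2) by (simp add: constant_degree)
  then obtain z where z: "poly p z = 0" using fundamental_theorem_of_algebra by blast
  then obtain q where q: "p = [:- z, 1:] * q" by (auto simp: poly_eq_0_iff_dvd)
  have "q \<noteq> 0" using Suc(2) q by auto
  hence dp: "degree p = Suc (degree q)" unfolding q by (subst degree_mult_eq) auto
  hence dq: "d = degree q" using Suc(2) by simp
  have lq: "lead_coeff q = 1" using Suc(3) unfolding q lead_coeff_mult by simp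
  have rq: "algebraic_int w \<and> cmod w \<le> C" if "poly q w = 0" for w
    using Suc(4)[of w] that q by simp
  note IH = Suc(1)[OF dq lq rq]
  have cp: "coeff p i = (if i = 0 then 0 else coeff q (i - 1)) - z * coeff q i"
    unfolding q by (cases i) (simp_all)
  have zz: "algebraic_int z" "cmod z \<le> C" using Suc(4)[OF z] by auto
  define e where "e = (if i = 0 then 0 else coeff q (i - 1))"
  have e: "algebraic_int e" "cmod e \<le> (1 + C) ^ degree q"
    using IH[of "i - 1"] assms(3) by (auto simp: e_def)
  have "algebraic_int (coeff p i)" unfolding cp e_def[symmetric]
    using e zz IH[of i] by (intro algebraic_int_diff algebraic_int_add_mult) auto
  moreover have "cmod (coeff p i) \<le> cmod e + cmod z * cmod (coeff q i)"
    unfolding cp e_def[symmetric] by (metis norm_mult norm_triangle_ineq4)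
  moreover have "cmod e + cmod z * cmod (coeff q i) \<le> (1 + C) ^ degree q + C * (1 + C) ^ degree q"
    using e zz IH[of i] assms(3) by (intro add_mono mult_mono) auto
  ultimately show ?case unfolding dp by (simp add: algebra_simps)
qed

text \<open>All complex roots of the minimal polynomial of \<open>x\<close> are values of
  embeddings, hence bounded algebraic integers. Its coefficients are therefore rational integers in
  a fixed range, and its degree is bounded, so only finitely many polynomials occur.\<close>

lemma finite_bounded_integers_complex:
  assumes nf: "number_field TYPE('k::field_char_0)"
  shows "finite {x::'k. algebraic_int x \<and> (\<forall>\<sigma>::'k \<Rightarrow> complex. field_embedding \<sigma> \<longrightarrow> cmod (\<sigma> x) \<le> C)}"
    (is "finite ?X")
proof -
  obtain n where n: "\<And>x::'k. \<exists>g. g \<noteq> 0 \<and> degree g \<le> n \<and> poly (rpoly g) x = 0"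
    using number_field_algebraic[OF nf] by metis
  define C' where "C' = max C 0"
  define M where "M = (1 + C') ^ n"
  define A where "A = (of_int :: int \<Rightarrow> rat) ` {- \<lceil>M\<rceil>..\<lceil>M\<rceil>}"
  define Ps where "Ps = Poly ` {xs. set xs \<subseteq> A \<and> length xs \<le> Suc n}"
  have "finite Ps" unfolding Ps_def A_def by (intro finite_imageI finite_lists_length_le) auto
  have "?X \<subseteq> (\<Union>g\<in>Ps - {0}. {x. poly (rpoly g) x = 0})"
  proof
    fix x assume x: "x \<in> ?X"
    define Q where "Q g \<longleftrightarrow> g \<noteq> 0 \<and> degree g \<le> n \<and> poly (rpoly g) x = 0" for g
    obtain g0 where "Q g0" using n unfolding Q_def by metis
    then obtain g where g: "Q g" and min: "\<And>h. Q h \<Longrightarrow> degree g \<le> degree h"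
      using ex_has_least_nat[of Q g0 degree] by metis
    define h where "h = smult (inverse (lead_coeff g)) g"
    have g0: "g \<noteq> 0" using g Q_def by blast
    have dh: "degree h = degree g" unfolding h_def using g0 by simp
    have hx: "poly (rpoly h) x = 0"
    proof -
      have "rpoly h = smult (of_rat (inverse (lead_coeff g))) (rpoly g :: 'k poly)"
        by (rule poly_eqI) (simp add: h_def coeff_map_poly of_rat_mult)
      thus ?thesis using g Q_def by simp
    qed
    have h0: "h \<noteq> 0" using g0 by (simp add: h_def)
    have lh: "lead_coeff h = 1" using g0 by (simp add: h_def)
    have minh: "degree h \<le> degree h'" if "h' \<noteq> 0" "poly (rpoly h') x = 0" for h'
    proof (cases "degree h' \<le> n")
      case True thus ?thesis using min[of h'] that dh by (simp add: Q_def)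
    next
      case False thus ?thesis using g dh by (simp add: Q_def)
    qed
    have lc: "lead_coeff (rpoly h :: complex poly) = 1" using lh
      by (subst degree_map_poly) (auto simp: coeff_map_poly)
    have roots: "algebraic_int z \<and> cmod z \<le> C'" if z: "poly (rpoly h) z = 0" for z :: complex
    proof -
      obtain \<sigma> :: "'k \<Rightarrow> complex" where \<sigma>: "field_embedding \<sigma>" "\<sigma> x = z"
        using embedding_at_root[OF nf h0 hx minh z] .
      have "cmod (\<sigma> x) \<le> C" "algebraic_int (\<sigma> x)" using x \<sigma>(1) emb_algebraic_int by blast+
      thus ?thesis using \<sigma> unfolding C'_def by auto
    qed
    have C0: "C' \<ge> 0" by (simp add: C'_def)
    have co: "coeff h i \<in> A" for i
    proof -
      have ai: "algebraic_int (coeff (rpoly h :: complex poly) i)"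
        and le: "cmod (coeff (rpoly h) i) \<le> (1 + C') ^ degree (rpoly h :: complex poly)"
        using monic_coeffs_bound[OF lc roots C0] by auto
      have cr: "coeff (rpoly h :: complex poly) i = of_rat (coeff h i)" by (simp add: coeff_map_poly)
      have "of_rat (coeff h i) \<in> (\<int> :: complex set)"
        using ai unfolding cr by (intro rational_algebraic_int_is_int) auto
      then obtain m where m: "of_rat (coeff h i) = (of_int m :: complex)" by (auto elim: Ints_cases)
      hence m': "coeff h i = of_int m" by (metis of_rat_eq_iff of_rat_of_int_eq)
      have "degree (rpoly h :: complex poly) \<le> n" using g dh Q_def
        by (subst degree_map_poly) auto
      hence "(1 + C') ^ degree (rpoly h :: complex poly) \<le> M"
        unfolding M_def using C0 by (intro power_increasing) auto
      hence "\<bar>of_int m\<bar> \<le> M" using le unfolding cr m by (simp add: norm_of_int)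
      hence "m \<in> {- \<lceil>M\<rceil>..\<lceil>M\<rceil>}" by (auto; linarith)
      thus ?thesis unfolding A_def m' by blast
    qed
    have "h = Poly (coeffs h)" by simp
    moreover have "set (coeffs h) \<subseteq> A" using co by (auto simp: coeffs_def)
    moreover have "length (coeffs h) \<le> Suc n" using g dh Q_def by (auto simp: length_coeffs_degree h0)
    ultimately have "h \<in> Ps" unfolding Ps_def by blast
    thus "x \<in> (\<Union>g\<in>Ps - {0}. {x. poly (rpoly g) x = 0})" using h0 hx by blast
  qed
  moreover have "finite {x::'k. poly (rpoly g) x = 0}" if "g \<noteq> 0" for g
    using that by (intro poly_roots_finite) (subst map_poly_eq_0_iff, auto)
  hence "finite (\<Union>g\<in>Ps - {0}. {x::'k. poly (rpoly g) x = 0})" using \<open>finite Ps\<close> by (intro finite_UN_I) auto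
  ultimately show ?thesis by (rule finite_subset)
qed

text \<open>If \<open>a\<close> is the leading coefficient of an integer relation of degree
  \<open>d\<close> for \<open>z\<close>, then \<open>a * z\<close> maps the group generated by the
  powers below \<open>d\<close> into itself.\<close>

lemma ex_integer_multiple:
  assumes nf: "number_field TYPE('k::field_char_0)"
  shows "\<exists>N>0. algebraic_int (of_nat N * (z::'k))"
proof -
  obtain n where n: "\<And>x::'k. \<exists>g. g \<noteq> 0 \<and> degree g \<le> n \<and> poly (rpoly g) x = 0"
    using number_field_algebraic[OF nf] by metis
  obtain g where "g \<noteq> 0" "poly (rpoly g) z = 0" using n by metis
  hence "algebraic z"
    unfolding algebraic_altdef
    by (intro exI[of _ "rpoly g"]) (auto simp: coeff_map_poly map_poly_eq_0_iff)
  then obtain p where p: "\<And>i. coeff p i \<in> \<int>" "p \<noteq> 0" "poly p z = 0" unfolding algebraic_def by blast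
  from p(1) have "\<forall>i. \<exists>c. coeff p i = of_int c" unfolding Ints_def by blast
  then obtain c where c: "\<And>i. coeff p i = of_int (c i)" by metis
  define d where "d = degree p"
  define a where "a = c d"
  have a0: "a \<noteq> 0"
  proof
    assume "a = 0"
    hence "lead_coeff p = 0" by (simp add: a_def d_def c)
    thus False using p(2) by simp
  qed
  have "algebraic_int (of_int a * z)"
  proof (cases "d = 0")
    case True
    then obtain b where "p = [:b:]" unfolding d_def using degree_eq_zeroE by metis
    thus ?thesis using p(2,3) by simp
  next
    case False
    have e: "(\<Sum>k<d. of_int (c k) * z ^ k) + of_int a * z ^ d = 0"
      using p(3) unfolding poly_altdef d_def[symmetric] lessThan_Suc_atMost[symmetric] sum.lessThan_Suc
      by (simp add: c a_def)
    have "1 \<in> (\<lambda>k. z ^ k) ` {..<d}" using False by (auto intro!: image_eqI[of _ _ 0])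
    moreover have "of_int a * z * w \<in> Zm.span ((\<lambda>k. z ^ k) ` {..<d})" if "w \<in> (\<lambda>k. z ^ k) ` {..<d}" for w
    proof -
      from that obtain k where k: "k < d" "w = z ^ k" by auto
      show ?thesis
      proof (cases "Suc k < d")
        case True
        have "z ^ Suc k \<in> Zm.span ((\<lambda>k. z ^ k) ` {..<d})" using True by (metis Zm.span_base imageI lessThan_iff)
        hence "of_int a * z ^ Suc k \<in> Zm.span ((\<lambda>k. z ^ k) ` {..<d})" by (rule Zm.span_scale)
        thus ?thesis by (simp add: k mult.assoc)
      next
        case False
        hence "d = Suc k" using k by simp
        hence "of_int a * z * w = of_int a * z ^ d" using k by simp
        also have "\<dots> = - (\<Sum>k<d. of_int (c k) * z ^ k)" using e by (simp add: eq_neg_iff_add_eq_0 add.commute)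
        also have "\<dots> \<in> Zm.span ((\<lambda>k. z ^ k) ` {..<d})"
          by (intro Zm.span_neg Zm.span_sum Zm.span_scale Zm.span_base) auto
        finally show ?thesis .
      qed
    qed
    ultimately show ?thesis using algebraic_int_stable[of "(\<lambda>k. z ^ k) ` {..<d}" 1] by auto
  qed
  hence "algebraic_int (of_nat (nat \<bar>a\<bar>) * z)"
    by (cases "a \<ge> 0") (auto simp: of_nat_nat)
  thus ?thesis using a0 by (intro exI[of _ "nat \<bar>a\<bar>"]) auto
qed

lemma Oring_subspace: "Zm.subspace (Oring :: 'k::field_char_0 set)"
  by (rule Zm.subspaceI) (auto simp: algebraic_int_add_mult int_imp_algebraic_int)

text \<open>Start from integers \<open>B\<close> spanning K over the rationals. Removing the
  integral parts of the coordinates of an integer leaves an integer with coordinates in [0, 1),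
  whose conjugates are at most \<open>C\<close>; these remainders form a finite set, which is added
  to the generators.\<close>

lemma Oring_finitely_generated:
  assumes nf: "number_field TYPE('k::field_char_0)"
  obtains W :: "'k::field_char_0 set" where "finite W" "Oring = Zm.span W"
proof -
  obtain B0 :: "'k set" where B0: "finite B0" "Qm.span B0 = UNIV"
    using number_field_basis[OF nf] .
  have "\<exists>N. \<forall>b::'k. N b > 0 \<and> algebraic_int (of_nat (N b) * b)"
    using ex_integer_multiple[OF nf] by metis
  then obtain N where N: "\<And>b::'k. N b > 0" "\<And>b::'k. algebraic_int (of_nat (N b) * b)" by metis
  define B where "B = (\<lambda>b. of_nat (N b) * b) ` B0"
  have B: "finite B" "B \<subseteq> Oring" unfolding B_def using B0 N by auto
  have "b \<in> Qm.span B" if "b \<in> B0" for b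
  proof -
    have "of_nat (N b) * b \<in> Qm.span B" using that by (intro Qm.span_base) (auto simp: B_def)
    hence "of_rat (inverse (of_nat (N b))) * (of_nat (N b) * b) \<in> Qm.span B" by (rule Qm.span_scale)
    thus ?thesis using N(1)[of b] by (simp add: of_rat_inverse mult.assoc[symmetric])
  qed
  hence "Qm.span B0 \<subseteq> Qm.span B" by (intro Qm.span_minimal) auto
  hence sB: "Qm.span B = UNIV" using B0 by auto
  define E where "E = {\<sigma> :: 'k \<Rightarrow> complex. field_embedding \<sigma>}"
  have "finite E" unfolding E_def using finite_embeddings[OF nf] .
  define C where "C = (\<Sum>\<sigma>\<in>E. \<Sum>b\<in>B. cmod (\<sigma> b))"
  define T where "T = {x::'k. algebraic_int x \<and> (\<forall>\<sigma>::'k \<Rightarrow> complex. field_embedding \<sigma> \<longrightarrow> cmod (\<sigma> x) \<le> C)}"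
  have T: "finite T" "T \<subseteq> Oring" unfolding T_def using finite_bounded_integers_complex[OF nf] by auto
  show ?thesis
  proof (rule that[of "B \<union> T"])
    show "Oring = Zm.span (B \<union> T)"
    proof
      show "Zm.span (B \<union> T) \<subseteq> Oring"
        using B T Oring_subspace by (intro Zm.span_minimal) auto
      show "Oring \<subseteq> Zm.span (B \<union> T)"
      proof
        fix x :: 'k assume x: "x \<in> Oring"
        have "x \<in> Qm.span B" using sB by simp
        then obtain r where r: "x = (\<Sum>b\<in>B. of_rat (r b) * b)"
          unfolding Qm.span_finite[OF B(1)] by auto
        define y where "y = (\<Sum>b\<in>B. of_int \<lfloor>r b\<rfloor> * b)"
        have y: "y \<in> Zm.span B" unfolding y_def by (intro Zm.span_sum Zm.span_scale Zm.span_base)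
        have xy: "x - y = (\<Sum>b\<in>B. of_rat (frac (r b)) * b)"
          unfolding r y_def sum_subtractf[symmetric]
          by (intro sum.cong) (auto simp: frac_def of_rat_diff algebra_simps)
        have "x - y \<in> T" unfolding T_def
        proof (intro CollectI conjI allI impI)
          have "y \<in> Oring" using y B Oring_subspace Zm.span_minimal by blast
          thus "algebraic_int (x - y)" using x by (simp add: algebraic_int_diff)
          fix \<sigma> :: "'k \<Rightarrow> complex" assume \<sigma>: "field_embedding \<sigma>"
          have "cmod (\<sigma> (x - y)) \<le> (\<Sum>b\<in>B. cmod (of_rat (frac (r b))) * cmod (\<sigma> b))"
            unfolding xy by (simp add: emb_sum[OF \<sigma>] emb_mult[OF \<sigma>] emb_of_rat[OF \<sigma>] sum_norm_le norm_mult)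
          also have "\<dots> \<le> (\<Sum>b\<in>B. 1 * cmod (\<sigma> b))"
          proof (intro sum_mono mult_right_mono)
            fix b
            have "field_embedding (of_real :: real \<Rightarrow> complex)" by (simp add: field_embedding_def)
            from emb_of_rat[OF this] have "cmod (of_rat (frac (r b))) = \<bar>of_rat (frac (r b))\<bar>"
              by (metis norm_of_real)
            also have "\<dots> = of_rat (frac (r b))" by (simp add: frac_ge_0)
            also have "\<dots> \<le> 1" using frac_lt_1[of "r b"] by simp
            finally show "cmod (of_rat (frac (r b))) \<le> 1" .
          qed simp
          also have "\<dots> \<le> C" unfolding C_def using \<sigma> \<open>finite E\<close>
            by (simp, intro member_le_sum) (auto simp: E_def intro: sum_nonneg)
          finally show "cmod (\<sigma> (x - y)) \<le> C" .
        qed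
        hence "(x - y) + y \<in> Zm.span (B \<union> T)"
          using y Zm.span_mono[of B "B \<union> T"] by (intro Zm.span_add) (auto intro: Zm.span_base)
        thus "x \<in> Zm.span (B \<union> T)" by simp
      qed
    qed
  qed (use B T in auto)
qed

lemma finite_quotient_of_nat:
  fixes W :: "'a::ring_1 set"
  assumes "finite W" "N > 0"
  obtains T where "finite T" "T \<subseteq> Zm.span W"
    "\<And>x. x \<in> Zm.span W \<Longrightarrow> \<exists>t\<in>T. \<exists>y\<in>Zm.span W. x - t = of_nat N * y"
proof -
  define T where "T = (\<lambda>c. \<Sum>w\<in>W. of_int (c w) * w) ` (PiE W (\<lambda>_. {0..<int N}))"
  show ?thesis
  proof (rule that[of T])
    show "finite T" unfolding T_def using assms(1) by (intro finite_imageI finite_PiE) auto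
    show "T \<subseteq> Zm.span W" unfolding T_def
      by (rule image_subsetI) (intro Zm.span_sum Zm.span_scale Zm.span_base)
    fix x :: 'a assume "x \<in> Zm.span W"
    then obtain u where u: "x = (\<Sum>w\<in>W. of_int (u w) * w)" unfolding Zm.span_finite[OF assms(1)] by auto
    define t where "t = (\<Sum>w\<in>W. of_int (restrict (\<lambda>w. u w mod int N) W w) * w)"
    define y where "y = (\<Sum>w\<in>W. of_int (u w div int N) * w)"
    have "t \<in> T" unfolding T_def t_def using assms(2) by (intro imageI) auto
    moreover have "y \<in> Zm.span W" unfolding y_def by (intro Zm.span_sum Zm.span_scale Zm.span_base)
    moreover have "x - t = of_nat N * y"
    proof -
      have "of_int (u w) * w - of_int (restrict (\<lambda>w. u w mod int N) W w) * w
         = of_nat N * (of_int (u w div int N) * w)" if "w \<in> W" for w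
      proof -
        have "u w - u w mod int N = int N * (u w div int N)" by (simp add: minus_mod_eq_mult_div)
        hence "of_int (u w - u w mod int N) * w = (of_int (int N * (u w div int N)) * w :: 'a)" by simp
        thus ?thesis using that by (simp add: left_diff_distrib mult.assoc)
      qed
      thus ?thesis unfolding u t_def y_def sum_distrib_left sum_subtractf[symmetric] by (rule sum.cong[OF refl])
    qed
    ultimately show "\<exists>t\<in>T. \<exists>y\<in>Zm.span W. x - t = of_nat N * y" by blast
  qed
qed

subsection \<open>Totally positive units\<close>

definition unit_OK :: "'k::field_char_0 \<Rightarrow> bool" where
  "unit_OK u \<longleftrightarrow> u \<noteq> 0 \<and> algebraic_int u \<and> algebraic_int (inverse u)"

lemma unit_OK_mult: "unit_OK u \<Longrightarrow> unit_OK v \<Longrightarrow> unit_OK (u * v)"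
  by (simp add: unit_OK_def algebraic_int_add_mult)

lemma unit_OK_inverse: "unit_OK u \<Longrightarrow> unit_OK (inverse u)"
  by (simp add: unit_OK_def)

lemma unit_OK_1: "unit_OK 1"
  by (simp add: unit_OK_def int_imp_algebraic_int)

lemma complex_embedding_real:
  assumes "totally_real TYPE('k::field_char_0)" "field_embedding (\<sigma> :: 'k \<Rightarrow> complex)"
  shows "field_embedding (\<lambda>x. Re (\<sigma> x))" "\<sigma> x = of_real (Re (\<sigma> x))"
proof -
  have r: "\<sigma> x = of_real (Re (\<sigma> x))" for x
    using assms unfolding totally_real_def by (metis of_real_Re range_subsetD)
  show "\<sigma> x = of_real (Re (\<sigma> x))" by (rule r)
  have i: "Im (\<sigma> x) = 0" for x by (subst r) simp
  show "field_embedding (\<lambda>x. Re (\<sigma> x))"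
    using assms(2) by (simp add: field_embedding_def i)
qed

text \<open>The element 0 has minimal polynomial X, whose root 0 yields some complex embedding;
  total reality makes it real.\<close>

lemma ex_real_embedding:
  assumes nf: "number_field TYPE('k::field_char_0)" and tr: "totally_real TYPE('k)"
  shows "\<exists>\<sigma> :: 'k \<Rightarrow> real. field_embedding \<sigma>"
proof -
  have 1: "[:0, 1::rat:] \<noteq> 0" by simp
  have 2: "poly (rpoly [:0, 1::rat:]) (0::'k) = 0" by (simp add: map_poly_pCons)
  have 3: "degree [:0, 1::rat:] \<le> degree h" if "h \<noteq> 0" "poly (rpoly h) (0::'k) = 0" for h
  proof (rule ccontr)
    assume "\<not> degree [:0, 1::rat:] \<le> degree h"
    hence "degree h = 0" by simp
    then obtain a where "h = [:a:]" by (rule degree_eq_zeroE)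
    thus False using that by (simp add: map_poly_pCons)
  qed
  have 4: "poly (rpoly [:0, 1::rat:]) (0::complex) = 0" by (simp add: map_poly_pCons)
  obtain \<sigma> :: "'k \<Rightarrow> complex" where "field_embedding \<sigma>"
    using embedding_at_root[OF nf 1 2 3 4] .
  thus ?thesis using complex_embedding_real(1)[OF tr] by metis
qed

lemma finite_bounded_integers:
  assumes nf: "number_field TYPE('k::field_char_0)" and tr: "totally_real TYPE('k)"
  shows "finite {x::'k. algebraic_int x \<and> (\<forall>\<sigma>::'k \<Rightarrow> real. field_embedding \<sigma> \<longrightarrow> \<bar>\<sigma> x\<bar> \<le> C)}"
proof (rule finite_subset[OF _ finite_bounded_integers_complex[OF nf, of C]], clarify)
  fix x :: 'k and \<sigma> :: "'k \<Rightarrow> complex"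
  assume x: "\<forall>\<sigma>::'k \<Rightarrow> real. field_embedding \<sigma> \<longrightarrow> \<bar>\<sigma> x\<bar> \<le> C" and \<sigma>: "field_embedding \<sigma>"
  note c = complex_embedding_real[OF tr \<sigma>]
  have "cmod (\<sigma> x) = \<bar>Re (\<sigma> x)\<bar>" by (subst c(2)) (simp only: norm_of_real)
  thus "cmod (\<sigma> x) \<le> C" using x c(1) by auto
qed

text \<open>Weak approximation by hand: for each other embedding there is an element small at
  \<sigma> and at least 1 in size there. The sum of their squares minus 1/2 has the required signs,
  and a positive integer multiple is integral.\<close>

lemma ex_negative_at:
  assumes nf: "number_field TYPE('k::field_char_0)" and \<sigma>: "field_embedding (\<sigma> :: 'k \<Rightarrow> real)"
  shows "\<exists>z. z \<noteq> 0 \<and> algebraic_int z \<and> \<sigma> z < 0 \<and> (\<forall>\<tau>::'k \<Rightarrow> real. field_embedding \<tau> \<and> \<tau> \<noteq> \<sigma> \<longrightarrow> \<tau> z > 0)"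
proof -
  define E where "E = {\<tau> :: 'k \<Rightarrow> real. field_embedding \<tau> \<and> \<tau> \<noteq> \<sigma>}"
  have fE: "finite E" using finite_embeddings[OF nf, where 'l = real] unfolding E_def
    by (rule rev_finite_subset) auto
  define n where "n = card E"
  \<comment> \<open>Chosen so that \<open>n\<close> squares of size at most
    \<open>\<epsilon>\<^sup>2\<close> add up to less than 1/2.\<close>
  define \<epsilon> :: real where "\<epsilon> = 1 / (2 * (real n + 1))"
  have \<epsilon>: "\<epsilon> > 0" "\<epsilon> \<le> 1 / 2" unfolding \<epsilon>_def by (auto simp: field_simps)
  have ne: "real n * \<epsilon>\<^sup>2 < 1 / 2"
  proof -
    have "real n * \<epsilon> \<le> 1 / 2" unfolding \<epsilon>_def by (auto simp: field_simps)
    hence "real n * \<epsilon> * \<epsilon> \<le> 1 / 2 * (1 / 2)" using \<epsilon> by (intro mult_mono) auto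
    thus ?thesis by (simp add: power2_eq_square mult.assoc)
  qed
  have "\<exists>a. \<bar>\<sigma> a\<bar> < \<epsilon> \<and> \<bar>\<tau> a\<bar> \<ge> 1" if "\<tau> \<in> E" for \<tau>
  proof -
    from that have \<tau>: "field_embedding \<tau>" "\<tau> \<noteq> \<sigma>" by (auto simp: E_def)
    then obtain b where b: "\<tau> b \<noteq> \<sigma> b" by auto
    \<comment> \<open>Multiplication by \<open>m\<close> widens the gap between the two conjugates
      beyond 2, so a rational number within 1/2 of one is at distance at least 1 from the other;
      rational numbers are fixed by both embeddings.\<close>
    obtain m :: nat where m: "real m * \<bar>\<tau> b - \<sigma> b\<bar> > 2"
      using b reals_Archimedean3[of "\<bar>\<tau> b - \<sigma> b\<bar>"] by auto
    define c where "c = of_nat m * b"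
    obtain r where r: "\<sigma> c - \<epsilon> < of_rat r" "of_rat r < \<sigma> c + \<epsilon>"
      using of_rat_dense[of "\<sigma> c - \<epsilon>" "\<sigma> c + \<epsilon>"] \<epsilon>(1) by auto
    have "\<tau> c - \<sigma> c = real m * (\<tau> b - \<sigma> b)"
      by (simp add: c_def emb_mult[OF \<sigma>] emb_mult[OF \<tau>(1)] emb_of_nat[OF \<sigma>] emb_of_nat[OF \<tau>(1)] algebra_simps)
    hence "\<bar>\<tau> c - \<sigma> c\<bar> > 2" using m by (simp add: abs_mult)
    hence "\<bar>\<tau> c - of_rat r\<bar> \<ge> 1" using r \<epsilon>(2) by linarith
    moreover have "\<bar>\<sigma> c - of_rat r\<bar> < \<epsilon>" using r by linarith
    ultimately show ?thesis
      by (intro exI[of _ "c - of_rat r"])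
         (simp add: emb_diff[OF \<sigma>] emb_diff[OF \<tau>(1)] emb_of_rat[OF \<sigma>] emb_of_rat[OF \<tau>(1)])
  qed
  then obtain a where a: "\<And>\<tau>. \<tau> \<in> E \<Longrightarrow> \<bar>\<sigma> (a \<tau>)\<bar> < \<epsilon>" "\<And>\<tau>. \<tau> \<in> E \<Longrightarrow> \<bar>\<tau> (a \<tau>)\<bar> \<ge> 1" by metis
  define w where "w = (\<Sum>\<tau>\<in>E. a \<tau> ^ 2) - of_rat (1 / 2)"
  have ev: "\<tau> w = (\<Sum>\<rho>\<in>E. (\<tau> (a \<rho>))\<^sup>2) - 1 / 2" if "field_embedding \<tau>" for \<tau> :: "'k \<Rightarrow> real"
  proof -
    have "\<tau> (1 / 2) = 1 / 2" using emb_of_rat[OF that, of "1 / 2"] by (simp add: of_rat_divide)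
    thus ?thesis unfolding w_def
      by (simp add: emb_diff[OF that] emb_sum[OF that] emb_power[OF that] of_rat_divide)
  qed
  have s: "\<sigma> w < 0"
  proof -
    have "(\<Sum>\<rho>\<in>E. (\<sigma> (a \<rho>))\<^sup>2) \<le> (\<Sum>\<rho>\<in>E. \<epsilon>\<^sup>2)"
    proof (rule sum_mono)
      fix \<rho> assume "\<rho> \<in> E"
      hence "\<bar>\<sigma> (a \<rho>)\<bar>\<^sup>2 \<le> \<epsilon>\<^sup>2" using a(1) by (intro power_mono) (auto intro: less_imp_le)
      thus "(\<sigma> (a \<rho>))\<^sup>2 \<le> \<epsilon>\<^sup>2" by simp
    qed
    also have "\<dots> = real n * \<epsilon>\<^sup>2" by (simp add: n_def)
    finally show ?thesis using ne ev[OF \<sigma>] by simp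
  qed
  have t: "\<tau> w > 0" if "\<tau> \<in> E" for \<tau>
  proof -
    have \<tau>: "field_embedding \<tau>" using that by (simp add: E_def)
    have "1\<^sup>2 \<le> \<bar>\<tau> (a \<tau>)\<bar>\<^sup>2" using a(2)[OF that] by (intro power_mono) auto
    hence "1 \<le> (\<tau> (a \<tau>))\<^sup>2" by simp
    also have "\<dots> \<le> (\<Sum>\<rho>\<in>E. (\<tau> (a \<rho>))\<^sup>2)" using that fE by (intro member_le_sum) auto
    finally show ?thesis using ev[OF \<tau>] by simp
  qed
  obtain N where N: "N > 0" "algebraic_int (of_nat N * w)" using ex_integer_multiple[OF nf] by metis
  show ?thesis
  proof (intro exI[of _ "of_nat N * w"] conjI allI impI)
    show "\<sigma> (of_nat N * w) < 0" using s N(1)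
      by (simp add: emb_mult[OF \<sigma>] emb_of_nat[OF \<sigma>] mult_pos_neg)
    thus "of_nat N * w \<noteq> 0" by (metis emb_0[OF \<sigma>] order.irrefl)
    fix \<tau> :: "'k \<Rightarrow> real" assume *: "field_embedding \<tau> \<and> \<tau> \<noteq> \<sigma>"
    hence \<tau>: "field_embedding \<tau>" by simp
    have "\<tau> w > 0" using * t by (auto simp: E_def)
    thus "\<tau> (of_nat N * w) > 0" using N(1) by (simp add: emb_mult[OF \<tau>] emb_of_nat[OF \<tau>])
  qed (rule N(2))
qed

text \<open>An integer that is negative only at one embedding becomes, after division by its totally
  positive factor, a unit with the same signs. Products of such units realize every sign
  pattern.\<close>

lemma units_with_signs:
  assumes nf: "number_field TYPE('k::field_char_0)"
    and fac: "\<And>x::'k. x \<noteq> 0 \<Longrightarrow> algebraic_int x \<Longrightarrow> \<exists>u y. unit_OK u \<and> totally_positive y \<and> x = u * y"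
    and T: "finite T" "\<And>\<sigma>. \<sigma> \<in> T \<Longrightarrow> field_embedding \<sigma>"
  shows "\<exists>u::'k. unit_OK u \<and> (\<forall>\<tau>::'k \<Rightarrow> real. field_embedding \<tau> \<longrightarrow> (\<tau> u < 0 \<longleftrightarrow> \<tau> \<in> T))"
  using T
proof (induction T rule: finite_induct)
  case empty
  show ?case by (rule exI[of _ 1]) (simp add: unit_OK_1 emb_1)
next
  case (insert \<sigma> T)
  then obtain u where u: "unit_OK u" "\<And>\<tau>. field_embedding \<tau> \<Longrightarrow> \<tau> u < 0 \<longleftrightarrow> \<tau> \<in> T" by auto
  have \<sigma>: "field_embedding \<sigma>" using insert by simp
  obtain z where z: "z \<noteq> 0" "algebraic_int z" "\<sigma> z < 0" 
    "\<And>\<tau>. field_embedding \<tau> \<Longrightarrow> \<tau> \<noteq> \<sigma> \<Longrightarrow> \<tau> z > 0"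
    using ex_negative_at[OF nf \<sigma>] by metis
  obtain v y where v: "unit_OK v" "totally_positive y" "z = v * y" using fac[OF z(1,2)] by metis
  have y: "\<tau> y > 0" if "field_embedding \<tau>" for \<tau> :: "'k \<Rightarrow> real" using v(2) that by (simp add: totally_positive_def)
  have zv: "\<tau> z = \<tau> v * \<tau> y" if "field_embedding \<tau>" for \<tau> :: "'k \<Rightarrow> real" unfolding v(3) by (rule emb_mult[OF that])
  have vs: "\<sigma> v < 0" using z(3) y[OF \<sigma>] zv[OF \<sigma>] by (simp add: mult_less_0_iff)
  have vt: "\<tau> v > 0" if "field_embedding \<tau>" "\<tau> \<noteq> \<sigma>" for \<tau>
    using z(4)[OF that] y[OF that(1)] zv[OF that(1)] by (simp add: zero_less_mult_iff)
  show ?case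
  proof (intro exI[of _ "v * u"] conjI allI impI)
    show "unit_OK (v * u)" using u(1) v(1) by (rule unit_OK_mult[rotated])
    fix \<tau> :: "'k \<Rightarrow> real" assume \<tau>: "field_embedding \<tau>"
    have "\<tau> u \<noteq> 0" using u(1) emb_eq_0[OF \<tau>] by (simp add: unit_OK_def)
    show "\<tau> (v * u) < 0 \<longleftrightarrow> \<tau> \<in> insert \<sigma> T"
    proof (cases "\<tau> = \<sigma>")
      case True
      have "\<not> \<sigma> u < 0" using u(2)[OF \<sigma>] insert.hyps by simp
      hence "\<sigma> u > 0" using \<open>\<tau> u \<noteq> 0\<close> True by simp
      thus ?thesis using True vs by (simp add: emb_mult[OF \<sigma>] mult_neg_pos)
    next
      case False
      thus ?thesis using vt[OF \<tau> False] u(2)[OF \<tau>] by (simp add: emb_mult[OF \<tau>] mult_less_0_iff)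
    qed
  qed
qed

text \<open>Otherwise all powers of \<open>u\<close> are integers with conjugates bounded by 1, so
  two of them coincide and some positive power is 1, contradicting
  \<open>\<bar>\<sigma> u\<bar> < 1\<close>.\<close>

lemma integer_not_small:
  assumes nf: "number_field TYPE('k::field_char_0)" and tr: "totally_real TYPE('k)"
    and u: "algebraic_int u" "u \<noteq> (0::'k)"
  shows "\<exists>\<sigma>::'k \<Rightarrow> real. field_embedding \<sigma> \<and> \<bar>\<sigma> u\<bar> \<ge> 1"
proof (rule ccontr)
  assume "\<not> ?thesis"
  hence lt: "\<bar>\<sigma> u\<bar> < 1" if "field_embedding \<sigma>" for \<sigma> :: "'k \<Rightarrow> real" using that by force
  have "range (\<lambda>k. u ^ k) \<subseteq> {x::'k. algebraic_int x \<and> (\<forall>\<sigma>::'k \<Rightarrow> real. field_embedding \<sigma> \<longrightarrow> \<bar>\<sigma> x\<bar> \<le> 1)}"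
  proof (rule image_subsetI, intro CollectI conjI allI impI)
    fix k :: nat
    show "algebraic_int (u ^ k)" using u(1) by (rule algebraic_int_power)
    fix \<sigma> :: "'k \<Rightarrow> real" assume \<sigma>: "field_embedding \<sigma>"
    have "\<bar>\<sigma> u\<bar> ^ k \<le> 1" using lt[OF \<sigma>] by (intro power_le_one) auto
    thus "\<bar>\<sigma> (u ^ k)\<bar> \<le> 1" by (simp only: emb_power[OF \<sigma>] power_abs)
  qed
  hence "finite (range (\<lambda>k. u ^ k))" by (rule finite_subset) (rule finite_bounded_integers[OF nf tr])
  hence "\<not> inj (\<lambda>k::nat. u ^ k)" using finite_imageD infinite_UNIV_nat by blast
  then obtain i j where ij: "i < j" "u ^ i = u ^ j"
    unfolding inj_def by (metis linorder_neqE_nat)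
  have "u ^ i * u ^ (j - i) = u ^ i * 1" using ij by (metis le_add_diff_inverse less_imp_le mult_1_right power_add)
  hence one: "u ^ (j - i) = 1" using u(2) by simp
  obtain \<sigma> :: "'k \<Rightarrow> real" where \<sigma>: "field_embedding \<sigma>" using ex_real_embedding[OF nf tr] by metis
  have "\<sigma> u ^ (j - i) = 1" using one by (metis emb_power[OF \<sigma>] emb_1[OF \<sigma>])
  hence "\<bar>\<sigma> u\<bar> ^ (j - i) = 1" by (metis power_abs abs_one)
  moreover have "\<bar>\<sigma> u\<bar> ^ (j - i) < 1" using lt[OF \<sigma>] ij(1) by (simp add: power_less_one_iff)
  ultimately show False by simp
qed

text \<open>
  If \<open>u\<^sub>0\<close> is a totally positive unit that is not a square, the units have at least \<open>2 ^ n\<close> classes modulo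
  squares that are positive at a fixed embedding \<open>\<sigma>\<^sub>0\<close>, \<open>n\<close> being the number of embeddings. Hence
  doubling \<open>R\<close> multiplies the number of units with \<open>\<bar>ln \<bar>\<sigma> u\<bar>\<bar> \<le> R\<close> for all \<open>\<sigma>\<close> by \<open>2 ^ n\<close>.
  This contradicts growth of order \<open>n - 1\<close>: no unit has all \<open>\<bar>\<sigma> u\<bar> > 1\<close>, so a unit is determined up to
  finitely many choices by the integer parts of \<open>ln \<bar>\<sigma> u\<bar> - ln \<bar>\<sigma>\<^sub>0 u\<bar>\<close>.
\<close>

lemma totally_positive_unit_square:
  assumes nf: "number_field TYPE('k::field_char_0)" and tr: "totally_real TYPE('k)"
    and fac: "\<And>x::'k. x \<noteq> 0 \<Longrightarrow> algebraic_int x \<Longrightarrow> \<exists>u y. unit_OK u \<and> totally_positive y \<and> x = u * y"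
    and u0: "unit_OK u0" "totally_positive (u0::'k)"
  shows "\<exists>v. unit_OK v \<and> u0 = v * v"
proof (rule ccontr)
  assume nsq: "\<not> ?thesis"
  define E where "E = {\<sigma> :: 'k \<Rightarrow> real. field_embedding \<sigma>}"
  have fE: "finite E" unfolding E_def by (rule finite_embeddings[OF nf])
  obtain \<sigma>0 where \<sigma>0: "\<sigma>0 \<in> E" using ex_real_embedding[OF nf tr] unfolding E_def by auto
  have E: "field_embedding \<sigma>" if "\<sigma> \<in> E" for \<sigma> using that by (simp add: E_def)
  define n where "n = card E"
  have n: "n > 0" unfolding n_def using fE \<sigma>0 by (auto simp: card_gt_0_iff)
  define L where "L \<sigma> u = ln \<bar>\<sigma> u\<bar>" for \<sigma> :: "'k \<Rightarrow> real" and u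
  have nz: "\<sigma> u \<noteq> 0" if "\<sigma> \<in> E" "unit_OK u" for \<sigma> u
    using that emb_eq_0[OF E] by (simp add: unit_OK_def)
  have Lm: "L \<sigma> (u * v) = L \<sigma> u + L \<sigma> v" if "\<sigma> \<in> E" "unit_OK u" "unit_OK v" for \<sigma> u v
    using nz[OF that(1,2)] nz[OF that(1,3)] unfolding L_def emb_mult[OF E[OF that(1)]] abs_mult
    by (simp add: ln_mult)
  have Li: "L \<sigma> (inverse u) = - L \<sigma> u" if "\<sigma> \<in> E" "unit_OK u" for \<sigma> u
    using nz[OF that] unfolding L_def emb_inverse[OF E[OF that(1)]] by (simp add: ln_inverse)
  \<comment> \<open>Positivity at \<open>\<sigma>0\<close> keeps exactly one of \<open>u\<close> and
    \<open>- u\<close>, so that a unit counted here is determined by its square.\<close>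
  define U where "U k = {u. unit_OK u \<and> \<sigma>0 u > 0 \<and> (\<forall>\<sigma>\<in>E. \<bar>L \<sigma> u\<bar> \<le> real k)}" for k :: nat
  have fU: "finite (U k)" for k
  proof (rule finite_subset[OF _ finite_bounded_integers[OF nf tr, of "exp (real k)"]], clarify, intro conjI allI impI)
    fix u assume u: "u \<in> U k"
    thus "algebraic_int u" by (simp add: U_def unit_OK_def)
    fix \<sigma> :: "'k \<Rightarrow> real" assume "field_embedding \<sigma>"
    hence \<sigma>: "\<sigma> \<in> E" by (simp add: E_def)
    have "L \<sigma> u \<le> real k" using u \<sigma> by (auto simp: U_def)
    moreover have "\<bar>\<sigma> u\<bar> > 0" using u nz[OF \<sigma>] by (auto simp: U_def)
    ultimately show "\<bar>\<sigma> u\<bar> \<le> exp (real k)" unfolding L_def by (metis exp_le_cancel_iff exp_ln)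
  qed
  have U0: "1 \<in> U 0" unfolding U_def L_def using E \<sigma>0 by (simp add: unit_OK_1 emb_1)
  \<comment> \<open>This bounds the fibres of the rounding map \<open>\<phi>\<close> below. A
    quotient of two units in one fibre has all its logarithms within 1 of the one at
    \<open>\<sigma>0\<close>. That one is at most 1 in size, since the logarithms of a unit cannot
    all be positive or all negative.\<close>
  define M where "M = card (U 2)"
  have upper: "card (U k) \<le> M * (4 * k + 2) ^ (n - 1)" for k
  proof -
    define \<phi> where "\<phi> u = (\<lambda>\<sigma>\<in>E - {\<sigma>0}. \<lfloor>L \<sigma> u - L \<sigma>0 u\<rfloor>)" for u
    define Z where "Z = PiE (E - {\<sigma>0}) (\<lambda>_. {- 2 * int k..2 * int k})"
    have fZ: "finite Z" unfolding Z_def using fE by (intro finite_PiE) auto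
    have "card Z = (\<Prod>i\<in>E - {\<sigma>0}. card {- 2 * int k..2 * int k})"
      unfolding Z_def using fE by (subst card_PiE) auto
    also have "\<dots> = (4 * k + 1) ^ (n - 1)" using \<sigma>0 fE by (simp add: n_def card_Diff_singleton nat_add_distrib nat_mult_distrib algebra_simps)
    finally have cZ: "card Z \<le> (4 * k + 2) ^ (n - 1)" by (simp add: power_mono)
    have \<phi>: "\<phi> u \<in> Z" if "u \<in> U k" for u
      unfolding \<phi>_def Z_def
    proof (rule restrict_PiE_iff[THEN iffD2], rule ballI)
      fix \<sigma> assume \<sigma>: "\<sigma> \<in> E - {\<sigma>0}"
      have "\<bar>L \<sigma> u\<bar> \<le> real k" "\<bar>L \<sigma>0 u\<bar> \<le> real k" using that \<sigma> \<sigma>0 by (auto simp: U_def)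
      hence "- 2 * real k \<le> L \<sigma> u - L \<sigma>0 u" "L \<sigma> u - L \<sigma>0 u \<le> 2 * real k" by linarith+
      thus "\<lfloor>L \<sigma> u - L \<sigma>0 u\<rfloor> \<in> {- 2 * int k..2 * int k}" by (auto simp: le_floor_iff floor_le_iff)
    qed
    have fib: "card {u \<in> U k. \<phi> u = z} \<le> M" for z
    proof (cases "\<exists>v. v \<in> U k \<and> \<phi> v = z")
      case True
      then obtain v where v: "v \<in> U k" "\<phi> v = z" by blast
      have vu: "unit_OK v" "\<sigma>0 v > 0" using v(1) by (auto simp: U_def)
      have "(\<lambda>u. u * inverse v) ` {u \<in> U k. \<phi> u = z} \<subseteq> U 2"
      proof clarify
        fix u assume u: "u \<in> U k" "z = \<phi> u"
        have uu: "unit_OK u" "\<sigma>0 u > 0" using u(1) by (auto simp: U_def)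
        define w where "w = u * inverse v"
        have w: "unit_OK w" unfolding w_def using uu vu by (intro unit_OK_mult unit_OK_inverse)
        have wp: "\<sigma>0 w > 0" using uu vu unfolding w_def
          by (simp add: emb_mult[OF E[OF \<sigma>0]] emb_inverse[OF E[OF \<sigma>0]])
        have d: "\<bar>L \<sigma> w - L \<sigma>0 w\<bar> \<le> 1" if \<sigma>: "\<sigma> \<in> E" for \<sigma>
        proof (cases "\<sigma> = \<sigma>0")
          case False
          have "\<phi> u \<sigma> = \<phi> v \<sigma>" using u v by simp
          hence "\<lfloor>L \<sigma> u - L \<sigma>0 u\<rfloor> = \<lfloor>L \<sigma> v - L \<sigma>0 v\<rfloor>" using False \<sigma> by (simp add: \<phi>_def)
          hence "\<bar>(L \<sigma> u - L \<sigma>0 u) - (L \<sigma> v - L \<sigma>0 v)\<bar> \<le> 1" by linarith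
          thus ?thesis unfolding w_def using \<sigma> \<sigma>0 uu vu by (simp add: Lm Li unit_OK_inverse)
        qed simp
        have "L \<sigma>0 w \<le> 1"
        proof (rule ccontr)
          assume "\<not> L \<sigma>0 w \<le> 1"
          hence pos: "L \<sigma> w > 0" if "\<sigma> \<in> E" for \<sigma> using d[OF that] by linarith
          have "\<exists>\<sigma>::'k \<Rightarrow> real. field_embedding \<sigma> \<and> \<bar>\<sigma> (inverse w)\<bar> \<ge> 1"
            using w by (intro integer_not_small[OF nf tr]) (auto simp: unit_OK_def)
          then obtain \<sigma> where \<sigma>: "\<sigma> \<in> E" "\<bar>\<sigma> (inverse w)\<bar> \<ge> 1" unfolding E_def by auto
          have "L \<sigma> (inverse w) \<ge> 0" unfolding L_def using \<sigma>(2) by simp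
          thus False using pos[OF \<sigma>(1)] Li[OF \<sigma>(1) w] by simp
        qed
        moreover have "L \<sigma>0 w \<ge> - 1"
        proof (rule ccontr)
          assume "\<not> L \<sigma>0 w \<ge> - 1"
          hence neg: "L \<sigma> w < 0" if "\<sigma> \<in> E" for \<sigma> using d[OF that] by linarith
          have "\<exists>\<sigma>::'k \<Rightarrow> real. field_embedding \<sigma> \<and> \<bar>\<sigma> w\<bar> \<ge> 1"
            using w by (intro integer_not_small[OF nf tr]) (auto simp: unit_OK_def)
          then obtain \<sigma> where \<sigma>: "\<sigma> \<in> E" "\<bar>\<sigma> w\<bar> \<ge> 1" unfolding E_def by auto
          have "L \<sigma> w \<ge> 0" unfolding L_def using \<sigma>(2) by simp
          thus False using neg[OF \<sigma>(1)] by simp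
        qed
        ultimately have "\<bar>L \<sigma> w\<bar> \<le> real 2" if "\<sigma> \<in> E" for \<sigma> using d[OF that] by simp
        thus "u * inverse v \<in> U 2" using w wp unfolding U_def w_def[symmetric] by blast
      qed
      moreover have "inj_on (\<lambda>u. u * inverse v) {u \<in> U k. \<phi> u = z}"
        using vu by (auto simp: inj_on_def unit_OK_def)
      ultimately show ?thesis unfolding M_def using fU by (metis card_inj_on_le)
    next
      case False
      hence e: "{u \<in> U k. \<phi> u = z} = {}" by blast
      show ?thesis unfolding e by simp
    qed
    have "U k = (\<Union>z\<in>Z. {u \<in> U k. \<phi> u = z})" using \<phi> by auto
    hence "card (U k) \<le> (\<Sum>z\<in>Z. card {u \<in> U k. \<phi> u = z})" using card_UN_le[OF fZ] by metis
    also have "\<dots> \<le> (\<Sum>z\<in>Z. M)" using fib by (intro sum_mono)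
    also have "\<dots> \<le> M * (4 * k + 2) ^ (n - 1)" using cZ by simp
    finally show ?thesis .
  qed
  have "\<exists>u. unit_OK u \<and> (\<forall>\<tau>\<in>E. \<tau> u < 0 \<longleftrightarrow> \<tau> \<in> T)" if "T \<subseteq> E" for T
  proof -
    have "finite T" "\<And>\<sigma>. \<sigma> \<in> T \<Longrightarrow> field_embedding \<sigma>" using that fE E finite_subset by auto
    from units_with_signs[OF nf fac this] show ?thesis unfolding E_def by auto
  qed
  then obtain \<epsilon> where \<epsilon>: "\<And>T. T \<subseteq> E \<Longrightarrow> unit_OK (\<epsilon> T)" "\<And>T \<tau>. T \<subseteq> E \<Longrightarrow> \<tau> \<in> E \<Longrightarrow> \<tau> (\<epsilon> T) < 0 \<longleftrightarrow> \<tau> \<in> T"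
    by metis
  \<comment> \<open>Half of all sign patterns are positive at \<open>\<sigma>0\<close>; the Boolean
    component, recording a factor \<open>u0\<close>, restores the exponent \<open>n\<close>.\<close>
  define I where "I = Pow (E - {\<sigma>0}) \<times> (UNIV :: bool set)"
  have fI: "finite I" unfolding I_def using fE by auto
  have cI: "card I = 2 ^ n"
  proof -
    have "card I = 2 ^ (n - 1) * 2" unfolding I_def using fE \<sigma>0 by (simp add: card_cartesian_product card_Pow n_def)
    thus ?thesis using n by (cases n) auto
  qed
  define \<rho> where "\<rho> i = \<epsilon> (fst i) * (if snd i then u0 else 1)" for i
  have \<rho>u: "unit_OK (\<rho> i)" if "i \<in> I" for i
  proof -
    have "fst i \<subseteq> E" using that by (auto simp: I_def)
    thus ?thesis unfolding \<rho>_def using u0(1) by (intro unit_OK_mult \<epsilon>(1)) (simp_all add: unit_OK_1)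
  qed
  have u0p: "\<sigma> u0 > 0" if "\<sigma> \<in> E" for \<sigma> using u0(2) E[OF that] by (simp add: totally_positive_def)
  have \<rho>s: "\<sigma> (\<rho> i) < 0 \<longleftrightarrow> \<sigma> \<in> fst i" if "i \<in> I" "\<sigma> \<in> E" for \<sigma> i
  proof -
    have "fst i \<subseteq> E" using that by (auto simp: I_def)
    moreover have "\<sigma> (if snd i then u0 else 1) > 0" using u0p[OF that(2)] emb_1[OF E[OF that(2)]] by simp
    ultimately show ?thesis using \<epsilon>(2)[of "fst i" \<sigma>] that(2) unfolding \<rho>_def emb_mult[OF E[OF that(2)]]
      by (simp add: mult_less_0_iff)
  qed
  define C where "C = nat \<lceil>\<Sum>i\<in>I. \<Sum>\<sigma>\<in>E. \<bar>L \<sigma> (\<rho> i)\<bar>\<rceil>"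
  have C: "\<bar>L \<sigma> (\<rho> i)\<bar> \<le> real C" if "i \<in> I" "\<sigma> \<in> E" for \<sigma> i
  proof -
    have "\<bar>L \<sigma> (\<rho> i)\<bar> \<le> (\<Sum>\<sigma>\<in>E. \<bar>L \<sigma> (\<rho> i)\<bar>)" using that fE by (intro member_le_sum) auto
    also have "\<dots> \<le> (\<Sum>i\<in>I. \<Sum>\<sigma>\<in>E. \<bar>L \<sigma> (\<rho> i)\<bar>)"
      using that fI by (intro member_le_sum[of i I "\<lambda>i. \<Sum>\<sigma>\<in>E. \<bar>L \<sigma> (\<rho> i)\<bar>"]) (auto intro: sum_nonneg)
    also have "\<dots> \<le> real C" unfolding C_def by (rule real_nat_ceiling_ge)
    finally show ?thesis .
  qed
  \<comment> \<open>The map sends \<open>(i, v)\<close> to \<open>\<rho> i * (v * v)\<close>. The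
    signs of the image recover the pattern in \<open>i\<close>, the nonsquare \<open>u0\<close>
    makes its Boolean recoverable, and positivity at \<open>\<sigma>0\<close> recovers
    \<open>v\<close> from its square.\<close>
  have lower: "2 ^ n * card (U k) \<le> card (U (2 * k + C))" for k
  proof -
    define \<psi> where "\<psi> x = \<rho> (fst x) * (snd x * snd x)" for x
    have im: "\<psi> ` (I \<times> U k) \<subseteq> U (2 * k + C)"
    proof clarify
      fix T b v assume i: "(T, b) \<in> I" and v: "v \<in> U k"
      have vu: "unit_OK v" "\<sigma>0 v > 0" using v by (auto simp: U_def)
      have uv: "unit_OK (v * v)" using vu by (simp add: unit_OK_mult)
      have 1: "unit_OK (\<psi> ((T, b), v))" unfolding \<psi>_def using \<rho>u[OF i] uv by (simp add: unit_OK_mult)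
      have "\<not> \<sigma>0 (\<rho> (T, b)) < 0" using \<rho>s[OF i \<sigma>0] i by (auto simp: I_def)
      hence "\<sigma>0 (\<rho> (T, b)) > 0" using nz[OF \<sigma>0 \<rho>u[OF i]] by simp
      hence 2: "\<sigma>0 (\<psi> ((T, b), v)) > 0" unfolding \<psi>_def using vu(2) by (simp add: emb_mult[OF E[OF \<sigma>0]])
      have 3: "\<bar>L \<sigma> (\<psi> ((T, b), v))\<bar> \<le> real (2 * k + C)" if \<sigma>: "\<sigma> \<in> E" for \<sigma>
      proof -
        have "\<bar>L \<sigma> v\<bar> \<le> real k" using v \<sigma> by (simp add: U_def)
        moreover have "L \<sigma> (\<psi> ((T, b), v)) = L \<sigma> (\<rho> (T, b)) + (L \<sigma> v + L \<sigma> v)"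
          unfolding \<psi>_def using \<sigma> \<rho>u[OF i] uv vu by (simp add: Lm)
        ultimately show ?thesis using C[OF i \<sigma>] by simp
      qed
      show "\<psi> ((T, b), v) \<in> U (2 * k + C)" unfolding U_def using 1 2 3 by blast
    qed
    have inj: "inj_on \<psi> (I \<times> U k)"
    proof (rule inj_onI)
      fix x x' assume x: "x \<in> I \<times> U k" "x' \<in> I \<times> U k" and exx: "\<psi> x = \<psi> x'"
      obtain T b v where xe: "x = ((T, b), v)" by (metis surj_pair)
      obtain T' b' v' where xe': "x' = ((T', b'), v')" by (metis surj_pair)
      have i: "(T, b) \<in> I" "(T', b') \<in> I" and v: "v \<in> U k" "v' \<in> U k"
        and e: "\<psi> ((T, b), v) = \<psi> ((T', b'), v')"
        using x exx unfolding xe xe' by auto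
      have vu: "unit_OK v" "\<sigma>0 v > 0" "unit_OK v'" "\<sigma>0 v' > 0" using v by (auto simp: U_def)
      have sg: "\<sigma> (\<psi> (i, w)) < 0 \<longleftrightarrow> \<sigma> \<in> fst i" if "i \<in> I" "w \<in> U k" "\<sigma> \<in> E" for i w \<sigma>
      proof -
        have "\<sigma> w * \<sigma> w > 0" using nz[OF that(3)] that(2) by (auto simp: U_def zero_less_mult_iff neq_iff)
        thus ?thesis unfolding \<psi>_def emb_mult[OF E[OF that(3)]] using \<rho>s[OF that(1,3)]
          by (simp add: emb_mult[OF E[OF that(3)]] mult_less_0_iff)
      qed
      have "T \<subseteq> E" "T' \<subseteq> E" using i by (auto simp: I_def)
      moreover have "\<sigma> \<in> T \<longleftrightarrow> \<sigma> \<in> T'" if "\<sigma> \<in> E" for \<sigma>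
        using sg[OF i(1) v(1) that] sg[OF i(2) v(2) that] e by simp
      ultimately have TT: "T = T'" by blast
      have "\<epsilon> T \<noteq> 0" using \<epsilon>(1)[OF \<open>T \<subseteq> E\<close>] by (simp add: unit_OK_def)
      hence e2: "(if b then u0 else 1) * (v * v) = (if b' then u0 else 1) * (v' * v')"
        using e unfolding \<psi>_def \<rho>_def TT by (simp add: mult.assoc split: if_splits)
      have sq: False if "u0 * (a * a) = c * c" "unit_OK a" "unit_OK c" for a c
      proof -
        have "u0 = (c * inverse a) * (c * inverse a)"
          using that by (simp add: unit_OK_def field_simps)
        thus False using nsq that by (metis unit_OK_mult unit_OK_inverse)
      qed
      have bb: "b = b'" using e2 sq[of v v'] sq[of v' v] vu by (auto split: if_splits)
      have "u0 \<noteq> 0" using u0 by (simp add: unit_OK_def)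
      hence "v * v = v' * v'" using e2 bb by (auto split: if_splits)
      hence "v = v' \<or> v = - v'" by (simp add: square_eq_iff)
      moreover have "v \<noteq> - v'"
      proof
        assume "v = - v'"
        hence "\<sigma>0 v = - \<sigma>0 v'" using emb_minus[OF E[OF \<sigma>0]] by simp
        thus False using vu by simp
      qed
      ultimately show "x = x'" using TT bb unfolding xe xe' by simp
    qed
    have "card (I \<times> U k) \<le> card (U (2 * k + C))" using card_inj_on_le[OF inj im fU] .
    thus ?thesis by (simp add: card_cartesian_product cI)
  qed
  \<comment> \<open>The solution of \<open>r (Suc j) = 2 * r j + C\<close> with
    \<open>r 0 = 0\<close>, matching the radii in \<open>lower\<close>.\<close>
  define r where "r j = (2 ^ j - 1) * C" for j :: nat
  have rS: "r (Suc j) = 2 * r j + C" for j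
  proof -
    have "(1::nat) \<le> 2 ^ j" by simp
    then obtain m where "(2::nat) ^ j = Suc m" by (metis Suc_le_D One_nat_def)
    thus ?thesis by (simp add: r_def algebra_simps)
  qed
  have low: "2 ^ (n * j) \<le> card (U (r j))" for j
  proof (induction j)
    case 0
    have "card (U 0) \<noteq> 0" using U0 fU by (metis card_0_eq empty_iff)
    thus ?case by (simp add: r_def)
  next
    case (Suc j)
    have "(2::nat) ^ (n * Suc j) = 2 ^ n * 2 ^ (n * j)" by (simp add: power_add)
    also have "\<dots> \<le> 2 ^ n * card (U (r j))" using Suc by simp
    also have "\<dots> \<le> card (U (r (Suc j)))" unfolding rS by (rule lower)
    finally show ?case .
  qed
  \<comment> \<open>Since \<open>r j \<le> 2 ^ j * C\<close>, the upper bound for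
    \<open>card (U (r j))\<close> is at most \<open>D * 2 ^ (j * (n - 1))\<close>; against
    \<open>2 ^ (n * j)\<close> this leaves \<open>2 ^ j \<le> D\<close> for every
    \<open>j\<close>.\<close>
  define D where "D = M * (4 * C + 2) ^ (n - 1)"
  have "2 ^ j \<le> D" for j
  proof -
    have "2 ^ (n * j) \<le> M * (4 * r j + 2) ^ (n - 1)" using low[of j] upper[of "r j"] by simp
    also have "\<dots> \<le> M * (2 ^ j * (4 * C + 2)) ^ (n - 1)"
    proof (rule mult_left_mono[OF power_mono])
      have "(2 ^ j - 1) * C \<le> 2 ^ j * C" by (intro mult_right_mono) auto
      hence "4 * r j \<le> 2 ^ j * (4 * C)" unfolding r_def by simp
      moreover have "(2::nat) \<le> 2 ^ j * 2" by simp
      ultimately have "4 * r j + 2 \<le> 2 ^ j * (4 * C) + 2 ^ j * 2" by (rule add_mono)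
      thus "4 * r j + 2 \<le> 2 ^ j * (4 * C + 2)" by (simp only: distrib_left)
    qed auto
    also have "\<dots> = D * 2 ^ (j * (n - 1))" 
      unfolding D_def power_mult power_mult_distrib by (simp only: mult_ac)
    finally have "2 ^ (n * j) \<le> D * 2 ^ (j * (n - 1))" .
    moreover have "(2::nat) ^ (n * j) = 2 ^ j * 2 ^ (j * (n - 1))"
      using n by (cases n) (auto simp: power_add[symmetric] algebra_simps)
    ultimately show ?thesis by simp
  qed
  hence "2 ^ D \<le> D" by blast
  thus False using less_exp[of D] by simp
qed

subsection \<open>Arithmetic of the reduced norm and trace\<close>

context quaternion_algebra
begin

abbreviation cj :: "'a \<Rightarrow> 'a" where "cj \<equiv> quat_conj s"

lemma standard_involution_cj: "standard_involution s cj"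
proof -
  obtain a b i j where B: "quaternion_basis s a b i j" using ex_quaternion_basis by blast
  obtain c where c: "standard_involution s c" using standard_involution_exists[OF B] by blast
  have "cj = c" unfolding quat_conj_def using c standard_involution_unique by blast
  thus ?thesis using c by simp
qed

lemma cj_add: "cj (x + y) = cj x + cj y" and cj_scale: "cj (s k x) = s k (cj x)"
  and cj_1 [simp]: "cj 1 = 1" and cj_cj [simp]: "cj (cj x) = x" and cj_mult: "cj (x * y) = cj y * cj x"
  using standard_involution_cj unfolding standard_involution_def by blast+

lemma cj_0 [simp]: "cj 0 = 0" using cj_scale[of 0 0] by simp

lemma cj_minus: "cj (- x) = - cj x" using cj_add[of x "- x"] by (simp add: eq_neg_iff_add_eq_0 add.commute)

lemma mult_cj: "x * cj x = s (nrd s x) 1"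
proof -
  have "\<forall>x. \<exists>n. x * cj x = s n 1"
    using standard_involution_cj unfolding standard_involution_def by (elim conjE)
  from spec[OF this, of x] obtain n where n: "x * cj x = s n 1" ..
  have "nrd s x = n" unfolding nrd_def n by (simp add: scale_one_inject)
  thus ?thesis using n by simp
qed

lemma add_cj: "x + cj x = s (trd s x) 1"
proof -
  have "(1 + x) * cj (1 + x) = 1 + (x + cj x) + x * cj x" by (simp add: cj_add algebra_simps)
  hence "x + cj x = s (nrd s (1 + x)) 1 - 1 - s (nrd s x) 1" by (simp add: mult_cj)
  hence n: "x + cj x = s (nrd s (1 + x) - 1 - nrd s x) 1" by (simp add: scale_left_diff_distrib)
  have "trd s x = nrd s (1 + x) - 1 - nrd s x" unfolding trd_def n by (simp add: scale_one_inject)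
  thus ?thesis using n by simp
qed

lemma cj_eq: "cj x = s (trd s x) 1 - x" by (simp flip: add_cj)

lemma scalar_mult: "s c 1 * x = s c x" "x * s c 1 = s c x"
  by (simp_all add: scale_mult_left scale_mult_right)

lemma cj_mult_self: "cj x * x = s (nrd s x) 1"
proof -
  have "cj x * x = x * cj x" by (simp add: cj_eq left_diff_distrib right_diff_distrib scalar_mult)
  thus ?thesis by (simp add: mult_cj)
qed

lemma cj_scalar [simp]: "cj (s c 1) = s c 1" by (simp add: cj_scale)

lemma nrd_eqI: "x * cj x = s n 1 \<Longrightarrow> nrd s x = n"
  by (simp add: mult_cj scale_one_inject)

lemma trd_eqI: "x + cj x = s n 1 \<Longrightarrow> trd s x = n"
  by (simp add: add_cj scale_one_inject)

lemma nrd_mult: "nrd s (x * y) = nrd s x * nrd s y"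
proof (rule nrd_eqI)
  have "x * y * cj (x * y) = x * (y * cj y) * cj x" by (simp add: cj_mult mult.assoc)
  also have "\<dots> = s (nrd s y) (x * cj x)" by (simp add: mult_cj scale_mult_left scale_mult_right)
  finally show "x * y * cj (x * y) = s (nrd s x * nrd s y) 1" by (simp add: mult_cj mult.commute)
qed

lemma nrd_scale: "nrd s (s c x) = c * c * nrd s x"
  by (rule nrd_eqI) (simp add: cj_scale scale_mult_left scale_mult_right mult_cj)

lemma nrd_1 [simp]: "nrd s 1 = 1" by (rule nrd_eqI) simp

lemma nrd_0 [simp]: "nrd s 0 = 0" by (rule nrd_eqI) simp

lemma nrd_scalar: "nrd s (s c 1) = c * c" by (simp add: nrd_scale)

lemma nrd_cj [simp]: "nrd s (cj x) = nrd s x" by (rule nrd_eqI) (simp add: cj_mult_self)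

lemma nrd_minus [simp]: "nrd s (- x) = nrd s x" by (rule nrd_eqI) (simp add: cj_minus mult_cj)

lemma trd_add: "trd s (x + y) = trd s x + trd s y"
proof (rule trd_eqI)
  have "x + y + cj (x + y) = (x + cj x) + (y + cj y)" by (simp add: cj_add)
  thus "x + y + cj (x + y) = s (trd s x + trd s y) 1" by (simp add: add_cj scale_left_distrib)
qed

lemma trd_scale: "trd s (s c x) = c * trd s x"
proof (rule trd_eqI)
  have "s c x + cj (s c x) = s c (x + cj x)" by (simp add: cj_scale scale_right_distrib)
  thus "s c x + cj (s c x) = s (c * trd s x) 1" by (simp add: add_cj)
qed

lemma trd_0 [simp]: "trd s 0 = 0" using trd_scale[of 0 0] by simp

lemma trd_minus: "trd s (- x) = - trd s x" using trd_scale[of "-1" x] by simp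

lemma trd_diff: "trd s (x - y) = trd s x - trd s y" using trd_add[of x "- y"] by (simp add: trd_minus)

lemma trd_1 [simp]: "trd s 1 = 2"
  by (rule trd_eqI) (metis cj_1 one_add_one scale_left_distrib scale_one)

lemma trd_scalar: "trd s (s c 1) = 2 * c" by (simp add: trd_scale)

lemma trd_cj [simp]: "trd s (cj x) = trd s x" by (rule trd_eqI) (simp add: add.commute add_cj)

lemma trd_sum: "trd s (sum f A) = (\<Sum>a\<in>A. trd s (f a))"
  by (induction A rule: infinite_finite_induct) (simp_all add: trd_add)

lemma trd_mult_commute: "trd s (x * y) = trd s (y * x)"
proof -
  have "x * y + cj (x * y) = y * x + cj (y * x)"
    by (simp add: cj_mult) (simp add: cj_eq left_diff_distrib right_diff_distrib scalar_mult scale_right_diff_distrib algebra_simps)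
  thus ?thesis by (simp add: add_cj scale_one_inject)
qed

lemma nrd_add: "nrd s (x + y) = nrd s x + nrd s y + trd s (x * cj y)"
proof (rule nrd_eqI)
  have "(x + y) * cj (x + y) = x * cj x + y * cj y + (x * cj y + cj (x * cj y))"
    by (simp add: cj_add cj_mult algebra_simps)
  thus "(x + y) * cj (x + y) = s (nrd s x + nrd s y + trd s (x * cj y)) 1"
    by (simp add: mult_cj add_cj scale_left_distrib)
qed

lemma self_mult: "x * x = s (trd s x) x - s (nrd s x) 1"
proof -
  have "x * cj x = s (trd s x) x - x * x" by (simp add: cj_eq right_diff_distrib scalar_mult)
  thus ?thesis by (simp add: mult_cj)
qed

text \<open>Multiplicativity of the norm form of a real quaternion algebra. It is needed in
  coordinates because total definiteness is expressed through \<open>quat_mult\<close> over the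
  reals.\<close>

lemma quat_mult_norm:
  "(t\<^sup>2 - a * x\<^sup>2 - b * y\<^sup>2 + a * b * z\<^sup>2) * (t'\<^sup>2 - a * x'\<^sup>2 - b * y'\<^sup>2 + a * b * z'\<^sup>2) =
   (let (T, X, Y, Z) = quat_mult a b (t, x, y, z) (t', x', y', z') in
     T\<^sup>2 - a * X\<^sup>2 - b * Y\<^sup>2 + a * b * (Z :: real)\<^sup>2)"
  unfolding quat_mult.simps Let_def prod.case power2_eq_square by (simp add: algebra_simps)

end

locale definite_quaternion_algebra = quaternion_algebra s
  for s :: "'k::field_char_0 \<Rightarrow> 'a::ring_1 \<Rightarrow> 'a" +
  assumes nf: "number_field TYPE('k)" and tr: "totally_real TYPE('k)" and td: "totally_definite s"
begin

text \<open>Invertibility of every nonzero real quaternion makes the norm form anisotropic at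
  \<sigma>. Restricted to two coordinates this forces \<open>\<sigma> a < 0\<close> and
  \<open>\<sigma> b < 0\<close>, so the form is a sum of nonnegative terms.\<close>

lemma nrd_totally_positive:
  assumes "x \<noteq> 0" shows "totally_positive (nrd s x)"
  unfolding totally_positive_def
proof (intro allI impI)
  fix \<sigma> :: "'k \<Rightarrow> real" assume \<sigma>: "field_embedding \<sigma>"
  obtain a b i j where B: "quaternion_basis s a b i j"
    and dv: "\<And>u. u \<noteq> (0, 0, 0, 0) \<Longrightarrow> \<exists>v. quat_mult (\<sigma> a) (\<sigma> b) u v = (1, 0, 0, 0)"
    using td \<sigma> unfolding totally_definite_def by metis
  have nz: "t\<^sup>2 - \<sigma> a * x\<^sup>2 - \<sigma> b * y\<^sup>2 + \<sigma> a * \<sigma> b * z\<^sup>2 \<noteq> 0" if u: "(t, x, y, z) \<noteq> (0, 0, 0, 0)" for t x y z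
  proof
    assume 0: "t\<^sup>2 - \<sigma> a * x\<^sup>2 - \<sigma> b * y\<^sup>2 + \<sigma> a * \<sigma> b * z\<^sup>2 = 0"
    obtain v where v: "quat_mult (\<sigma> a) (\<sigma> b) (t, x, y, z) v = (1, 0, 0, 0)" using dv[OF u] by blast
    obtain t' x' y' z' where "v = (t', x', y', z')" by (cases v)
    with v have "quat_mult (\<sigma> a) (\<sigma> b) (t, x, y, z) (t', x', y', z') = (1, 0, 0, 0)" by blast
    from quat_mult_norm[of t "\<sigma> a" x "\<sigma> b" y z t' x' y' z', unfolded this] 0 show False by simp
  qed
  have neg: "c < 0" if "\<And>t w :: real. (t, w) \<noteq> (0, 0) \<Longrightarrow> t\<^sup>2 - c * w\<^sup>2 \<noteq> 0" for c :: real
  proof (rule ccontr)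
    assume "\<not> c < 0"
    hence "(sqrt c)\<^sup>2 - c * 1\<^sup>2 = 0" by simp
    with that[of "sqrt c" 1] show False by simp
  qed
  have a: "\<sigma> a < 0" using nz[of _ _ 0 0] by (intro neg) auto
  have b: "\<sigma> b < 0" using nz[of _ 0 _ 0] by (intro neg) auto
  obtain u where u: "x = of_coords s i j u" using of_coords_bij[OF B] by (metis bij_pointE)
  obtain t x' y z where u': "u = (t, x', y, z)" by (cases u)
  have "u \<noteq> (0, 0, 0, 0)" using assms u by (auto simp: of_coords_def)
  hence "(\<sigma> t, \<sigma> x', \<sigma> y, \<sigma> z) \<noteq> (0, 0, 0, 0)" unfolding u' by (simp add: emb_eq_0[OF \<sigma>])
  note nz' = nz[OF this]
  have "\<sigma> (nrd s x) = (\<sigma> t)\<^sup>2 - \<sigma> a * (\<sigma> x')\<^sup>2 - \<sigma> b * (\<sigma> y)\<^sup>2 + \<sigma> a * \<sigma> b * (\<sigma> z)\<^sup>2"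
    unfolding u u' nrd_of_coords[OF B]
    by (simp add: emb_add[OF \<sigma>] emb_diff[OF \<sigma>] emb_mult[OF \<sigma>] emb_power[OF \<sigma>])
  moreover have "(\<sigma> t)\<^sup>2 - \<sigma> a * (\<sigma> x')\<^sup>2 - \<sigma> b * (\<sigma> y)\<^sup>2 + \<sigma> a * \<sigma> b * (\<sigma> z)\<^sup>2 \<ge> 0"
  proof -
    have "- \<sigma> a * (\<sigma> x')\<^sup>2 \<ge> 0" "- \<sigma> b * (\<sigma> y)\<^sup>2 \<ge> 0" "\<sigma> a * \<sigma> b * (\<sigma> z)\<^sup>2 \<ge> 0"
      using a b by (auto simp: mult_nonpos_nonpos less_imp_le mult_le_0_iff zero_le_mult_iff)
    thus ?thesis using zero_le_power2[of "\<sigma> t"] by linarith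
  qed
  ultimately show "\<sigma> (nrd s x) > 0" using nz' by simp
qed

lemma totally_positive_nonzero: "totally_positive (c::'k) \<Longrightarrow> c \<noteq> 0"
  using ex_real_embedding[OF nf tr] emb_0 unfolding totally_positive_def by force

lemma nrd_eq_0_iff: "nrd s x = 0 \<longleftrightarrow> x = 0"
  using nrd_totally_positive totally_positive_nonzero by fastforce

lemma quat_mult_eq_0: "x * y = 0 \<longleftrightarrow> x = 0 \<or> (y::'a) = 0"
  by (metis mult_eq_0_iff nrd_eq_0_iff nrd_mult mult_zero_left mult_zero_right)

lemma quat_mult_cancel_right: "x \<noteq> 0 \<Longrightarrow> y * x = z * x \<longleftrightarrow> y = (z::'a)"
  using quat_mult_eq_0[of "y - z" x] by (auto simp: left_diff_distrib)

definition qinv :: "'a \<Rightarrow> 'a" where "qinv x = s (inverse (nrd s x)) (cj x)"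

lemma qinv: "x \<noteq> 0 \<Longrightarrow> qinv x * x = 1"
  by (simp add: qinv_def scale_mult_left cj_mult_self nrd_eq_0_iff)

end

subsection \<open>Orders\<close>

context quaternion_algebra
begin

text \<open>The coefficient set is a parameter because the two cases \<open>C = Oring\<close>,
  giving lattices, and \<open>C = P\<close>, giving their multiples by an ideal, are compared in the
  Nakayama argument.\<close>

definition scspan :: "'k set \<Rightarrow> 'a set \<Rightarrow> 'a set" where
  "scspan C W = {\<Sum>b\<in>W. s (c b) b | c. \<forall>b\<in>W. c b \<in> C}"

lemma scspanI: "x = (\<Sum>b\<in>W. s (c b) b) \<Longrightarrow> \<forall>b\<in>W. c b \<in> C \<Longrightarrow> x \<in> scspan C W"
  unfolding scspan_def by (intro CollectI exI[of _ c] conjI)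

lemma scspanE:
  assumes "x \<in> scspan C W"
  obtains c where "x = (\<Sum>b\<in>W. s (c b) b)" "\<forall>b\<in>W. c b \<in> C"
  using assms unfolding scspan_def by (elim CollectE exE conjE)

lemma scspan_add:
  assumes "\<And>a b. a \<in> C \<Longrightarrow> b \<in> C \<Longrightarrow> a + b \<in> C" "x \<in> scspan C W" "y \<in> scspan C W"
  shows "x + y \<in> scspan C W"
proof -
  from assms(2) obtain c where c: "x = (\<Sum>b\<in>W. s (c b) b)" "\<forall>b\<in>W. c b \<in> C" by (rule scspanE)
  from assms(3) obtain d where d: "y = (\<Sum>b\<in>W. s (d b) b)" "\<forall>b\<in>W. d b \<in> C" by (rule scspanE)
  have "x + y = (\<Sum>b\<in>W. s (c b + d b) b)" by (simp add: c d scale_left_distrib sum.distrib)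
  moreover have "\<forall>b\<in>W. c b + d b \<in> C" using assms(1) c(2) d(2) by simp
  ultimately show ?thesis by (rule scspanI)
qed

lemma scspan_scale:
  assumes "\<And>a. a \<in> C \<Longrightarrow> r * a \<in> D" "x \<in> scspan C W"
  shows "s r x \<in> scspan D W"
proof -
  from assms(2) obtain c where c: "x = (\<Sum>b\<in>W. s (c b) b)" "\<forall>b\<in>W. c b \<in> C" by (rule scspanE)
  have "s r x = (\<Sum>b\<in>W. s (r * c b) b)" by (simp add: c scale_sum_right)
  moreover have "\<forall>b\<in>W. r * c b \<in> D" using assms(1) c(2) by simp
  ultimately show ?thesis by (rule scspanI)
qed

lemma scspan_base: "finite W \<Longrightarrow> w \<in> W \<Longrightarrow> 0 \<in> C \<Longrightarrow> c \<in> C \<Longrightarrow> s c w \<in> scspan C W"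
  unfolding scspan_def
  by (intro CollectI exI[of _ "\<lambda>b. if b = w then c else 0"])
     (auto simp: if_distrib[of "\<lambda>c. s c _"] if_distribR cong: if_cong)

lemma scspan_0: "0 \<in> C \<Longrightarrow> 0 \<in> scspan C W"
  unfolding scspan_def by (intro CollectI exI[of _ "\<lambda>_. 0"]) auto

lemma scspan_minimal:
  assumes "0 \<in> M" "\<And>x y. x \<in> M \<Longrightarrow> y \<in> M \<Longrightarrow> x + y \<in> M" "\<And>c w. c \<in> C \<Longrightarrow> w \<in> W \<Longrightarrow> s c w \<in> M"
  shows "scspan C W \<subseteq> M"
proof
  fix x assume "x \<in> scspan C W"
  then obtain c where c: "x = (\<Sum>b\<in>W. s (c b) b)" "\<forall>b\<in>W. c b \<in> C" by (rule scspanE)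
  have "(\<Sum>b\<in>W'. s (c b) b) \<in> M" if "W' \<subseteq> W" for W'
    using that by (induction W' rule: infinite_finite_induct) (use assms c(2) in auto)
  thus "x \<in> M" using c(1) by blast
qed

lemma lattice_alt: "lattice s L \<longleftrightarrow> (\<exists>B. finite B \<and> L = scspan Oring B) \<and> span L = UNIV"
  unfolding lattice_def scspan_def by simp

lemma of_int_mult_eq_scale: "of_int n * x = s (of_int n) x"
proof -
  have "of_nat m * x = s (of_nat m) x" for m
    by (induction m) (simp_all add: distrib_right scale_left_distrib)
  thus ?thesis by (cases n rule: int_cases2) (simp_all add: scale_minus_left)
qed

lemma of_nat_mult_eq_scale: "of_nat n * x = s (of_nat n) x"
  using of_int_mult_eq_scale[of "int n"] by simp

end

section \<open>Integrality and finite index in an order\<close>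

locale quaternion_order = definite_quaternion_algebra s
  for s :: "'k::field_char_0 \<Rightarrow> 'a::ring_1 \<Rightarrow> 'a" +
  fixes H :: "'a set"
  assumes order: "quat_order s H"
begin

lemma H_basis:
  obtains B where "finite B" "H = scspan Oring B"
  using order unfolding quat_order_def lattice_alt by (elim conjE exE)

lemma H_1: "1 \<in> H" and H_mult: "x \<in> H \<Longrightarrow> y \<in> H \<Longrightarrow> x * y \<in> H"
  and H_span: "span H = UNIV"
  using order unfolding quat_order_def lattice_alt by blast+

lemma H_add: "x \<in> H \<Longrightarrow> y \<in> H \<Longrightarrow> x + y \<in> H"
  using H_basis by (metis algebraic_int_add_mult(1) mem_Collect_eq scspan_add)

lemma H_scale: "algebraic_int c \<Longrightarrow> x \<in> H \<Longrightarrow> s c x \<in> H"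
  using H_basis by (metis algebraic_int_add_mult(2) mem_Collect_eq scspan_scale)

lemma H_0: "0 \<in> H" using H_scale[of 0 1] H_1 by simp

lemma H_minus: "x \<in> H \<Longrightarrow> - x \<in> H"
  using H_scale[of "-1" x] by (simp add: int_imp_algebraic_int)

lemma H_diff: "x \<in> H \<Longrightarrow> y \<in> H \<Longrightarrow> x - y \<in> H"
  using H_add[of x "- y"] H_minus by simp

lemma H_scalar: "algebraic_int c \<Longrightarrow> s c 1 \<in> H" by (intro H_scale H_1)

lemma H_int_span:
  obtains W where "finite W" "H = Zm.span W"
proof -
  obtain B where B: "finite B" "H = scspan Oring B" by (rule H_basis)
  obtain W0 :: "'k set" where W0: "finite W0" "Oring = Zm.span W0"
    using Oring_finitely_generated[OF nf] .
  define W where "W = (\<lambda>(w, b). s w b) ` (W0 \<times> B)"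
  show ?thesis
  proof (rule that)
    show "finite W" unfolding W_def using B W0 by simp
    show "H = Zm.span W"
    proof
      have sub: "Zm.subspace H"
        using H_0 H_add H_scale by (intro Zm.subspaceI) (auto simp: of_int_mult_eq_scale int_imp_algebraic_int)
      have WH: "W \<subseteq> H"
      proof
        fix x assume "x \<in> W"
        then obtain w b where x: "x = s w b" "w \<in> W0" "b \<in> B" by (auto simp: W_def)
        have "algebraic_int w" using x(2) W0(2) Zm.span_base by blast
        moreover have "s 1 b \<in> H" unfolding B(2) using x(3) B(1) by (intro scspan_base) auto
        ultimately show "x \<in> H" using x(1) H_scale by simp
      qed
      show "Zm.span W \<subseteq> H" using WH sub by (rule Zm.span_minimal)
      show "H \<subseteq> Zm.span W" unfolding B(2)
      proof (rule scspan_minimal)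
        fix c :: 'k and b assume "c \<in> Oring" and b: "b \<in> B"
        hence "c \<in> Zm.span W0" using W0 by simp
        thus "s c b \<in> Zm.span W"
        proof (induction rule: Zm.span_induct_alt)
          case (step n w c)
          have "s w b \<in> Zm.span W" using step(1) b by (intro Zm.span_base) (auto simp: W_def)
          hence "of_int n * s w b + s c b \<in> Zm.span W" using step by (intro Zm.span_add Zm.span_scale)
          thus ?case by (simp add: scale_left_distrib of_int_mult_eq_scale)
        qed (simp add: Zm.span_zero)
      qed (auto intro: Zm.span_zero Zm.span_add)
    qed
  qed
qed

text \<open>
  If \<open>H\<close> is generated by \<open>B\<close> over the integers, then \<open>nrd x\<close> preserves the finitely generated group
  spanned by the products \<open>cj b' * b\<close>, since \<open>cj (x * b') * (x * b) = s (nrd x) (cj b' * b)\<close>.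
\<close>

lemma nrd_integral: assumes x: "x \<in> H" shows "algebraic_int (nrd s x)"
proof -
  obtain B where B: "finite B" "H = Zm.span B" by (rule H_int_span)
  define W where "W = (\<lambda>(b', b). cj b' * b) ` (B \<times> B)"
  have fW: "finite W" unfolding W_def using B by simp
  have prod: "cj u * v \<in> Zm.span W" if u: "u \<in> Zm.span B" and v: "v \<in> Zm.span B" for u v
    using u
  proof (induction rule: Zm.span_induct_alt)
    case base
    show ?case by (simp add: Zm.span_zero)
  next
    case (step n b' y)
    have "cj b' * v \<in> Zm.span W" using v
    proof (induction rule: Zm.span_induct_alt)
      case base
      show ?case by (simp add: Zm.span_zero)
    next
      case (step m b z)
      have "cj b' * b \<in> Zm.span W" using \<open>b' \<in> B\<close> step(1) by (intro Zm.span_base) (auto simp: W_def)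
      hence "of_int m * (cj b' * b) + cj b' * z \<in> Zm.span W"
        using step by (intro Zm.span_add Zm.span_scale)
      thus ?case by (simp add: of_int_mult_eq_scale scale_mult_right distrib_left)
    qed
    hence "of_int n * (cj b' * v) + cj y * v \<in> Zm.span W"
      using step by (intro Zm.span_add Zm.span_scale)
    thus ?case by (simp add: of_int_mult_eq_scale scale_mult_left distrib_right cj_add cj_scale)
  qed
  have "\<exists>b\<in>B. b \<noteq> 0"
  proof (rule ccontr)
    assume "\<not> ?thesis"
    hence "Zm.span B \<subseteq> {0}" by (intro Zm.span_minimal) (auto simp: Zm.subspace_def)
    thus False using H_1 B by auto
  qed
  then obtain b where b: "b \<in> B" "b \<noteq> 0" by blast
  have w: "cj b * b \<in> W" "cj b * b \<noteq> 0"
    using b by (force simp: W_def, simp add: cj_mult_self nrd_eq_0_iff)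
  have "\<exists>u. s (nrd s x) w = (\<Sum>w'\<in>W. s (of_int (u w')) w')" if "w \<in> W" for w
  proof -
    obtain b' b where w: "w = cj b' * b" "b' \<in> B" "b \<in> B" using \<open>w \<in> W\<close> by (auto simp: W_def)
    have "b \<in> H" "b' \<in> H" using w B Zm.span_base by blast+
    hence "x * b' \<in> Zm.span B" "x * b \<in> Zm.span B" using H_mult[OF x] B(2) by auto
    hence "cj (x * b') * (x * b) \<in> Zm.span W" by (rule prod)
    also have "cj (x * b') * (x * b) = cj b' * (cj x * x) * b" by (simp add: cj_mult mult.assoc)
    also have "\<dots> = s (nrd s x) w" by (simp add: cj_mult_self scale_mult_left scale_mult_right w)
    finally show ?thesis unfolding Zm.span_finite[OF fW] by (auto simp: of_int_mult_eq_scale)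
  qed
  then obtain c where c: "\<And>w. w \<in> W \<Longrightarrow> s (nrd s x) w = (\<Sum>w'\<in>W. s (of_int (c w w')) w')" by metis
  show ?thesis by (rule algebraic_int_eigenvalue[OF vector_space_axioms fW w c])
qed

lemma trd_integral: assumes x: "x \<in> H" shows "algebraic_int (trd s x)"
proof -
  have "nrd s (1 + x) = 1 + nrd s x + trd s x" by (simp add: nrd_add)
  hence "trd s x = nrd s (1 + x) - 1 - nrd s x" by simp
  thus ?thesis using x H_add[OF H_1 x]
    by (simp add: algebraic_int_diff nrd_integral int_imp_algebraic_int)
qed

lemma H_cj: "x \<in> H \<Longrightarrow> cj x \<in> H"
  unfolding cj_eq by (intro H_diff H_scalar trd_integral)

lemma H_scalar_iff: "s c 1 \<in> H \<longleftrightarrow> algebraic_int c"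
  using nrd_integral[of "s c 1"] algebraic_int_of_square[of c] H_scalar[of c] by (auto simp: nrd_scalar)

lemma finite_index:
  assumes m: "algebraic_int m" "m \<noteq> 0"
  obtains T where "finite T" "T \<subseteq> H" "\<And>x. x \<in> H \<Longrightarrow> \<exists>t\<in>T. \<exists>y\<in>H. x - t = s m y"
proof -
  obtain W where W: "finite W" "H = Zm.span W" by (rule H_int_span)
  obtain N where N: "N > 0" "algebraic_int (of_nat N * inverse m)"
    using ex_integer_multiple[OF nf, of "inverse m"] by metis
  obtain T where T: "finite T" "T \<subseteq> Zm.span W"
    "\<And>x. x \<in> Zm.span W \<Longrightarrow> \<exists>t\<in>T. \<exists>y\<in>Zm.span W. x - t = of_nat N * y"
    using finite_quotient_of_nat[OF W(1) N(1)] by metis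
  show ?thesis
  proof (rule that[of T])
    show "finite T" "T \<subseteq> H" using T W by auto
    fix x assume "x \<in> H"
    then obtain t y where ty: "t \<in> T" "y \<in> H" "x - t = of_nat N * y" using T(3) W by blast
    have "x - t = s m (s (of_nat N * inverse m) y)" using ty(3) m(2) by (simp add: of_nat_mult_eq_scale)
    thus "\<exists>t\<in>T. \<exists>y\<in>H. x - t = s m y" using ty H_scale[OF N(2)] by blast
  qed
qed

text \<open>Multiplication by \<open>k\<close> embeds \<open>M / m H\<close> into the finite group
  \<open>H / k m H\<close>. Hence \<open>M\<close> is generated by \<open>m\<close> times generators
  of \<open>H\<close> together with one representative for each class that is attained.\<close>

lemma lattice_of_finite_index:
  assumes M: "0 \<in> M" "\<And>x y. x \<in> M \<Longrightarrow> y \<in> M \<Longrightarrow> x + y \<in> M" "\<And>c x. algebraic_int c \<Longrightarrow> x \<in> M \<Longrightarrow> s c x \<in> M"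
    and m: "algebraic_int m" "m \<noteq> 0" "\<And>h. h \<in> H \<Longrightarrow> s m h \<in> M"
    and k: "algebraic_int k" "k \<noteq> 0" "\<And>x. x \<in> M \<Longrightarrow> s k x \<in> H"
  shows "lattice s M"
proof -
  obtain B where B: "finite B" "H = scspan Oring B" by (rule H_basis)
  have km: "algebraic_int (k * m)" "k * m \<noteq> 0" using m k by (auto simp: algebraic_int_add_mult)
  obtain T where T: "finite T" "T \<subseteq> H" "\<And>x. x \<in> H \<Longrightarrow> \<exists>t\<in>T. \<exists>y\<in>H. x - t = s (k * m) y"
    using finite_index[OF km] by metis
  define P where "P t x \<longleftrightarrow> x \<in> M \<and> (\<exists>y\<in>H. s k x - t = s (k * m) y)" for t x
  \<comment> \<open>Classes that are not attained by \<open>M\<close> receive the harmless generator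
    0.\<close>
  define f where "f t = (if \<exists>x. P t x then SOME x. P t x else 0)" for t
  have f: "P t (f t)" if "P t x" for t x
    using someI[of "P t" x] that unfolding f_def by auto
  have fM: "f t \<in> M" for t
  proof (cases "\<exists>x. P t x")
    case True thus ?thesis using f P_def by blast
  next
    case False thus ?thesis using M(1) by (simp add: f_def)
  qed
  define G where "G = (s m ` B) \<union> (f ` T)"
  have fG: "finite G" unfolding G_def using B T by simp
  have BH: "b \<in> H" if "b \<in> B" for b
    using scspan_base[OF B(1) that, of Oring 1] B(2) by simp
  have mH: "s m h \<in> scspan Oring G" if "h \<in> H" for h
  proof -
    have "scspan Oring B \<subseteq> {h. s m h \<in> scspan Oring G}"
    proof (rule scspan_minimal)
      fix c :: 'k and b assume cb: "c \<in> Oring" "b \<in> B"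
      have "s c (s m b) \<in> scspan Oring G"
        using cb by (intro scspan_base[OF fG]) (auto simp: G_def)
      thus "s c b \<in> {h. s m h \<in> scspan Oring G}" by (simp add: mult.commute)
    qed (auto simp: scale_right_distrib intro!: scspan_0 scspan_add algebraic_int_add_mult)
    thus ?thesis using that B(2) by blast
  qed
  have "M = scspan Oring G"
  proof
    show "scspan Oring G \<subseteq> M"
    proof (rule scspan_minimal)
      fix c :: 'k and g assume cg: "c \<in> Oring" "g \<in> G"
      have "g \<in> M" using cg(2) m(3) BH fM unfolding G_def by auto
      thus "s c g \<in> M" using M(3) cg(1) by simp
    qed (use M in auto)
    show "M \<subseteq> scspan Oring G"
    proof
      fix x assume x: "x \<in> M"
      obtain t y where ty: "t \<in> T" "y \<in> H" "s k x - t = s (k * m) y" using T(3)[OF k(3)[OF x]] by blast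
      have "P t x" unfolding P_def using x ty by blast
      hence "P t (f t)" by (rule f)
      then obtain z where z: "z \<in> H" "s k (f t) - t = s (k * m) z" unfolding P_def by blast
      have "s k (x - f t) = (s k x - t) - (s k (f t) - t)" by (simp add: scale_right_diff_distrib)
      also have "\<dots> = s k (s m (y - z))" using ty(3) z(2) by (simp add: scale_right_diff_distrib)
      finally have "x - f t = s m (y - z)" by (rule scale_left_imp_eq[OF k(2)])
      hence "x - f t \<in> scspan Oring G" using mH[OF H_diff[OF ty(2) z(1)]] by simp
      moreover have "s 1 (f t) \<in> scspan Oring G"
        using ty(1) by (intro scspan_base[OF fG]) (auto simp: G_def)
      ultimately have "x - f t + s 1 (f t) \<in> scspan Oring G"
        by (intro scspan_add) (auto simp: algebraic_int_add_mult)
      thus "x \<in> scspan Oring G" by simp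
    qed
  qed
  moreover have "span M = UNIV"
  proof -
    have "H \<subseteq> span M"
    proof
      fix h assume "h \<in> H"
      hence "s m h \<in> span M" using m(3) by (intro span_base)
      hence "s (inverse m) (s m h) \<in> span M" by (rule span_scale)
      thus "h \<in> span M" using m(2) by simp
    qed
    hence "span H \<subseteq> span M" by (intro span_minimal) (auto simp: subspace_span)
    thus ?thesis using H_span by auto
  qed
  ultimately show ?thesis unfolding lattice_alt using fG by auto
qed

section \<open>Left ideals of an order\<close>

definition left_ideal :: "'a set \<Rightarrow> bool" where
  "left_ideal J \<longleftrightarrow> J \<subseteq> H \<and> 0 \<in> J \<and> (\<forall>x\<in>J. \<forall>y\<in>J. x + y \<in> J) \<and> (\<forall>h\<in>H. \<forall>x\<in>J. h * x \<in> J)"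

lemma left_idealD:
  assumes "left_ideal J"
  shows "J \<subseteq> H" "0 \<in> J" "x \<in> J \<Longrightarrow> y \<in> J \<Longrightarrow> x + y \<in> J" "h \<in> H \<Longrightarrow> x \<in> J \<Longrightarrow> h * x \<in> J"
    "algebraic_int c \<Longrightarrow> x \<in> J \<Longrightarrow> s c x \<in> J" "x \<in> J \<Longrightarrow> - x \<in> J" "x \<in> J \<Longrightarrow> y \<in> J \<Longrightarrow> x - y \<in> J"
proof -
  show 1: "J \<subseteq> H" "0 \<in> J" "\<And>x y. x \<in> J \<Longrightarrow> y \<in> J \<Longrightarrow> x + y \<in> J" "\<And>h x. h \<in> H \<Longrightarrow> x \<in> J \<Longrightarrow> h * x \<in> J"
    using assms unfolding left_ideal_def by blast+
  show 2: "s c x \<in> J" if "algebraic_int c" "x \<in> J" for c x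
    using 1(4)[OF H_scalar[OF that(1)] that(2)] by (simp add: scalar_mult)
  show 3: "- x \<in> J" if "x \<in> J" for x using 2[of "-1" x] that by (simp add: int_imp_algebraic_int)
  show "x - y \<in> J" if "x \<in> J" "y \<in> J" for x y using 1(3)[OF that(1) 3[OF that(2)]] by simp
qed

definition lmul :: "'a \<Rightarrow> 'a set" where "lmul y = (\<lambda>h. h * y) ` H"

lemma left_ideal_lmul: "y \<in> H \<Longrightarrow> left_ideal (lmul y)"
  unfolding left_ideal_def lmul_def
proof (intro conjI ballI)
  assume y: "y \<in> H"
  show "(\<lambda>h. h * y) ` H \<subseteq> H" using y by (auto intro: H_mult)
  show "0 \<in> (\<lambda>h. h * y) ` H" using H_0 by (intro image_eqI[of _ _ 0]) auto
  show "u + v \<in> (\<lambda>h. h * y) ` H" if "u \<in> (\<lambda>h. h * y) ` H" "v \<in> (\<lambda>h. h * y) ` H" for u v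
    using that by (auto simp: distrib_right[symmetric] intro!: imageI H_add)
  show "h * v \<in> (\<lambda>h. h * y) ` H" if "h \<in> H" "v \<in> (\<lambda>h. h * y) ` H" for h v
    using that by (auto simp: mult.assoc[symmetric] intro!: imageI H_mult)
qed

lemma lmul_self: "y \<in> lmul y" unfolding lmul_def using H_1 by (intro image_eqI[of _ _ 1]) auto

lemma lmul_minimal: "left_ideal J \<Longrightarrow> y \<in> J \<Longrightarrow> lmul y \<subseteq> J"
  unfolding lmul_def using left_idealD(4) by blast

lemma lmul_unit:
  assumes "u \<in> H" "unit_OK (nrd s u)" shows "lmul (u * y) = lmul y"
proof
  show "lmul (u * y) \<subseteq> lmul y"
    unfolding lmul_def using assms(1) by (auto simp: mult.assoc[symmetric] intro!: imageI H_mult)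
  have u: "u \<noteq> 0" using assms(2) by (auto simp: unit_OK_def)
  have ui: "qinv u \<in> H" unfolding qinv_def using assms by (intro H_scale H_cj) (auto simp: unit_OK_def)
  show "lmul y \<subseteq> lmul (u * y)"
  proof
    fix z assume "z \<in> lmul y"
    then obtain h where h: "h \<in> H" "z = h * y" unfolding lmul_def by blast
    have "z = (h * qinv u) * (u * y)" using qinv[OF u] h(2) by (metis mult.assoc mult_1)
    thus "z \<in> lmul (u * y)" unfolding lmul_def using H_mult[OF h(1) ui] by blast
  qed
qed

end

section \<open>Class number one: one-sided ideals are principal\<close>

locale class_one_order = definite_quaternion_algebra s
  for s :: "'k::field_char_0 \<Rightarrow> 'a::ring_1 \<Rightarrow> 'a" +
  fixes H :: "'a set"
  assumes maximal: "maximal_order s H" and class_one: "class_number s H = 1"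

sublocale class_one_order \<subseteq> quaternion_order
  using maximal by unfold_locales (simp add: maximal_order_def)

context class_one_order
begin

lemma right_order_H: "right_order H = H"
proof
  show "right_order H \<subseteq> H" unfolding right_order_def using H_1 by (auto dest!: bspec[of _ _ 1])
  show "H \<subseteq> right_order H" unfolding right_order_def using H_mult by auto
qed

text \<open>The right order of \<open>L\<close> is an order containing \<open>H\<close>, hence equal
  to \<open>H\<close> by maximality. So \<open>L\<close> and \<open>H\<close> lie in the same set of
  lattices, which has a single class.\<close>

lemma right_ideal_principal:
  assumes L: "0 \<in> L" "\<And>x y. x \<in> L \<Longrightarrow> y \<in> L \<Longrightarrow> x + y \<in> L" "\<And>x h. x \<in> L \<Longrightarrow> h \<in> H \<Longrightarrow> x * h \<in> L"
    and m: "algebraic_int m" "m \<noteq> 0" "\<And>h. h \<in> H \<Longrightarrow> s m h \<in> L"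
    and k: "algebraic_int k" "k \<noteq> 0" "\<And>x. x \<in> L \<Longrightarrow> s k x \<in> H"
  obtains x where "L = (\<lambda>h. x * h) ` H"
proof -
  have Lsc: "s c x \<in> L" if "algebraic_int c" "x \<in> L" for c x
    using L(3)[OF that(2) H_scalar[OF that(1)]] by (simp add: scalar_mult)
  have lat: "lattice s L" by (rule lattice_of_finite_index[OF L(1,2) Lsc m k])
  define R where "R = right_order L"
  have HR: "H \<subseteq> R" unfolding R_def right_order_def using L(3) by auto
  have R1: "s c x \<in> R" if "algebraic_int c" "x \<in> R" for c x
    using that Lsc unfolding R_def right_order_def by (auto simp: scale_mult_right)
  have "quat_order s R"
    unfolding quat_order_def
  proof (intro conjI ballI)
    \<comment> \<open>From \<open>s m 1 \<in> L\<close> and \<open>k L \<subseteq> H\<close> it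
      follows that \<open>k m R \<subseteq> H\<close>, which bounds the right order from
      above.\<close>
    show "lattice s R"
    proof (rule lattice_of_finite_index[of _ 1 "k * m"])
      show "0 \<in> R" using HR H_0 by blast
      show "x + y \<in> R" if "x \<in> R" "y \<in> R" for x y
        using that L(2) unfolding R_def right_order_def by (auto simp: distrib_left)
      show "s (k * m) x \<in> H" if "x \<in> R" for x
      proof -
        have "s m 1 \<in> L" using m(3) H_1 by blast
        hence "s m 1 * x \<in> L" using that unfolding R_def right_order_def by blast
        hence "s k (s m 1 * x) \<in> H" by (rule k(3))
        thus ?thesis by (simp add: scalar_mult)
      qed
    qed (use R1 HR m k in \<open>auto simp: algebraic_int_add_mult\<close>)
    show "1 \<in> R" using HR H_1 by blast
    show "x * y \<in> R" if "x \<in> R" "y \<in> R" for x y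
      using that unfolding R_def right_order_def by (auto simp: mult.assoc[symmetric])
  qed
  hence RH: "R = H" using HR maximal unfolding maximal_order_def by blast
  define X where "X = {L. lattice s L \<and> right_order L = H}"
  define r where "r = {(L :: 'a set, M). \<exists>x. (\<exists>y. x * y = 1 \<and> y * x = 1) \<and> M = (\<lambda>l. x * l) ` L}"
  have c1: "card (X // r) = 1" using class_one unfolding class_number_def X_def r_def .
  have "lattice s H" using order by (simp add: quat_order_def)
  hence HX: "H \<in> X" using right_order_H by (simp add: X_def)
  have LX: "L \<in> X" using lat RH by (simp add: X_def R_def)
  obtain c where c: "X // r = {c}" using c1 by (auto simp: card_1_singleton_iff)
  have "r `` {L} \<in> X // r" "r `` {H} \<in> X // r" using LX HX by (auto simp: quotient_def)
  hence "r `` {L} = r `` {H}" unfolding c by simp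
  moreover have "(L, L) \<in> r" unfolding r_def by (auto intro!: exI[of _ 1])
  ultimately have "(H, L) \<in> r" by auto
  then obtain x where "L = (\<lambda>h. x * h) ` H" unfolding r_def by auto
  thus ?thesis by (rule that)
qed

text \<open>Conjugation reverses products and preserves \<open>H\<close>, so it turns
  \<open>J\<close> into a right ideal and a generator of that into one of \<open>J\<close>.\<close>

lemma left_ideal_principal:
  assumes J: "left_ideal J" and m: "algebraic_int m" "m \<noteq> 0" "\<And>h. h \<in> H \<Longrightarrow> s m h \<in> J"
  obtains y where "y \<in> H" "y \<noteq> 0" "J = lmul y"
proof -
  note D = left_idealD[OF J]
  have e1: "0 \<in> cj ` J" using D(2) by (intro image_eqI[of _ _ 0]) auto
  have e2: "x + y \<in> cj ` J" if "x \<in> cj ` J" "y \<in> cj ` J" for x y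
    using that D(3) by (auto simp: cj_add[symmetric] intro!: imageI)
  have e3: "x * h \<in> cj ` J" if "x \<in> cj ` J" "h \<in> H" for x h
  proof -
    from that obtain j where j: "j \<in> J" "x = cj j" by auto
    have "x * h = cj (cj h * j)" by (simp add: cj_mult j)
    thus ?thesis using D(4)[OF H_cj[OF that(2)] j(1)] by auto
  qed
  have e4: "s m h \<in> cj ` J" if "h \<in> H" for h
  proof -
    have "s m h = cj (s m (cj h))" by (simp add: cj_scale)
    thus ?thesis using m(3)[OF H_cj[OF that]] by auto
  qed
  have e5: "s 1 x \<in> H" if "x \<in> cj ` J" for x using that D(1) H_cj by auto
  obtain x where x: "cj ` J = (\<lambda>h. x * h) ` H"
    using right_ideal_principal[OF e1 e2 e3 m(1,2) e4 _ _ e5] by auto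
  have "J = cj ` cj ` J" by (simp add: image_image)
  also have "\<dots> = lmul (cj x)"
    unfolding x lmul_def image_image cj_mult using H_cj by (force intro: image_eqI[of _ _ "cj _"])
  finally have J': "J = lmul (cj x)" .
  have xJ: "cj x \<in> J" unfolding J' by (rule lmul_self)
  show ?thesis
  proof (rule that[OF _ _ J'])
    show "cj x \<in> H" using xJ D(1) by blast
    show "cj x \<noteq> 0"
    proof
      assume "cj x = 0"
      hence "J = {0}" unfolding J' lmul_def using H_0 by auto
      hence "s m 1 = 0" using m(3)[OF H_1] by blast
      thus False using m(2) by simp
    qed
  qed
qed

end

subsection \<open>Residues\<close>

text \<open>Elementwise forms of the ideals and nonzero primes of \<open>OK\<close>, stated with the
  operations of the field; \<open>O_ideal_iff\<close> and \<open>O_prime_iff\<close> connect them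
  with the ring-theoretic notions.\<close>

definition O_ideal :: "'k::field_char_0 set \<Rightarrow> bool" where
  "O_ideal I \<longleftrightarrow> I \<subseteq> Oring \<and> 0 \<in> I \<and> (\<forall>x\<in>I. \<forall>y\<in>I. x + y \<in> I) \<and> (\<forall>r\<in>Oring. \<forall>x\<in>I. r * x \<in> I)"

definition O_prime :: "'k::field_char_0 set \<Rightarrow> bool" where
  "O_prime P \<longleftrightarrow> O_ideal P \<and> P \<noteq> {0} \<and> 1 \<notin> P \<and> (\<forall>x\<in>Oring. \<forall>y\<in>Oring. x * y \<in> P \<longrightarrow> x \<in> P \<or> y \<in> P)"

definition O_mul :: "'k::field_char_0 \<Rightarrow> 'k set" where "O_mul a = (\<lambda>r. a * r) ` Oring"

lemma O_idealD:
  assumes "O_ideal I"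
  shows "I \<subseteq> Oring" "x \<in> I \<Longrightarrow> algebraic_int x" "0 \<in> I" "x \<in> I \<Longrightarrow> y \<in> I \<Longrightarrow> x + y \<in> I"
    "algebraic_int r \<Longrightarrow> x \<in> I \<Longrightarrow> r * x \<in> I" "algebraic_int r \<Longrightarrow> x \<in> I \<Longrightarrow> x * r \<in> I"
    "x \<in> I \<Longrightarrow> - x \<in> I" "x \<in> I \<Longrightarrow> y \<in> I \<Longrightarrow> x - y \<in> I"
proof -
  show 1: "I \<subseteq> Oring" "0 \<in> I" "\<And>x y. x \<in> I \<Longrightarrow> y \<in> I \<Longrightarrow> x + y \<in> I"
    "\<And>r x. algebraic_int r \<Longrightarrow> x \<in> I \<Longrightarrow> r * x \<in> I"
    using assms unfolding O_ideal_def by auto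
  show "x \<in> I \<Longrightarrow> algebraic_int x" using 1(1) by blast
  show "algebraic_int r \<Longrightarrow> x \<in> I \<Longrightarrow> x * r \<in> I" using 1(4)[of r x] by (simp add: mult.commute)
  show 3: "- x \<in> I" if "x \<in> I" for x using 1(4)[of "-1" x] that by (simp add: int_imp_algebraic_int)
  show "x - y \<in> I" if "x \<in> I" "y \<in> I" for x y using 1(3)[OF that(1) 3[OF that(2)]] by simp
qed

lemma O_primeD:
  assumes "O_prime P"
  shows "O_ideal P" "1 \<notin> P" "algebraic_int x \<Longrightarrow> algebraic_int y \<Longrightarrow> x * y \<in> P \<Longrightarrow> x \<in> P \<or> y \<in> P"
    "\<exists>m\<in>P. m \<noteq> 0"
proof -
  show "O_ideal P" "1 \<notin> P" using assms unfolding O_prime_def by auto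
  show "algebraic_int x \<Longrightarrow> algebraic_int y \<Longrightarrow> x * y \<in> P \<Longrightarrow> x \<in> P \<or> y \<in> P"
    using assms unfolding O_prime_def by blast
  show "\<exists>m\<in>P. m \<noteq> 0"
  proof (rule ccontr)
    assume "\<not> ?thesis"
    moreover have "0 \<in> P" using \<open>O_ideal P\<close> by (rule O_idealD)
    ultimately have "P = {0}" by blast
    thus False using assms by (simp add: O_prime_def)
  qed
qed

lemma OK_uminus:
  assumes "algebraic_int x" shows "\<ominus>\<^bsub>OK\<^esub> x = - x"
proof -
  interpret cring "OK :: 'a ring" by (rule cring_OK)
  show ?thesis by (rule minus_equality) (use assms in auto)
qed

lemma O_ideal_iff: "O_ideal I \<longleftrightarrow> ideal I OK"
proof
  assume I: "O_ideal I"
  note D = O_idealD[OF I]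
  show "ideal I OK"
  proof (rule idealI)
    show "ring OK" using cring_OK by (rule cring.axioms)
    show "subgroup I (add_monoid OK)"
    proof
      show "I \<subseteq> carrier (add_monoid OK)" using D(1) by simp
      show "x \<otimes>\<^bsub>add_monoid OK\<^esub> y \<in> I" if "x \<in> I" "y \<in> I" for x y using D(4)[OF that] by simp
      show "\<one>\<^bsub>add_monoid OK\<^esub> \<in> I" using D(3) by simp
      show "inv\<^bsub>add_monoid OK\<^esub> x \<in> I" if "x \<in> I" for x
        using D(7)[OF that] OK_uminus[OF D(2)[OF that]] by (simp add: a_inv_def)
    qed
  qed (use D in auto)
next
  assume I: "ideal I OK"
  interpret ideal I OK by (rule I)
  show "O_ideal I"
    unfolding O_ideal_def
    using a_subset additive_subgroup.zero_closed[OF ideal.axioms(1)[OF I]]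
      additive_subgroup.a_closed[OF ideal.axioms(1)[OF I]] I_l_closed by auto
qed

lemma O_prime_iff: "O_prime P \<longleftrightarrow> prime_of_OK P"
proof
  assume P: "O_prime P"
  note D = O_primeD[OF P]
  show "prime_of_OK P" unfolding prime_of_OK_def
  proof
    show "primeideal P OK"
    proof (rule primeidealI)
      show "ideal P OK" using D(1) O_ideal_iff by blast
      show "cring OK" by (rule cring_OK)
      show "carrier OK \<noteq> P" using D(2) by auto
    qed (use D(3) in auto)
    show "P \<noteq> {0}" using P by (simp add: O_prime_def)
  qed
next
  assume P: "prime_of_OK P"
  hence "primeideal P OK" by (simp add: prime_of_OK_def)
  then interpret primeideal P OK .
  have i: "O_ideal P" using is_ideal O_ideal_iff by blast
  have "1 \<notin> P"
  proof
    assume "1 \<in> P"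
    hence "P = carrier OK" using one_imp_carrier by simp
    thus False using I_notcarr by simp
  qed
  thus "O_prime P" unfolding O_prime_def using i P I_prime by (auto simp: prime_of_OK_def)
qed

lemma O_mul_eq: "algebraic_int a \<Longrightarrow> O_mul a = PIdl\<^bsub>OK\<^esub> a"
  unfolding O_mul_def cgenideal_def by (auto simp: mult.commute)

lemma O_ideal_O_mul: "algebraic_int a \<Longrightarrow> O_ideal (O_mul a)"
  unfolding O_ideal_iff by (simp add: O_mul_eq cring.cgenideal_ideal[OF cring_OK])

lemma O_mul_mem: "a \<noteq> 0 \<Longrightarrow> x \<in> O_mul a \<longleftrightarrow> algebraic_int (x / a)"
  unfolding O_mul_def by (auto intro!: image_eqI[of _ _ "x / a"])

lemma O_mul_self: "a \<in> O_mul a" unfolding O_mul_def by (auto intro!: image_eqI[of _ _ 1] simp: int_imp_algebraic_int)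

lemma O_mulI: "algebraic_int r \<Longrightarrow> a * r \<in> O_mul a" unfolding O_mul_def by auto

lemma O_mul_minimal: "O_ideal I \<Longrightarrow> a \<in> I \<Longrightarrow> O_mul a \<subseteq> I"
  unfolding O_mul_def using O_idealD(6) by blast

lemma O_mul_eq_iff:
  assumes "algebraic_int a" "a \<noteq> 0" "algebraic_int b" "b \<noteq> 0"
  shows "O_mul a = O_mul b \<longleftrightarrow> unit_OK (b / a)"
proof
  assume e: "O_mul a = O_mul b"
  have "a \<in> O_mul b" "b \<in> O_mul a" using O_mul_self e by auto
  thus "unit_OK (b / a)" using assms by (simp add: O_mul_mem unit_OK_def)
next
  assume u: "unit_OK (b / a)"
  have "a \<in> O_mul b" "b \<in> O_mul a" using u assms by (simp_all add: O_mul_mem unit_OK_def)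
  thus "O_mul a = O_mul b" using O_mul_minimal O_ideal_O_mul assms by blast
qed

section \<open>Residue classes and absolute norms\<close>

text \<open>The chosen representative depends only on the class of \<open>x\<close>, as congruent
  elements satisfy the same choice condition. Residue rings can thus be counted as sets of field
  elements.\<close>

definition res :: "'k::field_char_0 set \<Rightarrow> 'k \<Rightarrow> 'k" where
  "res I x = (SOME y. algebraic_int y \<and> x - y \<in> I)"

lemma res:
  assumes I: "O_ideal I" and x: "algebraic_int x"
  shows "algebraic_int (res I x)" "x - res I x \<in> I"
proof -
  have "algebraic_int x \<and> x - x \<in> I" using x O_idealD(3)[OF I] by simp
  hence "algebraic_int (res I x) \<and> x - res I x \<in> I" unfolding res_def by (rule someI)
  thus "algebraic_int (res I x)" "x - res I x \<in> I" by auto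
qed

lemma res_eq_iff:
  assumes I: "O_ideal I" and x: "algebraic_int x" "algebraic_int y"
  shows "res I x = res I y \<longleftrightarrow> x - y \<in> I"
proof
  assume e: "res I x = res I y"
  have "(x - res I x) - (y - res I y) \<in> I" by (intro O_idealD(8)[OF I] res(2)[OF I] x)
  thus "x - y \<in> I" using e by simp
next
  assume d: "x - y \<in> I"
  have "x - z \<in> I \<longleftrightarrow> y - z \<in> I" for z
    using O_idealD(8)[OF I, of "x - z" "x - y"] O_idealD(4)[OF I, of "y - z" "x - y"] d by (auto simp: algebra_simps)
  thus "res I x = res I y" by (simp add: res_def)
qed

lemma res_res: "O_ideal I \<Longrightarrow> algebraic_int x \<Longrightarrow> res I (res I x) = res I x"
  using res[of I x] res_eq_iff[of I x "res I x"] by auto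

lemma card_image_same_kernel:
  assumes "\<And>x y. x \<in> A \<Longrightarrow> y \<in> A \<Longrightarrow> f x = f y \<longleftrightarrow> g x = g y"
  shows "card (f ` A) = card (g ` A)"
proof -
  define h where "h u = g (SOME x. x \<in> A \<and> f x = u)" for u
  have h: "h (f x) = g x" if "x \<in> A" for x
  proof -
    have "x \<in> A \<and> f x = f x" using that by simp
    hence "(SOME x'. x' \<in> A \<and> f x' = f x) \<in> A \<and> f (SOME x'. x' \<in> A \<and> f x' = f x) = f x" by (rule someI)
    thus ?thesis unfolding h_def using assms that by blast
  qed
  have im: "h ` f ` A = g ` A" using h by (force simp: image_iff)
  have "inj_on h (f ` A)" using h assms by (auto simp: inj_on_def)
  thus ?thesis using im card_image by metis
qed

lemma OK_coset_eq_iff: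
  assumes "O_ideal I" "algebraic_int x" "algebraic_int y"
  shows "I +>\<^bsub>OK\<^esub> x = I +>\<^bsub>OK\<^esub> y \<longleftrightarrow> x - y \<in> I"
proof -
  interpret ring "OK :: 'a ring" using cring_OK by (rule cring.axioms)
  have "x \<ominus>\<^bsub>OK\<^esub> y = x - y" using assms by (simp add: a_minus_def OK_uminus)
  thus ?thesis using quotient_eq_iff_same_a_r_cos[of I x y] assms O_ideal_iff by auto
qed

lemma OK_Quot_carrier: "carrier (OK Quot I) = (\<lambda>x. I +>\<^bsub>OK\<^esub> x) ` Oring"
  by (auto simp: FactRing_def A_RCOSETS_def')

lemma ideal_norm_res:
  assumes I: "O_ideal (I :: 'k::field_char_0 set)"
  shows "ideal_norm I = card (res I ` Oring)"
  unfolding ideal_norm_def OK_Quot_carrier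
  by (rule card_image_same_kernel) (simp add: OK_coset_eq_iff[OF I] res_eq_iff[OF I])

lemma Oring_finite_index:
  assumes nf: "number_field TYPE('k::field_char_0)" and m: "algebraic_int m" "m \<noteq> (0::'k)"
  obtains T where "finite T" "T \<subseteq> Oring" "\<And>x. algebraic_int x \<Longrightarrow> \<exists>t\<in>T. x - t \<in> O_mul m"
proof -
  obtain W :: "'k set" where W: "finite W" "Oring = Zm.span W"
    using Oring_finitely_generated[OF nf] .
  obtain N where N: "N > 0" "algebraic_int (of_nat N * inverse m)"
    using ex_integer_multiple[OF nf, of "inverse m"] by metis
  obtain T where T: "finite T" "T \<subseteq> Zm.span W"
    "\<And>x. x \<in> Zm.span W \<Longrightarrow> \<exists>t\<in>T. \<exists>y\<in>Zm.span W. x - t = of_nat N * y"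
    using finite_quotient_of_nat[OF W(1) N(1)] by metis
  show ?thesis
  proof (rule that[of T])
    show "finite T" "T \<subseteq> Oring" using T W by auto
    fix x :: 'k assume "algebraic_int x"
    then obtain t y where ty: "t \<in> T" "algebraic_int y" "x - t = of_nat N * y" using T(3) W by blast
    have "algebraic_int (of_nat N * inverse m * y)" using N(2) ty(2) by (rule algebraic_int_add_mult)
    hence "x - t \<in> O_mul m" using ty(3) m by (simp add: O_mul_mem field_simps)
    thus "\<exists>t\<in>T. x - t \<in> O_mul m" using ty(1) by blast
  qed
qed

lemma finite_res:
  assumes nf: "number_field TYPE('k::field_char_0)" and I: "O_ideal I" and m: "m \<in> I" "m \<noteq> (0::'k)"
  shows "finite (res I ` Oring)"
proof -
  have mi: "algebraic_int m" using O_idealD(2)[OF I m(1)] .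
  obtain T where T: "finite T" "T \<subseteq> Oring" "\<And>x. algebraic_int x \<Longrightarrow> \<exists>t\<in>T. x - t \<in> O_mul m"
    using Oring_finite_index[OF nf mi m(2)] by metis
  have "res I ` Oring \<subseteq> res I ` T"
  proof clarify
    fix x :: 'k assume x: "algebraic_int x"
    obtain t where t: "t \<in> T" "x - t \<in> O_mul m" using T(3)[OF x] by blast
    have "x - t \<in> I" using t O_mul_minimal[OF I m(1)] by blast
    hence "res I x = res I t" using x t T(2) by (subst res_eq_iff[OF I]) auto
    thus "res I x \<in> res I ` T" using t by blast
  qed
  thus ?thesis using T(1) finite_surj by blast
qed

text \<open>Expansion to two digits: \<open>t + a * u\<close>, with \<open>t\<close> a residue
  modulo \<open>a\<close> and \<open>u\<close> one modulo \<open>b\<close>, meets every class modulo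
  \<open>a * b\<close> once.\<close>

lemma ideal_norm_mult:
  assumes nf: "number_field TYPE('k::field_char_0)"
    and a: "algebraic_int a" "a \<noteq> (0::'k)" and b: "algebraic_int b" "b \<noteq> 0"
  shows "ideal_norm (O_mul (a * b)) = ideal_norm (O_mul a) * ideal_norm (O_mul b)"
proof -
  have ab: "algebraic_int (a * b)" "a * b \<noteq> 0" using a b by (auto simp: algebraic_int_add_mult)
  note Ia = O_ideal_O_mul[OF a(1)] and Ib = O_ideal_O_mul[OF b(1)] and Iab = O_ideal_O_mul[OF ab(1)]
  define R where "R c = res (O_mul c) ` Oring" for c :: 'k
  define f where "f = (\<lambda>(t, u). res (O_mul (a * b)) (t + a * u))"
  have Ri: "algebraic_int t" if "t \<in> R c" "algebraic_int c" for t c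
    using that res(1)[OF O_ideal_O_mul[OF that(2)]] unfolding R_def by auto
  have Re: "t = u" if "t \<in> R c" "u \<in> R c" "algebraic_int c" "t - u \<in> O_mul c" for t u c
  proof -
    note Ic = O_ideal_O_mul[OF that(3)]
    from that(1) obtain x where x: "algebraic_int x" "t = res (O_mul c) x" unfolding R_def by auto
    from that(2) obtain y where y: "algebraic_int y" "u = res (O_mul c) y" unfolding R_def by auto
    note xy = x y
    have "res (O_mul c) t = res (O_mul c) u" using that Ri by (subst res_eq_iff[OF Ic]) auto
    thus ?thesis using xy res_res[OF Ic] by simp
  qed
  have "bij_betw f (R a \<times> R b) (R (a * b))"
    unfolding bij_betw_def
  proof
    show "inj_on f (R a \<times> R b)"
    proof (rule inj_onI, clarify)
      fix t u t' u' assume t: "t \<in> R a" "t' \<in> R a" and u: "u \<in> R b" "u' \<in> R b" and e: "f (t, u) = f (t', u')"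
      have i: "algebraic_int t" "algebraic_int t'" "algebraic_int u" "algebraic_int u'"
        using t u Ri a b by auto
      have i2: "algebraic_int (t + a * u)" "algebraic_int (t' + a * u')"
        using i a by (auto simp: algebraic_int_add_mult)
      have d: "(t + a * u) - (t' + a * u') \<in> O_mul (a * b)"
        using e i2 unfolding f_def by (simp add: res_eq_iff[OF Iab])
      then obtain r where r: "algebraic_int r" "(t + a * u) - (t' + a * u') = a * b * r"
        unfolding O_mul_def by auto
      have "t - t' = a * (b * r + u' - u)" using r(2) by (simp add: algebra_simps)
      moreover have "algebraic_int (b * r + u' - u)" using r i b by (auto simp: algebraic_int_add_mult algebraic_int_diff)
      ultimately have "t - t' \<in> O_mul a" by (simp add: O_mulI)
      hence tt: "t = t'" using Re t a by blast
      hence "a * (u - u') = a * (b * r)" using r(2) by (simp add: algebra_simps)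
      hence "u - u' = b * r" using a(2) by simp
      hence "u - u' \<in> O_mul b" using r(1) by (simp add: O_mulI)
      thus "t = t' \<and> u = u'" using tt Re u b by blast
    qed
    show "f ` (R a \<times> R b) = R (a * b)"
    proof
      show "f ` (R a \<times> R b) \<subseteq> R (a * b)"
      proof clarify
        fix t u assume "t \<in> R a" "u \<in> R b"
        hence "algebraic_int t" "algebraic_int u" using Ri a b by auto
        hence "algebraic_int (t + a * u)" using a by (simp add: algebraic_int_add_mult)
        thus "f (t, u) \<in> R (a * b)" by (simp add: f_def R_def)
      qed
      show "R (a * b) \<subseteq> f ` (R a \<times> R b)"
      proof
        fix z assume "z \<in> R (a * b)"
        then obtain x where x: "algebraic_int x" "z = res (O_mul (a * b)) x" by (auto simp: R_def)
        define t where "t = res (O_mul a) x"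
        have "x - t \<in> O_mul a" unfolding t_def by (rule res(2)[OF Ia x(1)])
        then obtain y where y: "algebraic_int y" "x - t = a * y" unfolding O_mul_def by auto
        define u where "u = res (O_mul b) y"
        have "y - u \<in> O_mul b" unfolding u_def by (rule res(2)[OF Ib y(1)])
        then obtain w where w: "algebraic_int w" "y - u = b * w" unfolding O_mul_def by auto
        have i: "algebraic_int t" "algebraic_int u" unfolding t_def u_def
          using res(1)[OF Ia x(1)] res(1)[OF Ib y(1)] by auto
        have "x - (t + a * u) = a * (y - u)" using y(2) by (simp add: algebra_simps)
        hence "x - (t + a * u) = a * b * w" using w(2) by (simp add: mult.assoc)
        hence "x - (t + a * u) \<in> O_mul (a * b)" using O_mulI[OF w(1), of "a * b"] by simp
        hence "z = f (t, u)" unfolding x(2) f_def prod.case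
          using x(1) i a by (subst res_eq_iff[OF Iab]) (auto simp: algebraic_int_add_mult)
        moreover have "t \<in> R a" "u \<in> R b" unfolding t_def u_def R_def using x(1) y(1) by auto
        ultimately show "z \<in> f ` (R a \<times> R b)" by blast
      qed
    qed
  qed
  hence "card (R a \<times> R b) = card (R (a * b))" by (rule bij_betw_same_card)
  thus ?thesis by (simp add: ideal_norm_res[OF Ia] ideal_norm_res[OF Ib] ideal_norm_res[OF Iab]
      R_def card_cartesian_product)
qed

lemma ideal_norm_gt_1:
  assumes nf: "number_field TYPE('k::field_char_0)" and I: "O_ideal I" and m: "m \<in> I" "m \<noteq> (0::'k)"
    and one: "1 \<notin> I"
  shows "ideal_norm I > 1"
proof -
  have "res I 1 \<noteq> res I 0" using one by (subst res_eq_iff[OF I]) (auto simp: int_imp_algebraic_int)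
  moreover have "{res I 0, res I 1} \<subseteq> res I ` Oring" by (auto simp: int_imp_algebraic_int)
  hence "card {res I 0, res I 1} \<le> card (res I ` Oring)" using finite_res[OF nf I m] by (rule card_mono[rotated])
  ultimately show ?thesis by (simp add: ideal_norm_res[OF I])
qed

text \<open>An ideal containing \<open>x\<close> is a union of classes modulo \<open>x\<close>,
  hence determined by which of finitely many representatives it contains.\<close>

lemma finite_ideals_containing:
  assumes nf: "number_field TYPE('k::field_char_0)" and x: "algebraic_int x" "x \<noteq> (0::'k)"
  shows "finite {I. O_ideal I \<and> x \<in> I}" (is "finite ?X")
proof -
  obtain T where T: "finite T" "T \<subseteq> Oring" "\<And>y. algebraic_int y \<Longrightarrow> \<exists>t\<in>T. y - t \<in> O_mul x"
    using Oring_finite_index[OF nf x] by metis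
  have mem: "y \<in> I \<longleftrightarrow> t \<in> I" if "I \<in> ?X" "y - t \<in> O_mul x" for I y t
  proof -
    have I: "O_ideal I" "x \<in> I" using that by auto
    have "y - t \<in> I" using that(2) O_mul_minimal[OF I] by blast
    thus ?thesis using O_idealD(8)[OF I(1), of y "y - t"] O_idealD(4)[OF I(1), of t "y - t"] by auto
  qed
  have "inj_on (\<lambda>I. I \<inter> T) ?X"
  proof (rule inj_onI)
    fix I J assume IJ: "I \<in> ?X" "J \<in> ?X" "I \<inter> T = J \<inter> T"
    have "y \<in> I \<longleftrightarrow> y \<in> J" if "algebraic_int y" for y
    proof -
      obtain t where t: "t \<in> T" "y - t \<in> O_mul x" using T(3)[OF \<open>algebraic_int y\<close>] by blast
      have "t \<in> I \<longleftrightarrow> t \<in> J" using t(1) IJ(3) by blast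
      thus ?thesis using mem[OF IJ(1) t(2)] mem[OF IJ(2) t(2)] by simp
    qed
    moreover have "I \<subseteq> Oring" "J \<subseteq> Oring" using IJ O_idealD(1) by auto
    ultimately show "I = J" by blast
  qed
  moreover have "(\<lambda>I. I \<inter> T) ` ?X \<subseteq> Pow T" by blast
  ultimately show ?thesis using T(1) by (meson finite_Pow_iff inj_on_finite)
qed

section \<open>Primes and their residue fields\<close>

text \<open>Among the finitely many ideals that contain \<open>x\<close> but not 1, one is maximal
  under inclusion; it is a maximal ideal of \<open>OK\<close> and so prime.\<close>

lemma ex_prime_containing:
  assumes nf: "number_field TYPE('k::field_char_0)" and x: "algebraic_int x" "x \<noteq> (0::'k)" "\<not> unit_OK x"
  shows "\<exists>P. O_prime P \<and> x \<in> P"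
proof -
  define X where "X = {I. O_ideal I \<and> x \<in> I \<and> 1 \<notin> I}"
  have "finite X" unfolding X_def
    by (rule finite_subset[OF _ finite_ideals_containing[OF nf x(1,2)]]) auto
  moreover have "O_mul x \<in> X"
    using x by (auto simp: X_def O_ideal_O_mul O_mul_self O_mul_mem unit_OK_def divide_inverse)
  ultimately obtain I where I: "I \<in> X" and max: "\<And>J. J \<in> X \<Longrightarrow> I \<subseteq> J \<Longrightarrow> I = J"
    using finite_has_maximal[of X] by auto
  have Ii: "O_ideal I" "x \<in> I" "1 \<notin> I" using I by (auto simp: X_def)
  have "maximalideal I OK"
  proof (rule maximalidealI)
    show "ideal I OK" using Ii O_ideal_iff by blast
    show "carrier OK \<noteq> I" using Ii(3) by (auto simp: int_imp_algebraic_int)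
    fix J assume J: "ideal J OK" "I \<subseteq> J" "J \<subseteq> carrier OK"
    show "J = I \<or> J = carrier OK"
    proof (cases "1 \<in> J")
      case True
      thus ?thesis using ideal.one_imp_carrier[OF J(1)] by simp
    next
      case False
      hence "J \<in> X" using J Ii O_ideal_iff unfolding X_def by blast
      thus ?thesis using max J by blast
    qed
  qed
  hence "primeideal I OK" by (rule cring.maximalideal_prime[OF cring_OK])
  hence "prime_of_OK I" using Ii(2) x(2) by (auto simp: prime_of_OK_def)
  thus ?thesis using Ii(2) O_prime_iff by blast
qed

text \<open>The powers of \<open>a\<close> repeat modulo \<open>P\<close>. Cancelling the smaller
  power leaves \<open>a ^ (j - i)\<close> congruent to 1, and the inverse is one power less.\<close>

lemma prime_inverse_mod:
  assumes nf: "number_field TYPE('k::field_char_0)" and P: "O_prime P" and a: "algebraic_int a" "a \<notin> (P :: 'k set)"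
  obtains r where "algebraic_int r" "1 - r * a \<in> P"
proof -
  note D = O_primeD[OF P] and ID = O_idealD[OF O_primeD(1)[OF P]]
  obtain m where m: "m \<in> P" "m \<noteq> 0" using D(4) by blast
  have pw: "algebraic_int (a ^ k)" for k using a(1) by (rule algebraic_int_power)
  have "range (\<lambda>k. res P (a ^ k)) \<subseteq> res P ` Oring" using pw by auto
  hence "finite (range (\<lambda>k. res P (a ^ k)))" using finite_res[OF nf D(1) m] finite_subset by blast
  hence "\<not> inj (\<lambda>k::nat. res P (a ^ k))" using finite_imageD infinite_UNIV_nat by blast
  then obtain i j where ij: "i < j" "res P (a ^ i) = res P (a ^ j)"
    unfolding inj_def by (metis linorder_neqE_nat)
  have "a ^ i - a ^ j \<in> P" using ij(2) pw by (simp add: res_eq_iff[OF D(1)])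
  moreover have "a ^ i - a ^ j = a ^ i * (1 - a ^ (j - i))"
    using ij(1) by (simp add: right_diff_distrib flip: power_add)
  moreover have "a ^ k \<notin> P" for k
    by (induction k) (use D(2,3) a pw in auto)
  ultimately have "1 - a ^ (j - i) \<in> P"
    using D(3)[of "a ^ i" "1 - a ^ (j - i)"] pw by (auto simp: algebraic_int_diff int_imp_algebraic_int)
  moreover have "a ^ (j - i) = a ^ (j - i - 1) * a"
    using ij(1) by (metis Suc_pred' mult.commute power_Suc zero_less_diff diff_Suc_eq_diff_pred Suc_diff_Suc diff_Suc_1)
  ultimately show ?thesis using that[of "a ^ (j - i - 1)"] pw by simp
qed

text \<open>
  Two-to-one maps on the residue field, such as \<open>x \<mapsto> c - a * x\<^sup>2\<close>, take more than half of all values;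
  so two of them share a value.
\<close>

lemma two_to_one_card:
  assumes nf: "number_field TYPE('k::field_char_0)" and P: "O_prime P"
    and fi: "\<And>x. algebraic_int x \<Longrightarrow> algebraic_int (f x)"
    and f: "\<And>x y. algebraic_int x \<Longrightarrow> algebraic_int y \<Longrightarrow> f x - f y \<in> P \<Longrightarrow> x - y \<in> P \<or> x + y \<in> (P :: 'k set)"
  shows "card (res P ` Oring) < 2 * card ((\<lambda>x. res P (f x)) ` Oring)"
proof -
  note D = O_primeD[OF P] and ID = O_idealD[OF O_primeD(1)[OF P]]
  obtain m where m: "m \<in> P" "m \<noteq> 0" using D(4) by blast
  define R where "R = res P ` Oring"
  have fR: "finite R" unfolding R_def by (rule finite_res[OF nf D(1) m])
  define A where "A = (\<lambda>x. res P (f x)) ` Oring"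
  have AR: "A \<subseteq> R" unfolding A_def R_def using fi by auto
  have fA: "finite A" using AR fR finite_subset by blast
  have Ri: "algebraic_int t" "res P t = t" if "t \<in> R" for t
    using that res(1)[OF D(1)] res_res[OF D(1)] unfolding R_def by auto
  define F where "F \<alpha> = {t \<in> R. res P (f t) = \<alpha>}" for \<alpha>
  have F2: "card (F \<alpha>) \<le> 2" for \<alpha>
  proof (cases "F \<alpha> = {}")
    case False
    then obtain u where u: "u \<in> F \<alpha>" by blast
    have ui: "algebraic_int u" "res P (f u) = \<alpha>" using u Ri by (auto simp: F_def)
    have "F \<alpha> \<subseteq> {u, res P (- u)}"
    proof
      fix t assume t: "t \<in> F \<alpha>"
      have ti: "algebraic_int t" "res P t = t" "res P (f t) = \<alpha>" using t Ri by (auto simp: F_def)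
      have "f t - f u \<in> P" using ti ui fi by (simp add: res_eq_iff[OF D(1), symmetric])
      hence "t - u \<in> P \<or> t + u \<in> P" using f ti ui by blast
      thus "t \<in> {u, res P (- u)}"
      proof
        assume "t - u \<in> P"
        hence "res P t = res P u" using ti ui by (subst res_eq_iff[OF D(1)]) auto
        thus ?thesis using ti Ri(2)[of u] u by (simp add: F_def)
      next
        assume "t + u \<in> P"
        hence "res P t = res P (- u)" using ti ui by (subst res_eq_iff[OF D(1)]) auto
        thus ?thesis using ti by simp
      qed
    qed
    hence "card (F \<alpha>) \<le> card {u, res P (- u)}" by (rule card_mono[rotated]) simp
    also have "\<dots> \<le> 2" by (metis card_2_iff' card.empty card_insert_le_m1 card_insert_disjoint Suc_1 finite.emptyI finite.insertI insert_absorb card_1_singleton_iff le_Suc_eq order_refl One_nat_def)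
    finally show ?thesis .
  qed simp
  define \<alpha>0 where "\<alpha>0 = res P (f 0)"
  have \<alpha>0: "\<alpha>0 \<in> A" unfolding A_def \<alpha>0_def by auto
  have F1: "card (F \<alpha>0) \<le> 1"
  proof -
    have "F \<alpha>0 \<subseteq> {res P 0}"
    proof
      fix t assume t: "t \<in> F \<alpha>0"
      have ti: "algebraic_int t" "res P t = t" "res P (f t) = \<alpha>0" using t Ri by (auto simp: F_def)
      have "f t - f 0 \<in> P" using ti fi by (simp add: res_eq_iff[OF D(1), symmetric] \<alpha>0_def)
      hence "t \<in> P" using f[of t 0] ti by auto
      hence "res P t = res P 0" using ti by (subst res_eq_iff[OF D(1)]) auto
      thus "t \<in> {res P 0}" using ti by simp
    qed
    hence "card (F \<alpha>0) \<le> card {res P 0}" by (rule card_mono[rotated]) simp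
    thus ?thesis by simp
  qed
  have "R = (\<Union>\<alpha>\<in>A. F \<alpha>)" unfolding F_def A_def using Ri by auto
  hence "card R \<le> (\<Sum>\<alpha>\<in>A. card (F \<alpha>))" using card_UN_le[OF fA] by metis
  also have "\<dots> = card (F \<alpha>0) + (\<Sum>\<alpha>\<in>A - {\<alpha>0}. card (F \<alpha>))" using fA \<alpha>0 by (simp add: sum.remove)
  also have "\<dots> \<le> 1 + (\<Sum>\<alpha>\<in>A - {\<alpha>0}. 2)" using F1 F2 by (intro add_mono sum_mono)
  also have "\<dots> < 2 * card A"
  proof -
    have "card A > 0" using fA \<alpha>0 by (auto simp: card_gt_0_iff)
    thus ?thesis using fA \<alpha>0 by (simp add: card_Diff_singleton)
  qed
  finally show ?thesis unfolding R_def A_def .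
qed

lemma ex_square_sum_mod:
  assumes nf: "number_field TYPE('k::field_char_0)" and P: "O_prime P" and two: "2 \<notin> (P :: 'k set)"
    and a: "algebraic_int a" "a \<notin> P" and c: "algebraic_int c"
  obtains x y where "algebraic_int x" "algebraic_int y" "x * x + a * (y * y) - c \<in> P"
proof -
  note D = O_primeD[OF P] and ID = O_idealD[OF O_primeD(1)[OF P]]
  obtain m where m: "m \<in> P" "m \<noteq> 0" using D(4) by blast
  define R where "R = res P ` Oring"
  have fR: "finite R" unfolding R_def by (rule finite_res[OF nf D(1) m])
  define A where "A = (\<lambda>x. res P (x * x)) ` Oring"
  define B where "B = (\<lambda>y. res P (c - a * (y * y))) ` Oring"
  have sq: "x - y \<in> P \<or> x + y \<in> P" if "algebraic_int x" "algebraic_int y" "x * x - y * y \<in> P" for x y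
  proof -
    have "(x - y) * (x + y) \<in> P" using that(3) by (simp add: algebra_simps)
    thus ?thesis using D(3)[of "x - y" "x + y"] that by (auto simp: algebraic_int_add_mult algebraic_int_diff)
  qed
  have cA: "card R < 2 * card A" unfolding R_def A_def
    by (rule two_to_one_card[OF nf P]) (use sq in \<open>auto simp: algebraic_int_add_mult\<close>)
  have cB: "card R < 2 * card B" unfolding R_def B_def
  proof (rule two_to_one_card[OF nf P])
    fix x y :: 'k assume xy: "algebraic_int x" "algebraic_int y" "c - a * (x * x) - (c - a * (y * y)) \<in> P"
    have "- (c - a * (x * x) - (c - a * (y * y))) \<in> P" using xy(3) by (rule ID(7))
    hence "a * (x * x - y * y) \<in> P" by (simp add: algebra_simps)
    hence "x * x - y * y \<in> P" using D(3)[of a "x * x - y * y"] a xy by (auto simp: algebraic_int_add_mult algebraic_int_diff)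
    thus "x - y \<in> P \<or> x + y \<in> P" using sq xy by blast
  qed (use a c in \<open>auto simp: algebraic_int_add_mult algebraic_int_diff\<close>)
  have AB: "A \<subseteq> R" "B \<subseteq> R" unfolding A_def B_def R_def
    using a c by (auto intro!: imageI simp: algebraic_int_add_mult algebraic_int_diff)
  have "A \<inter> B \<noteq> {}"
  proof
    assume "A \<inter> B = {}"
    hence "card (A \<union> B) = card A + card B" using AB fR finite_subset by (metis card_Un_disjoint)
    moreover have "card (A \<union> B) \<le> card R" using AB fR by (intro card_mono) auto
    ultimately show False using cA cB by simp
  qed
  then obtain x y where xy: "algebraic_int x" "algebraic_int y" "res P (x * x) = res P (c - a * (y * y))"
    unfolding A_def B_def by auto
  hence "x * x - (c - a * (y * y)) \<in> P"
    using a c by (subst (asm) res_eq_iff[OF D(1)]) (auto simp: algebraic_int_add_mult algebraic_int_diff)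
  hence "x * x + a * (y * y) - c \<in> P" by (simp add: algebra_simps)
  with xy show ?thesis using that by blast
qed

text \<open>When 2 lies in \<open>P\<close>, the factors \<open>x - y\<close> and
  \<open>x + y\<close> of a difference of squares are congruent, so squaring is injective on the
  finite residue field and therefore surjective.\<close>

lemma ex_square_mod_char_2:
  assumes nf: "number_field TYPE('k::field_char_0)" and P: "O_prime P" and two: "2 \<in> (P :: 'k set)"
    and c: "algebraic_int c"
  obtains x where "algebraic_int x" "x * x - c \<in> P"
proof -
  note D = O_primeD[OF P] and ID = O_idealD[OF O_primeD(1)[OF P]]
  obtain m where m: "m \<in> P" "m \<noteq> 0" using D(4) by blast
  define R where "R = res P ` Oring"
  have fR: "finite R" unfolding R_def by (rule finite_res[OF nf D(1) m])
  define A where "A = (\<lambda>x. res P (x * x)) ` Oring"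
  have k: "res P x = res P y \<longleftrightarrow> res P (x * x) = res P (y * y)" if "x \<in> Oring" "y \<in> Oring" for x y
  proof -
    have xy: "algebraic_int x" "algebraic_int y" using that by auto
    have e: "x * x - y * y = (x - y) * (x + y)" by (simp add: algebra_simps)
    have "x - y = (x + y) - 2 * y" by simp
    hence "x + y \<in> P \<Longrightarrow> x - y \<in> P"
      using ID(8)[of "x + y" "2 * y"] ID(6)[OF xy(2) two] by metis
    hence "x * x - y * y \<in> P \<longleftrightarrow> x - y \<in> P"
      unfolding e using D(3)[of "x - y" "x + y"] ID(6)[of "x + y" "x - y"] xy
      by (auto simp: algebraic_int_add_mult algebraic_int_diff)
    thus ?thesis using xy by (simp add: res_eq_iff[OF D(1)] algebraic_int_add_mult)
  qed
  have "card R = card A" unfolding R_def A_def by (rule card_image_same_kernel) (rule k)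
  moreover have "A \<subseteq> R" unfolding A_def R_def by (auto intro!: imageI simp: algebraic_int_add_mult)
  ultimately have "A = R" using fR card_subset_eq by metis
  hence "res P c \<in> A" using c by (auto simp: R_def)
  then obtain x where x: "algebraic_int x" "res P c = res P (x * x)" unfolding A_def by auto
  hence "x * x - c \<in> P" using c by (simp add: res_eq_iff[OF D(1), symmetric] algebraic_int_add_mult)
  with x show ?thesis using that by blast
qed

subsection \<open>Prime ideals are generated by reduced norms\<close>

context quaternion_algebra
begin

lemma dim_4:
  obtains E where "independent E" "finite E" "card E = 4" "span E = UNIV"
proof -
  obtain a b i j where B: "quaternion_basis s a b i j" using ex_quaternion_basis by blast
  define F where "F = of_coords s i j"
  have inj: "inj F" and surj: "surj F" using of_coords_bij[OF B] unfolding F_def bij_def by auto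
  have F: "F (t, x, y, z) = s t 1 + s x i + s y j + s z (i * j)" for t x y z by (simp add: F_def of_coords_def)
  have e: "F (1, 0, 0, 0) = 1" "F (0, 1, 0, 0) = i" "F (0, 0, 1, 0) = j" "F (0, 0, 0, 1) = i * j" by (simp_all add: F)
  have ne: "1 \<noteq> i" "1 \<noteq> j" "1 \<noteq> i * j" "i \<noteq> j" "i \<noteq> i * j" "j \<noteq> i * j"
    by (subst e[symmetric], subst e[symmetric], simp add: inj_eq[OF inj])+
  define E where "E = {1, i, j, i * j}"
  have f: "finite E" and c: "card E = 4" using ne by (auto simp: E_def)
  have sm: "(\<Sum>v\<in>E. s (u v) v) = F (u 1, u i, u j, u (i * j))" for u
    using ne by (simp add: E_def F add.assoc)
  show ?thesis
  proof (rule that[OF _ f c])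
    show "independent E"
    proof
      assume "dependent E"
      then obtain u where u: "\<exists>v\<in>E. u v \<noteq> 0" "(\<Sum>v\<in>E. s (u v) v) = 0"
        unfolding dependent_finite[OF f] by blast
      have "F (u 1, u i, u j, u (i * j)) = F (0, 0, 0, 0)" using u(2) unfolding sm by (simp add: F)
      hence "u 1 = 0 \<and> u i = 0 \<and> u j = 0 \<and> u (i * j) = 0" by (simp add: inj_eq[OF inj])
      thus False using u(1) by (auto simp: E_def)
    qed
    have "x \<in> span E" for x
    proof -
      obtain v where "x = F v" using surj by (metis surjD)
      moreover obtain t x' y z where "v = (t, x', y, z)" by (cases v)
      ultimately have "x = s t 1 + s x' i + s y j + s z (i * j)" by (simp add: F)
      also have "\<dots> \<in> span E" by (intro span_add span_scale span_base) (auto simp: E_def)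
      finally show ?thesis .
    qed
    thus "span E = UNIV" by blast
  qed
qed

lemma spanning_card_ge_4: "finite T \<Longrightarrow> span T = UNIV \<Longrightarrow> card T \<ge> 4"
  by (rule dim_4) (metis independent_span_bound subset_UNIV)

lemma independent_card_le_4: "independent T \<Longrightarrow> finite T \<and> card T \<le> 4"
  by (rule dim_4) (metis independent_span_bound subset_UNIV)

end

context quaternion_order
begin

section \<open>The ideal \<open>P H\<close> and its residue algebra\<close>

text \<open>Additive generation is required as long as \<open>P\<close> is not known to be
  principal; \<open>PH_principal\<close> gives the simpler form afterwards.\<close>

definition PH :: "'k set \<Rightarrow> 'a set" where "PH P = Zm.span {s p h | p h. p \<in> P \<and> h \<in> H}"

lemma PH_base: "p \<in> P \<Longrightarrow> h \<in> H \<Longrightarrow> s p h \<in> PH P"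
  unfolding PH_def by (rule Zm.span_base) blast

lemma PH_0: "0 \<in> PH P" unfolding PH_def by (rule Zm.span_zero)
lemma PH_add: "x \<in> PH P \<Longrightarrow> y \<in> PH P \<Longrightarrow> x + y \<in> PH P" unfolding PH_def by (rule Zm.span_add)
lemma PH_diff: "x \<in> PH P \<Longrightarrow> y \<in> PH P \<Longrightarrow> x - y \<in> PH P" unfolding PH_def by (rule Zm.span_diff)
lemma PH_minus: "x \<in> PH P \<Longrightarrow> - x \<in> PH P" unfolding PH_def by (rule Zm.span_neg)

lemma PH_induct [consumes 2, case_names 0 add]:
  assumes P: "O_ideal P" and z: "z \<in> PH P" and Q0: "Q 0"
    and step: "\<And>p h x. p \<in> P \<Longrightarrow> h \<in> H \<Longrightarrow> x \<in> PH P \<Longrightarrow> Q x \<Longrightarrow> Q (s p h + x)"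
  shows "Q z"
proof -
  have "z \<in> PH P \<and> Q z" using z unfolding PH_def
  proof (induction rule: Zm.span_induct_alt)
    case base
    show ?case using Q0 Zm.span_zero by blast
  next
    case (step n w x)
    then obtain p h where w: "w = s p h" "p \<in> P" "h \<in> H" by blast
    have e: "of_int n * w = s (of_int n * p) h" by (simp add: w of_int_mult_eq_scale)
    have np: "of_int n * p \<in> P" using w(2) P by (intro O_idealD(5)) (auto simp: int_imp_algebraic_int)
    have x: "x \<in> PH P" "Q x" using step(2) by (auto simp: PH_def)
    have "of_int n * w + x \<in> PH P" unfolding e using PH_add[OF PH_base[OF np w(3)] x(1)] .
    moreover have "Q (of_int n * w + x)" unfolding e using assms(4)[OF np w(3) x] .
    ultimately show ?case by (simp add: PH_def)
  qed
  thus ?thesis ..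
qed

context
  fixes P :: "'k set"
  assumes P: "O_ideal P"
begin

lemma PH_sub: "z \<in> PH P \<Longrightarrow> z \<in> H"
  using P by (induction z rule: PH_induct) (auto intro: H_0 H_add H_scale O_idealD(2)[OF P])

lemma PH_lmult: "z \<in> PH P \<Longrightarrow> g \<in> H \<Longrightarrow> g * z \<in> PH P"
  using P by (induction z rule: PH_induct)
    (auto simp: PH_0 distrib_left scale_mult_right intro!: PH_add PH_base H_mult)

lemma PH_rmult: "z \<in> PH P \<Longrightarrow> g \<in> H \<Longrightarrow> z * g \<in> PH P"
  using P by (induction z rule: PH_induct)
    (auto simp: PH_0 distrib_right scale_mult_left intro!: PH_add PH_base H_mult)

lemma PH_scale: "z \<in> PH P \<Longrightarrow> algebraic_int r \<Longrightarrow> s r z \<in> PH P"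
  using PH_lmult[OF _ H_scalar] by (simp add: scalar_mult)

lemma PH_cj: "z \<in> PH P \<Longrightarrow> cj z \<in> PH P"
  using P by (induction z rule: PH_induct)
    (auto simp: PH_0 cj_add cj_scale intro!: PH_add PH_base H_cj)

lemma trd_PH: "z \<in> PH P \<Longrightarrow> trd s z \<in> P"
  using P by (induction z rule: PH_induct)
    (auto simp: trd_add trd_scale intro!: O_idealD(3,4,6)[OF P] trd_integral)

lemma nrd_PH: assumes z: "z \<in> PH P" shows "nrd s z \<in> P"
  using P z
proof (induction z rule: PH_induct)
  case 0
  show ?case by (simp add: O_idealD(3)[OF P])
next
  case (add p h x)
  have a: "p * nrd s h \<in> P" and b: "p * trd s (h * cj x) \<in> P"
    using add PH_sub by (auto intro!: O_idealD(6)[OF P] nrd_integral trd_integral H_mult H_cj)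
  have "p * (p * nrd s h) \<in> P" using O_idealD(5)[OF P O_idealD(2)[OF P add(1)] a] .
  hence "p * (p * nrd s h) + nrd s x + p * trd s (h * cj x) \<in> P"
    using add(4) b by (intro O_idealD(4)[OF P])
  thus ?case by (simp add: nrd_add nrd_scale scale_mult_left trd_scale mult.assoc)
qed

lemma nrd_PH_add:
  assumes "z \<in> H" "w \<in> PH P" shows "nrd s (z + w) - nrd s z \<in> P"
proof -
  have "trd s (z * cj w) \<in> P" using assms by (intro trd_PH PH_lmult PH_cj)
  moreover have "nrd s (z + w) - nrd s z = nrd s w + trd s (z * cj w)" by (simp add: nrd_add)
  ultimately show ?thesis using nrd_PH[OF assms(2)] O_idealD(4)[OF P] by simp
qed

lemma PH_subset_scspan:
  assumes B: "finite B" "H = scspan Oring B" shows "PH P \<subseteq> scspan P B"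
proof
  fix z assume z: "z \<in> PH P"
  from P z show "z \<in> scspan P B"
  proof (induction z rule: PH_induct)
    case 0
    show ?case using O_idealD(3)[OF P] by (rule scspan_0)
  next
    case (add p h x)
    have "s p h \<in> scspan P B"
      using add O_idealD(6)[OF P] unfolding B(2) by (intro scspan_scale[where C = Oring]) auto
    thus ?case using add O_idealD(4)[OF P] by (intro scspan_add) auto
  qed
qed

end

lemma PH_principal:
  assumes "algebraic_int \<pi>" shows "PH (O_mul \<pi>) = s \<pi> ` H"
proof
  show "s \<pi> ` H \<subseteq> PH (O_mul \<pi>)" using PH_base[OF O_mul_self] by auto
  show "PH (O_mul \<pi>) \<subseteq> s \<pi> ` H"
  proof
    fix z assume z: "z \<in> PH (O_mul \<pi>)"
    from O_ideal_O_mul[OF assms] z show "z \<in> s \<pi> ` H"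
    proof (induction z rule: PH_induct)
      case 0
      show ?case using H_0 by (intro image_eqI[of _ _ 0]) auto
    next
      case (add p h x)
      then obtain r y where "p = \<pi> * r" "algebraic_int r" "x = s \<pi> y" "y \<in> H" unfolding O_mul_def by auto
      hence "s p h + x = s \<pi> (s r h + y)" "s r h + y \<in> H"
        using add by (auto simp: scale_right_distrib intro: H_add H_scale)
      thus ?case by blast
    qed
  qed
qed

context
  fixes P :: "'k set"
  assumes P: "O_prime P"
begin

lemma PH_scalarD: assumes "s c 1 \<in> PH P" shows "c \<in> P"
proof -
  note I = O_primeD(1)[OF P]
  have "algebraic_int c" using PH_sub[OF I assms] by (simp add: H_scalar_iff)
  moreover have "c * c \<in> P" using nrd_PH[OF I assms] by (simp add: nrd_scalar)
  ultimately show ?thesis using O_primeD(3)[OF P] by blast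
qed

lemma PH_cancel_scale:
  assumes "algebraic_int c" "c \<notin> P" "x \<in> H" "s c x \<in> PH P" shows "x \<in> PH P"
proof -
  note I = O_primeD(1)[OF P]
  obtain r where r: "algebraic_int r" "1 - r * c \<in> P" using prime_inverse_mod[OF nf P assms(1,2)] .
  have "s (1 - r * c) x + s r (s c x) \<in> PH P"
    by (rule PH_add[OF PH_base[OF r(2) assms(3)] PH_scale[OF I assms(4) r(1)]])
  thus ?thesis by (simp add: scale_left_diff_distrib)
qed

text \<open>By Nakayama, generators of \<open>H\<close> modulo \<open>P H\<close> span the whole
  algebra over K, whose dimension is 4. This is how the size of \<open>H / P H\<close> is controlled
  without a basis of \<open>H\<close>.\<close>

lemma residue_generators_ge_4:
  assumes T: "finite T" and gen: "\<And>h. h \<in> H \<Longrightarrow> \<exists>y\<in>scspan Oring T. h - y \<in> PH P"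
  shows "card T \<ge> 4"
proof -
  note D = O_primeD[OF P] and ID = O_idealD[OF O_primeD(1)[OF P]]
  obtain B where B: "finite B" "H = scspan Oring B" by (rule H_basis)
  have BH: "b \<in> H" if "b \<in> B" for b
    using scspan_base[OF B(1) that, of Oring 1] B(2) by simp
  have "\<exists>p. (\<forall>b'\<in>B. p b' \<in> P) \<and> b - (\<Sum>b'\<in>B. s (p b') b') \<in> scspan Oring T" if b: "b \<in> B" for b
  proof -
    obtain y where y: "y \<in> scspan Oring T" "b - y \<in> PH P" using gen[OF BH[OF b]] by blast
    have "b - y \<in> scspan P B" using y(2) PH_subset_scspan[OF D(1) B] by blast
    then obtain p where "b - y = (\<Sum>b'\<in>B. s (p b') b')" "\<forall>b'\<in>B. p b' \<in> P" by (rule scspanE)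
    moreover from this(1) have "b - (\<Sum>b'\<in>B. s (p b') b') = y" by (simp add: algebra_simps)
    ultimately show ?thesis using y(1) by (intro exI[of _ p]) simp
  qed
  then obtain p where p: "\<And>b b'. b \<in> B \<Longrightarrow> b' \<in> B \<Longrightarrow> p b b' \<in> P"
    "\<And>b. b \<in> B \<Longrightarrow> b - (\<Sum>b'\<in>B. s (p b b') b') \<in> scspan Oring T" by metis
  have TS: "scspan Oring T \<subseteq> span T"
    by (rule scspan_minimal) (auto intro: span_zero span_add span_scale span_base)
  have one: "- 1 \<notin> P" using ID(7)[of "- 1"] D(2) by auto
  have "b \<in> span T" if "b \<in> B" for b
  proof (rule nakayama_elim[where P = P and B = B and f = "\<lambda>b. b" and c = 1 and p = p])
    show "finite B" "- 1 \<notin> P" "b \<in> B" by fact+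
    show "subspace (span T)" by (rule subspace_span)
    show "s 1 b - (\<Sum>b'\<in>B. s (p b b') b') \<in> span T" if "b \<in> B" for b
      using p(2)[OF that] TS by auto
    show "1 - 1 \<in> P" using ID(3) by simp
    show "x * y \<in> P" if "x \<in> P" "y \<in> P" for x y using ID(2)[OF that(1)] that(2) by (rule ID(5))
  qed (use ID p(1) in auto)
  hence "scspan Oring B \<subseteq> span T"
    by (intro scspan_minimal) (auto intro: span_zero span_add span_scale)
  hence "span H \<subseteq> span T" unfolding B(2) by (intro span_minimal subspace_span)
  hence "span T = UNIV" using H_span by blast
  thus ?thesis using T by (intro spanning_card_ge_4)
qed

lemma ex_not_in_residue_plane:
  obtains w where "w \<in> H"
    "\<And>a b. algebraic_int a \<Longrightarrow> algebraic_int b \<Longrightarrow> w - (s a u + s b v) \<notin> PH P"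
proof -
  have "card {u, v} \<le> 2" by (cases "u = v") auto
  hence "\<not> (\<forall>h\<in>H. \<exists>y\<in>scspan Oring {u, v}. h - y \<in> PH P)"
    using residue_generators_ge_4[of "{u, v}"] by auto
  then obtain w where w: "w \<in> H" "\<And>y. y \<in> scspan Oring {u, v} \<Longrightarrow> w - y \<notin> PH P" by blast
  show ?thesis
  proof (rule that[OF w(1)])
    fix a b :: 'k assume "algebraic_int a" "algebraic_int b"
    hence "s a u + s b v \<in> scspan Oring {u, v}"
      by (intro scspan_add scspan_base) (auto simp: algebraic_int_add_mult)
    thus "w - (s a u + s b v) \<notin> PH P" by (rule w(2))
  qed
qed

text \<open>If 2 is in \<open>P\<close>, a nonscalar element of trace in \<open>P\<close> plus a
  suitable scalar has norm in \<open>P\<close>, since every residue is a square. Otherwise 1,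
  \<open>y\<close> and \<open>w2\<close> are made orthogonal for the trace form modulo
  \<open>P\<close>, and a combination of the three has norm in \<open>P\<close> because the residue
  field represents every value by \<open>u * u + n * (v * v)\<close>. Independence from the other
  elements keeps the zero outside \<open>P H\<close>.\<close>

lemma ex_isotropic: "\<exists>z\<in>H. z \<notin> PH P \<and> nrd s z \<in> P"
proof (rule ccontr)
  assume "\<not> ?thesis"
  hence an: "z \<in> PH P" if "z \<in> H" "nrd s z \<in> P" for z using that by blast
  note D = O_primeD[OF P] and ID = O_idealD[OF O_primeD(1)[OF P]]
  have i2: "algebraic_int (2::'k)" by (rule int_imp_algebraic_int) simp
  obtain z where z: "z \<in> H" "\<And>a b. algebraic_int a \<Longrightarrow> algebraic_int b \<Longrightarrow> z - (s a 1 + s b 1) \<notin> PH P"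
    using ex_not_in_residue_plane[of 1 1] by metis
  have z1: "z - s a 1 \<notin> PH P" if "algebraic_int a" for a using z(2)[OF that, of 0] by simp
  show False
  proof (cases "2 \<in> P")
    case True
    have "\<exists>z'\<in>H. trd s z' \<in> P \<and> (\<forall>a. algebraic_int a \<longrightarrow> z' - s a 1 \<notin> PH P)"
    proof (cases "trd s z \<in> P")
      case True thus ?thesis using z z1 by blast
    next
      case False
      obtain r where r: "algebraic_int r" "1 - r * trd s z \<in> P"
        using prime_inverse_mod[OF nf P trd_integral[OF z(1)] False] .
      obtain w where w: "w \<in> H" "\<And>a b. algebraic_int a \<Longrightarrow> algebraic_int b \<Longrightarrow> w - (s a 1 + s b z) \<notin> PH P"
        using ex_not_in_residue_plane[of 1 z] by metis
      \<comment> \<open>Modulo \<open>P\<close> this is the quotient of the traces of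
        \<open>w\<close> and \<open>z\<close>, so subtracting \<open>s c z\<close> cancels the trace
        of \<open>w\<close>.\<close>
      define c where "c = r * trd s w"
      have c: "algebraic_int c" unfolding c_def using r w trd_integral by (simp add: algebraic_int_add_mult)
      have "trd s (w - s c z) = (1 - r * trd s z) * trd s w" by (simp add: trd_diff trd_scale c_def algebra_simps)
      also have "\<dots> \<in> P" using r(2) trd_integral[OF w(1)] by (intro ID(6))
      finally have "trd s (w - s c z) \<in> P" .
      moreover have "w - s c z - s a 1 \<notin> PH P" if "algebraic_int a" for a
        using w(2)[OF that c] by (simp add: algebra_simps)
      moreover have "w - s c z \<in> H" using w z c by (intro H_diff H_scale)
      ultimately show ?thesis by blast
    qed
    then obtain z' where z': "z' \<in> H" "trd s z' \<in> P" "\<And>a. algebraic_int a \<Longrightarrow> z' - s a 1 \<notin> PH P" by blast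
    obtain x where x: "algebraic_int x" "x * x - nrd s z' \<in> P"
      using ex_square_mod_char_2[OF nf P True nrd_integral[OF z'(1)]] .
    define v where "v = s x 1 + z'"
    \<comment> \<open>The norm contains a sum where the choice of \<open>x\<close> controls a
      difference; the discrepancy is twice \<open>nrd s z'\<close>, which lies in
      \<open>P\<close>.\<close>
    have "nrd s v = (x * x - nrd s z') + nrd s z' * 2 + x * trd s z'"
      by (simp add: v_def nrd_add nrd_scalar scalar_mult trd_scale)
    also have "\<dots> \<in> P" using x z' nrd_integral True by (intro ID(4,5)) auto
    finally have "v \<in> PH P" using an[of v] x z' by (auto simp: v_def intro: H_add H_scalar)
    thus False using z'(3)[of "- x"] x(1) by (simp add: v_def scale_minus_left add.commute)
  next
    case two: False
    obtain h where h: "algebraic_int h" "1 - h * 2 \<in> P" using prime_inverse_mod[OF nf P i2 two] .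
    \<comment> \<open>The scalar part is removed: \<open>h\<close> inverts 2 modulo
      \<open>P\<close>, and a scalar has twice its value as trace.\<close>
    have half: "trd s (w - s (h * trd s w) 1) \<in> P" if "w \<in> H" for w
    proof -
      have "trd s (w - s (h * trd s w) 1) = (1 - h * 2) * trd s w" by (simp add: trd_diff trd_scalar algebra_simps)
      thus ?thesis using ID(6)[OF trd_integral[OF that] h(2)] by simp
    qed
    have hi: "algebraic_int (h * trd s w)" if "w \<in> H" for w
      using h trd_integral[OF that] by (simp add: algebraic_int_add_mult)
    define y where "y = z - s (h * trd s z) 1"
    have y: "y \<in> H" "trd s y \<in> P" using half z hi H_diff H_scalar unfolding y_def by auto
    have yP: "y \<notin> PH P" using z1[OF hi[OF z(1)]] by (simp add: y_def)
    define n where "n = nrd s y"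
    have n: "algebraic_int n" "n \<notin> P" unfolding n_def using y yP nrd_integral an by auto
    obtain r where r: "algebraic_int r" "1 - r * n \<in> P" using prime_inverse_mod[OF nf P n] .
    obtain w where w: "w \<in> H" "\<And>a b. algebraic_int a \<Longrightarrow> algebraic_int b \<Longrightarrow> w - (s a 1 + s b y) \<notin> PH P"
      using ex_not_in_residue_plane[of 1 y] by metis
    define w1 where "w1 = w - s (h * trd s w) 1"
    have w1: "w1 \<in> H" "trd s w1 \<in> P" using half w hi H_diff H_scalar unfolding w1_def by auto
    define b where "b = trd s (w1 * cj y)"
    have b: "algebraic_int b" unfolding b_def using w1 y by (intro trd_integral H_mult H_cj)
    \<comment> \<open>The Gram-Schmidt coefficient: \<open>y\<close> pairs with itself to
      \<open>2 * n\<close>, so modulo \<open>P\<close> this is \<open>b\<close> divided by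
      \<open>2 * n\<close>.\<close>
    define c where "c = h * (r * b)"
    have c: "algebraic_int c" unfolding c_def using h r b by (simp add: algebraic_int_add_mult)
    define w2 where "w2 = w1 - s c y"
    have w2: "w2 \<in> H" unfolding w2_def using w1 y c by (intro H_diff H_scale)
    have tw2: "trd s w2 \<in> P" unfolding w2_def trd_diff trd_scale using w1 y c by (intro ID(5,8))
    have orth: "trd s (y * cj w2) \<in> P"
    proof -
      have "trd s (y * cj w2) = trd s (w2 * cj y)" by (metis trd_cj cj_mult cj_cj)
      also have "\<dots> = b - c * (2 * n)"
        by (simp add: w2_def left_diff_distrib trd_diff scale_mult_left trd_scale mult_cj b_def n_def)
      also have "\<dots> = (1 - h * 2) * b + (1 - r * n) * (h * 2 * b)" by (simp add: c_def algebra_simps)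
      also have "\<dots> \<in> P" using h r b i2 by (intro ID(4,6)) (auto simp: algebraic_int_add_mult)
      finally show ?thesis .
    qed
    have "algebraic_int (- nrd s w2)" using w2 nrd_integral by simp
    then obtain u v where uv: "algebraic_int u" "algebraic_int v" "u * u + n * (v * v) - - nrd s w2 \<in> P"
      using ex_square_sum_mod[OF nf P two n] by metis
    define q where "q = s u 1 + (s v y + w2)"
    have "nrd s q = (u * u + n * (v * v) - - nrd s w2) + v * trd s (y * cj w2) + u * (v * trd s y + trd s w2)"
    proof -
      have a: "nrd s (s v y + w2) = v * v * n + nrd s w2 + v * trd s (y * cj w2)"
        by (simp only: nrd_add nrd_scale scale_mult_left trd_scale n_def)
      have "nrd s q = u * u + nrd s (s v y + w2) + u * trd s (s v y + w2)"
        by (simp only: q_def nrd_add[of "s u 1"] nrd_scalar scalar_mult trd_scale trd_cj)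
      thus ?thesis unfolding a trd_add trd_scale by (simp add: algebra_simps)
    qed
    also have "\<dots> \<in> P" using uv orth y tw2 by (intro ID(4,5))
    finally have "q \<in> PH P" using an[of q] uv y w2 by (auto simp: q_def intro!: H_add H_scalar H_scale)
    moreover have "q = w - (s (h * trd s w - u) 1 + s (c - v) y)"
      by (simp add: q_def w2_def w1_def scale_left_diff_distrib algebra_simps)
    ultimately show False using w(2)[of "h * trd s w - u" "c - v"] hi[OF w(1)] uv c by (simp add: algebraic_int_diff)
  qed
qed

end

end

section \<open>Principal primes with positive generators\<close>

text \<open>A nonzero ideal is a finitely generated group: multiples of \<open>m\<close> come from
  generators of the ring of integers, and finitely many classes modulo \<open>m\<close> are lifted.
  A multiplier of a nonzero finitely generated group is integral.\<close>

lemma stable_ideal_integral: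
  assumes nf: "number_field TYPE('k::field_char_0)" and I: "O_ideal I" and m: "m \<in> I" "m \<noteq> (0::'k)"
    and x: "\<And>p. p \<in> I \<Longrightarrow> x * p \<in> I"
  shows "algebraic_int x"
proof -
  note ID = O_idealD[OF I]
  obtain W :: "'k set" where W: "finite W" "Oring = Zm.span W"
    using Oring_finitely_generated[OF nf] .
  have Wi: "algebraic_int w" if "w \<in> W" for w using Zm.span_base[OF that] W(2) by blast
  obtain T where T: "finite T" "T \<subseteq> Oring" "\<And>y. algebraic_int y \<Longrightarrow> \<exists>t\<in>T. y - t \<in> O_mul m"
    using Oring_finite_index[OF nf ID(2)[OF m(1)] m(2)] by metis
  define f where "f t = (if \<exists>y. y \<in> I \<and> y - t \<in> O_mul m then SOME y. y \<in> I \<and> y - t \<in> O_mul m else 0)" for t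
  have f: "f t \<in> I \<and> f t - t \<in> O_mul m" if "y \<in> I \<and> y - t \<in> O_mul m" for t y
    using someI[of "\<lambda>y. y \<in> I \<and> y - t \<in> O_mul m", OF that] that unfolding f_def by auto
  have fI: "f t \<in> I" for t
  proof (cases "\<exists>y. y \<in> I \<and> y - t \<in> O_mul m")
    case True thus ?thesis using f by blast
  next
    case False
    show ?thesis unfolding f_def if_not_P[OF False] by (rule ID(3))
  qed
  define G where "G = (\<lambda>w. m * w) ` W \<union> f ` T \<union> {m}"
  have GI: "G \<subseteq> I" unfolding G_def using fI m Wi ID(6) by auto
  have "Zm.subspace I" using ID by (intro Zm.subspaceI) (auto simp: int_imp_algebraic_int)
  hence sub: "Zm.span G \<subseteq> I" using GI by (rule Zm.span_minimal[rotated])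
  have mO: "m * r \<in> Zm.span G" if "algebraic_int r" for r
  proof -
    have "r \<in> Zm.span W" using that W(2) by blast
    thus ?thesis
    proof (induction rule: Zm.span_induct_alt)
      case (step n w y)
      have "m * w \<in> Zm.span G" using step(1) by (intro Zm.span_base) (auto simp: G_def)
      hence "of_int n * (m * w) + m * y \<in> Zm.span G" using step by (intro Zm.span_add Zm.span_scale)
      thus ?case by (simp add: algebra_simps)
    qed (simp add: Zm.span_zero)
  qed
  have "I \<subseteq> Zm.span G"
  proof
    fix y assume y: "y \<in> I"
    obtain t where t: "t \<in> T" "y - t \<in> O_mul m" using T(3)[OF ID(2)[OF y]] by blast
    have "f t - t \<in> O_mul m" using f[of y t] y t by blast
    moreover have "O_ideal (O_mul m)" using ID(2)[OF m(1)] by (rule O_ideal_O_mul)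
    ultimately have "(y - t) - (f t - t) \<in> O_mul m" using t(2) O_idealD(8) by metis
    hence "y - f t \<in> Zm.span G" using mO unfolding O_mul_def by auto
    moreover have "f t \<in> Zm.span G" using t(1) by (intro Zm.span_base) (auto simp: G_def)
    ultimately have "(y - f t) + f t \<in> Zm.span G" by (rule Zm.span_add)
    thus "y \<in> Zm.span G" by simp
  qed
  moreover have "finite G" "m \<in> G" using W T by (auto simp: G_def)
  ultimately show ?thesis using x GI m by (intro algebraic_int_stable[of G m]) auto
qed

context class_one_order
begin

text \<open>
  Let \<open>n = nrd y\<close>. From \<open>P H \<subseteq> H y\<close> one gets \<open>P (H y) \<subseteq> n H\<close>. Either \<open>n\<^sup>-\<^sup>1 P\<close> preserves \<open>P\<close>, hence is integral
  and \<open>P\<close> is generated by \<open>n\<close>; or \<open>n\<^sup>-\<^sup>1 P P\<close> contains a unit modulo \<open>P\<close>, which gives \<open>H y \<subseteq> P H\<close>.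
\<close>

lemma intermediate_left_ideal:
  assumes P: "O_prime P" and J: "left_ideal J" "PH P \<subseteq> J" "J \<noteq> PH P" "J \<noteq> H"
  obtains y where "y \<in> H" "y \<noteq> 0" "J = lmul y" "P = O_mul (nrd s y)"
proof -
  note D = O_primeD[OF P] and ID = O_idealD[OF O_primeD(1)[OF P]] and JD = left_idealD[OF J(1)]
  obtain m where m: "m \<in> P" "m \<noteq> 0" using D(4) by blast
  have "s m h \<in> J" if "h \<in> H" for h using PH_base[OF m(1) that] J(2) by blast
  then obtain y where y: "y \<in> H" "y \<noteq> 0" "J = lmul y"
    using left_ideal_principal[OF J(1) ID(2)[OF m(1)] m(2)] by metis
  define n where "n = nrd s y"
  have n: "algebraic_int n" "n \<noteq> 0" unfolding n_def using y nrd_integral by (auto simp: nrd_eq_0_iff)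
  have yJ: "y \<in> J" unfolding y(3) by (rule lmul_self)
  have nP: "n \<in> P"
  proof (rule ccontr)
    assume "n \<notin> P"
    then obtain r where r: "algebraic_int r" "1 - r * n \<in> P" using prime_inverse_mod[OF nf P n(1)] by metis
    have "s (1 - r * n) 1 \<in> J" using PH_base[OF r(2) H_1] J(2) by blast
    moreover have "s r (cj y * y) \<in> J" using yJ y(1) r(1) by (intro JD(4,5) H_cj)
    ultimately have "s (1 - r * n) 1 + s r (cj y * y) \<in> J" by (rule JD(3))
    hence one: "1 \<in> J" by (simp add: cj_mult_self n_def scale_left_diff_distrib)
    have "H \<subseteq> J" using JD(4)[OF _ one] by auto
    thus False using J(4) JD(1) by blast
  qed
  have key: "\<exists>g\<in>H. s p w = s n g" if p: "p \<in> P" and w: "w \<in> J" for p w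
  proof -
    have "s p 1 \<in> J" using PH_base[OF p H_1] J(2) by blast
    then obtain h where h: "h \<in> H" "s p 1 = h * y" unfolding y(3) lmul_def by blast
    obtain h' where h': "h' \<in> H" "w = h' * y" using w unfolding y(3) lmul_def by blast
    \<comment> \<open>Conjugation fixes the scalar and places \<open>cj y\<close> directly to the
      right of \<open>y\<close> in \<open>h' * y * s p 1\<close>, which produces the factor
      \<open>n\<close>.\<close>
    have "s p 1 = cj y * cj h" using arg_cong[OF h(2), of cj] by (simp add: cj_mult)
    hence "s p w = h' * (y * cj y) * cj h" using h'(2) by (metis mult.assoc scalar_mult(2))
    also have "\<dots> = s n (h' * cj h)" by (simp add: mult_cj n_def scale_mult_left scale_mult_right)
    finally show ?thesis using H_mult[OF h'(1) H_cj[OF h(1)]] by blast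
  qed
  have pq: "algebraic_int (p * q / n)" if p: "p \<in> P" and q: "q \<in> P" for p q
  proof -
    have "s q 1 \<in> J" using PH_base[OF q H_1] J(2) by blast
    then obtain g where g: "g \<in> H" "s p (s q 1) = s n g" using key[OF p] by blast
    have "s (inverse n) (s p (s q 1)) = g" using n(2) by (simp add: g(2) del: scale_scale) (simp add: scale_scale)
    hence "s (p * q / n) 1 \<in> H" using g(1) by (simp add: field_simps)
    thus ?thesis by (simp add: H_scalar_iff)
  qed
  have "P = O_mul n"
  proof (cases "\<forall>p\<in>P. \<forall>q\<in>P. p * q / n \<in> P")
    case True
    have "p \<in> O_mul n" if p: "p \<in> P" for p
    proof -
      have "p / n * q \<in> P" if "q \<in> P" for q using True p that by (simp add: field_simps)
      hence "algebraic_int (p / n)" by (rule stable_ideal_integral[OF nf D(1) m])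
      thus ?thesis using n by (simp add: O_mul_mem)
    qed
    moreover have "O_mul n \<subseteq> P" using D(1) nP by (rule O_mul_minimal)
    ultimately show ?thesis by blast
  next
    case False
    then obtain p q where p: "p \<in> P" "q \<in> P" "p * q / n \<notin> P" by blast
    obtain r where r: "algebraic_int r" "1 - r * (p * q / n) \<in> P" using prime_inverse_mod[OF nf P pq[OF p(1,2)] p(3)] .
    have "w \<in> PH P" if w: "w \<in> J" for w
    proof -
      obtain g where g: "g \<in> H" "s q w = s n g" using key[OF p(2) w] by blast
      have "s (r * (p * q / n)) w = s (r * p / n) (s q w)" by (simp add: field_simps)
      also have "\<dots> = s (r * p) g" unfolding g(2) using n(2) by simp
      finally have e: "s (r * (p * q / n)) w = s (r * p) g" .
      have "s (1 - r * (p * q / n)) w + s (r * p) g \<in> PH P"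
        using r p g w JD(1) ID(5) by (intro PH_add PH_base) auto
      thus ?thesis unfolding e[symmetric] by (simp add: scale_left_diff_distrib)
    qed
    thus ?thesis using J(2,3) by blast
  qed
  thus ?thesis using that[OF y] by (simp add: n_def)
qed

text \<open>The ideal is \<open>H z + P H\<close>. Norms are constant on classes modulo
  \<open>P H\<close> up to \<open>P\<close>, so every element of it has norm in \<open>P\<close> and
  1 is excluded.\<close>

lemma isotropic_left_ideal:
  assumes P: "O_prime P" and z: "z \<in> H" "z \<notin> PH P" "nrd s z \<in> P"
  obtains J where "left_ideal J" "PH P \<subseteq> J" "J \<noteq> PH P" "J \<noteq> H" "z \<in> J"
proof -
  note D = O_primeD[OF P] and ID = O_idealD[OF O_primeD(1)[OF P]]
  define J where "J = {h * z + w | h w. h \<in> H \<and> w \<in> PH P}"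
  have JI: "h * z + w \<in> J" if "h \<in> H" "w \<in> PH P" for h w using that unfolding J_def by blast
  have JE: "\<exists>h w. x = h * z + w \<and> h \<in> H \<and> w \<in> PH P" if "x \<in> J" for x using that unfolding J_def by blast
  have li: "left_ideal J"
    unfolding left_ideal_def
  proof (intro conjI ballI subsetI)
    fix x assume "x \<in> J"
    then obtain h w where x: "x = h * z + w" "h \<in> H" "w \<in> PH P" using JE by blast
    show "x \<in> H" using x z PH_sub[OF D(1)] by (auto intro: H_add H_mult)
    fix g assume g: "g \<in> H"
    have "g * x = (g * h) * z + g * w" by (simp add: x distrib_left mult.assoc)
    thus "g * x \<in> J" using x g PH_lmult[OF D(1)] by (auto intro!: JI H_mult)
  next
    show "0 \<in> J" using JI[OF H_0 PH_0] by simp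
    fix x y assume "x \<in> J" "y \<in> J"
    then obtain h w h' w' where "x = h * z + w" "h \<in> H" "w \<in> PH P" "y = h' * z + w'" "h' \<in> H" "w' \<in> PH P"
      using JE by metis
    moreover from this have "x + y = (h + h') * z + (w + w')" by (simp add: distrib_right)
    ultimately show "x + y \<in> J" using JI H_add PH_add by metis
  qed
  have sub: "PH P \<subseteq> J" using JI[OF H_0] by auto
  have zJ: "z \<in> J" using JI[OF H_1 PH_0] by simp
  have "1 \<notin> J"
  proof
    assume "1 \<in> J"
    then obtain h w where x: "1 = h * z + w" "h \<in> H" "w \<in> PH P" using JE by blast
    have "nrd s (h * z + w) - nrd s (h * z) \<in> P" using x z by (intro nrd_PH_add[OF D(1)] H_mult)
    moreover have "nrd s (h * z) \<in> P" unfolding nrd_mult using x z nrd_integral by (intro ID(5))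
    ultimately have "nrd s (h * z + w) - nrd s (h * z) + nrd s (h * z) \<in> P" by (rule ID(4))
    thus False using x(1) D(2) by simp
  qed
  hence "J \<noteq> H" using H_1 by blast
  moreover have "J \<noteq> PH P" using zJ z by blast
  ultimately show ?thesis using li sub zJ by (intro that)
qed

lemma prime_generator:
  assumes P: "O_prime (P :: 'k set)"
  obtains \<pi> where "P = O_mul \<pi>" "algebraic_int \<pi>" "totally_positive \<pi>"
proof -
  obtain z where z: "z \<in> H" "z \<notin> PH P" "nrd s z \<in> P" using ex_isotropic[OF P] by blast
  obtain J where J: "left_ideal J" "PH P \<subseteq> J" "J \<noteq> PH P" "J \<noteq> H" by (rule isotropic_left_ideal[OF P z])
  obtain y where y: "y \<in> H" "y \<noteq> 0" "P = O_mul (nrd s y)" by (rule intermediate_left_ideal[OF P J])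
  show ?thesis
    by (rule that[OF y(3)]) (use y nrd_integral nrd_totally_positive in auto)
qed

section \<open>Prime elements and factorization of integers\<close>

definition prime_el :: "'k \<Rightarrow> bool" where
  "prime_el \<pi> \<longleftrightarrow> algebraic_int \<pi> \<and> totally_positive \<pi> \<and> O_prime (O_mul \<pi>)"

lemma prime_el_nonzero: "prime_el \<pi> \<Longrightarrow> \<pi> \<noteq> 0"
  using totally_positive_nonzero by (auto simp: prime_el_def)

text \<open>Dividing out a totally positive generator of a prime that contains \<open>x\<close>
  lowers the absolute norm, so the induction ends at units. It takes the place of unique
  factorization.\<close>

lemma integer_induct [consumes 2, case_names unit mult]:
  assumes x: "algebraic_int x" "x \<noteq> 0" and U: "\<And>u. unit_OK u \<Longrightarrow> Q u"
    and M: "\<And>\<pi> y. prime_el \<pi> \<Longrightarrow> algebraic_int y \<Longrightarrow> y \<noteq> 0 \<Longrightarrow> Q y \<Longrightarrow> Q (\<pi> * y)"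
  shows "Q x"
  using x
proof (induction "ideal_norm (O_mul x)" arbitrary: x rule: less_induct)
  case less
  show ?case
  proof (cases "unit_OK x")
    case False
    obtain P where P: "O_prime P" "x \<in> P" using ex_prime_containing[OF nf less(2,3) False] by blast
    obtain \<pi> where \<pi>: "P = O_mul \<pi>" "algebraic_int \<pi>" "totally_positive \<pi>" by (rule prime_generator[OF P(1)])
    have pe: "prime_el \<pi>" using \<pi> P by (simp add: prime_el_def)
    obtain y where y: "algebraic_int y" "x = \<pi> * y" using P(2) unfolding \<pi>(1) O_mul_def by auto
    have y0: "y \<noteq> 0" and p0: "\<pi> \<noteq> 0" using y less(3) by auto
    have "ideal_norm (O_mul \<pi>) > 1"
      using O_primeD(1,2)[OF P(1)] \<pi> p0 by (intro ideal_norm_gt_1[OF nf _ O_mul_self]) auto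
    moreover have "ideal_norm (O_mul y) > 0"
    proof -
      have "res (O_mul y) 0 \<in> res (O_mul y) ` Oring" by auto
      hence "card (res (O_mul y) ` Oring) > 0"
        using finite_res[OF nf O_ideal_O_mul[OF y(1)] O_mul_self y0] by (auto simp: card_gt_0_iff)
      thus ?thesis by (simp add: ideal_norm_res[OF O_ideal_O_mul[OF y(1)]])
    qed
    ultimately have "ideal_norm (O_mul y) < ideal_norm (O_mul x)"
      unfolding y(2) ideal_norm_mult[OF nf \<pi>(2) p0 y(1) y0] by simp
    hence "Q y" using less(1) y y0 by blast
    thus ?thesis unfolding y(2) using M pe y y0 by blast
  qed (rule U)
qed

lemma unit_totally_positive_factor:
  assumes "x \<noteq> (0::'k)" "algebraic_int x"
  shows "\<exists>u y. unit_OK u \<and> totally_positive y \<and> x = u * y"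
  using assms(2,1)
proof (induction rule: integer_induct)
  case (unit u)
  have "totally_positive (1::'k)" by (simp add: totally_positive_def emb_1)
  thus ?case using unit by (intro exI[of _ u] exI[of _ 1]) simp
next
  case (mult \<pi> y)
  then obtain u z where uz: "unit_OK u" "totally_positive z" "y = u * z" by blast
  have "totally_positive (\<pi> * z)" using mult(1) uz(2) unfolding prime_el_def totally_positive_def
    by (simp add: emb_mult)
  thus ?case using uz by (intro exI[of _ u] exI[of _ "\<pi> * z"]) (simp add: algebra_simps)
qed

lemma totally_positive_unit_is_square:
  "unit_OK u \<Longrightarrow> totally_positive u \<Longrightarrow> \<exists>v::'k. unit_OK v \<and> u = v * v"
  by (rule totally_positive_unit_square[OF nf tr unit_totally_positive_factor])

end

subsection \<open>Residues of the order at a prime\<close>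

locale prime_in_order = class_one_order s H
  for s :: "'k::field_char_0 \<Rightarrow> 'a::ring_1 \<Rightarrow> 'a" and H :: "'a set" +
  fixes P :: "'k set"
  assumes P: "O_prime P"
begin

lemmas PD = O_primeD[OF P]
lemmas PI = O_idealD[OF O_primeD(1)[OF P]]

section \<open>Left ideals over a prime\<close>

text \<open>These are the maximal left ideals over \<open>P\<close>: all have generators whose norms
  generate \<open>P\<close>, so no member properly contains another
  (\<open>Zs_minimal\<close>).\<close>

definition Zs :: "'a set set" where
  "Zs = {J. left_ideal J \<and> PH P \<subseteq> J \<and> J \<noteq> PH P \<and> J \<noteq> H}"

lemma ZsD:
  assumes "J \<in> Zs"
  shows "left_ideal J" "PH P \<subseteq> J" "J \<noteq> PH P" "J \<noteq> H" "1 \<notin> J" "x \<in> PH P \<Longrightarrow> x \<in> J"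
proof -
  show 1: "left_ideal J" "PH P \<subseteq> J" "J \<noteq> PH P" "J \<noteq> H" "x \<in> PH P \<Longrightarrow> x \<in> J" using assms by (auto simp: Zs_def)
  show "1 \<notin> J"
  proof
    assume one: "1 \<in> J"
    have "H \<subseteq> J" using left_idealD(4)[OF 1(1) _ one] by auto
    thus False using 1(4) left_idealD(1)[OF 1(1)] by blast
  qed
qed

lemma Zs_generator:
  assumes "J \<in> Zs"
  obtains y where "y \<in> H" "y \<noteq> 0" "J = lmul y" "P = O_mul (nrd s y)"
  using intermediate_left_ideal[OF P ZsD(1-4)[OF assms]] .

lemma Zs_nrd: assumes "J \<in> Zs" "x \<in> J" shows "nrd s x \<in> P"
proof -
  obtain y where y: "y \<in> H" "J = lmul y" "P = O_mul (nrd s y)" using Zs_generator[OF assms(1)] by metis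
  obtain h where h: "h \<in> H" "x = h * y" using assms(2) unfolding y(2) lmul_def by blast
  show ?thesis unfolding h(2) y(3) nrd_mult
    using O_mulI[OF nrd_integral[OF h(1)], of "nrd s y"] by (simp add: mult.commute)
qed

lemma PH_principal_nrd:
  assumes "y \<in> H" "P = O_mul (nrd s y)" shows "PH P = s (nrd s y) ` H"
  using PH_principal[OF nrd_integral[OF assms(1)]] assms(2) by simp

lemma lmul_in_Zs: assumes y: "y \<in> H" "P = O_mul (nrd s y)" shows "lmul y \<in> Zs"
proof -
  have y0: "nrd s y \<noteq> 0" using PD(4) unfolding y(2) O_mul_def by auto
  have nP: "nrd s y \<in> P" using O_mul_self y(2) by blast
  have no: "\<not> nrd s h * nrd s y = 1" if "h \<in> H" for h
  proof
    assume "nrd s h * nrd s y = 1"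
    moreover have "nrd s h * nrd s y \<in> P" using nP nrd_integral[OF that] by (intro PI(5))
    ultimately show False using PD(2) by simp
  qed
  have "PH P \<subseteq> lmul y"
  proof
    fix x assume "x \<in> PH P"
    then obtain h where h: "h \<in> H" "x = s (nrd s y) h" unfolding PH_principal_nrd[OF y] by blast
    have "x = (h * cj y) * y" by (simp add: h mult.assoc cj_mult_self scale_mult_right)
    thus "x \<in> lmul y" unfolding lmul_def using H_mult[OF h(1) H_cj[OF y(1)]] by blast
  qed
  moreover have "lmul y \<noteq> PH P"
  proof
    assume "lmul y = PH P"
    hence "y \<in> s (nrd s y) ` H" using lmul_self PH_principal_nrd[OF y] by blast
    then obtain h where h: "h \<in> H" "y = s (nrd s y) h" by blast
    have "nrd s y = nrd s y * nrd s y * nrd s h" using arg_cong[OF h(2), of "nrd s"] by (simp add: nrd_scale)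
    hence "nrd s h * nrd s y = 1" using y0 by (simp add: mult.commute)
    thus False using no[OF h(1)] by blast
  qed
  moreover have "lmul y \<noteq> H"
  proof
    assume "lmul y = H"
    then obtain h where h: "h \<in> H" "1 = h * y" using H_1 unfolding lmul_def by blast
    have "nrd s h * nrd s y = 1" using arg_cong[OF h(2), of "nrd s"] by (simp add: nrd_mult)
    thus False using no[OF h(1)] by blast
  qed
  ultimately show ?thesis unfolding Zs_def using left_ideal_lmul[OF y(1)] by blast
qed

text \<open>If \<open>y = h * y'\<close> and both norms generate the same ideal, then
  \<open>nrd s h\<close> is a unit of the ring of integers and \<open>h\<close> is invertible in
  \<open>H\<close>.\<close>

lemma Zs_minimal:
  assumes J: "J \<in> Zs" "J' \<in> Zs" "J \<subseteq> J'" shows "J = J'"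
proof -
  obtain y where y: "y \<in> H" "y \<noteq> 0" "J = lmul y" "P = O_mul (nrd s y)" by (rule Zs_generator[OF J(1)])
  obtain y' where y': "y' \<in> H" "y' \<noteq> 0" "J' = lmul y'" "P = O_mul (nrd s y')" by (rule Zs_generator[OF J(2)])
  have "y \<in> lmul y'" using J(3) y(3) y'(3) lmul_self by blast
  then obtain h where h: "h \<in> H" "y = h * y'" unfolding lmul_def by blast
  have nz: "nrd s y \<noteq> 0" "nrd s y' \<noteq> 0" using y(2) y'(2) by (auto simp: nrd_eq_0_iff)
  have "O_mul (nrd s y') = O_mul (nrd s y)" using y(4) y'(4) by simp
  hence "unit_OK (nrd s y / nrd s y')"
    using nz nrd_integral y(1) y'(1) by (simp add: O_mul_eq_iff)
  moreover have "nrd s y / nrd s y' = nrd s h" using nz(2) by (simp add: h(2) nrd_mult)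
  ultimately have "lmul y = lmul y'" using lmul_unit[OF h(1)] h(2) by simp
  thus ?thesis using y y' by simp
qed

text \<open>Otherwise \<open>J \<inter> J'\<close> would itself be strictly between
  \<open>P H\<close> and \<open>H\<close>, and minimality would identify it with both.\<close>

lemma Zs_eqI:
  assumes J: "J \<in> Zs" "J' \<in> Zs" and z: "z \<in> J" "z \<in> J'" "z \<notin> PH P" shows "J = J'"
proof -
  have "left_ideal (J \<inter> J')"
    using ZsD(1)[OF J(1)] ZsD(1)[OF J(2)] unfolding left_ideal_def by (simp add: le_infI1)
  moreover have "PH P \<subseteq> J \<inter> J'" using ZsD(2) J by (simp add: Int_greatest)
  moreover have "J \<inter> J' \<noteq> PH P" "J \<inter> J' \<noteq> H" using z ZsD(5)[OF J(1)] H_1 by auto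
  ultimately have "J \<inter> J' \<in> Zs" by (simp add: Zs_def)
  thus ?thesis using Zs_minimal[of "J \<inter> J'"] J by (metis Int_lower1 Int_lower2)
qed

lemma Zs_exists:
  assumes "z \<in> H" "z \<notin> PH P" "nrd s z \<in> P" obtains J where "J \<in> Zs" "z \<in> J"
proof -
  obtain J where "left_ideal J" "PH P \<subseteq> J" "J \<noteq> PH P" "J \<noteq> H" "z \<in> J" by (rule isotropic_left_ideal[OF P assms])
  thus ?thesis using that by (auto simp: Zs_def)
qed

lemma Zs_nonempty: "Zs \<noteq> {}"
  using ex_isotropic[OF P] Zs_exists by (metis empty_iff)

lemma Zs_cancel_scale:
  assumes J: "J \<in> Zs" and c: "algebraic_int c" "c \<notin> P" and x: "x \<in> H" "s c x \<in> J" shows "x \<in> J"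
proof -
  obtain r where r: "algebraic_int r" "1 - r * c \<in> P" using prime_inverse_mod[OF nf P c] .
  have "s (1 - r * c) x + s r (s c x) \<in> J"
    by (intro left_idealD(3,5)[OF ZsD(1)[OF J]] ZsD(6)[OF J] PH_base r x)
  thus ?thesis by (simp add: scale_left_diff_distrib)
qed

section \<open>Matrix units modulo \<open>P H\<close>\<close>

definition cg :: "'a \<Rightarrow> 'a \<Rightarrow> bool" where "cg x y \<longleftrightarrow> x - y \<in> PH P"

lemma cg_refl [simp]: "cg x x" by (simp add: cg_def PH_0)

lemma cg_sym: "cg x y \<Longrightarrow> cg y x" using PH_minus[of "x - y" P] by (simp add: cg_def)

lemma cg_trans [trans]: "cg x y \<Longrightarrow> cg y z \<Longrightarrow> cg x z" using PH_add[of "x - y" P "y - z"] by (simp add: cg_def)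

lemma cg_add: "cg x y \<Longrightarrow> cg z w \<Longrightarrow> cg (x + z) (y + w)"
  using PH_add[of "x - y" P "z - w"] by (simp add: cg_def algebra_simps)

lemma cg_diff: "cg x y \<Longrightarrow> cg z w \<Longrightarrow> cg (x - z) (y - w)"
  using PH_diff[of "x - y" P "z - w"] by (simp add: cg_def algebra_simps)

lemma cg_lmult: "cg x y \<Longrightarrow> g \<in> H \<Longrightarrow> cg (g * x) (g * y)"
  using PH_lmult[OF PD(1), of "x - y" g] by (simp add: cg_def right_diff_distrib)

lemma cg_rmult: "cg x y \<Longrightarrow> g \<in> H \<Longrightarrow> cg (x * g) (y * g)"
  using PH_rmult[OF PD(1), of "x - y" g] by (simp add: cg_def left_diff_distrib)

lemma cg_scale: "cg x y \<Longrightarrow> algebraic_int r \<Longrightarrow> cg (s r x) (s r y)"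
  using PH_scale[OF PD(1), of "x - y" r] by (simp add: cg_def scale_right_diff_distrib)

lemma cg_scale_left: "a - b \<in> P \<Longrightarrow> x \<in> H \<Longrightarrow> cg (s a x) (s b x)"
  using PH_base[of "a - b" P x] by (simp add: cg_def scale_left_diff_distrib)

lemma cg_trd: "cg x y \<Longrightarrow> trd s x - trd s y \<in> P"
  using trd_PH[OF PD(1), of "x - y"] by (simp add: cg_def trd_diff)

lemma cg_0: "cg x 0 \<longleftrightarrow> x \<in> PH P" by (simp add: cg_def)

lemma cg_mem_Zs: "cg x y \<Longrightarrow> J \<in> Zs \<Longrightarrow> x \<in> J \<longleftrightarrow> y \<in> J"
proof -
  assume c: "cg x y" and J: "J \<in> Zs"
  note L = left_idealD[OF ZsD(1)[OF J]]
  have d: "x - y \<in> J" using c ZsD(6)[OF J] by (simp add: cg_def)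
  show ?thesis using L(3)[OF d, of y] L(7)[OF _ d, of x] by auto
qed

text \<open>
  \<open>munits e u v\<close>: modulo \<open>P H\<close> the elements \<open>e, u, v, 1 - e\<close> multiply like the matrix units
  \<open>E\<^sub>1\<^sub>1, E\<^sub>1\<^sub>2, E\<^sub>2\<^sub>1, E\<^sub>2\<^sub>2\<close>.
\<close>

definition munits :: "'a \<Rightarrow> 'a \<Rightarrow> 'a \<Rightarrow> bool" where
  "munits e u v \<longleftrightarrow> e \<in> H \<and> u \<in> H \<and> v \<in> H \<and> cg (e * e) e \<and> cg (e * u) u \<and> cg (u * e) 0 \<and>
     cg (v * e) v \<and> cg (e * v) 0 \<and> cg (u * v) e \<and> cg (v * u) (1 - e) \<and> trd s e - 1 \<in> P"

text \<open>For \<open>x = e * w * e\<close> the element \<open>e * x\<close> is congruent to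
  \<open>x\<close>, while \<open>e * cj x\<close> contains the factor \<open>e * cj e\<close>, a
  scalar in \<open>P\<close>. Adding the two gives \<open>trd s x\<close> times \<open>e\<close>, so
  the corner is one-dimensional.\<close>

lemma idempotent_corner:
  assumes e: "e \<in> H" "cg (e * e) e" "nrd s e \<in> P" and w: "w \<in> H"
  shows "cg (e * w * e) (s (trd s (e * w * e)) e)"
proof -
  define x where "x = e * w * e"
  have x: "x \<in> H" unfolding x_def using e w H_mult by blast
  have "e * (x + cj x) = s (trd s x) e" by (simp add: add_cj scalar_mult)
  moreover have "cg (e * x) x" unfolding x_def mult.assoc[symmetric]
    using e w H_mult by (intro cg_rmult) auto
  moreover have "cg (e * cj x) 0"
  proof -
    have "e * cj x = (e * cj e) * (cj w * cj e)" by (simp add: x_def cj_mult mult.assoc)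
    also have "\<dots> = s (nrd s e) (cj w * cj e)" by (simp add: mult_cj scalar_mult)
    also have "cg \<dots> 0" unfolding cg_0 using e w H_cj H_mult by (intro PH_base) auto
    finally show ?thesis .
  qed
  ultimately have "cg (s (trd s x) e) x" using cg_add[of "e * x" x "e * cj x" 0] by (simp add: distrib_left)
  thus ?thesis unfolding x_def by (rule cg_sym)
qed

context
  fixes J J' :: "'a set"
  assumes J: "J \<in> Zs" "J' \<in> Zs" "J \<noteq> J'"
begin

text \<open>The sum of two different members is all of \<open>H\<close>, so \<open>1 = e + f\<close>
  with one summand in each. These commute, their product lies in both ideals and hence in
  \<open>P H\<close>; so \<open>e\<close> is idempotent modulo \<open>P H\<close>.\<close>

lemma split_idempotent:
  obtains e where "e \<in> J" "1 - e \<in> J'" "e \<in> H" "cg (e * e) e" "nrd s e \<in> P" "trd s e - 1 \<in> P"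
    "e \<notin> PH P" "1 - e \<notin> PH P"
proof -
  note L = left_idealD[OF ZsD(1)[OF J(1)]] and L' = left_idealD[OF ZsD(1)[OF J(2)]]
  define S where "S = {x + y | x y. x \<in> J \<and> y \<in> J'}"
  have SI: "x + y \<in> S" if "x \<in> J" "y \<in> J'" for x y using that unfolding S_def by blast
  have JS: "J \<subseteq> S" using SI[OF _ L'(2)] by auto
  have JS': "J' \<subseteq> S" using SI[OF L(2)] by auto
  have li: "left_ideal S"
    unfolding left_ideal_def
  proof (intro conjI ballI subsetI)
    fix z assume "z \<in> S"
    then obtain x y where z: "z = x + y" "x \<in> J" "y \<in> J'" unfolding S_def by blast
    show "z \<in> H" using z L(1) L'(1) H_add by blast
    show "h * z \<in> S" if "h \<in> H" for h unfolding z distrib_left using z that L(4) L'(4) SI by blast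
    fix z' assume "z' \<in> S"
    then obtain x' y' where z': "z' = x' + y'" "x' \<in> J" "y' \<in> J'" unfolding S_def by blast
    have "z + z' = (x + x') + (y + y')" by (simp add: z z')
    thus "z + z' \<in> S" using z z' L(3) L'(3) SI by metis
  qed (use SI[OF L(2) L'(2)] in simp)
  have "S = H"
  proof (rule ccontr)
    assume "S \<noteq> H"
    moreover have "S \<noteq> PH P" using JS ZsD(2,3)[OF J(1)] by blast
    ultimately have S: "S \<in> Zs" unfolding Zs_def using li JS ZsD(2)[OF J(1)] by blast
    hence "J = S" "J' = S" using Zs_minimal J JS JS' by blast+
    thus False using J(3) by simp
  qed
  then obtain e f where ef: "1 = e + f" "e \<in> J" "f \<in> J'" using H_1 unfolding S_def by blast
  have f: "f = 1 - e" unfolding ef(1) by simp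
  have eH: "e \<in> H" using ef L(1) by blast
  have common: "z \<in> PH P" if "z \<in> J" "z \<in> J'" for z using Zs_eqI[OF J(1,2) that] J(3) by blast
  have e1: "e \<notin> PH P"
  proof
    assume "e \<in> PH P"
    hence "e + f \<in> J'" using ef(3) ZsD(6)[OF J(2)] L'(3) by blast
    thus False using ef(1) ZsD(5)[OF J(2)] by simp
  qed
  have f1: "f \<notin> PH P"
  proof
    assume "f \<in> PH P"
    hence "e + f \<in> J" using ef(2) ZsD(6)[OF J(1)] L(3) by blast
    thus False using ef(1) ZsD(5)[OF J(1)] by simp
  qed
  have eq: "e * f = f * e" unfolding f by (simp add: algebra_simps)
  have "e * f \<in> J'" using eH ef(3) by (rule L'(4))
  moreover have "e * f \<in> J" unfolding eq using ef L'(1) by (intro L(4)) auto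
  ultimately have "e * f \<in> PH P" using common by blast
  hence ee: "cg (e * e) e" using PH_minus[of "e * f" P] by (simp add: f cg_def algebra_simps)
  have n: "nrd s e \<in> P" using Zs_nrd[OF J(1) ef(2)] .
  \<comment> \<open>Comparing idempotency with \<open>e * e = s (trd s e) e - s (nrd s e) 1\<close>
    shows that \<open>trd s e - 1\<close> annihilates \<open>e\<close> modulo
    \<open>P H\<close>.\<close>
  have t: "trd s e - 1 \<in> P"
  proof (rule ccontr)
    assume nt: "trd s e - 1 \<notin> P"
    have "e * e - e + s (nrd s e) 1 \<in> PH P" using ee PH_base[OF n H_1] by (intro PH_add) (simp_all add: cg_def)
    hence "s (trd s e - 1) e \<in> PH P" by (simp add: self_mult scale_left_diff_distrib)
    thus False using PH_cancel_scale[OF P _ nt eH] e1 trd_integral[OF eH]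
      by (simp add: algebraic_int_diff int_imp_algebraic_int)
  qed
  show ?thesis using that[of e] ef eH ee n t e1 f1 unfolding f by blast
qed

text \<open>The radical \<open>R\<close> is a two-sided ideal. If it met \<open>J\<close> or
  \<open>J'\<close> outside \<open>P H\<close>, it would be a member of \<open>Zs\<close> and equal
  to that ideal, which contains an element of trace 1 modulo \<open>P\<close>. So both
  \<open>x * e\<close> and \<open>x * (1 - e)\<close> lie in \<open>P H\<close>.\<close>

lemma trace_form_nondegenerate:
  assumes x: "x \<in> H" "\<And>h. h \<in> H \<Longrightarrow> trd s (x * h) \<in> P" shows "x \<in> PH P"
proof -
  note L = left_idealD[OF ZsD(1)[OF J(1)]] and L' = left_idealD[OF ZsD(1)[OF J(2)]]
  obtain e where e: "e \<in> J" "1 - e \<in> J'" "e \<in> H" "trd s e - 1 \<in> P" using split_idempotent by metis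
  define R where "R = {x \<in> H. \<forall>h\<in>H. trd s (x * h) \<in> P}"
  have li: "left_ideal R"
    unfolding left_ideal_def
  proof (intro conjI ballI)
    show "R \<subseteq> H" "0 \<in> R" using H_0 PI(3) by (auto simp: R_def)
    show "x + y \<in> R" if "x \<in> R" "y \<in> R" for x y
      using that H_add PI(4) by (auto simp: R_def distrib_right trd_add)
    show "g * x \<in> R" if "g \<in> H" "x \<in> R" for g x
    proof -
      have "trd s (g * x * h) = trd s (x * (h * g))" for h by (metis mult.assoc trd_mult_commute)
      thus ?thesis using that H_mult by (auto simp: R_def)
    qed
  qed
  have sub: "PH P \<subseteq> R" unfolding R_def using PH_sub[OF PD(1)] trd_PH[OF PD(1) PH_rmult[OF PD(1)]] by auto
  have tf: "trd s (1 - e) - 1 \<in> P" using PI(7)[OF e(4)] by (simp add: trd_diff)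
  have no: "w \<notin> R" if "trd s w - 1 \<in> P" for w
  proof
    assume "w \<in> R"
    hence "trd s (w * 1) \<in> P" using H_1 unfolding R_def by blast
    hence "trd s w \<in> P" by simp
    hence "trd s w - (trd s w - 1) \<in> P" using PI(8)[OF _ that] by blast
    thus False using PD(2) by simp
  qed
  have RH: "R \<noteq> H" using no e by blast
  have common: "z \<in> PH P" if "z \<in> R" "z \<in> K" "K \<in> Zs" "w \<in> K" "w \<notin> R" for z K w
  proof (rule ccontr)
    assume z: "z \<notin> PH P"
    have "R \<in> Zs" unfolding Zs_def using li sub RH that(1) z by blast
    thus False using Zs_eqI[OF _ that(3,1,2) z] that by blast
  qed
  have xR: "x \<in> R" using x by (simp add: R_def)
  have rm: "x * g \<in> R" if "g \<in> H" for g
    using xR that H_mult by (auto simp: R_def mult.assoc)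
  have "x * e \<in> PH P" using common[OF rm L(4) J(1) e(1) no] e x by blast
  moreover have "x * (1 - e) \<in> PH P" using common[OF rm L'(4) J(2) e(2) no[OF tf]] e x H_diff H_1 by blast
  ultimately have "x * e + x * (1 - e) \<in> PH P" by (rule PH_add)
  thus ?thesis by (simp add: algebra_simps)
qed

text \<open>In the Peirce decomposition by \<open>e\<close> and \<open>f = 1 - e\<close> the
  diagonal corners are multiples of \<open>e\<close> and \<open>f\<close>, so some off-diagonal
  corner is nonzero by dimension. Nondegeneracy of the trace pairs it with an element of the
  opposite corner, and the corner lemma identifies the two products.\<close>

lemma munits_exist: "\<exists>e u v. munits e u v \<and> e \<in> J"
proof -
  obtain e where e: "e \<in> J" "1 - e \<in> J'" "e \<in> H" "cg (e * e) e" "nrd s e \<in> P" "trd s e - 1 \<in> P"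
    using split_idempotent by metis
  define f where "f = 1 - e"
  have fH: "f \<in> H" unfolding f_def using e H_diff H_1 by blast
  have fe: "cg (f * e) 0" "cg (e * f) 0"
    using cg_sym[OF e(4)] unfolding f_def cg_def by (simp_all add: algebra_simps)
  have ff: "cg (f * f) f"
  proof -
    have "f * f = f - e * f" by (simp add: f_def algebra_simps)
    thus ?thesis using cg_diff[OF cg_refl[of f] fe(2)] by simp
  qed
  have fn: "nrd s f \<in> P" using Zs_nrd[OF J(2)] e(2) by (simp add: f_def)
  have build: "\<exists>u v. munits e u v" if w: "w \<in> H" "h \<in> H" "trd s (e * w * f * h) \<notin> P" for w h
  proof -
    define u0 where "u0 = e * w * f"
    define v where "v = f * h * e"
    have uH: "u0 \<in> H" and vH: "v \<in> H" unfolding u0_def v_def using e fH w H_mult by auto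
    define c where "c = trd s (u0 * v)"
    have c: "algebraic_int c" unfolding c_def using uH vH by (intro trd_integral H_mult)
    \<comment> \<open>Cyclicity of the trace and idempotency of \<open>e\<close> and
      \<open>f\<close> give \<open>c\<close> the residue of
      \<open>trd s (e * w * f * h)\<close>.\<close>
    have cP: "c \<notin> P"
    proof
      assume "c \<in> P"
      have "trd s (u0 * v) = trd s ((e * e) * (w * f * f * h))"
        unfolding u0_def v_def by (metis mult.assoc trd_mult_commute)
      moreover have "cg ((e * e) * (w * f * f * h)) (e * (w * f * f * h))"
        using e fH w H_mult by (intro cg_rmult) auto
      moreover have "cg (e * w * (f * f) * h) (e * w * f * h)"
        using ff e fH w H_mult by (intro cg_rmult cg_lmult) auto
      ultimately have "c - trd s (e * w * f * h) \<in> P"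
        using cg_trd[OF cg_trans] unfolding c_def by (metis mult.assoc)
      hence "c - (c - trd s (e * w * f * h)) \<in> P" by (rule PI(8)[OF \<open>c \<in> P\<close>])
      thus False using w(3) by simp
    qed
    \<comment> \<open>Scaling by \<open>r\<close> normalizes the trace of \<open>u * v\<close> to 1
      modulo \<open>P\<close>.\<close>
    obtain r where r: "algebraic_int r" "1 - r * c \<in> P" using prime_inverse_mod[OF nf P c cP] .
    define u where "u = s r u0"
    have uH': "u \<in> H" unfolding u_def using uH r by (intro H_scale)
    have eu0: "cg (e * u0) u0" unfolding u0_def mult.assoc[symmetric]
      using e fH w H_mult by (intro cg_rmult) auto
    have u0e: "cg (u0 * e) 0"
      using cg_lmult[OF fe(1), of "e * w"] e w H_mult unfolding u0_def by (simp add: mult.assoc)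
    have ve: "cg (v * e) v"
      using cg_lmult[OF e(4), of "f * h"] e fH w H_mult unfolding v_def by (simp add: mult.assoc)
    have ev: "cg (e * v) 0"
      using cg_rmult[OF fe(2), of "h * e"] e w H_mult unfolding v_def by (simp add: mult.assoc)
    have tuv: "1 - trd s (u * v) \<in> P" using r(2) by (simp add: u_def c_def scale_mult_left trd_scale)
    have uv: "cg (u * v) e"
    proof -
      have "u * v = e * s r (w * f * f * h) * e"
        by (simp add: u_def u0_def v_def scale_mult_left scale_mult_right mult.assoc)
      moreover have "s r (w * f * f * h) \<in> H" using r w fH H_mult H_scale by auto
      ultimately have "cg (u * v) (s (trd s (u * v)) e)" using idempotent_corner[OF e(3,4,5)] by simp
      also have "cg \<dots> (s 1 e)" using PI(7)[OF tuv] e(3) by (intro cg_scale_left) auto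
      finally show ?thesis by simp
    qed
    have vu: "cg (v * u) f"
    proof -
      have "v * u = f * s r (h * e * e * w) * f"
        by (simp add: u_def u0_def v_def scale_mult_left scale_mult_right mult.assoc)
      moreover have "s r (h * e * e * w) \<in> H" using r w e H_mult H_scale by auto
      ultimately have "cg (v * u) (s (trd s (v * u)) f)" using idempotent_corner[OF fH ff fn] by simp
      also have "cg \<dots> (s 1 f)" using PI(7)[OF tuv] fH trd_mult_commute[of u v] by (intro cg_scale_left) auto
      finally show ?thesis by simp
    qed
    have "cg (e * u) u" using cg_scale[OF eu0 r(1)] by (simp add: u_def scale_mult_right)
    moreover have "cg (u * e) 0" using cg_scale[OF u0e r(1)] by (simp add: u_def scale_mult_left)
    ultimately have "munits e u v" unfolding munits_def using e uH' vH ve ev uv vu by (simp add: f_def)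
    thus ?thesis by blast
  qed
  obtain w where w: "w \<in> H" "\<And>a b. algebraic_int a \<Longrightarrow> algebraic_int b \<Longrightarrow> w - (s a e + s b f) \<notin> PH P"
    using ex_not_in_residue_plane[OF P, of e f] by metis
  have "e * w * f \<notin> PH P \<or> f * w * e \<notin> PH P"
  proof (rule ccontr)
    assume "\<not> ?thesis"
    hence "cg (e * w * f) 0" "cg (f * w * e) 0" by (simp_all add: cg_0)
    moreover have "cg (e * w * e) (s (trd s (e * w * e)) e)" by (rule idempotent_corner[OF e(3,4,5) w(1)])
    moreover have "cg (f * w * f) (s (trd s (f * w * f)) f)" by (rule idempotent_corner[OF fH ff fn w(1)])
    ultimately have "cg ((e * w * f + f * w * e) + (e * w * e + f * w * f))
      ((0 + 0) + (s (trd s (e * w * e)) e + s (trd s (f * w * f)) f))" by (intro cg_add)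
    moreover have "(e * w * f + f * w * e) + (e * w * e + f * w * f) = w" by (simp add: f_def algebra_simps)
    ultimately have "w - (s (trd s (e * w * e)) e + s (trd s (f * w * f)) f) \<in> PH P" by (simp add: cg_def)
    moreover have "algebraic_int (trd s (e * w * e))" "algebraic_int (trd s (f * w * f))"
      using e fH w H_mult trd_integral by auto
    ultimately show False using w(2) by blast
  qed
  thus ?thesis
  proof
    assume a: "e * w * f \<notin> PH P"
    have "e * w * f \<in> H" by (intro H_mult fH w(1) e(3))
    then obtain h where h: "h \<in> H" "trd s (e * w * f * h) \<notin> P" using trace_form_nondegenerate a by metis
    from build[OF w(1) h] obtain u v where "munits e u v" by (elim exE)
    thus ?thesis using e(1) by (intro exI conjI)
  next
    assume a: "f * w * e \<notin> PH P"
    have "f * w * e \<in> H" by (intro H_mult fH w(1) e(3))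
    then obtain h where h: "h \<in> H" "trd s (f * w * e * h) \<notin> P" using trace_form_nondegenerate a by metis
    \<comment> \<open>Cyclicity of the trace reduces the opposite corner to the first case with
      \<open>w\<close> and \<open>h\<close> exchanged.\<close>
    have t: "trd s (f * w * e * h) = trd s (e * h * f * w)" by (metis mult.assoc trd_mult_commute)
    from build[OF h(1) w(1) h(2)[unfolded t]] obtain u v where "munits e u v" by (elim exE)
    thus ?thesis using e(1) by (intro exI conjI)
  qed
qed

end

context
  fixes e u v
  assumes M: "munits e u v"
begin

lemma mH: "e \<in> H" "u \<in> H" "v \<in> H" "1 - e \<in> H"
  and mm: "cg (e * e) e" "cg (e * u) u" "cg (u * e) 0" "cg (v * e) v" "cg (e * v) 0" "cg (u * v) e" "cg (v * u) (1 - e)"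
  and trd_e: "trd s e - 1 \<in> P"
  using M H_1 H_diff unfolding munits_def by blast+

lemma nrd_e: "nrd s e \<in> P"
proof -
  have "cg (s (trd s e) e - s (nrd s e) 1) (s 1 e)" using mm(1) by (simp add: self_mult)
  moreover have "cg (s (trd s e) e) (s 1 e)" using trd_e mH by (intro cg_scale_left)
  ultimately have "cg (s (trd s e) e - (s (trd s e) e - s (nrd s e) 1)) (s 1 e - s 1 e)" by (intro cg_diff)
  hence "s (nrd s e) 1 \<in> PH P" by (simp add: cg_0)
  thus ?thesis by (rule PH_scalarD[OF P])
qed

lemma trd_e_notin: "trd s e \<notin> P"
proof
  assume "trd s e \<in> P"
  hence "trd s e - (trd s e - 1) \<in> P" using PI(8)[OF _ trd_e] by blast
  thus False using PD(2) by simp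
qed

lemma e_notin: "e \<notin> PH P" using trd_PH[OF PD(1)] trd_e_notin by blast

lemma mm_more: "cg (u * u) 0" "cg (v * v) 0" "cg (u * (1 - e)) u" "cg ((1 - e) * u) 0"
  "cg ((1 - e) * v) v" "cg (v * (1 - e)) 0" "cg (e * (1 - e)) 0" "cg ((1 - e) * e) 0" "cg ((1 - e) * (1 - e)) (1 - e)"
proof -
  have "cg (u * u) (u * (e * u))" using cg_sym[OF mm(2)] mH by (intro cg_lmult)
  also have "u * (e * u) = (u * e) * u" by (simp add: mult.assoc)
  also have "cg \<dots> (0 * u)" using mm(3) mH by (intro cg_rmult)
  finally show "cg (u * u) 0" by simp
  have "cg (v * v) ((v * e) * v)" using cg_sym[OF mm(4)] mH by (intro cg_rmult)
  also have "(v * e) * v = v * (e * v)" by (simp add: mult.assoc)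
  also have "cg \<dots> (v * 0)" using mm(5) mH by (intro cg_lmult)
  finally show "cg (v * v) 0" by simp
  show "cg (u * (1 - e)) u" using cg_diff[OF cg_refl[of u] mm(3)] by (simp add: algebra_simps)
  show "cg ((1 - e) * u) 0" using cg_diff[OF cg_refl[of u] mm(2)] by (simp add: algebra_simps)
  show "cg ((1 - e) * v) v" using cg_diff[OF cg_refl[of v] mm(5)] by (simp add: algebra_simps)
  show "cg (v * (1 - e)) 0" using cg_diff[OF cg_refl[of v] mm(4)] by (simp add: algebra_simps)
  show a: "cg (e * (1 - e)) 0" using cg_diff[OF cg_refl[of e] mm(1)] by (simp add: algebra_simps)
  show b: "cg ((1 - e) * e) 0" using cg_diff[OF cg_refl[of e] mm(1)] by (simp add: algebra_simps)
  show "cg ((1 - e) * (1 - e)) (1 - e)" using cg_diff[OF cg_refl[of "1 - e"] a] by (simp add: algebra_simps)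
qed

lemma trd_u: "trd s u \<in> P" and trd_v: "trd s v \<in> P"
proof -
  have a: "trd s (u * e) \<in> P" "trd s (e * v) \<in> P" using cg_trd[OF mm(3)] cg_trd[OF mm(5)] by auto
  have "trd s (e * u) - trd s u \<in> P" "trd s (v * e) - trd s v \<in> P" by (rule cg_trd[OF mm(2)], rule cg_trd[OF mm(4)])
  hence "trd s (u * e) - (trd s (e * u) - trd s u) \<in> P" "trd s (e * v) - (trd s (v * e) - trd s v) \<in> P"
    using a PI(8) by blast+
  thus "trd s u \<in> P" "trd s v \<in> P" using trd_mult_commute[of e] by simp_all
qed

lemma nrd_1_minus_e: "nrd s (1 - e) \<in> P"
proof -
  have "nrd s (1 - e) = nrd s e - (trd s e - 1)"
    using nrd_add[of 1 "- e"] by (simp add: cj_minus trd_minus)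
  thus ?thesis using nrd_e trd_e PI(8) by simp
qed

lemma nrd_u: "nrd s u \<in> P"
proof -
  have "cg (s (trd s u) u) 0" unfolding cg_0 using trd_u mH by (intro PH_base)
  hence "cg (s (trd s u) u - u * u) (0 - 0)" using mm_more(1) by (intro cg_diff)
  hence "s (nrd s u) 1 \<in> PH P" by (simp add: self_mult cg_0)
  thus ?thesis by (rule PH_scalarD[OF P])
qed

lemma u_notin: "u \<notin> PH P"
proof
  assume "u \<in> PH P"
  hence "u * v \<in> PH P" using mH by (intro PH_rmult[OF PD(1)])
  hence "cg 0 (u * v)" by (simp add: cg_sym cg_0)
  hence "cg 0 e" using mm(6) by (rule cg_trans)
  thus False using e_notin by (simp add: cg_0[symmetric] cg_sym)
qed

text \<open>Each Peirce component is reduced to a corner at \<open>e\<close> or at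
  \<open>1 - e\<close>. For the off-diagonal ones, \<open>v * u\<close> is inserted in place of
  \<open>1 - e\<close>, which turns them into a corner at \<open>e\<close> times \<open>u\<close> or
  \<open>v\<close>.\<close>

lemma munits_span:
  assumes w: "w \<in> H"
  obtains \<alpha> \<beta> \<gamma> \<delta> where "algebraic_int \<alpha>" "algebraic_int \<beta>" "algebraic_int \<gamma>" "algebraic_int \<delta>"
    "cg w (s \<alpha> e + s \<beta> u + s \<gamma> v + s \<delta> (1 - e))"
proof -
  define f where "f = 1 - e"
  have fH: "f \<in> H" using mH by (simp add: f_def)
  note mf = mm_more[folded f_def]
  define \<alpha> where "\<alpha> = trd s (e * w * e)"
  define \<delta> where "\<delta> = trd s (f * w * f)"
  define \<beta> where "\<beta> = trd s (e * (w * f * v) * e)"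
  define \<gamma> where "\<gamma> = trd s (e * (u * f * w) * e)"
  have a: "cg (e * w * e) (s \<alpha> e)" unfolding \<alpha>_def by (rule idempotent_corner[OF mH(1) mm(1) nrd_e w])
  have d: "cg (f * w * f) (s \<delta> f)" unfolding \<delta>_def
    using idempotent_corner[OF fH mf(9) _ w] nrd_1_minus_e by (simp add: f_def)
  have b: "cg (e * w * f) (s \<beta> u)"
  proof -
    have "cg (e * w * f) (e * w * (f * f))" using mf(9) mH fH w H_mult by (intro cg_lmult cg_sym[OF mf(9)])
    also have "cg (e * w * (f * f)) (e * w * (f * (v * u)))"
      using cg_sym[OF mm(7)] mH fH w H_mult unfolding f_def[symmetric] by (intro cg_lmult) auto
    also have "e * w * (f * (v * u)) = (e * (w * f)) * v * u" by (simp add: mult.assoc)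
    also have "cg \<dots> ((e * (w * f)) * (v * e) * u)"
      using cg_sym[OF mm(4)] mH fH w H_mult by (intro cg_rmult[OF cg_lmult]) auto
    also have "(e * (w * f)) * (v * e) * u = (e * (w * f * v) * e) * u" by (simp add: mult.assoc)
    also have "cg \<dots> (s \<beta> e * u)" unfolding \<beta>_def
      using mH fH w H_mult by (intro cg_rmult idempotent_corner[OF mH(1) mm(1) nrd_e]) auto
    also have "s \<beta> e * u = s \<beta> (e * u)" by (simp add: scale_mult_left)
    also have "cg \<dots> (s \<beta> u)" unfolding \<beta>_def using mH fH w H_mult by (intro cg_scale mm trd_integral) auto
    finally show ?thesis .
  qed
  have c: "cg (f * w * e) (s \<gamma> v)"
  proof -
    have "cg (f * w * e) ((f * f) * (w * e))"
      using cg_rmult[OF cg_sym[OF mf(9)], of "w * e"] mH w H_mult by (simp add: mult.assoc)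
    also have "cg \<dots> ((v * u * f) * (w * e))"
      using cg_sym[OF mm(7)] mH fH w H_mult unfolding f_def[symmetric] by (intro cg_rmult) auto
    also have "(v * u * f) * (w * e) = v * (u * f * w * e)" by (simp add: mult.assoc)
    also have "cg \<dots> ((v * e) * (u * f * w * e))"
      using cg_sym[OF mm(4)] mH fH w H_mult by (intro cg_rmult) auto
    also have "(v * e) * (u * f * w * e) = v * (e * (u * f * w) * e)" by (simp add: mult.assoc)
    also have "cg \<dots> (v * s \<gamma> e)" unfolding \<gamma>_def
      using mH fH w H_mult by (intro cg_lmult idempotent_corner[OF mH(1) mm(1) nrd_e]) auto
    also have "v * s \<gamma> e = s \<gamma> (v * e)" by (simp add: scale_mult_right)
    also have "cg \<dots> (s \<gamma> v)" unfolding \<gamma>_def using mH fH w H_mult by (intro cg_scale mm trd_integral) auto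
    finally show ?thesis .
  qed
  have "w = e * w * e + e * w * f + f * w * e + f * w * f" by (simp add: f_def algebra_simps)
  also have "cg \<dots> (s \<alpha> e + s \<beta> u + s \<gamma> v + s \<delta> f)" using a b c d by (intro cg_add)
  finally have "cg w (s \<alpha> e + s \<beta> u + s \<gamma> v + s \<delta> f)" .
  moreover have "algebraic_int \<alpha>" "algebraic_int \<beta>" "algebraic_int \<gamma>" "algebraic_int \<delta>"
    unfolding \<alpha>_def \<beta>_def \<gamma>_def \<delta>_def using mH fH w H_mult trd_integral by auto
  ultimately show ?thesis using that by (simp add: f_def)
qed

end

end

subsection \<open>The number of maximal left ideals over a prime, and the discriminant\<close>

lemma O_ideal_sum: "O_ideal I \<Longrightarrow> (\<And>i. i \<in> S \<Longrightarrow> f i \<in> I) \<Longrightarrow> sum f S \<in> I"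
  by (induction S rule: infinite_finite_induct) (simp_all add: O_idealD(3,4))

text \<open>Replacing row \<open>i0\<close> by the combination with coefficients \<open>c\<close>
  multiplies the determinant by \<open>c i0\<close> and makes that row vanish modulo
  \<open>I\<close>.\<close>

lemma det_congruent_0:
  fixes A :: "'k::field_char_0^'n^'n"
  assumes I: "O_ideal I" and A: "\<And>i j. algebraic_int (A $ i $ j)"
    and c: "\<And>j. (\<Sum>i\<in>UNIV. c i * A $ i $ j) \<in> I"
  shows "c i0 * det A \<in> I"
proof -
  define x where "x = (\<Sum>i\<in>UNIV - {i0}. c i *s row i A)"
  define B where "B = (\<chi> k. if k = i0 then c i0 *s row i0 A else row k A)"
  have rB: "row i0 B = c i0 *s row i0 A" "j \<noteq> i0 \<Longrightarrow> row j B = row j A" for j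
    by (simp_all add: B_def row_def vec_eq_iff)
  have "det B = c i0 * det (\<chi> k. if k = i0 then row i0 A else row k A)" unfolding B_def by (rule det_row_mul)
  also have "(\<chi> k. if k = i0 then row i0 A else row k A) = A" by (simp add: vec_eq_iff row_def)
  finally have dB: "det B = c i0 * det A" .
  have "x \<in> vec.span {row j B | j. j \<noteq> i0}"
    unfolding x_def
  proof (intro vec.span_sum vec.span_scale vec.span_base)
    fix j assume "j \<in> UNIV - {i0}"
    thus "row j A \<in> {row j B | j. j \<noteq> i0}" using rB(2)[of j] by (intro CollectI exI[of _ j]) simp
  qed
  from det_row_span[OF this]
  have dC: "det (\<chi> k. if k = i0 then row i0 B + x else row k B) = det B" .
  define C where "C = (\<chi> k. if k = i0 then row i0 B + x else row k B)"
  have C0: "C $ i0 $ j \<in> I" for j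
  proof -
    have "C $ i0 $ j = c i0 * A $ i0 $ j + (\<Sum>i\<in>UNIV - {i0}. c i * A $ i $ j)"
      unfolding C_def rB x_def by (simp add: row_def)
    also have "\<dots> = (\<Sum>i\<in>UNIV. c i * A $ i $ j)" by (simp add: sum.remove[of UNIV i0])
    finally show ?thesis using c by simp
  qed
  have Ci: "algebraic_int (C $ i $ j)" if "i \<noteq> i0" for i j
    using A[of i j] that by (simp add: C_def B_def row_def)
  have "det C \<in> I"
    unfolding det_def
  proof -
    have "of_int (sign p) * (\<Prod>i\<in>UNIV. C $ i $ p i) \<in> I" for p
    proof -
      have "(\<Prod>i\<in>UNIV. C $ i $ p i) = C $ i0 $ p i0 * (\<Prod>i\<in>UNIV - {i0}. C $ i $ p i)"
        by (simp add: prod.remove[of UNIV i0])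
      moreover have "algebraic_int (\<Prod>i\<in>UNIV - {i0}. C $ i $ p i)"
        using Ci by (intro algebraic_int_prod) auto
      ultimately have "(\<Prod>i\<in>UNIV. C $ i $ p i) \<in> I" using O_idealD(6)[OF I] C0 by metis
      thus ?thesis using O_idealD(5)[OF I] by (simp add: int_imp_algebraic_int)
    qed
    thus "(\<Sum>p | p permutes UNIV. of_int (sign p) * (\<Prod>i\<in>UNIV. C $ i $ p i)) \<in> I" by (intro O_ideal_sum[OF I])
  qed
  thus ?thesis using dC dB by (simp add: C_def)
qed

lemma det_congruent:
  fixes A B :: "'k::field_char_0^'n^'n"
  assumes I: "O_ideal I" and A: "\<And>i j. algebraic_int (A $ i $ j)" and B: "\<And>i j. algebraic_int (B $ i $ j)"
    and AB: "\<And>i j. A $ i $ j - B $ i $ j \<in> I"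
  shows "det A - det B \<in> I"
proof -
  have pr: "(\<Prod>i\<in>S. A $ i $ p i) - (\<Prod>i\<in>S. B $ i $ p i) \<in> I" for S :: "'n set" and p
  proof (induction S rule: infinite_finite_induct)
    case (insert i S)
    have "A $ i $ p i * ((\<Prod>i\<in>S. A $ i $ p i) - (\<Prod>i\<in>S. B $ i $ p i))
       + (A $ i $ p i - B $ i $ p i) * (\<Prod>i\<in>S. B $ i $ p i) \<in> I"
      using insert.IH A B AB
      by (intro O_idealD(4)[OF I] O_idealD(5)[OF I A] O_idealD(6)[OF I _ AB] algebraic_int_prod) auto
    thus ?case using insert.hyps by (simp add: algebra_simps)
  qed (use O_idealD(3)[OF I] in auto)
  have "of_int (sign p) * ((\<Prod>i\<in>UNIV. A $ i $ p i) - (\<Prod>i\<in>UNIV. B $ i $ p i)) \<in> I" for p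
    using pr by (intro O_idealD(5)[OF I]) (auto simp: int_imp_algebraic_int)
  hence "(\<Sum>p | p permutes UNIV. of_int (sign p) * ((\<Prod>i\<in>UNIV. A $ i $ p i) - (\<Prod>i\<in>UNIV. B $ i $ p i))) \<in> I"
    by (intro O_ideal_sum[OF I])
  thus ?thesis by (simp add: det_def right_diff_distrib sum_subtractf)
qed

lemma det_integral:
  fixes A :: "'k::field_char_0^'n^'n"
  assumes "\<And>i j. algebraic_int (A $ i $ j)" shows "algebraic_int (det A)"
  unfolding det_def using assms
  by (intro algebraic_int_sum algebraic_int_add_mult algebraic_int_prod) (auto simp: int_imp_algebraic_int)

lemma (in quaternion_algebra) ex_linear_relation:
  fixes x :: "'i::finite \<Rightarrow> 'a"
  assumes "CARD('i) > 4"
  shows "\<exists>c. (\<exists>i. c i \<noteq> 0) \<and> (\<Sum>i\<in>UNIV. s (c i) (x i)) = 0"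
proof (cases "inj x")
  case True
  have f: "finite (range x)" by simp
  have "card (range x) = CARD('i)" using True by (rule card_image)
  hence "dependent (range x)" using independent_card_le_4[of "range x"] assms by auto
  then obtain u where u: "\<exists>v\<in>range x. u v \<noteq> 0" "(\<Sum>v\<in>range x. s (u v) v) = 0"
    unfolding dependent_finite[OF f] by blast
  have "(\<Sum>i\<in>UNIV. s (u (x i)) (x i)) = 0" using u(2) by (simp add: sum.reindex[OF True])
  thus ?thesis using u(1) by (intro exI[of _ "\<lambda>i. u (x i)"]) auto
next
  case False
  then obtain i j where ij: "x i = x j" "i \<noteq> j" unfolding inj_def by blast
  have "(\<Sum>k\<in>UNIV. s (if k = i then 1 else if k = j then - 1 else 0) (x k))
     = (\<Sum>k\<in>UNIV. (if k = i then x i else 0)) - (\<Sum>k\<in>UNIV. (if k = j then x j else 0))"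
    unfolding sum_subtractf[symmetric] using ij by (intro sum.cong) auto
  also have "\<dots> = 0" using ij by simp
  finally show ?thesis using ij by (intro exI[of _ "\<lambda>k. if k = i then 1 else if k = j then - 1 else 0"]) auto
qed

lemma ideal_norm_pos:
  assumes nf: "number_field TYPE('k::field_char_0)" and I: "O_ideal I" and m: "m \<in> I" "m \<noteq> (0::'k)"
  shows "ideal_norm I > 0"
proof -
  have "res I 0 \<in> res I ` Oring" by auto
  thus ?thesis using finite_res[OF nf I m] by (auto simp: card_gt_0_iff ideal_norm_res[OF I])
qed

context prime_in_order
begin

section \<open>Primitive relations and the discriminant\<close>

text \<open>As long as all coefficients lie in \<open>P\<close>, its generator can be divided out;
  the absolute norm of the nonzero coefficient \<open>c i0\<close> decreases each time.\<close>

lemma ex_primitive_multiple: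
  assumes c: "\<And>i. algebraic_int (c i)" "c i0 \<noteq> (0::'k)"
  shows "\<exists>t. \<exists>d. (\<forall>i. algebraic_int (d i) \<and> c i = t * d i) \<and> (\<exists>i. d i \<notin> P)"
  using c
proof (induction "ideal_norm (O_mul (c i0))" arbitrary: c rule: less_induct)
  case less
  show ?case
  proof (cases "\<exists>i. c i \<notin> P")
    case True
    thus ?thesis using less(2) by (intro exI[of _ 1] exI[of _ c]) auto
  next
    case False
    obtain \<pi> where \<pi>: "P = O_mul \<pi>" "algebraic_int \<pi>" "totally_positive \<pi>" by (rule prime_generator[OF P])
    have p0: "\<pi> \<noteq> 0" using \<pi>(3) totally_positive_nonzero by blast
    have "\<forall>i. \<exists>d. algebraic_int d \<and> c i = \<pi> * d" using False unfolding \<pi>(1) O_mul_def by auto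
    then obtain d where d: "\<And>i. algebraic_int (d i)" "\<And>i. c i = \<pi> * d i" by metis
    have d0: "d i0 \<noteq> 0" using less(3) d(2)[of i0] by auto
    have "ideal_norm (O_mul \<pi>) > 1"
      using PD(1,2) \<pi> p0 by (intro ideal_norm_gt_1[OF nf _ O_mul_self]) auto
    moreover have "ideal_norm (O_mul (d i0)) > 0"
      by (rule ideal_norm_pos[OF nf O_ideal_O_mul[OF d(1)] O_mul_self d0])
    ultimately have "ideal_norm (O_mul (d i0)) < ideal_norm (O_mul (c i0))"
      unfolding d(2)[of i0] ideal_norm_mult[OF nf \<pi>(2) p0 d(1) d0] by simp
    from less(1)[of d, OF this d(1) d0] obtain t e where te: "\<And>i. algebraic_int (e i)" "\<And>i. d i = t * e i" "\<exists>i. e i \<notin> P"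
      by blast
    show ?thesis using te d(2) by (intro exI[of _ "\<pi> * t"] exI[of _ e]) (auto simp: mult.assoc)
  qed
qed

text \<open>Clearing denominators makes a linear relation integral, and removing common factors from
  \<open>P\<close> keeps it nontrivial modulo \<open>P\<close>.\<close>

lemma ex_primitive_relation:
  fixes x :: "'i::finite \<Rightarrow> 'a"
  assumes "CARD('i) > 4"
  shows "\<exists>c. (\<forall>i. algebraic_int (c i)) \<and> (\<exists>i. c i \<notin> P) \<and> (\<Sum>i\<in>UNIV. s (c i) (x i)) = 0"
proof -
  obtain c i0 where c: "c i0 \<noteq> 0" "(\<Sum>i\<in>UNIV. s (c i) (x i)) = 0"
    using ex_linear_relation[OF assms, of x] by blast
  have "\<forall>i. \<exists>N>0. algebraic_int (of_nat N * c i)" using ex_integer_multiple[OF nf] by blast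
  then obtain N where N: "\<And>i. N i > 0" "\<And>i. algebraic_int (of_nat (N i) * c i)" by metis
  define M where "M = (\<Prod>i\<in>UNIV. of_nat (N i) :: 'k)"
  have M0: "M \<noteq> 0" unfolding M_def using N(1) by (simp add: not_gr0[symmetric])
  have Mi: "algebraic_int (M * c i)" for i
  proof -
    have "M * c i = (\<Prod>j\<in>UNIV - {i}. of_nat (N j)) * (of_nat (N i) * c i)"
      unfolding M_def by (simp add: prod.remove[of UNIV i] mult_ac)
    moreover have "algebraic_int (\<Prod>j\<in>UNIV - {i}. of_nat (N j) :: 'k)"
      by (intro algebraic_int_prod int_imp_algebraic_int) auto
    ultimately show ?thesis using N(2) algebraic_int_add_mult(2) by metis
  qed
  have Mc0: "M * c i0 \<noteq> 0" using M0 c by simp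
  obtain t d where td: "\<forall>i. algebraic_int (d i) \<and> M * c i = t * d i" "\<exists>i. d i \<notin> P"
    using ex_primitive_multiple[of "\<lambda>i. M * c i", OF Mi Mc0] by blast
  have t0: "t \<noteq> 0" using td(1) Mc0 by (metis mult_zero_left)
  have "s t (\<Sum>i\<in>UNIV. s (d i) (x i)) = (\<Sum>i\<in>UNIV. s (M * c i) (x i))"
    using td(1) by (simp add: scale_sum_right)
  also have "\<dots> = s M (\<Sum>i\<in>UNIV. s (c i) (x i))" by (simp add: scale_sum_right)
  also have "\<dots> = 0" using c(2) by simp
  finally have "(\<Sum>i\<in>UNIV. s (d i) (x i)) = 0" using t0 by simp
  thus ?thesis using td by blast
qed

lemma disc_subset_iff: "disc s H \<subseteq> P \<longleftrightarrow> (\<forall>e :: 4 \<Rightarrow> 'a. range e \<subseteq> H \<longrightarrow> det (\<chi> m n. trd s (e m * e n)) \<in> P)"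
proof -
  interpret ring "OK :: 'k ring" using cring_OK by (rule cring.axioms)
  have ip: "ideal P OK" using PD(1) O_ideal_iff by blast
  define S where "S = {det (\<chi> m n. trd s (e m * e n)) | e :: 4 \<Rightarrow> 'a. range e \<subseteq> H}"
  have "S \<subseteq> carrier OK"
  proof
    fix x assume "x \<in> S"
    then obtain e :: "4 \<Rightarrow> 'a" where e: "range e \<subseteq> H" "x = det (\<chi> m n. trd s (e m * e n))" unfolding S_def by blast
    have "e m \<in> H" for m using e(1) by auto
    hence "algebraic_int x" unfolding e(2) by (intro det_integral) (simp add: trd_integral H_mult)
    thus "x \<in> carrier OK" by simp
  qed
  hence "S \<subseteq> disc s H" unfolding disc_def S_def[symmetric] by (rule genideal_self)
  moreover have "S \<subseteq> P \<Longrightarrow> disc s H \<subseteq> P" unfolding disc_def S_def[symmetric] using ip by (rule genideal_minimal)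
  ultimately have "disc s H \<subseteq> P \<longleftrightarrow> S \<subseteq> P" by blast
  thus ?thesis unfolding S_def by blast
qed

text \<open>The Gram matrix of the matrix units for the trace form is congruent to a permutation
  matrix of order 2, whose determinant squares to 1.\<close>

lemma munits_disc:
  assumes M: "munits e u v" shows "\<not> disc s H \<subseteq> P"
proof
  assume sub: "disc s H \<subseteq> P"
  note mH = mH[OF M] and mm = mm[OF M] mm_more[OF M]
  define f where "f = 1 - e"
  note mH = mH[folded f_def] and mm = mm[folded f_def]
  define b :: "4 \<Rightarrow> 'a" where "b m = (if m = 1 then e else if m = 2 then u else if m = 3 then v else f)" for m
  define A :: "'k^4^4" where "A = (\<chi> m n. trd s (b m * b n))"
  \<comment> \<open>For matrix units the trace of E_ij E_kl is 1 exactly if j = k and i = l: the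
    diagonal units pair with themselves, the second and third basis elements with each
    other.\<close>
  define B :: "'k^4^4" where "B = (\<chi> m n. if m = n then (if m = 1 \<or> m = 4 then 1 else 0)
     else if (m = 2 \<and> n = 3) \<or> (m = 3 \<and> n = 2) then 1 else 0)"
  have bH: "b m \<in> H" for m using mH by (simp add: b_def)
  have "range b \<subseteq> H" using bH by blast
  hence dA: "det A \<in> P" using sub unfolding disc_subset_iff A_def by blast
  have Ai: "algebraic_int (A $ m $ n)" for m n unfolding A_def using bH by (simp add: trd_integral H_mult)
  have Bi: "algebraic_int (B $ m $ n)" for m n unfolding B_def by simp
  have z: "trd s x \<in> P" if "cg x 0" for x using cg_trd[OF that] by simp
  have te: "trd s e - 1 \<in> P" by (rule trd_e[OF M])
  have tf: "trd s f - 1 \<in> P" using PI(7)[OF te] by (simp add: f_def trd_diff)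
  have one: "trd s x - 1 \<in> P" if "cg x y" "trd s y - 1 \<in> P" for x y
    using PI(4)[OF cg_trd[OF that(1)] that(2)] by simp
  have zero: "trd s x \<in> P" if "cg x y" "trd s y \<in> P" for x y
    using PI(4)[OF cg_trd[OF that(1)] that(2)] by simp
  note tu = trd_u[OF M] and tv = trd_v[OF M]
  have AB: "A $ m $ n - B $ m $ n \<in> P" for m n
    using exhaust_4[of m] exhaust_4[of n]
      one[OF mm(1) te] zero[OF mm(2) tu] zero[OF mm(5)] z[OF mm(14)] z[OF mm(3)] z[OF mm(8)] one[OF mm(6) te]
      zero[OF mm(10) tu] zero[OF mm(4) tv] one[OF mm(7) tf] z[OF mm(9)] z[OF mm(13)] z[OF mm(15)]
      z[OF mm(11)] zero[OF mm(12) tv] one[OF mm(16) tf] z[OF mm(5)]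
    by (elim disjE) (simp_all add: A_def B_def b_def)
  have dB: "det B \<in> P"
  proof -
    have "det A - det B \<in> P" by (rule det_congruent[OF PD(1) Ai Bi AB])
    hence "det A - (det A - det B) \<in> P" by (rule PI(8)[OF dA])
    thus ?thesis by simp
  qed
  have "B ** B = mat 1"
    by (simp add: vec_eq_iff matrix_matrix_mult_def mat_def sum_4 forall_4 B_def)
  hence "det B * det B = 1" by (metis det_mul det_I)
  moreover have "det B * det B \<in> P" using det_integral[OF Bi] dB by (intro PI(5))
  ultimately show False using PD(2) by simp
qed

text \<open>A single member contains every element with norm in \<open>P\<close>, which makes it a
  radical for the trace form modulo \<open>P\<close>. By dimension, some combination of any four
  given elements, primitive modulo \<open>P\<close>, falls into it; this makes the rows of their
  Gram matrix dependent modulo \<open>P\<close>.\<close>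

lemma single_Zs_disc:
  assumes Z: "Zs = {J}" shows "disc s H \<subseteq> P"
  unfolding disc_subset_iff
proof (intro allI impI)
  fix e :: "4 \<Rightarrow> 'a" assume "range e \<subseteq> H"
  hence e: "e m \<in> H" for m by auto
  have J: "J \<in> Zs" using Z by simp
  note L = left_idealD[OF ZsD(1)[OF J]]
  have mem: "x \<in> J" if x: "x \<in> H" "nrd s x \<in> P" for x
  proof (cases "x \<in> PH P")
    case False
    obtain J' where "J' \<in> Zs" "x \<in> J'" by (rule Zs_exists[OF x(1) False x(2)])
    thus ?thesis using Z by blast
  qed (rule ZsD(6)[OF J])
  \<comment> \<open>Both \<open>x * h\<close> and its conjugate have norm in \<open>P\<close> and
    lie in \<open>J\<close>; their sum is the scalar \<open>trd s (x * h)\<close>, whose norm is its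
    square.\<close>
  have rad: "trd s (x * h) \<in> P" if x: "x \<in> J" and h: "h \<in> H" for x h
  proof -
    have xH: "x \<in> H" using L(1) x by blast
    have n: "nrd s (x * h) \<in> P" unfolding nrd_mult using Zs_nrd[OF J x] nrd_integral[OF h] by (intro PI(6))
    have "x * h \<in> J" "cj (x * h) \<in> J" using xH h n by (intro mem H_cj H_mult; simp)+
    hence "x * h + cj (x * h) \<in> J" by (rule L(3))
    hence "nrd s (s (trd s (x * h)) 1) \<in> P" unfolding add_cj by (rule Zs_nrd[OF J])
    thus ?thesis unfolding nrd_scalar using PD(3) trd_integral[OF H_mult[OF xH h]] by blast
  qed
  obtain z where z: "z \<in> J" "z \<notin> PH P" using ZsD(2,3)[OF J] by blast
  have zH: "z \<in> H" using L(1) z by blast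
  \<comment> \<open>Five elements of a four-dimensional algebra: the index \<open>None\<close>
    carries an element of \<open>J\<close> outside \<open>P H\<close>, the others carry the given
    four.\<close>
  define x where "x i = (case i of None \<Rightarrow> z | Some m \<Rightarrow> e m)" for i
  have "CARD(4 option) > 4" by simp
  from ex_primitive_relation[OF this, of x] obtain c where c: "\<And>i. algebraic_int (c i)" "\<exists>i. c i \<notin> P"
    "(\<Sum>i\<in>UNIV. s (c i) (x i)) = 0" by blast
  define y where "y = (\<Sum>m\<in>UNIV. s (c (Some m)) (e m))"
  have zy: "s (c None) z + y = 0"
    using c(3) unfolding UNIV_option_conv y_def x_def by (simp add: sum.reindex)
  have yz: "y = - s (c None) z" using zy by (simp add: eq_neg_iff_add_eq_0 add.commute)
  have yJ: "y \<in> J" unfolding yz using z(1) c(1) by (intro L(5,6))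
  have "\<exists>m. c (Some m) \<notin> P"
  proof (rule ccontr)
    assume "\<not> ?thesis"
    hence cm: "c (Some m) \<in> P" for m by blast
    hence cN: "c None \<notin> P" using c(2) by (metis option.exhaust)
    have "(\<Sum>m\<in>S. s (c (Some m)) (e m)) \<in> PH P" for S
      by (induction S rule: infinite_finite_induct) (auto intro!: PH_0 PH_add PH_base cm e)
    hence "- y \<in> PH P" unfolding y_def by (intro PH_minus)
    hence "s (c None) z \<in> PH P" by (simp add: yz)
    thus False using PH_cancel_scale[OF P c(1) cN zH] z(2) by blast
  qed
  then obtain m where m: "c (Some m) \<notin> P" by blast
  define A :: "'k^4^4" where "A = (\<chi> m n. trd s (e m * e n))"
  have Ai: "algebraic_int (A $ m $ n)" for m n unfolding A_def using e by (simp add: trd_integral H_mult)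
  have "c (Some m) * det A \<in> P"
  proof (rule det_congruent_0[OF PD(1) Ai])
    fix n
    have "(\<Sum>i\<in>UNIV. c (Some i) * A $ i $ n) = trd s (y * e n)"
      by (simp add: A_def y_def sum_distrib_right trd_sum scale_mult_left trd_scale)
    thus "(\<Sum>i\<in>UNIV. c (Some i) * A $ i $ n) \<in> P" using rad[OF yJ e] by simp
  qed
  hence "det A \<in> P" using PD(3) c(1) det_integral[OF Ai] m by blast
  thus "det (\<chi> m n. trd s (e m * e n)) \<in> P" by (simp add: A_def)
qed

definition Zof :: "'a \<Rightarrow> 'a set" where "Zof z = (THE J. J \<in> Zs \<and> z \<in> J)"

lemma Zof:
  assumes "z \<in> H" "z \<notin> PH P" "nrd s z \<in> P"
  shows "Zof z \<in> Zs" "z \<in> Zof z" "J \<in> Zs \<Longrightarrow> z \<in> J \<Longrightarrow> J = Zof z"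
proof -
  obtain J0 where J0: "J0 \<in> Zs" "z \<in> J0" by (rule Zs_exists[OF assms])
  have un: "J = J0" if "J \<in> Zs" "z \<in> J" for J using Zs_eqI[OF that(1) J0(1) that(2) J0(2) assms(2)] .
  have "Zof z = J0" unfolding Zof_def
  proof (rule the_equality)
    show "J0 \<in> Zs \<and> z \<in> J0" using J0 by simp
    show "J = J0" if "J \<in> Zs \<and> z \<in> J" for J using un that by simp
  qed
  thus "Zof z \<in> Zs" "z \<in> Zof z" using J0 by simp_all
  show "J = Zof z" if "J \<in> Zs" "z \<in> J" using un[OF that] \<open>Zof z = J0\<close> by simp
qed

text \<open>The members of \<open>Zs\<close> correspond to the points \<open>(1 : a)\<close> and \<open>(0 : 1)\<close> of the projective line.\<close>

lemma card_Zs: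
  assumes M: "munits e u v" shows "card Zs = ideal_norm P + 1" "finite Zs"
proof -
  note mH = mH[OF M] and mm = mm[OF M] and mm' = mm_more[OF M]
  define R where "R = res P ` Oring"
  obtain m where m: "m \<in> P" "m \<noteq> 0" using PD(4) by blast
  have fR: "finite R" unfolding R_def by (rule finite_res[OF nf PD(1) m])
  have Ri: "algebraic_int a" "res P a = a" if "a \<in> R" for a
    using that res(1)[OF PD(1)] res_res[OF PD(1)] unfolding R_def by auto
  \<comment> \<open>As matrices modulo \<open>P\<close>, \<open>z a\<close> has first row
    \<open>(1, a)\<close>, \<open>u\<close> has first row \<open>(0, 1)\<close>, and their second
    rows vanish.\<close>
  define z where "z a = e + s a u" for a
  have zH: "z a \<in> H" if "algebraic_int a" for a unfolding z_def using mH that by (intro H_add H_scale)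
  have zn: "nrd s (z a) \<in> P" if a: "algebraic_int a" for a
  proof -
    have "trd s (e * cj u) = trd s u * trd s e - trd s (u * e)"
      by (simp add: cj_eq right_diff_distrib scalar_mult trd_diff trd_scale trd_mult_commute[of e u])
    moreover have "trd s u * trd s e \<in> P" using trd_u[OF M] trd_integral mH by (intro PI(6))
    moreover have "trd s (u * e) \<in> P" using cg_trd[OF mm(3)] by simp
    ultimately have "trd s (e * cj u) \<in> P" using PI(8) by simp
    hence "nrd s e + a * a * nrd s u + a * trd s (e * cj u) \<in> P"
      using nrd_e[OF M] nrd_u[OF M] a by (intro PI(4,5)) (auto simp: algebraic_int_add_mult)
    thus ?thesis by (simp add: z_def nrd_add nrd_scale cj_scale scale_mult_right trd_scale)
  qed
  have zP: "z a \<notin> PH P" if a: "algebraic_int a" for a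
  proof
    assume "z a \<in> PH P"
    hence "z a * e \<in> PH P" using mH by (intro PH_rmult[OF PD(1)])
    hence "cg 0 (e * e + s a (u * e))" by (simp add: cg_sym cg_0 z_def distrib_right scale_mult_left)
    also have "cg \<dots> (e + s a 0)" using mm a by (intro cg_add cg_scale)
    finally have "cg 0 e" by simp
    thus False using e_notin[OF M] by (simp add: cg_0[symmetric] cg_sym)
  qed
  have Zz: "Zof (z a) \<in> Zs" "z a \<in> Zof (z a)" if a: "algebraic_int a" for a
    by (rule Zof[OF zH[OF a] zP[OF a] zn[OF a]])+
  have Zz3: "J = Zof (z a)" if a: "algebraic_int a" and J: "J \<in> Zs" "z a \<in> J" for a J
    by (rule Zof(3)[OF zH[OF a] zP[OF a] zn[OF a] J])
  note Zu = Zof[OF mH(2) u_notin[OF M] nrd_u[OF M]]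
  have notboth: False if J: "J \<in> Zs" and uJ: "u \<in> J" and eJ: "e \<in> J" for J
  proof -
    note L = left_idealD[OF ZsD(1)[OF J]]
    have "v * u \<in> J" using mH(3) uJ by (rule L(4))
    hence "1 - e \<in> J" using cg_mem_Zs[OF mm(7) J] by blast
    hence "1 - e + e \<in> J" using eJ by (rule L(3))
    thus False using ZsD(5)[OF J] by simp
  qed
  have diff: "b - a \<in> P" if J: "J \<in> Zs" and a: "algebraic_int a" "z a \<in> J" and b: "algebraic_int b" "z b \<in> J" for J a b
  proof (rule ccontr)
    note L = left_idealD[OF ZsD(1)[OF J]]
    assume n: "b - a \<notin> P"
    have "z b - z a \<in> J" using a b by (intro L(7))
    hence "s (b - a) u \<in> J" by (simp add: z_def scale_left_diff_distrib)
    hence uJ: "u \<in> J" using a b by (intro Zs_cancel_scale[OF J _ n mH(2)]) (auto simp: algebraic_int_diff)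
    have "z a - s a u \<in> J" using L(7)[OF a(2) L(5)[OF a(1) uJ]] .
    thus False using notboth[OF J uJ] by (simp add: z_def)
  qed
  have inj: "inj_on (\<lambda>a. Zof (z a)) R"
  proof (rule inj_onI)
    fix a b assume ab: "a \<in> R" "b \<in> R" "Zof (z a) = Zof (z b)"
    have "a - b \<in> P" using diff[OF Zz(1) Ri(1) _ Ri(1)] Zz(2) ab Ri(1) by metis
    hence "res P a = res P b" using ab Ri(1) by (subst res_eq_iff[OF PD(1)]) auto
    thus "a = b" using ab Ri(2) by simp
  qed
  have nin: "Zof u \<notin> (\<lambda>a. Zof (z a)) ` R"
  proof
    assume "Zof u \<in> (\<lambda>a. Zof (z a)) ` R"
    then obtain a where a: "a \<in> R" "Zof u = Zof (z a)" by blast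
    note L = left_idealD[OF ZsD(1)[OF Zu(1)]]
    have "z a - s a u \<in> Zof u" using L(7) L(5)[OF Ri(1)[OF a(1)] Zu(2)] Zz(2)[OF Ri(1)[OF a(1)]] a(2) by metis
    thus False using notboth[OF Zu(1) Zu(2)] by (simp add: z_def)
  qed
  have row: "J \<in> insert (Zof u) ((\<lambda>a. Zof (z a)) ` R)"
    if J: "J \<in> Zs" and ab: "algebraic_int \<alpha>" "algebraic_int \<beta>" "s \<alpha> e + s \<beta> u \<in> J" "\<alpha> \<notin> P \<or> \<beta> \<notin> P" for J \<alpha> \<beta>
  proof -
    note L = left_idealD[OF ZsD(1)[OF J]]
    show ?thesis
    proof (cases "\<alpha> \<in> P")
      case True
      hence "s \<alpha> e \<in> J" using mH by (intro ZsD(6)[OF J] PH_base)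
      hence "s \<alpha> e + s \<beta> u - s \<alpha> e \<in> J" using ab(3) by (intro L(7))
      hence "u \<in> J" using True ab by (intro Zs_cancel_scale[OF J ab(2) _ mH(2)]) auto
      hence "J = Zof u" by (rule Zu(3)[OF J])
      thus ?thesis by simp
    next
      case False
      obtain r where r: "algebraic_int r" "1 - r * \<alpha> \<in> P" using prime_inverse_mod[OF nf P ab(1) False] .
      define a where "a = res P (r * \<beta>)"
      have rb: "algebraic_int (r * \<beta>)" using r ab by (simp add: algebraic_int_add_mult)
      have a: "a \<in> R" "r * \<beta> - a \<in> P" unfolding a_def R_def using rb res(2)[OF PD(1) rb] by auto
      have "s r (s \<alpha> e + s \<beta> u) \<in> J" using L(5) r ab by blast
      hence "s (r * \<alpha>) e + s (r * \<beta>) u \<in> J" by (simp add: scale_right_distrib)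
      moreover have "cg (s (r * \<alpha>) e + s (r * \<beta>) u) (s 1 e + s a u)"
        using PI(7)[OF r(2)] a(2) mH by (intro cg_add cg_scale_left) auto
      ultimately have "z a \<in> J" using cg_mem_Zs[OF _ J] by (simp add: z_def)
      hence "J = Zof (z a)" by (rule Zz3[OF Ri(1)[OF a(1)] J])
      thus ?thesis using a(1) by blast
    qed
  qed
  have Zeq: "Zs = insert (Zof u) ((\<lambda>a. Zof (z a)) ` R)"
  proof
    show "insert (Zof u) ((\<lambda>a. Zof (z a)) ` R) \<subseteq> Zs" using Zu(1) Zz(1) Ri(1) by auto
    show "Zs \<subseteq> insert (Zof u) ((\<lambda>a. Zof (z a)) ` R)"
    proof
      fix J assume J: "J \<in> Zs"
      note L = left_idealD[OF ZsD(1)[OF J]]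
      obtain y where y: "y \<in> J" "y \<notin> PH P" using ZsD(2,3)[OF J] by blast
      have yH: "y \<in> H" using y L(1) by blast
      define f where "f = 1 - e"
      have fH: "f \<in> H" using mH by (simp add: f_def)
      obtain \<alpha> \<beta> \<gamma> \<delta> where i: "algebraic_int \<alpha>" "algebraic_int \<beta>" "algebraic_int \<gamma>" "algebraic_int \<delta>"
        and c: "cg y (s \<alpha> e + s \<beta> u + s \<gamma> v + s \<delta> f)"
        unfolding f_def by (rule munits_span[OF M yH])
      \<comment> \<open>Left multiplication by \<open>e\<close> isolates the first row of
        \<open>y\<close>; multiplication by \<open>u\<close>, used next, moves the second row into
        the first. One of the two is nonzero modulo \<open>P\<close> and determines the
        point.\<close>
      have ey: "s \<alpha> e + s \<beta> u \<in> J"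
      proof -
        have "cg (e * y) (e * (s \<alpha> e + s \<beta> u + s \<gamma> v + s \<delta> f))" using c mH(1) by (rule cg_lmult)
        also have "\<dots> = s \<alpha> (e * e) + s \<beta> (e * u) + s \<gamma> (e * v) + s \<delta> (e * f)"
          by (simp add: distrib_left scale_mult_right)
        also have "cg \<dots> (s \<alpha> e + s \<beta> u + s \<gamma> 0 + s \<delta> 0)"
          using mm mm' i unfolding f_def by (intro cg_add cg_scale)
        finally have "cg (e * y) (s \<alpha> e + s \<beta> u)" by simp
        thus ?thesis using cg_mem_Zs[OF _ J] L(4)[OF mH(1) y(1)] by blast
      qed
      have uy: "s \<gamma> e + s \<delta> u \<in> J"
      proof -
        have "cg (u * y) (u * (s \<alpha> e + s \<beta> u + s \<gamma> v + s \<delta> f))" using c mH(2) by (rule cg_lmult)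
        also have "\<dots> = s \<alpha> (u * e) + s \<beta> (u * u) + s \<gamma> (u * v) + s \<delta> (u * f)"
          by (simp add: distrib_left scale_mult_right)
        also have "cg \<dots> (s \<alpha> 0 + s \<beta> 0 + s \<gamma> e + s \<delta> u)"
          using mm mm' i unfolding f_def by (intro cg_add cg_scale)
        finally have "cg (u * y) (s \<gamma> e + s \<delta> u)" by simp
        thus ?thesis using cg_mem_Zs[OF _ J] L(4)[OF mH(2) y(1)] by blast
      qed
      have "\<alpha> \<notin> P \<or> \<beta> \<notin> P \<or> \<gamma> \<notin> P \<or> \<delta> \<notin> P"
      proof (rule ccontr)
        assume "\<not> ?thesis"
        hence "s \<alpha> e + s \<beta> u + s \<gamma> v + s \<delta> f \<in> PH P" using mH fH by (intro PH_add PH_base) auto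
        hence "cg y 0" by (intro cg_trans[OF c]) (simp only: cg_0)
        thus False using y(2) by (simp add: cg_0)
      qed
      thus "J \<in> insert (Zof u) ((\<lambda>a. Zof (z a)) ` R)" using row[OF J] ey uy i by metis
    qed
  qed
  show "finite Zs" unfolding Zeq using fR by simp
  have "card Zs = card R + 1" unfolding Zeq using fR nin by (simp add: card_image[OF inj])
  thus "card Zs = ideal_norm P + 1" by (simp add: ideal_norm_res[OF PD(1)] R_def)
qed

text \<open>A single member forces the discriminant into \<open>P\<close>; two members yield matrix
  units, which keep it outside and give the larger count.\<close>

lemma card_Zs_cases:
  shows "disc s H \<subseteq> P \<Longrightarrow> card Zs = 1"
    "\<not> disc s H \<subseteq> P \<Longrightarrow> card Zs = ideal_norm P + 1" "finite Zs"
proof -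
  obtain J where J: "J \<in> Zs" using Zs_nonempty by blast
  have *: "disc s H \<subseteq> P \<and> Zs = {J} \<or> \<not> disc s H \<subseteq> P \<and> (\<exists>e u v. munits e u v)"
  proof (cases "Zs = {J}")
    case True
    thus ?thesis using single_Zs_disc by blast
  next
    case False
    then obtain J' where "J' \<in> Zs" "J \<noteq> J'" using J by blast
    then obtain e u v where "munits e u v" using munits_exist[OF J] by metis
    thus ?thesis using munits_disc by blast
  qed
  show "disc s H \<subseteq> P \<Longrightarrow> card Zs = 1" using * by auto
  show "\<not> disc s H \<subseteq> P \<Longrightarrow> card Zs = ideal_norm P + 1" using * card_Zs(1) by metis
  show "finite Zs" using * card_Zs(2) by (metis finite.emptyI finite.insertI)
qed

end

subsection \<open>Divisor sums\<close>

text \<open>To contain is to divide when the divisor is principal: the cofactor is \<open>J\<close>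
  divided elementwise by \<open>d\<close>.\<close>

lemma ideal_dvd_principal:
  assumes d: "algebraic_int d" "d \<noteq> 0" and J: "O_ideal J"
  shows "ideal_dvd (O_mul d) J \<longleftrightarrow> J \<subseteq> O_mul d"
proof
  interpret ring "OK :: 'a ring" using cring_OK by (rule cring.axioms)
  show "ideal_dvd (O_mul d) J \<Longrightarrow> J \<subseteq> O_mul d"
    unfolding ideal_dvd_def using ideal_prod_inter O_ideal_O_mul[OF d(1)] O_ideal_iff by blast
  assume sub: "J \<subseteq> O_mul d"
  define L where "L = {x. algebraic_int x \<and> d * x \<in> J}"
  have "O_ideal L" unfolding O_ideal_def L_def
    using O_idealD[OF J] by (auto simp: distrib_left algebraic_int_add_mult mult.left_commute[of d])
  moreover have "J = ideal_prod OK (O_mul d) L"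
  proof
    show "J \<subseteq> ideal_prod OK (O_mul d) L"
    proof
      fix j assume j: "j \<in> J"
      then obtain x where x: "algebraic_int x" "j = d * x" using sub unfolding O_mul_def by auto
      have "x \<in> L" using x j by (simp add: L_def)
      from ideal_prod.prod[OF O_mul_self this, where R = OK]
      show "j \<in> ideal_prod OK (O_mul d) L" unfolding x(2) by simp
    qed
    show "ideal_prod OK (O_mul d) L \<subseteq> J"
    proof
      fix j assume "j \<in> ideal_prod OK (O_mul d) L"
      thus "j \<in> J"
      proof (induction rule: ideal_prod.induct)
        case (prod i l)
        then obtain r where r: "algebraic_int r" "i = d * r" unfolding O_mul_def by auto
        have "r * (d * l) \<in> J" using r(1) prod(2) O_idealD(5)[OF J] by (simp add: L_def)
        thus ?case by (simp add: r(2) mult_ac)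
      qed (simp add: O_idealD(4)[OF J])
    qed
  qed
  ultimately show "ideal_dvd (O_mul d) J" unfolding ideal_dvd_def O_ideal_iff by blast
qed

text \<open>The index set of \<open>ideal_sigma\<close> with divisibility replaced by membership.
  \<open>ideal_sigma_eq\<close> justifies this for nonzero integral \<alpha> once primes are
  principal.\<close>

definition Div :: "'k::field_char_0 set \<Rightarrow> 'k \<Rightarrow> 'k set set" where
  "Div E \<alpha> = {O_mul d | d. algebraic_int d \<and> \<alpha> \<in> O_mul d \<and> (\<forall>P. O_prime P \<and> E \<subseteq> P \<longrightarrow> d \<notin> P)}"

lemma DivE:
  assumes "I \<in> Div E \<alpha>"
  obtains d r where "I = O_mul d" "algebraic_int d" "algebraic_int r" "\<alpha> = d * r"
    "\<forall>P. O_prime P \<longrightarrow> E \<subseteq> P \<longrightarrow> d \<notin> P"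
proof -
  obtain d where d: "I = O_mul d" "algebraic_int d" "\<alpha> \<in> O_mul d" "\<forall>P. O_prime P \<and> E \<subseteq> P \<longrightarrow> d \<notin> P"
    using assms(1) unfolding Div_def by blast
  obtain r where "algebraic_int r" "\<alpha> = d * r" using d(3) unfolding O_mul_def by auto
  with d show ?thesis by (intro that[of d r]) simp_all
qed

lemma DivI:
  "algebraic_int d \<Longrightarrow> algebraic_int r \<Longrightarrow> \<alpha> = d * r \<Longrightarrow> (\<And>P. O_prime P \<Longrightarrow> E \<subseteq> P \<Longrightarrow> d \<notin> P) \<Longrightarrow> O_mul d \<in> Div E \<alpha>"
  unfolding Div_def using O_mulI by blast

lemma O_mul_mult: "O_mul (a * b) = (\<lambda>x. a * x) ` O_mul b"
  unfolding O_mul_def by (simp add: image_image mult.assoc)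

lemma mem_iff_O_mul_subset: "O_ideal P \<Longrightarrow> d \<in> P \<longleftrightarrow> O_mul d \<subseteq> P"
  using O_mul_minimal O_mul_self by blast

context class_one_order
begin

lemma prime_dvd_iff:
  assumes P: "O_prime (P :: 'k set)" and J: "O_ideal J" shows "ideal_dvd P J \<longleftrightarrow> J \<subseteq> P"
proof -
  obtain \<pi> where \<pi>: "P = O_mul \<pi>" "algebraic_int \<pi>" "totally_positive \<pi>" by (rule prime_generator[OF P])
  show ?thesis unfolding \<pi>(1) using \<pi> totally_positive_nonzero by (intro ideal_dvd_principal J) auto
qed

text \<open>In \<open>\<pi> = \<pi>' * r\<close> one factor lies in \<open>P\<close>. If it were
  \<open>r\<close>, then \<open>\<pi>'\<close> would be a unit; so \<open>\<pi>'\<close> lies in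
  \<open>P\<close>.\<close>

lemma prime_maximal:
  assumes P: "O_prime (P :: 'k set)" "O_prime P'" "P \<subseteq> P'" shows "P = P'"
proof -
  obtain \<pi>' where \<pi>': "P' = O_mul \<pi>'" "algebraic_int \<pi>'" "totally_positive \<pi>'" by (rule prime_generator[OF P(2)])
  obtain \<pi> where \<pi>: "P = O_mul \<pi>" "algebraic_int \<pi>" "totally_positive \<pi>" by (rule prime_generator[OF P(1)])
  have "\<pi> \<in> P'" using P(3) \<pi>(1) O_mul_self by blast
  then obtain r where r: "algebraic_int r" "\<pi> = \<pi>' * r" unfolding \<pi>'(1) O_mul_def by auto
  have "\<pi>' * r \<in> P" using r \<pi>(1) O_mul_self by metis
  hence "\<pi>' \<in> P \<or> r \<in> P" using O_primeD(3)[OF P(1)] \<pi>'(2) r(1) by blast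
  moreover have "r \<notin> P"
  proof
    assume "r \<in> P"
    then obtain t where t: "algebraic_int t" "r = \<pi> * t" unfolding \<pi>(1) O_mul_def by auto
    have "\<pi> * 1 = \<pi> * (\<pi>' * t)" using r(2) t(2) by (simp add: mult_ac)
    hence "1 = \<pi>' * t" using totally_positive_nonzero[OF \<pi>(3)] by simp
    hence "1 \<in> P'" using O_mulI[OF t(1), of \<pi>'] \<pi>'(1) by simp
    thus False using O_primeD(2)[OF P(2)] by blast
  qed
  ultimately have "P' \<subseteq> P" unfolding \<pi>'(1) using O_mul_minimal O_primeD(1)[OF P(1)] by blast
  thus ?thesis using P(3) by blast
qed

lemma ideal_sigma_eq:
  assumes a: "algebraic_int \<alpha>" "\<alpha> \<noteq> (0::'k)" and E: "O_ideal E"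
  shows "ideal_sigma E \<alpha> = (\<Sum>I\<in>Div E \<alpha>. ideal_norm I)"
proof -
  have pr: "(\<forall>P. prime_of_OK P \<and> ideal_dvd P E \<longrightarrow> \<not> ideal_dvd P (O_mul d)) \<longleftrightarrow> (\<forall>P. O_prime P \<and> E \<subseteq> P \<longrightarrow> d \<notin> P)"
    if d: "algebraic_int d" for d
    unfolding O_prime_iff[symmetric]
    using prime_dvd_iff[OF _ E] prime_dvd_iff[OF _ O_ideal_O_mul[OF d]] mem_iff_O_mul_subset O_primeD(1) by metis
  have dv: "ideal_dvd (O_mul d) (O_mul \<alpha>) \<longleftrightarrow> \<alpha> \<in> O_mul d" if d: "algebraic_int d" for d
  proof (cases "d = 0")
    case False
    show ?thesis unfolding ideal_dvd_principal[OF d False O_ideal_O_mul[OF a(1)]]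
      using mem_iff_O_mul_subset[OF O_ideal_O_mul[OF d]] by blast
  next
    \<comment> \<open>The description by containment requires \<open>d \<noteq> 0\<close>. For
      \<open>d = 0\<close> both sides fail, because \<alpha> is nonzero.\<close>
    case True
    interpret ring "OK :: 'k ring" using cring_OK by (rule cring.axioms)
    have z: "O_mul 0 = {0::'k}" unfolding O_mul_def by (auto intro!: image_eqI[of _ _ 0])
    have "\<not> ideal_dvd (O_mul d) (O_mul \<alpha>)"
    proof
      assume "ideal_dvd (O_mul d) (O_mul \<alpha>)"
      then obtain L where "ideal L OK" "O_mul \<alpha> = ideal_prod OK (O_mul d) L" unfolding ideal_dvd_def by blast
      hence "O_mul \<alpha> \<subseteq> O_mul d" using ideal_prod_inter O_ideal_O_mul[OF d] O_ideal_iff by blast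
      thus False using O_mul_self[of \<alpha>] a(2) True z by auto
    qed
    thus ?thesis using True z a(2) by simp
  qed
  have "{PIdl\<^bsub>OK\<^esub> d | d. d \<in> carrier OK \<and> ideal_dvd (PIdl\<^bsub>OK\<^esub> d) (PIdl\<^bsub>OK\<^esub> \<alpha>) \<and>
            (\<forall>P. prime_of_OK P \<and> ideal_dvd P E \<longrightarrow> \<not> ideal_dvd P (PIdl\<^bsub>OK\<^esub> d))} = Div E \<alpha>"
  proof -
    have "(x = PIdl\<^bsub>OK\<^esub> d \<and> d \<in> carrier OK \<and> ideal_dvd (PIdl\<^bsub>OK\<^esub> d) (PIdl\<^bsub>OK\<^esub> \<alpha>) \<and>
            (\<forall>P. prime_of_OK P \<and> ideal_dvd P E \<longrightarrow> \<not> ideal_dvd P (PIdl\<^bsub>OK\<^esub> d)))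
      \<longleftrightarrow> (x = O_mul d \<and> algebraic_int d \<and> \<alpha> \<in> O_mul d \<and> (\<forall>P. O_prime P \<and> E \<subseteq> P \<longrightarrow> d \<notin> P))" for x d
    proof (cases "algebraic_int d")
      case True
      show ?thesis unfolding O_mul_eq[OF True, symmetric] O_mul_eq[OF a(1), symmetric] dv[OF True] pr[OF True]
        by (simp add: True)
    qed simp
    thus ?thesis unfolding Div_def by (simp only:)
  qed
  thus ?thesis unfolding ideal_sigma_def by simp
qed

lemma finite_Div:
  assumes "algebraic_int \<alpha>" "\<alpha> \<noteq> (0::'k)" shows "finite (Div E \<alpha>)"
  by (rule finite_subset[OF _ finite_ideals_containing[OF nf assms]])
     (auto simp: Div_def O_ideal_O_mul)

section \<open>Recurrences for divisor sums\<close>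

text \<open>The part of the divisor sum coming from divisors prime to \<open>P\<close>. It does not
  change when \<alpha> is multiplied by a generator of \<open>P\<close>, and it equals the sum for
  the ideal \<open>P E\<close> (\<open>sigma_prod_prime\<close>), which is how the second term of
  the theorem enters.\<close>

definition tau :: "'k set \<Rightarrow> 'k set \<Rightarrow> 'k \<Rightarrow> nat" where
  "tau E P \<alpha> = (\<Sum>I | I \<in> Div E \<alpha> \<and> \<not> I \<subseteq> P. ideal_norm I)"

context
  fixes \<pi> and P E :: "'k set"
  assumes \<pi>: "prime_el \<pi>" and Pdef: "P = O_mul \<pi>" and E: "O_ideal E"
begin

lemma prime_facts: "O_prime P" "algebraic_int \<pi>" "\<pi> \<noteq> 0" "O_ideal P" "1 \<notin> P"
  "algebraic_int x \<Longrightarrow> algebraic_int y \<Longrightarrow> x * y \<in> P \<Longrightarrow> x \<in> P \<or> y \<in> P"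
proof -
  show P: "O_prime P" and "algebraic_int \<pi>" using \<pi> Pdef by (auto simp: prime_el_def)
  show "\<pi> \<noteq> 0" by (rule prime_el_nonzero[OF \<pi>])
  show "O_ideal P" "1 \<notin> P" "algebraic_int x \<Longrightarrow> algebraic_int y \<Longrightarrow> x * y \<in> P \<Longrightarrow> x \<in> P \<or> y \<in> P"
    using O_primeD[OF P] by auto
qed

lemma prime_cofactor:
  assumes "algebraic_int r" "algebraic_int d" "algebraic_int \<beta>" "d \<notin> P" "\<pi> * \<beta> = d * r"
  obtains r' where "algebraic_int r'" "\<beta> = d * r'"
proof -
  have "d * r \<in> P" using O_mulI[OF assms(3), of \<pi>] assms(5) Pdef by simp
  hence "r \<in> P" using prime_facts(6)[OF assms(2,1)] assms(4) by blast
  then obtain r' where r': "algebraic_int r'" "r = \<pi> * r'" unfolding Pdef O_mul_def by auto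
  have "\<pi> * \<beta> = \<pi> * (d * r')" using assms(5) r'(2) by (simp add: mult_ac)
  hence "\<beta> = d * r'" using prime_facts(3) by simp
  thus ?thesis using that r'(1) by blast
qed

lemma Div_prime_to:
  assumes \<beta>: "algebraic_int \<beta>" "\<beta> \<noteq> 0"
  shows "{I \<in> Div E (\<pi> * \<beta>). \<not> I \<subseteq> P} = {I \<in> Div E \<beta>. \<not> I \<subseteq> P}"
proof (intro equalityI subsetI)
  have pb: "\<pi> * \<beta> \<noteq> 0" using \<beta> prime_facts(3) by simp
  fix I assume "I \<in> {I \<in> Div E (\<pi> * \<beta>). \<not> I \<subseteq> P}"
  hence I: "I \<in> Div E (\<pi> * \<beta>)" "\<not> I \<subseteq> P" by auto
  obtain d r where d: "I = O_mul d" "algebraic_int d" "algebraic_int r" "\<pi> * \<beta> = d * r"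
    "\<forall>P. O_prime P \<longrightarrow> E \<subseteq> P \<longrightarrow> d \<notin> P" by (rule DivE[OF I(1)])
    note d5 = d(5)[rule_format]
  have "d \<notin> P" using I(2) d(1) mem_iff_O_mul_subset[OF prime_facts(4)] by simp
  then obtain r' where "algebraic_int r'" "\<beta> = d * r'" using prime_cofactor[OF d(3,2) \<beta>(1)] d(4) by metis
  thus "I \<in> {I \<in> Div E \<beta>. \<not> I \<subseteq> P}" using I(2) DivI[OF d(2) _ _ d5] d(1) by blast
next
  fix I assume "I \<in> {I \<in> Div E \<beta>. \<not> I \<subseteq> P}"
  hence I: "I \<in> Div E \<beta>" "\<not> I \<subseteq> P" by auto
  obtain d r where d: "I = O_mul d" "algebraic_int d" "algebraic_int r" "\<beta> = d * r"
    "\<forall>P. O_prime P \<longrightarrow> E \<subseteq> P \<longrightarrow> d \<notin> P" by (rule DivE[OF I(1)])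
    note d5 = d(5)[rule_format]
  have "algebraic_int (\<pi> * r)" using prime_facts(2) d(3) by (simp add: algebraic_int_add_mult)
  moreover have "\<pi> * \<beta> = d * (\<pi> * r)" using d(4) by (simp add: mult_ac)
  ultimately have "O_mul d \<in> Div E (\<pi> * \<beta>)" using DivI[OF d(2) _ _ d5] by blast
  thus "I \<in> {I \<in> Div E (\<pi> * \<beta>). \<not> I \<subseteq> P}" using I(2) d(1) by blast
qed

lemma tau_mult: "algebraic_int \<beta> \<Longrightarrow> \<beta> \<noteq> 0 \<Longrightarrow> tau E P (\<pi> * \<beta>) = tau E P \<beta>"
  unfolding tau_def by (simp add: Div_prime_to)

lemma sigma_not_dvd:
  assumes \<beta>: "algebraic_int \<beta>" "\<beta> \<notin> P" shows "ideal_sigma E \<beta> = tau E P \<beta>"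
proof -
  have b0: "\<beta> \<noteq> 0" using \<beta>(2) O_idealD(3)[OF prime_facts(4)] by auto
  have "\<not> I \<subseteq> P" if "I \<in> Div E \<beta>" for I using that \<beta>(2) unfolding Div_def by blast
  hence "{I. I \<in> Div E \<beta> \<and> \<not> I \<subseteq> P} = Div E \<beta>" by blast
  thus ?thesis unfolding ideal_sigma_eq[OF \<beta>(1) b0 E] tau_def by simp
qed

lemma sigma_mult_dvd:
  assumes EP: "E \<subseteq> P" and \<beta>: "algebraic_int \<beta>" "\<beta> \<noteq> 0"
  shows "ideal_sigma E (\<pi> * \<beta>) = ideal_sigma E \<beta>"
proof -
  have *: "\<not> I \<subseteq> P" if I: "I \<in> Div E \<gamma>" and g: "\<gamma> \<noteq> 0" for I \<gamma>
  proof -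
    obtain d where d: "I = O_mul d" "\<forall>P. O_prime P \<longrightarrow> E \<subseteq> P \<longrightarrow> d \<notin> P" using DivE[OF I] by metis
    show ?thesis using d(2)[rule_format, OF prime_facts(1) EP] d(1) mem_iff_O_mul_subset[OF prime_facts(4)] by simp
  qed
  have pb: "algebraic_int (\<pi> * \<beta>)" "\<pi> * \<beta> \<noteq> 0" using \<beta> prime_facts by (auto simp: algebraic_int_add_mult)
  have e: "{I \<in> Div E (\<pi> * \<beta>). \<not> I \<subseteq> P} = Div E (\<pi> * \<beta>)" "{I \<in> Div E \<beta>. \<not> I \<subseteq> P} = Div E \<beta>"
    using * pb(2) \<beta>(2) by blast+
  have "Div E (\<pi> * \<beta>) = Div E \<beta>" by (rule trans[OF trans[OF e(1)[symmetric] Div_prime_to[OF \<beta>]] e(2)])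
  thus ?thesis unfolding ideal_sigma_eq[OF pb E] ideal_sigma_eq[OF \<beta> E] by simp
qed

text \<open>Divisors of \<open>\<pi> * \<beta>\<close> not contained in \<open>P\<close> are those
  of \<beta> and add up to \<open>tau\<close>; the rest are \<pi> times a divisor of \<beta>, with
  the norm multiplied by that of \<open>P\<close>.\<close>

lemma sigma_mult_not_dvd:
  assumes EP: "\<not> E \<subseteq> P" and \<beta>: "algebraic_int \<beta>" "\<beta> \<noteq> 0"
  shows "ideal_sigma E (\<pi> * \<beta>) = tau E P \<beta> + ideal_norm P * ideal_sigma E \<beta>"
proof -
  have pb: "algebraic_int (\<pi> * \<beta>)" "\<pi> * \<beta> \<noteq> 0" using \<beta> prime_facts by (auto simp: algebraic_int_add_mult)
  define f where "f I = (\<lambda>x. \<pi> * x) ` I" for I :: "'k set"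
  have inj: "inj f" unfolding f_def
    by (rule injI) (metis (no_types, lifting) inj_image_eq_iff inj_onI mult_left_cancel prime_facts(3))
  have fO: "f (O_mul d) = O_mul (\<pi> * d)" for d unfolding f_def by (rule O_mul_mult[symmetric])
  have im: "{I \<in> Div E (\<pi> * \<beta>). I \<subseteq> P} = f ` Div E \<beta>"
  proof (intro equalityI subsetI)
    fix I assume "I \<in> {I \<in> Div E (\<pi> * \<beta>). I \<subseteq> P}"
    hence I: "I \<in> Div E (\<pi> * \<beta>)" "I \<subseteq> P" by auto
    obtain d r where d: "I = O_mul d" "algebraic_int d" "algebraic_int r" "\<pi> * \<beta> = d * r"
      "\<forall>P. O_prime P \<longrightarrow> E \<subseteq> P \<longrightarrow> d \<notin> P" by (rule DivE[OF I(1)])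
    note d5 = d(5)[rule_format]
    have "d \<in> P" using I(2) d(1) O_mul_self by blast
    then obtain c where c: "algebraic_int c" "d = \<pi> * c" unfolding Pdef O_mul_def by auto
    have "\<pi> * \<beta> = \<pi> * (c * r)" using d(4) c(2) by (simp add: mult_ac)
    hence "\<beta> = c * r" using prime_facts(3) by simp
    moreover have "c \<notin> P'" if "O_prime P'" "E \<subseteq> P'" for P'
      using d5[OF that] c(2) O_idealD(5)[OF O_primeD(1)[OF that(1)] prime_facts(2)] by blast
    ultimately have "O_mul c \<in> Div E \<beta>" using c d(3) by (intro DivI)
    thus "I \<in> f ` Div E \<beta>" using d(1) c(2) fO by blast
  next
    fix I assume "I \<in> f ` Div E \<beta>"
    then obtain K where K: "K \<in> Div E \<beta>" "I = f K" by blast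
    obtain d r where d: "K = O_mul d" "algebraic_int d" "algebraic_int r" "\<beta> = d * r"
      "\<forall>P. O_prime P \<longrightarrow> E \<subseteq> P \<longrightarrow> d \<notin> P" by (rule DivE[OF K(1)])
    note d5 = d(5)[rule_format]
    have pd: "algebraic_int (\<pi> * d)" using prime_facts(2) d(2) by (simp add: algebraic_int_add_mult)
    \<comment> \<open>The hypothesis \<open>\<not> E \<subseteq> P\<close> enters here: the factor
      \<pi> lies in no prime other than \<open>P\<close>, and \<open>P\<close> is not among the
      excluded primes.\<close>
    have np: "\<pi> * d \<notin> P'" if P': "O_prime P'" "E \<subseteq> P'" for P'
    proof
      assume "\<pi> * d \<in> P'"
      hence "\<pi> \<in> P'" using O_primeD(3)[OF P'(1) prime_facts(2) d(2)] d5[OF P'] by blast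
      hence "P \<subseteq> P'" unfolding Pdef using O_mul_minimal O_primeD(1)[OF P'(1)] by blast
      hence "P = P'" by (rule prime_maximal[OF prime_facts(1) P'(1)])
      thus False using EP P'(2) by blast
    qed
    have "\<pi> * \<beta> = \<pi> * d * r" using d(4) by simp
    hence "O_mul (\<pi> * d) \<in> Div E (\<pi> * \<beta>)" by (rule DivI[OF pd d(3) _ np])
    moreover have "O_mul (\<pi> * d) \<subseteq> P"
      using O_mul_minimal[OF prime_facts(4)] O_mulI[OF d(2), of \<pi>] Pdef by blast
    ultimately show "I \<in> {I \<in> Div E (\<pi> * \<beta>). I \<subseteq> P}" using K(2) d(1) fO by simp
  qed
  have norm: "ideal_norm (f K) = ideal_norm P * ideal_norm K" if K: "K \<in> Div E \<beta>" for K
  proof -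
    obtain d r where d: "K = O_mul d" "algebraic_int d" "\<beta> = d * r" by (rule DivE[OF K])
    have d0: "d \<noteq> 0" using d(3) \<beta>(2) by auto
    show ?thesis unfolding d(1) fO Pdef by (rule ideal_norm_mult[OF nf prime_facts(2,3) d(2) d0])
  qed
  have fin: "finite (Div E (\<pi> * \<beta>))" using pb by (rule finite_Div)
  have "ideal_sigma E (\<pi> * \<beta>) = (\<Sum>I\<in>{I \<in> Div E (\<pi> * \<beta>). \<not> I \<subseteq> P} \<union> {I \<in> Div E (\<pi> * \<beta>). I \<subseteq> P}. ideal_norm I)"
    unfolding ideal_sigma_eq[OF pb E] by (rule sum.cong) auto
  also have "\<dots> = (\<Sum>I\<in>{I \<in> Div E (\<pi> * \<beta>). \<not> I \<subseteq> P}. ideal_norm I) + (\<Sum>I\<in>{I \<in> Div E (\<pi> * \<beta>). I \<subseteq> P}. ideal_norm I)"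
    using fin by (intro sum.union_disjoint) auto
  also have "(\<Sum>I\<in>{I \<in> Div E (\<pi> * \<beta>). \<not> I \<subseteq> P}. ideal_norm I) = tau E P \<beta>"
    unfolding Div_prime_to[OF \<beta>] tau_def by simp
  also have "(\<Sum>I\<in>{I \<in> Div E (\<pi> * \<beta>). I \<subseteq> P}. ideal_norm I) = (\<Sum>K\<in>Div E \<beta>. ideal_norm (f K))"
    unfolding im using inj by (subst sum.reindex) (auto simp: inj_on_def inj_def)
  also have "\<dots> = ideal_norm P * ideal_sigma E \<beta>"
    unfolding ideal_sigma_eq[OF \<beta> E] sum_distrib_left using norm by (intro sum.cong) auto
  finally show ?thesis .
qed

text \<open>The primes containing \<open>P E\<close> are \<open>P\<close> and the primes containing
  \<open>E\<close>, so the new exclusion is exactly divisibility by \<open>P\<close>.\<close>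

lemma sigma_prod_prime:
  assumes \<beta>: "algebraic_int \<beta>" "\<beta> \<noteq> 0"
  shows "ideal_sigma (ideal_prod OK P E) \<beta> = tau E P \<beta>"
proof -
  interpret ring "OK :: 'k ring" using cring_OK by (rule cring.axioms)
  have id: "ideal P OK" "ideal E OK" using prime_facts(4) E O_ideal_iff by blast+
  have PE: "O_ideal (ideal_prod OK P E)" unfolding O_ideal_iff using id by (rule ideal_prod_is_ideal)
  have sub: "ideal_prod OK P E \<subseteq> P' \<longleftrightarrow> P' = P \<or> E \<subseteq> P'" if P': "O_prime P'" for P'
  proof
    assume s: "ideal_prod OK P E \<subseteq> P'"
    show "P' = P \<or> E \<subseteq> P'"
    proof (cases "E \<subseteq> P'")
      case False
      then obtain x where x: "x \<in> E" "x \<notin> P'" by blast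
      have "p \<in> P'" if p: "p \<in> P" for p
      proof -
        have "p * x \<in> P'" using s ideal_prod.prod[OF p x(1), of OK] by auto
        thus ?thesis using O_primeD(3)[OF P' O_idealD(2)[OF prime_facts(4) p] O_idealD(2)[OF E x(1)]] x(2) by blast
      qed
      hence "P = P'" by (intro prime_maximal[OF prime_facts(1) P']) blast
      thus ?thesis by simp
    qed simp
  next
    assume "P' = P \<or> E \<subseteq> P'"
    thus "ideal_prod OK P E \<subseteq> P'" using ideal_prod_inter[OF id] by blast
  qed
  have "Div (ideal_prod OK P E) \<beta> = {I. I \<in> Div E \<beta> \<and> \<not> I \<subseteq> P}"
  proof (intro equalityI subsetI)
    fix I assume I: "I \<in> Div (ideal_prod OK P E) \<beta>"
    obtain d r where d: "I = O_mul d" "algebraic_int d" "algebraic_int r" "\<beta> = d * r"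
      "\<forall>P'. O_prime P' \<longrightarrow> ideal_prod OK P E \<subseteq> P' \<longrightarrow> d \<notin> P'" by (rule DivE[OF I])
    note d5 = d(5)[rule_format]
    have "d \<notin> P" using d5[OF prime_facts(1)] sub[OF prime_facts(1)] by blast
    hence "\<not> I \<subseteq> P" using d(1) mem_iff_O_mul_subset[OF prime_facts(4)] by simp
    moreover have "I \<in> Div E \<beta>" unfolding d(1) using d(2-4) d5 sub by (intro DivI) blast+
    ultimately show "I \<in> {I. I \<in> Div E \<beta> \<and> \<not> I \<subseteq> P}" by blast
  next
    fix I assume "I \<in> {I. I \<in> Div E \<beta> \<and> \<not> I \<subseteq> P}"
    hence I: "I \<in> Div E \<beta>" "\<not> I \<subseteq> P" by auto
    obtain d r where d: "I = O_mul d" "algebraic_int d" "algebraic_int r" "\<beta> = d * r"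
      "\<forall>P'. O_prime P' \<longrightarrow> E \<subseteq> P' \<longrightarrow> d \<notin> P'" by (rule DivE[OF I(1)])
    note d5 = d(5)[rule_format]
    have "d \<notin> P" using I(2) d(1) mem_iff_O_mul_subset[OF prime_facts(4)] by simp
    thus "I \<in> Div (ideal_prod OK P E) \<beta>" unfolding d(1) using d(2-4) d5 sub by (intro DivI) blast+
  qed
  thus ?thesis unfolding ideal_sigma_eq[OF \<beta> PE] tau_def by simp
qed

end

lemma sigma_unit:
  assumes u: "unit_OK u" and E: "O_ideal (E :: 'k set)" shows "ideal_sigma E u = 1"
proof -
  have ui: "algebraic_int u" "u \<noteq> 0" "algebraic_int (inverse u)" using u by (auto simp: unit_OK_def)
  have one: "algebraic_int (1::'k)" by (simp add: int_imp_algebraic_int)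
  have "Div E u = {O_mul 1}"
  proof (intro equalityI subsetI)
    fix I assume I: "I \<in> Div E u"
    obtain d r where d: "I = O_mul d" "algebraic_int d" "algebraic_int r" "u = d * r" by (rule DivE[OF I])
    have "inverse d = inverse u * r" using d ui(2) by (auto simp: field_simps)
    hence "algebraic_int (inverse d)" using ui(3) d(3) by (simp add: algebraic_int_add_mult)
    moreover have "d \<noteq> 0" using d(4) ui(2) by auto
    ultimately have "O_mul 1 = O_mul d" using d one by (subst O_mul_eq_iff) (auto simp: unit_OK_def)
    thus "I \<in> {O_mul 1}" using d(1) by simp
  next
    fix I assume "I \<in> {O_mul (1::'k)}"
    thus "I \<in> Div E u" using DivI[OF one ui(1)] O_primeD(2) by auto
  qed
  moreover have "ideal_norm (O_mul (1::'k)) = 1"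
  proof -
    have O1: "O_ideal (O_mul (1::'k))" using one by (rule O_ideal_O_mul)
    have c: "res (O_mul 1) x = res (O_mul 1) (0::'k)" if "algebraic_int x" for x
      using that O_mulI[OF that, of 1] by (subst res_eq_iff[OF O1]) auto
    have "res (O_mul 1) ` Oring = {res (O_mul 1) (0::'k)}"
    proof
      show "res (O_mul 1) ` Oring \<subseteq> {res (O_mul 1) (0::'k)}"
      proof (rule image_subsetI)
        fix x :: 'k assume "x \<in> Oring"
        hence "algebraic_int x" by simp
        from c[OF this] show "res (O_mul 1) x \<in> {res (O_mul 1) 0}" by (rule ssubst) (rule singletonI)
      qed
      show "{res (O_mul 1) (0::'k)} \<subseteq> res (O_mul 1) ` Oring" by simp
    qed
    thus ?thesis by (simp add: ideal_norm_res[OF O1])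
  qed
  ultimately show ?thesis unfolding ideal_sigma_eq[OF ui(1,2) E] by simp
qed

subsection \<open>Counting elements of given norm in the maximal order\<close>

text \<open>The norm is prescribed only as an ideal, because a generator of a left ideal may be
  changed by an invertible element of \<open>H\<close>.\<close>

definition LI :: "'k \<Rightarrow> 'a set set" where
  "LI \<alpha> = {L. \<exists>x\<in>H. L = lmul x \<and> O_mul (nrd s x) = O_mul \<alpha>}"

lemma LI_unit: assumes u: "unit_OK (u::'k)" shows "LI u = {H}"
proof -
  have H1: "lmul 1 = H" by (simp add: lmul_def)
  have ui: "algebraic_int u" "u \<noteq> 0" "algebraic_int (inverse u)" using u by (auto simp: unit_OK_def)
  have one: "algebraic_int (1::'k)" by (simp add: int_imp_algebraic_int)
  have "O_mul 1 = O_mul u" using u ui one by (subst O_mul_eq_iff) auto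
  hence 1: "H \<in> LI u" unfolding LI_def using H_1 H1 by (auto intro!: bexI[of _ 1])
  have "L = H" if L: "L \<in> LI u" for L
  proof -
    obtain x where x: "x \<in> H" "L = lmul x" "O_mul (nrd s x) = O_mul u" using L unfolding LI_def by blast
    have "nrd s x \<noteq> 0"
    proof
      assume "nrd s x = 0"
      hence "u \<in> O_mul 0" using x(3) O_mul_self[of u] by simp
      thus False using ui(2) by (auto simp: O_mul_def)
    qed
    moreover have "O_mul 1 = O_mul (nrd s x)" using x(3) \<open>O_mul 1 = O_mul u\<close> by simp
    ultimately have "unit_OK (nrd s x)" using nrd_integral[OF x(1)] one by (subst (asm) O_mul_eq_iff) auto
    hence "lmul (x * 1) = lmul 1" by (rule lmul_unit[OF x(1)])
    thus ?thesis using x(2) H1 by simp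
  qed
  thus ?thesis using 1 by blast
qed

lemma O_mul_cong:
  assumes "c \<noteq> (0::'k)" shows "O_mul (c * a) = O_mul (c * b) \<longleftrightarrow> O_mul a = O_mul b"
proof -
  have "inj (\<lambda>x. c * x)" using assms by (simp add: inj_def)
  thus ?thesis unfolding O_mul_mult by (rule inj_image_eq_iff)
qed

lemma LI_E:
  assumes "L \<in> LI \<alpha>" "\<alpha> \<noteq> 0"
  obtains x where "x \<in> H" "x \<noteq> 0" "L = lmul x" "O_mul (nrd s x) = O_mul \<alpha>"
proof -
  obtain x where x: "x \<in> H" "L = lmul x" "O_mul (nrd s x) = O_mul \<alpha>" using assms(1) unfolding LI_def by blast
  have "x \<noteq> 0"
  proof
    assume "x = 0"
    hence "\<alpha> \<in> O_mul 0" using x(3) O_mul_self[of \<alpha>] by simp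
    thus False using assms(2) by (auto simp: O_mul_def)
  qed
  thus ?thesis using x that by blast
qed

lemma lmul_subset_iff: "x \<in> H \<Longrightarrow> left_ideal J \<Longrightarrow> lmul x \<subseteq> J \<longleftrightarrow> x \<in> J"
  using lmul_self lmul_minimal by blast

text \<open>Right multiplication by \<open>y\<close> is injective and carries the ideals of norm
  \<alpha> onto those of norm \<open>\<pi> * \<alpha>\<close> inside \<open>lmul y\<close>. The
  element \<pi> need not be prime, so the lemma also serves the scalar generator of
  \<open>P H\<close>, whose norm is a square.\<close>

lemma LI_below:
  assumes y: "y \<in> H" "y \<noteq> 0" "O_mul (nrd s y) = O_mul \<pi>" and a: "\<alpha> \<noteq> 0" and p: "\<pi> \<noteq> 0"
  shows "card {L \<in> LI (\<pi> * \<alpha>). L \<subseteq> lmul y} = card (LI \<alpha>)"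
    "finite (LI \<alpha>) \<Longrightarrow> finite {L \<in> LI (\<pi> * \<alpha>). L \<subseteq> lmul y}"
proof -
  define f where "f M = (\<lambda>m. m * y) ` M" for M :: "'a set"
  have fl: "f (lmul x) = lmul (x * y)" for x unfolding f_def lmul_def by (simp add: image_image mult.assoc)
  have inj: "inj f" unfolding f_def
    by (rule injI) (metis (no_types, lifting) inj_image_eq_iff inj_onI quat_mult_cancel_right y(2))
  have ny: "nrd s y \<noteq> 0" using y(2) by (simp add: nrd_eq_0_iff)
  have sw: "O_mul (nrd s y * c) = O_mul (\<pi> * c)" for c
    using y(3) O_mul_mult[of c "nrd s y"] O_mul_mult[of c \<pi>] by (simp add: mult.commute)
  have eq: "O_mul (nrd s (x * y)) = O_mul (\<pi> * \<alpha>) \<longleftrightarrow> O_mul (nrd s x) = O_mul \<alpha>" for x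
  proof -
    have "O_mul (nrd s (x * y)) = O_mul (\<pi> * nrd s x)" using sw[of "nrd s x"] by (simp add: nrd_mult mult.commute)
    thus ?thesis using O_mul_cong[OF p] by simp
  qed
  have im: "{L \<in> LI (\<pi> * \<alpha>). L \<subseteq> lmul y} = f ` LI \<alpha>"
  proof (intro equalityI subsetI)
    fix L assume "L \<in> {L \<in> LI (\<pi> * \<alpha>). L \<subseteq> lmul y}"
    then obtain z where z: "z \<in> H" "L = lmul z" "O_mul (nrd s z) = O_mul (\<pi> * \<alpha>)" "L \<subseteq> lmul y"
      unfolding LI_def by blast
    have "z \<in> lmul y" using z(2,4) lmul_self by blast
    then obtain x where x: "x \<in> H" "z = x * y" unfolding lmul_def by blast
    have "lmul x \<in> LI \<alpha>" unfolding LI_def using x z(3) eq by blast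
    thus "L \<in> f ` LI \<alpha>" using z(2) x(2) fl by blast
  next
    fix L assume "L \<in> f ` LI \<alpha>"
    then obtain x where x: "x \<in> H" "L = lmul (x * y)" "O_mul (nrd s x) = O_mul \<alpha>"
      unfolding LI_def using fl by auto
    have "x * y \<in> lmul y" unfolding lmul_def using x(1) by blast
    hence "L \<subseteq> lmul y" unfolding x(2) by (rule lmul_minimal[OF left_ideal_lmul[OF y(1)]])
    thus "L \<in> {L \<in> LI (\<pi> * \<alpha>). L \<subseteq> lmul y}"
      unfolding LI_def using x eq H_mult[OF x(1) y(1)] by blast
  qed
  show "card {L \<in> LI (\<pi> * \<alpha>). L \<subseteq> lmul y} = card (LI \<alpha>)"
    unfolding im using inj by (intro card_image) (auto simp: inj_on_def inj_def)
  show "finite (LI \<alpha>) \<Longrightarrow> finite {L \<in> LI (\<pi> * \<alpha>). L \<subseteq> lmul y}" unfolding im by simp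
qed

text \<open>
  Double counting of the pairs \<open>L \<subseteq> J\<close> with \<open>L \<in> LI (\<pi> * \<alpha>)\<close> and \<open>J\<close> a maximal left ideal over \<open>\<pi>\<close>:
  an \<open>L\<close> not contained in \<open>\<pi> H\<close> lies in exactly one \<open>J\<close>, the others lie in every \<open>J\<close>.
\<close>

lemma LI_recurrence:
  assumes \<pi>: "prime_el \<pi>" and a: "algebraic_int \<alpha>" "\<alpha> \<noteq> 0" and fin: "finite (LI \<alpha>)"
  defines "Z \<equiv> card (prime_in_order.Zs s H (O_mul \<pi>))"
  defines "b \<equiv> (if \<alpha> \<in> O_mul \<pi> then card (LI (\<alpha> / \<pi>)) else 0)"
  shows "finite (LI (\<pi> * \<alpha>))" "Z * card (LI \<alpha>) + b = card (LI (\<pi> * \<alpha>)) + b * Z"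
proof -
  define P where "P = O_mul \<pi>"
  have P: "O_prime P" and pi: "algebraic_int \<pi>" using \<pi> by (auto simp: prime_el_def P_def)
  have p0: "\<pi> \<noteq> 0" by (rule prime_el_nonzero[OF \<pi>])
  interpret prime_in_order s H P by unfold_locales (rule P)
  have Zdef: "Z = card Zs" unfolding Z_def P_def ..
  have fZ: "finite Zs" by (rule card_Zs_cases(3))
  have pa: "\<pi> * \<alpha> \<noteq> 0" using a p0 by simp
  have below: "card {L \<in> LI (\<pi> * \<alpha>). L \<subseteq> J} = card (LI \<alpha>)" "finite {L \<in> LI (\<pi> * \<alpha>). L \<subseteq> J}" if J: "J \<in> Zs" for J
  proof -
    obtain y where y: "y \<in> H" "y \<noteq> 0" "J = lmul y" "P = O_mul (nrd s y)" by (rule Zs_generator[OF J])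
    have "O_mul (nrd s y) = O_mul \<pi>" using y(4) P_def by simp
    from LI_below[OF y(1,2) this a(2) p0] fin show "card {L \<in> LI (\<pi> * \<alpha>). L \<subseteq> J} = card (LI \<alpha>)"
      "finite {L \<in> LI (\<pi> * \<alpha>). L \<subseteq> J}" unfolding y(3) by auto
  qed
  have one: "card {J \<in> Zs. L \<subseteq> J} = (if L \<subseteq> PH P then Z else 1)" and ex: "\<exists>J\<in>Zs. L \<subseteq> J"
    if L: "L \<in> LI (\<pi> * \<alpha>)" for L
  proof -
    obtain x where x: "x \<in> H" "L = lmul x" "O_mul (nrd s x) = O_mul (\<pi> * \<alpha>)" using L unfolding LI_def by blast
    have liP: "left_ideal (PH P)"
      unfolding left_ideal_def using PH_sub[OF PD(1)] PH_0 PH_add PH_lmult[OF PD(1)] by blast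
    have inJ: "L \<subseteq> J \<longleftrightarrow> x \<in> J" if "J \<in> Zs" for J unfolding x(2) by (rule lmul_subset_iff[OF x(1) ZsD(1)[OF that]])
    have inP: "L \<subseteq> PH P \<longleftrightarrow> x \<in> PH P" unfolding x(2) by (rule lmul_subset_iff[OF x(1) liP])
    have n: "nrd s x \<in> P"
    proof -
      have "nrd s x \<in> O_mul (\<pi> * \<alpha>)" using x(3) O_mul_self by metis
      then obtain r where "algebraic_int r" "nrd s x = \<pi> * (\<alpha> * r)" unfolding O_mul_def by (auto simp: mult.assoc)
      thus ?thesis unfolding P_def using O_mulI[of "\<alpha> * r" \<pi>] a(1) by (simp add: algebraic_int_add_mult)
    qed
    have *: "card {J \<in> Zs. L \<subseteq> J} = (if L \<subseteq> PH P then Z else 1) \<and> (\<exists>J\<in>Zs. L \<subseteq> J)"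
    proof (cases "x \<in> PH P")
      case True
      hence all: "L \<subseteq> J" if "J \<in> Zs" for J using inJ[OF that] ZsD(6)[OF that] by blast
      hence e: "{J \<in> Zs. L \<subseteq> J} = Zs" by blast
      obtain J where "J \<in> Zs" using Zs_nonempty by blast
      thus ?thesis unfolding e using True inP Zdef all by auto
    next
      case False
      note Zo = Zof[OF x(1) False n]
      have e: "{J \<in> Zs. L \<subseteq> J} = {Zof x}"
      proof (intro equalityI subsetI)
        fix J assume "J \<in> {J \<in> Zs. L \<subseteq> J}"
        hence "J \<in> Zs" "x \<in> J" using inJ by blast+
        hence "J = Zof x" by (rule Zo(3))
        thus "J \<in> {Zof x}" by (simp only: singleton_iff)
      next
        fix J assume "J \<in> {Zof x}"
        hence "J = Zof x" by (simp only: singleton_iff)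
        thus "J \<in> {J \<in> Zs. L \<subseteq> J}" using inJ[OF Zo(1)] Zo(1,2) by blast
      qed
      have "L \<subseteq> Zof x" using inJ[OF Zo(1)] Zo(2) by blast
      moreover have "\<not> L \<subseteq> PH P" using False inP by blast
      ultimately show ?thesis unfolding e using Zo(1) by auto
    qed
    thus "card {J \<in> Zs. L \<subseteq> J} = (if L \<subseteq> PH P then Z else 1)" "\<exists>J\<in>Zs. L \<subseteq> J" by blast+
  qed
  have "LI (\<pi> * \<alpha>) = (\<Union>J\<in>Zs. {L \<in> LI (\<pi> * \<alpha>). L \<subseteq> J})" using ex by auto
  moreover have "finite (\<Union>J\<in>Zs. {L \<in> LI (\<pi> * \<alpha>). L \<subseteq> J})" using fZ below(2) by (intro finite_UN_I)
  ultimately show fin': "finite (LI (\<pi> * \<alpha>))" by simp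
  define A where "A = {L \<in> LI (\<pi> * \<alpha>). L \<subseteq> PH P}"
  define A' where "A' = {L \<in> LI (\<pi> * \<alpha>). \<not> L \<subseteq> PH P}"
  have fA: "finite A" "finite A'" unfolding A_def A'_def using fin' by auto
  have LA: "LI (\<pi> * \<alpha>) = A \<union> A'" "A \<inter> A' = {}" unfolding A_def A'_def by blast+
  have "Z * card (LI \<alpha>) = (\<Sum>J\<in>Zs. card {L \<in> LI (\<pi> * \<alpha>). L \<subseteq> J})" using below(1) Zdef by simp
  also have "\<dots> = (\<Sum>J\<in>Zs. \<Sum>L\<in>LI (\<pi> * \<alpha>). if L \<subseteq> J then 1 else 0)"
    using fin' by (intro sum.cong) (auto simp: sum.If_cases Int_def)
  also have "\<dots> = (\<Sum>L\<in>LI (\<pi> * \<alpha>). \<Sum>J\<in>Zs. if L \<subseteq> J then 1 else 0)" by (rule sum.swap)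
  also have "\<dots> = (\<Sum>L\<in>LI (\<pi> * \<alpha>). card {J \<in> Zs. L \<subseteq> J})"
    using fZ by (intro sum.cong) (auto simp: sum.If_cases Int_def)
  also have "\<dots> = (\<Sum>L\<in>LI (\<pi> * \<alpha>). if L \<subseteq> PH P then Z else 1)" using one by (intro sum.cong) auto
  also have "\<dots> = (\<Sum>L\<in>A. if L \<subseteq> PH P then Z else 1) + (\<Sum>L\<in>A'. if L \<subseteq> PH P then Z else 1)"
    unfolding LA(1) using fA LA(2) by (intro sum.union_disjoint)
  also have "(\<Sum>L\<in>A. if L \<subseteq> PH P then Z else 1) = card A * Z" unfolding A_def by simp
  also have "(\<Sum>L\<in>A'. if L \<subseteq> PH P then Z else 1) = card A'" unfolding A'_def by simp
  finally have e1: "Z * card (LI \<alpha>) = card A * Z + card A'" .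
  have e2: "card (LI (\<pi> * \<alpha>)) = card A + card A'" unfolding LA(1) using fA LA(2) by (intro card_Un_disjoint)
  \<comment> \<open>\<open>P H\<close> is generated by the scalar \<pi> of norm
    \<open>\<pi> * \<pi>\<close>, so the ideals inside it are \<pi> times ideals of norm
    \<open>\<alpha> / \<pi>\<close>; there are none unless \<pi> divides \<alpha>.\<close>
  have bA: "card A = b"
  proof -
    have p1: "s \<pi> 1 \<in> H" "s \<pi> 1 \<noteq> 0" using H_scalar[OF pi] p0 by auto
    have PHl: "PH P = lmul (s \<pi> 1)" unfolding P_def PH_principal[OF pi] lmul_def by (simp add: scalar_mult)
    have np: "O_mul (nrd s (s \<pi> 1)) = O_mul (\<pi> * \<pi>)" by (simp add: nrd_scalar)
    show ?thesis
    proof (cases "\<alpha> \<in> O_mul \<pi>")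
      case True
      have e: "(\<pi> * \<pi>) * (\<alpha> / \<pi>) = \<pi> * \<alpha>" using p0 by simp
      have "\<alpha> / \<pi> \<noteq> 0" "\<pi> * \<pi> \<noteq> 0" using a p0 by auto
      from LI_below(1)[OF p1 np this, unfolded e] have "card A = card (LI (\<alpha> / \<pi>))" unfolding A_def PHl .
      thus ?thesis using True by (simp add: b_def)
    next
      case False
      have "A = {}"
      proof (rule ccontr)
        assume "A \<noteq> {}"
        then obtain x where x: "x \<in> H" "lmul x \<subseteq> PH P" "O_mul (nrd s x) = O_mul (\<pi> * \<alpha>)" unfolding A_def LI_def by blast
        have "x \<in> s \<pi> ` H" using x(2) lmul_self PH_principal[OF pi] P_def by blast
        then obtain h where h: "h \<in> H" "x = s \<pi> h" by blast
        have "O_mul (\<pi> * (\<pi> * nrd s h)) = O_mul (\<pi> * \<alpha>)" using x(3) h(2) by (simp add: nrd_scale mult.assoc)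
        hence "O_mul (\<pi> * nrd s h) = O_mul \<alpha>" using O_mul_cong[OF p0] by simp
        hence "\<alpha> \<in> O_mul (\<pi> * nrd s h)" using O_mul_self by metis
        then obtain r where "algebraic_int r" "\<alpha> = \<pi> * (nrd s h * r)" unfolding O_mul_def by (auto simp: mult.assoc)
        hence "\<alpha> \<in> O_mul \<pi>" using O_mulI[of "nrd s h * r" \<pi>] nrd_integral[OF h(1)] by (simp add: algebraic_int_add_mult)
        thus False using False by blast
      qed
      thus ?thesis using False by (simp add: b_def)
    qed
  qed
  show "Z * card (LI \<alpha>) + b = card (LI (\<pi> * \<alpha>)) + b * Z" unfolding e1 e2 bA by simp
qed

text \<open>Left ideals and divisor sums obey the same recurrence at each prime element. The ideal
  \<open>E\<close> stands for the reduced discriminant; the two are compared only through the primes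
  containing them.\<close>

lemma card_LI:
  assumes E: "O_ideal E" and ED: "\<And>P. O_prime P \<Longrightarrow> E \<subseteq> P \<longleftrightarrow> disc s H \<subseteq> P"
    and a: "algebraic_int \<alpha>" "\<alpha> \<noteq> (0::'k)"
  shows "finite (LI \<alpha>) \<and> card (LI \<alpha>) = ideal_sigma E \<alpha>"
proof -
  \<comment> \<open>The recurrence for \<open>\<pi> * c\<close> reaches back to
    \<open>c / \<pi>\<close> as well as to \<open>c\<close>, so the induction carries all divisors
    of \<alpha> at once.\<close>
  have "\<forall>d r. algebraic_int d \<and> algebraic_int r \<and> \<alpha> = d * r \<longrightarrow> finite (LI d) \<and> card (LI d) = ideal_sigma E d"
    using a
  proof (induction \<alpha> rule: integer_induct)
    case (unit u)
    show ?case
    proof (intro allI impI)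
      fix d r assume *: "algebraic_int d \<and> algebraic_int r \<and> u = d * r"
      have "d \<noteq> 0" using * unit by (auto simp: unit_OK_def)
      have e: "inverse d = inverse u * r" using * unit by (auto simp: unit_OK_def field_simps)
      have "algebraic_int (inverse d)" unfolding e using * unit by (simp add: algebraic_int_add_mult unit_OK_def)
      with \<open>d \<noteq> 0\<close> have "unit_OK d" using * by (simp add: unit_OK_def)
      thus "finite (LI d) \<and> card (LI d) = ideal_sigma E d" by (simp add: LI_unit sigma_unit[OF _ E])
    qed
  next
    case (mult \<pi> y)
    define P where "P = O_mul \<pi>"
    note pf = prime_facts[OF mult(1) P_def E]
    note IH = mult(4)[rule_format]
    show ?case
    proof (intro allI impI)
      fix d r assume *: "algebraic_int d \<and> algebraic_int r \<and> \<pi> * y = d * r"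
      show "finite (LI d) \<and> card (LI d) = ideal_sigma E d"
      proof (cases "d \<in> P")
        case False
        obtain r' where r': "algebraic_int r'" "y = d * r'"
          using prime_cofactor[OF mult(1) P_def E, of r d y] * mult(2) False by metis
        thus ?thesis using IH[of d r'] * by blast
      next
        case True
        then obtain c where c: "algebraic_int c" "d = \<pi> * c" unfolding P_def O_mul_def by auto
        have "\<pi> * y = \<pi> * (c * r)" using * c(2) by (simp add: mult.assoc)
        hence y: "y = c * r" using pf(3) by simp
        have c0: "c \<noteq> 0" using y mult(3) by auto
        have IHc: "finite (LI c)" "card (LI c) = ideal_sigma E c" using IH[of c r] c(1) * y by auto
        interpret prime_in_order s H P by unfold_locales (rule pf(1))
        define Z where "Z = card Zs"
        define b where "b = (if c \<in> P then card (LI (c / \<pi>)) else 0)"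
        have rec: "finite (LI d)" "Z * card (LI c) + b = card (LI d) + b * Z"
          using LI_recurrence[OF mult(1) c(1) c0 IHc(1)] unfolding Z_def b_def P_def c(2) by auto
        show ?thesis
        proof (cases "E \<subseteq> P")
          case True
          hence "Z = 1" using ED[OF pf(1)] card_Zs_cases(1) by (simp add: Z_def)
          hence "card (LI d) = card (LI c)" using rec(2) by simp
          thus ?thesis using rec(1) IHc(2) sigma_mult_dvd[OF mult(1) P_def E True c(1) c0] c(2) by simp
        next
          case False
          define N where "N = ideal_norm P"
          have ZN: "Z = N + 1" using False ED[OF pf(1)] card_Zs_cases(2) by (simp add: Z_def N_def)
          have sd: "ideal_sigma E d = tau E P c + N * ideal_sigma E c"
            using sigma_mult_not_dvd[OF mult(1) P_def E False c(1) c0] c(2) by (simp add: N_def)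
          have sc: "ideal_sigma E c = tau E P c + N * b"
          proof (cases "c \<in> P")
            case True
            then obtain c' where c': "algebraic_int c'" "c = \<pi> * c'" unfolding P_def O_mul_def by auto
            have c'0: "c' \<noteq> 0" using c' c0 by auto
            have "y = c' * (\<pi> * r)" using y c'(2) by (simp add: mult_ac)
            moreover have "algebraic_int (\<pi> * r)" using pf(2) * by (simp add: algebraic_int_add_mult)
            ultimately have "card (LI c') = ideal_sigma E c'" using IH[of c' "\<pi> * r"] c'(1) by blast
            hence "b = ideal_sigma E c'" using True c'(2) pf(3) by (simp add: b_def)
            moreover have "ideal_sigma E c = tau E P c' + N * ideal_sigma E c'"
              using sigma_mult_not_dvd[OF mult(1) P_def E False c'(1) c'0] c'(2) by (simp add: N_def)
            ultimately show ?thesis using tau_mult[OF mult(1) P_def E c'(1) c'0] c'(2) by simp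
          next
            case False
            thus ?thesis using sigma_not_dvd[OF mult(1) P_def E c(1) False] by (simp add: b_def)
          qed
          have "card (LI d) + b * (N + 1) = (N + 1) * ideal_sigma E c + b" using rec(2) IHc(2) ZN by simp
          also have "\<dots> = ideal_sigma E d + b * (N + 1)" unfolding sd by (subst (1) distrib_right, subst sc) (simp add: algebra_simps)
          finally show ?thesis using rec(1) by simp
        qed
      qed
    qed
  qed
  thus ?thesis using a by (metis int_imp_algebraic_int Ints_1 mult_1_right)
qed

text \<open>
  Every ideal in \<open>LI \<alpha>\<close> has a generator of norm exactly \<open>\<alpha>\<close> since totally positive units are squares,
  and the generators of norm \<open>\<alpha>\<close> form one orbit of \<open>norm_one s H\<close>.
\<close>

lemma rep_count_H:
  assumes a: "algebraic_int \<alpha>" "totally_positive (\<alpha>::'k)"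
  shows "rep_count s H \<alpha> = card (norm_one s H) * card (LI \<alpha>)"
    "finite (norm_one s H) \<Longrightarrow> finite (LI \<alpha>) \<Longrightarrow> finite {q \<in> H. nrd s q = \<alpha>}"
proof -
  have a0: "\<alpha> \<noteq> 0" using a(2) by (rule totally_positive_nonzero)
  have "\<exists>x. x \<in> H \<and> lmul x = L \<and> nrd s x = \<alpha>" if L: "L \<in> LI \<alpha>" for L
  proof -
    obtain x where x: "x \<in> H" "x \<noteq> 0" "L = lmul x" "O_mul (nrd s x) = O_mul \<alpha>" by (rule LI_E[OF L a0])
    define u where "u = nrd s x / \<alpha>"
    have u: "unit_OK u" unfolding u_def
      using x a(1) a0 nrd_integral[OF x(1)] by (subst O_mul_eq_iff[symmetric]) (auto simp: nrd_eq_0_iff)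
    have "totally_positive u" using nrd_totally_positive[OF x(2)] a(2) unfolding totally_positive_def u_def
      by (simp add: emb_divide)
    then obtain v where v: "unit_OK v" "u = v * v" using totally_positive_unit_is_square[OF u] by blast
    define w where "w = s (inverse v) 1"
    have w: "w \<in> H" unfolding w_def using v(1) by (intro H_scalar) (simp add: unit_OK_def)
    have nw: "nrd s w = inverse v * inverse v" by (simp add: w_def nrd_scalar)
    have uw: "unit_OK (nrd s w)" unfolding nw using v(1) by (intro unit_OK_mult unit_OK_inverse)
    have "v \<noteq> 0" using v(1) by (simp add: unit_OK_def)
    have "nrd s x = v * v * \<alpha>" using v(2) a0 by (simp add: u_def field_simps)
    hence "nrd s (w * x) = \<alpha>" using \<open>v \<noteq> 0\<close> by (simp add: nrd_mult nw field_simps)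
    moreover have "lmul (w * x) = L" unfolding x(3) by (rule lmul_unit[OF w uw])
    ultimately show ?thesis using H_mult[OF w x(1)] by blast
  qed
  then obtain \<rho> where \<rho>: "\<And>L. L \<in> LI \<alpha> \<Longrightarrow> \<rho> L \<in> H" "\<And>L. L \<in> LI \<alpha> \<Longrightarrow> lmul (\<rho> L) = L" "\<And>L. L \<in> LI \<alpha> \<Longrightarrow> nrd s (\<rho> L) = \<alpha>"
    by metis
  have nz: "x \<noteq> 0" if "nrd s x = \<alpha>" for x using that a0 by auto
  have "bij_betw (\<lambda>(u, L). u * \<rho> L) (norm_one s H \<times> LI \<alpha>) {q \<in> H. nrd s q = \<alpha>}"
    unfolding bij_betw_def
  proof
    show "inj_on (\<lambda>(u, L). u * \<rho> L) (norm_one s H \<times> LI \<alpha>)"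
    proof (rule inj_onI)
      fix p p' assume p: "p \<in> norm_one s H \<times> LI \<alpha>" "p' \<in> norm_one s H \<times> LI \<alpha>"
        and e: "(case p of (u, L) \<Rightarrow> u * \<rho> L) = (case p' of (u, L) \<Rightarrow> u * \<rho> L)"
      obtain u L where pe: "p = (u, L)" by (cases p)
      obtain u' L' where pe': "p' = (u', L')" by (cases p')
      have m: "u \<in> H" "nrd s u = 1" "L \<in> LI \<alpha>" "u' \<in> H" "nrd s u' = 1" "L' \<in> LI \<alpha>"
        using p unfolding pe pe' norm_one_def by auto
      have e': "u * \<rho> L = u' * \<rho> L'" using e by (simp add: pe pe')
      have "L = lmul (u * \<rho> L)" using lmul_unit[OF m(1)] m(2) \<rho>(2)[OF m(3)] by (simp add: unit_OK_1)
      moreover have "L' = lmul (u' * \<rho> L')" using lmul_unit[OF m(4)] m(5) \<rho>(2)[OF m(6)] by (simp add: unit_OK_1)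
      ultimately have LL: "L = L'" using e' by simp
      hence "u = u'" using e' quat_mult_cancel_right[OF nz[OF \<rho>(3)[OF m(3)]]] by simp
      thus "p = p'" using LL by (simp add: pe pe')
    qed
    show "(\<lambda>(u, L). u * \<rho> L) ` (norm_one s H \<times> LI \<alpha>) = {q \<in> H. nrd s q = \<alpha>}"
    proof (intro equalityI subsetI)
      fix q assume "q \<in> (\<lambda>(u, L). u * \<rho> L) ` (norm_one s H \<times> LI \<alpha>)"
      then obtain u L where "q = u * \<rho> L" "u \<in> H" "nrd s u = 1" "L \<in> LI \<alpha>" unfolding norm_one_def by auto
      thus "q \<in> {q \<in> H. nrd s q = \<alpha>}" using \<rho> by (auto simp: nrd_mult intro: H_mult)
    next
      fix q assume "q \<in> {q \<in> H. nrd s q = \<alpha>}"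
      hence q: "q \<in> H" "nrd s q = \<alpha>" by auto
      define L where "L = lmul q"
      have L: "L \<in> LI \<alpha>" unfolding LI_def L_def using q by blast
      have "q \<in> lmul (\<rho> L)" unfolding \<rho>(2)[OF L] unfolding L_def by (rule lmul_self)
      then obtain u where u: "u \<in> H" "q = u * \<rho> L" unfolding lmul_def by blast
      have "nrd s u * \<alpha> = 1 * \<alpha>" using q(2) u(2) \<rho>(3)[OF L] by (simp add: nrd_mult)
      hence "nrd s u = 1" using a0 by simp
      hence "u \<in> norm_one s H" using u(1) by (simp add: norm_one_def)
      thus "q \<in> (\<lambda>(u, L). u * \<rho> L) ` (norm_one s H \<times> LI \<alpha>)" using u(2) L by (auto intro!: image_eqI[of _ _ "(u, L)"])
    qed
  qed
  note b = this
  have "card (norm_one s H \<times> LI \<alpha>) = card {q \<in> H. nrd s q = \<alpha>}" using b by (rule bij_betw_same_card)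
  thus "rep_count s H \<alpha> = card (norm_one s H) * card (LI \<alpha>)" by (simp add: rep_count_def card_cartesian_product)
  show "finite {q \<in> H. nrd s q = \<alpha>}" if "finite (norm_one s H)" "finite (LI \<alpha>)"
    using bij_betw_finite[OF b] that by simp
qed

end

subsection \<open>Suborders of prime index\<close>

lemma ideal_list_prod_Cons: "ideal_list_prod (I # Is) = ideal_prod OK I (ideal_list_prod Is)"
  by (simp add: ideal_list_prod_def)

lemma O_ideal_prod: "O_ideal I \<Longrightarrow> O_ideal J \<Longrightarrow> O_ideal (ideal_prod OK I J)"
  unfolding O_ideal_iff using ring.ideal_prod_is_ideal[OF cring.axioms(1)[OF cring_OK]] by blast

lemma O_ideal_Oring: "O_ideal (Oring :: 'k::field_char_0 set)"
  by (auto simp: O_ideal_def algebraic_int_add_mult)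

lemma O_ideal_list_prod: "\<forall>I\<in>set Is. O_ideal I \<Longrightarrow> O_ideal (ideal_list_prod Is)"
  by (induction Is) (simp_all add: ideal_list_prod_Cons O_ideal_prod, simp add: ideal_list_prod_def O_ideal_Oring)

lemma ideal_prod_subset:
  assumes "O_ideal I" "O_ideal J" shows "ideal_prod OK I J \<subseteq> I" "ideal_prod OK I J \<subseteq> J"
  using ring.ideal_prod_inter[OF cring.axioms(1)[OF cring_OK]] assms O_ideal_iff by blast+

lemma ideal_prod_mono:
  assumes "J \<subseteq> J'" shows "ideal_prod OK I J \<subseteq> ideal_prod OK I J'"
proof
  fix x assume "x \<in> ideal_prod OK I J"
  thus "x \<in> ideal_prod OK I J'"
  proof (induction rule: ideal_prod.induct)
    case (prod i j)
    from ideal_prod.prod[OF prod(1) subsetD[OF assms prod(2)]] show ?case .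
  next
    case (sum x y)
    from ideal_prod.sum[OF sum(3,4)] show ?case .
  qed
qed

lemma ideal_list_prod_subset_nth:
  assumes "\<forall>I\<in>set Is. O_ideal I" "n < length Is" shows "ideal_list_prod Is \<subseteq> Is ! n"
  using assms
proof (induction Is arbitrary: n)
  case (Cons I Is)
  hence i: "O_ideal I" "O_ideal (ideal_list_prod Is)" using O_ideal_list_prod by auto
  show ?case
  proof (cases n)
    case 0 thus ?thesis using ideal_prod_subset(1)[OF i] by (simp add: ideal_list_prod_Cons)
  next
    case (Suc m)
    hence "ideal_list_prod Is \<subseteq> Is ! m" using Cons by simp
    thus ?thesis using Suc ideal_prod_subset(2)[OF i] by (auto simp: ideal_list_prod_Cons)
  qed
qed simp

text \<open>Two factors are kept apart so that, when one of them is the prime product itself, the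
  other can be shown to be trivial by cancellation.\<close>

lemma ideal_list_prod_subset_nth_nth:
  assumes "\<forall>I\<in>set Is. O_ideal I" "m < n" "n < length Is"
  shows "ideal_list_prod Is \<subseteq> ideal_prod OK (Is ! m) (Is ! n)"
  using assms
proof (induction Is arbitrary: m n)
  case (Cons I Is)
  hence i: "O_ideal I" "O_ideal (ideal_list_prod Is)" using O_ideal_list_prod by auto
  obtain n' where n': "n = Suc n'" using Cons.prems by (cases n) auto
  show ?case
  proof (cases m)
    case 0
    have "ideal_list_prod Is \<subseteq> Is ! n'" using Cons.prems n' by (intro ideal_list_prod_subset_nth) auto
    thus ?thesis using 0 n' ideal_prod_mono by (simp add: ideal_list_prod_Cons)
  next
    case (Suc m')
    hence "ideal_list_prod Is \<subseteq> ideal_prod OK (Is ! m') (Is ! n')" using Cons n' by simp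
    thus ?thesis using Suc n' ideal_prod_subset(2)[OF i] by (auto simp: ideal_list_prod_Cons)
  qed
qed simp

lemma prime_ideal_list_prod:
  assumes P: "O_prime P" and Is: "\<forall>I\<in>set Is. O_ideal I" "ideal_list_prod Is \<subseteq> P"
  shows "\<exists>I\<in>set Is. I \<subseteq> P"
  using Is
proof (induction Is)
  case Nil
  thus ?case using O_primeD(2)[OF P] by (auto simp: ideal_list_prod_def int_imp_algebraic_int)
next
  case (Cons I Is)
  show ?case
  proof (cases "I \<subseteq> P")
    case False
    then obtain x where x: "x \<in> I" "x \<notin> P" by blast
    have "O_ideal I" "O_ideal (ideal_list_prod Is)" using Cons.prems O_ideal_list_prod by auto
    note i = O_idealD(2)[OF this(1)] O_idealD(2)[OF this(2)]
    have "y \<in> P" if y: "y \<in> ideal_list_prod Is" for y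
    proof -
      have "x * y \<in> ideal_list_prod (I # Is)" using ideal_prod.prod[OF x(1) y, of OK] by (simp add: ideal_list_prod_Cons)
      hence "x * y \<in> P" using Cons.prems(2) by blast
      thus ?thesis using O_primeD(3)[OF P i(1)[OF x(1)] i(2)[OF y]] x(2) by blast
    qed
    hence "ideal_list_prod Is \<subseteq> P" by blast
    thus ?thesis using Cons by auto
  qed auto
qed

lemma ideal_prod_principal_cancel:
  assumes d: "d \<noteq> 0" "algebraic_int d" and J: "O_ideal J" and sub: "O_mul d \<subseteq> ideal_prod OK (O_mul d) J"
  shows "1 \<in> J"
proof -
  have "x \<in> (\<lambda>j. d * j) ` J" if "x \<in> ideal_prod OK (O_mul d) J" for x
    using that
  proof (induction rule: ideal_prod.induct)
    case (prod i j)
    then obtain r where r: "algebraic_int r" "i = d * r" unfolding O_mul_def by auto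
    have "r * j \<in> J" using O_idealD(5)[OF J r(1) prod(2)] .
    thus ?case by (intro image_eqI[of _ _ "r * j"]) (simp_all add: r(2) mult.assoc)
  next
    case (sum x y)
    then obtain a b where "x = d * a" "a \<in> J" "y = d * b" "b \<in> J" by blast
    thus ?case using O_idealD(4)[OF J] by (intro image_eqI[of _ _ "a + b"]) (simp_all add: distrib_left)
  qed
  hence "d \<in> (\<lambda>j. d * j) ` J" using sub O_mul_self by blast
  thus ?thesis using d by auto
qed

context class_one_order
begin

text \<open>Some factor lies in \<open>P\<close> and also contains the product \<open>P\<close>,
  hence equals it. Any other factor \<open>I\<close> then satisfies
  \<open>P \<subseteq> P I\<close>, and cancelling a generator of \<open>P\<close> puts 1 into
  \<open>I\<close>.\<close>

lemma prime_factorization_trivial: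
  assumes P: "O_prime (P :: 'k set)" and Is: "\<forall>I\<in>set Is. O_ideal I" "P = ideal_list_prod Is"
  obtains k where "k < length Is" "Is ! k = P" "\<And>n. n < length Is \<Longrightarrow> n \<noteq> k \<Longrightarrow> Is ! n = Oring"
proof -
  obtain \<pi> where \<pi>: "P = O_mul \<pi>" "algebraic_int \<pi>" "totally_positive \<pi>" by (rule prime_generator[OF P])
  have p0: "\<pi> \<noteq> 0" using \<pi>(3) totally_positive_nonzero by blast
  obtain I where I: "I \<in> set Is" "I \<subseteq> P" using prime_ideal_list_prod[OF P Is(1)] Is(2) by blast
  then obtain k where k: "k < length Is" "Is ! k = I" by (metis in_set_conv_nth)
  have kP: "Is ! k = P" using ideal_list_prod_subset_nth[OF Is(1) k(1)] I(2) k(2) Is(2) by blast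
  have "Is ! n = Oring" if n: "n < length Is" "n \<noteq> k" for n
  proof -
    have In: "O_ideal (Is ! n)" using Is(1) n(1) by simp
    have "P \<subseteq> ideal_prod OK P (Is ! n)"
    proof (cases "k < n")
      case True
      thus ?thesis using ideal_list_prod_subset_nth_nth[OF Is(1) True n(1)] kP Is(2) by simp
    next
      case False
      hence "n < k" using n(2) by simp
      hence "P \<subseteq> ideal_prod OK (Is ! n) P" using ideal_list_prod_subset_nth_nth[OF Is(1) _ k(1)] kP Is(2) by metis
      moreover have "ideal_prod OK (Is ! n) P = ideal_prod OK P (Is ! n)"
        using In O_primeD(1)[OF P] O_ideal_iff by (intro cring.ideal_prod_commute[OF cring_OK]) auto
      ultimately show ?thesis by simp
    qed
    hence one: "1 \<in> Is ! n" using ideal_prod_principal_cancel[OF p0 \<pi>(2) In] \<pi>(1) by simp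
    have "x \<in> Is ! n" if "algebraic_int x" for x using O_idealD(5)[OF In that one] by simp
    thus ?thesis using O_idealD(1)[OF In] by blast
  qed
  thus ?thesis using that[OF k(1) kP] by blast
qed

end

locale prime_suborder = prime_in_order s H P
  for s :: "'k::field_char_0 \<Rightarrow> 'a::ring_1 \<Rightarrow> 'a" and H :: "'a set" and P :: "'k set" +
  fixes G :: "'a set"
  assumes G_order: "quat_order s G" and GH: "G \<subseteq> H" and index: "is_OK_index s H G P"
    and perc: "perceptive s H G" and split: "\<not> disc s H \<subseteq> P"
begin

sublocale G: quaternion_order s G by unfold_locales (rule G_order)

lemma coset_eq_iff: "add_coset G x = add_coset G y \<longleftrightarrow> x - y \<in> G"
proof
  assume "add_coset G x = add_coset G y"
  moreover have "x \<in> add_coset G x" unfolding add_coset_def using G.H_0 by (auto intro!: image_eqI[of _ _ 0])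
  ultimately obtain g where "g \<in> G" "x = y + g" unfolding add_coset_def by blast
  thus "x - y \<in> G" by simp
next
  assume d: "x - y \<in> G"
  have 1: "add_coset G x \<subseteq> add_coset G y" if "x - y \<in> G" for x y
  proof
    fix z assume "z \<in> add_coset G x"
    then obtain g where "g \<in> G" "z = x + g" unfolding add_coset_def by blast
    hence "z = y + (x - y + g)" "x - y + g \<in> G" using that G.H_add by auto
    thus "z \<in> add_coset G y" unfolding add_coset_def by blast
  qed
  show "add_coset G x = add_coset G y"
    using 1[OF d] 1[of y x] G.H_minus[OF d] by (simp add: subset_antisym)
qed

text \<open>Since the index is prime, all summands but one are zero, so \<open>H / G\<close> is a
  copy of the residue field of \<open>P\<close>: it is killed by \<open>P\<close> and generated by
  one class.\<close>

lemma quotient_structure: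
  shows "p \<in> P \<Longrightarrow> x \<in> H \<Longrightarrow> s p x \<in> G"
    and "\<exists>h0\<in>H. h0 \<notin> G \<and> (\<forall>x\<in>H. \<exists>r. algebraic_int r \<and> x - s r h0 \<in> G)"
proof -
  obtain Is \<Phi> where Is: "\<forall>I\<in>set Is. ideal I OK" "P = ideal_list_prod Is"
    and bij: "bij_betw \<Phi> (add_coset G ` H) (\<Pi>\<^sub>E n\<in>{..<length Is}. carrier (OK Quot (Is ! n)))"
    and sc: "\<And>r x n. r \<in> carrier OK \<Longrightarrow> x \<in> H \<Longrightarrow> n < length Is \<Longrightarrow>
      \<Phi> (add_coset G (s r x)) n = ((Is ! n) +>\<^bsub>OK\<^esub> r) \<otimes>\<^bsub>OK Quot (Is ! n)\<^esub> \<Phi> (add_coset G x) n"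
    using index unfolding is_OK_index_def by blast
  have IsO: "\<forall>I\<in>set Is. O_ideal I" using Is(1) O_ideal_iff by blast
  obtain k where k: "k < length Is" "Is ! k = P" "\<And>n. n < length Is \<Longrightarrow> n \<noteq> k \<Longrightarrow> Is ! n = Oring"
    using prime_factorization_trivial[OF P IsO Is(2)] by blast
  have car: "\<Phi> (add_coset G x) n \<in> carrier (OK Quot (Is ! n))" if "x \<in> H" "n < length Is" for x n
    using bij_betwE[OF bij] that by (auto simp: PiE_iff)
  have id: "ideal P OK" using PD(1) O_ideal_iff by blast
  interpret RP: ideal P "OK :: 'k ring" by (rule id)
  interpret Q: ring "OK Quot P" by (rule RP.quotient_is_ring)
  have hom: "(+>\<^bsub>OK\<^esub>) P \<in> ring_hom OK (OK Quot P)" by (rule RP.rcos_ring_hom)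
  have triv: "a = b" if ab: "a \<in> carrier (OK Quot (Is ! n))" "b \<in> carrier (OK Quot (Is ! n))" and n: "n < length Is" "n \<noteq> k" for a b n
  proof -
    obtain x y where "algebraic_int x" "algebraic_int y" "a = Oring +>\<^bsub>OK\<^esub> x" "b = Oring +>\<^bsub>OK\<^esub> y"
      using ab unfolding k(3)[OF n] OK_Quot_carrier by auto
    thus ?thesis using OK_coset_eq_iff[OF O_ideal_Oring, of x y] by (simp add: algebraic_int_diff)
  qed
  have eqI: "x - y \<in> G" if x: "x \<in> H" and y: "y \<in> H" and e: "\<Phi> (add_coset G x) k = \<Phi> (add_coset G y) k" for x y
  proof -
    have "\<Phi> (add_coset G x) n = \<Phi> (add_coset G y) n" if n: "n < length Is" for n
      using triv[OF car[OF x n] car[OF y n] n] e by (cases "n = k") auto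
    moreover have "\<Phi> (add_coset G x) \<in> (\<Pi>\<^sub>E n\<in>{..<length Is}. carrier (OK Quot (Is ! n)))"
      "\<Phi> (add_coset G y) \<in> (\<Pi>\<^sub>E n\<in>{..<length Is}. carrier (OK Quot (Is ! n)))"
      using bij_betwE[OF bij] x y by auto
    ultimately have "\<Phi> (add_coset G x) = \<Phi> (add_coset G y)" by (intro PiE_ext) auto
    hence "add_coset G x = add_coset G y" using bij x y unfolding bij_betw_def inj_on_def by blast
    thus ?thesis by (simp add: coset_eq_iff)
  qed
  have sck: "\<Phi> (add_coset G (s r x)) k = (P +>\<^bsub>OK\<^esub> r) \<otimes>\<^bsub>OK Quot P\<^esub> \<Phi> (add_coset G x) k"
    if "algebraic_int r" "x \<in> H" for r x
    using sc[of r x k] that k by simp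
  have zero: "P +>\<^bsub>OK\<^esub> p = \<zero>\<^bsub>OK Quot P\<^esub>" if "p \<in> P" for p
  proof -
    have "P +>\<^bsub>OK\<^esub> p = P +>\<^bsub>OK\<^esub> 0" using that PI(2)[OF that] by (subst OK_coset_eq_iff[OF PD(1)]) auto
    also have "\<dots> = \<zero>\<^bsub>OK Quot P\<^esub>"
      using ring_hom_zero[OF hom cring.axioms(1)[OF cring_OK] Q.ring_axioms] by simp
    finally show ?thesis .
  qed
  have sz: "\<Phi> (add_coset G (s p x)) k = \<zero>\<^bsub>OK Quot P\<^esub>" if "p \<in> P" "x \<in> H" for p x
    using sck[OF PI(2)[OF that(1)] that(2)] zero[OF that(1)] car[OF that(2) k(1)] k(2) by simp
  show "s p x \<in> G" if p: "p \<in> P" and x: "x \<in> H" for p x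
  proof -
    have "\<Phi> (add_coset G (s p x)) k = \<Phi> (add_coset G (s 0 x)) k"
      by (simp only: sz[OF p x] sz[OF PI(3) x])
    hence "s p x - s 0 x \<in> G" by (rule eqI[OF H_scale[OF PI(2)[OF p] x] H_scale[OF PI(2)[OF PI(3)] x]])
    thus ?thesis by simp
  qed
  \<comment> \<open>The family of unit classes; its preimage \<open>h0\<close> generates
    \<open>H / G\<close>, since component \<open>k\<close> of it is the unit of the residue
    field.\<close>
  define c where "c = (\<lambda>n\<in>{..<length Is}. (Is ! n) +>\<^bsub>OK\<^esub> (1::'k))"
  have one: "(1::'k) \<in> Oring" by (simp add: int_imp_algebraic_int)
  have "c \<in> (\<Pi>\<^sub>E n\<in>{..<length Is}. carrier (OK Quot (Is ! n)))" unfolding c_def OK_Quot_carrier using one by auto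
  hence "c \<in> \<Phi> ` add_coset G ` H" unfolding bij_betw_imp_surj_on[OF bij] .
  then obtain h0 where h0: "h0 \<in> H" "\<Phi> (add_coset G h0) = c" by blast
  have ck: "\<Phi> (add_coset G h0) k = P +>\<^bsub>OK\<^esub> 1" using h0(2) k by (simp add: c_def)
  have "h0 \<notin> G"
  proof
    assume "h0 \<in> G"
    hence "add_coset G h0 = add_coset G (s 0 h0)" by (simp add: coset_eq_iff)
    hence "P +>\<^bsub>OK\<^esub> 1 = \<zero>\<^bsub>OK Quot P\<^esub>" using sz[OF PI(3) h0(1)] ck by simp
    hence "P +>\<^bsub>OK\<^esub> 1 = P +>\<^bsub>OK\<^esub> 0" using zero[OF PI(3)] by simp
    hence "1 - 0 \<in> P" using one by (subst (asm) OK_coset_eq_iff[OF PD(1)]) auto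
    thus False using PD(2) by simp
  qed
  moreover have "\<exists>r. algebraic_int r \<and> x - s r h0 \<in> G" if x: "x \<in> H" for x
  proof -
    obtain r where r: "algebraic_int r" "\<Phi> (add_coset G x) k = P +>\<^bsub>OK\<^esub> r"
      using car[OF x k(1)] unfolding k(2) OK_Quot_carrier by auto
    have "\<Phi> (add_coset G (s r h0)) k = (P +>\<^bsub>OK\<^esub> r) \<otimes>\<^bsub>OK Quot P\<^esub> (P +>\<^bsub>OK\<^esub> 1)"
      using sck[OF r(1) h0(1)] ck by simp
    also have "\<dots> = P +>\<^bsub>OK\<^esub> r" using ring_hom_mult[OF hom, of r 1] r(1) one by simp
    finally have "\<Phi> (add_coset G x) k = \<Phi> (add_coset G (s r h0)) k" by (simp only: r(2))
    hence "x - s r h0 \<in> G" by (rule eqI[OF x H_scale[OF r(1) h0(1)]])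
    thus ?thesis using r(1) by blast
  qed
  ultimately show "\<exists>h0\<in>H. h0 \<notin> G \<and> (\<forall>x\<in>H. \<exists>r. algebraic_int r \<and> x - s r h0 \<in> G)" using h0(1) by blast
qed

lemma PH_sub_G: assumes "x \<in> PH P" shows "x \<in> G"
  using PD(1) assms by (induction x rule: PH_induct) (auto intro: G.H_0 G.H_add quotient_structure(1))

text \<open>There are at least two members, hence matrix units with \<open>e\<close> in
  \<open>J\<close>. A two-sided \<open>J\<close> would contain \<open>v * e * u\<close>, which is
  congruent to \<open>1 - e\<close>, and therefore 1.\<close>

lemma Zs_not_two_sided:
  assumes J: "J \<in> Zs" shows "\<exists>j\<in>J. \<exists>h\<in>H. j * h \<notin> J"
proof (rule ccontr)
  assume c: "\<not> ?thesis"
  have two: "j * h \<in> J" if "j \<in> J" "h \<in> H" for j h using c that by blast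
  have "ideal_norm P > 0" using ideal_norm_pos[OF nf PD(1)] PD(4) by blast
  hence "card Zs \<noteq> 1" using card_Zs_cases(2)[OF split] by simp
  hence "Zs \<noteq> {J}" by auto
  then obtain J' where J': "J' \<in> Zs" "J \<noteq> J'" using J by blast
  obtain e u v where M: "munits e u v" "e \<in> J" using munits_exist[OF J J'] by metis
  note mH = mH[OF M(1)]
  have "v * e * u \<in> J" using left_idealD(4)[OF ZsD(1)[OF J] mH(3) M(2)] mH(2) by (rule two)
  moreover have "cg (v * e * u) (1 - e)" using cg_rmult[OF mm(4)[OF M(1)] mH(2)] mm(7)[OF M(1)] by (rule cg_trans)
  ultimately have "1 - e \<in> J" using cg_mem_Zs[OF _ J] by blast
  hence "1 - e + e \<in> J" using M(2) by (rule left_idealD(3)[OF ZsD(1)[OF J]])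
  thus False using ZsD(5)[OF J] by simp
qed

text \<open>
  The largest left ideal of \<open>H\<close> inside \<open>G\<close> lies in \<open>Zs\<close>, and \<open>G\<close> is its right idealizer: \<open>G\<close> is an
  Eichler order.
\<close>

definition J0 :: "'a set" where "J0 = {g \<in> H. \<forall>h\<in>H. h * g \<in> G}"

lemma J0_sub: "J0 \<subseteq> G" unfolding J0_def using H_1 by (auto dest!: bspec[of _ _ 1])

text \<open>Right multiplication by \<open>g\<close> in \<open>G\<close> acts on the line
  \<open>H / G\<close> by a scalar \<open>r\<close>, and \<open>g - r\<close> lies in
  \<open>J0\<close>; so \<open>G\<close> consists of scalars modulo \<open>J0\<close>. If
  \<open>J0\<close> were only \<open>P H\<close>, then \<open>h0\<close> and 1 would generate
  \<open>H\<close> modulo \<open>P H\<close>, which is too large for that.\<close>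

lemma J0_Zs: "J0 \<in> Zs"
proof -
  obtain h0 where h0: "h0 \<in> H" "h0 \<notin> G" "\<And>x. x \<in> H \<Longrightarrow> \<exists>r. algebraic_int r \<and> x - s r h0 \<in> G"
    using quotient_structure(2) by blast
  have li: "left_ideal J0"
    unfolding left_ideal_def
  proof (intro conjI ballI)
    show "J0 \<subseteq> H" "0 \<in> J0" using H_0 G.H_0 by (auto simp: J0_def)
    show "x + y \<in> J0" if "x \<in> J0" "y \<in> J0" for x y
      using that H_add G.H_add by (auto simp: J0_def distrib_left)
    show "h * x \<in> J0" if "h \<in> H" "x \<in> J0" for h x
      using that H_mult by (auto simp: J0_def mult.assoc[symmetric])
  qed
  have sub: "PH P \<subseteq> J0" unfolding J0_def using PH_sub[OF PD(1)] PH_sub_G PH_lmult[OF PD(1)] by auto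
  have nH: "J0 \<noteq> H" using J0_sub h0 by blast
  have gJ: "\<exists>r. algebraic_int r \<and> g - s r 1 \<in> J0" if g: "g \<in> G" for g
  proof -
    have gH: "g \<in> H" using g GH by blast
    obtain r where r: "algebraic_int r" "h0 * g - s r h0 \<in> G" using h0(3)[OF H_mult[OF h0(1) gH]] by blast
    have r1: "g - s r 1 \<in> G" using g r(1) by (intro G.H_diff G.H_scalar)
    have "h * (g - s r 1) \<in> G" if h: "h \<in> H" for h
    proof -
      obtain t where t: "algebraic_int t" "h - s t h0 \<in> G" using h0(3)[OF h] by blast
      have "(h - s t h0) * (g - s r 1) + s t (h0 * g - s r h0) \<in> G"
        using t r r1 by (intro G.H_add G.H_mult G.H_scale)
      moreover have "(h - s t h0) * (g - s r 1) + s t (h0 * g - s r h0) = h * (g - s r 1)"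
        by (simp add: algebra_simps scale_mult_left scale_mult_right scale_right_diff_distrib)
      ultimately show ?thesis by simp
    qed
    moreover have "g - s r 1 \<in> H" using r1 GH by blast
    ultimately show ?thesis using r(1) unfolding J0_def by blast
  qed
  have "J0 \<noteq> PH P"
  proof
    assume e: "J0 = PH P"
    obtain w where w: "w \<in> H" "\<And>a b. algebraic_int a \<Longrightarrow> algebraic_int b \<Longrightarrow> w - (s a h0 + s b 1) \<notin> PH P"
      using ex_not_in_residue_plane[OF P, of h0 1] by metis
    obtain a where a: "algebraic_int a" "w - s a h0 \<in> G" using h0(3)[OF w(1)] by blast
    obtain b where b: "algebraic_int b" "w - s a h0 - s b 1 \<in> J0" using gJ[OF a(2)] by blast
    show False using w(2)[OF a(1) b(1)] b(2) e by (simp add: algebra_simps)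
  qed
  thus ?thesis unfolding Zs_def using li sub nH by blast
qed

lemmas J0L = left_idealD[OF ZsD(1)[OF J0_Zs]]

text \<open>Products of \<open>J0\<close> with \<open>G\<close> stay in \<open>J0\<close> because
  \<open>G\<close> is closed under multiplication. Conversely, an element outside \<open>G\<close>
  that stabilizes \<open>J0\<close> generates \<open>H / G\<close>; then all of \<open>H\<close>
  would stabilize \<open>J0\<close>, making it two-sided.\<close>

lemma mem_G_iff: assumes x: "x \<in> H" shows "x \<in> G \<longleftrightarrow> (\<forall>j\<in>J0. j * x \<in> J0)"
proof
  assume g: "x \<in> G"
  have "j * x \<in> J0" if j: "j \<in> J0" for j
  proof -
    have "h * (j * x) \<in> G" if "h \<in> H" for h
      using j that g G.H_mult[of "h * j" x] by (auto simp: J0_def mult.assoc)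
    thus ?thesis using j x H_mult by (auto simp: J0_def)
  qed
  thus "\<forall>j\<in>J0. j * x \<in> J0" by blast
next
  assume r: "\<forall>j\<in>J0. j * x \<in> J0"
  obtain h0 where h0: "h0 \<in> H" "h0 \<notin> G" "\<And>x. x \<in> H \<Longrightarrow> \<exists>r. algebraic_int r \<and> x - s r h0 \<in> G"
    using quotient_structure(2) by blast
  show "x \<in> G"
  proof (rule ccontr)
    assume nx: "x \<notin> G"
    obtain t where t: "algebraic_int t" "x - s t h0 \<in> G" using h0(3)[OF x] by blast
    have tP: "t \<notin> P"
    proof
      assume "t \<in> P"
      hence "s t h0 \<in> G" using h0(1) by (rule quotient_structure(1))
      hence "x - s t h0 + s t h0 \<in> G" using t(2) by (intro G.H_add)
      thus False using nx by simp
    qed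
    have Gst: "j * g \<in> J0" if j: "j \<in> J0" and g: "g \<in> G" for j g
    proof -
      have "h * (j * g) \<in> G" if "h \<in> H" for h
        using j that g G.H_mult[of "h * j" g] by (auto simp: J0_def mult.assoc)
      thus ?thesis using j g GH H_mult by (auto simp: J0_def)
    qed
    have h0s: "j * h0 \<in> J0" if j: "j \<in> J0" for j
    proof -
      have "j * x - j * (x - s t h0) \<in> J0" using r j Gst[OF j t(2)] by (intro J0L(7)) auto
      hence "s t (j * h0) \<in> J0" by (simp add: right_diff_distrib scale_mult_right)
      thus ?thesis using Zs_cancel_scale[OF J0_Zs t(1) tP] H_mult J0L(1) j h0(1) by blast
    qed
    have "j * h \<in> J0" if j: "j \<in> J0" and h: "h \<in> H" for j h
    proof -
      obtain q where q: "algebraic_int q" "h - s q h0 \<in> G" using h0(3)[OF h] by blast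
      have "j * (h - s q h0) + s q (j * h0) \<in> J0" using Gst[OF j q(2)] J0L(5)[OF q(1) h0s[OF j]] by (rule J0L(3))
      thus ?thesis by (simp add: right_diff_distrib scale_mult_right)
    qed
    thus False using Zs_not_two_sided[OF J0_Zs] by blast
  qed
qed

section \<open>The action of \<open>norm_one s H\<close> on \<open>Zs\<close>\<close>

text \<open>Over the residue field \<open>J0\<close> is the left annihilator of a line in the column
  space; for \<open>x\<close> outside \<open>J0\<close> this is the annihilator of the image of that
  line under \<open>x\<close>.\<close>

definition colon :: "'a \<Rightarrow> 'a set" where "colon x = {z \<in> H. z * x \<in> J0}"

text \<open>A member outside \<open>P H\<close> is exhibited: \<open>cj x\<close> if the norm of
  \<open>x\<close> lies in \<open>P\<close>, since \<open>cj x * x\<close> is that norm; otherwise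
  \<open>y * cj x\<close> with \<open>y\<close> in \<open>J0\<close> outside
  \<open>P H\<close>.\<close>

lemma colon_Zs: assumes x: "x \<in> H" "x \<notin> J0" shows "colon x \<in> Zs"
proof -
  have li: "left_ideal (colon x)"
    unfolding left_ideal_def colon_def using H_0 H_add H_mult J0L(2,3,4) by (auto simp: distrib_right mult.assoc)
  have sub: "PH P \<subseteq> colon x"
    unfolding colon_def using PH_sub[OF PD(1)] PH_rmult[OF PD(1) _ x(1)] ZsD(6)[OF J0_Zs] by blast
  have "1 \<notin> colon x" using x(2) by (simp add: colon_def)
  hence nH: "colon x \<noteq> H" using H_1 by blast
  have n: "nrd s x \<in> P \<Longrightarrow> cj x \<in> colon x"
    using PH_base[of "nrd s x" P 1] H_1 H_cj[OF x(1)] ZsD(6)[OF J0_Zs] by (simp add: colon_def cj_mult_self)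
  have "colon x \<noteq> PH P"
  proof
    assume e: "colon x = PH P"
    show False
    proof (cases "nrd s x \<in> P")
      case True
      hence "cj x \<in> PH P" using n e by simp
      hence "cj (cj x) \<in> PH P" by (rule PH_cj[OF PD(1)])
      thus False using x(2) ZsD(6)[OF J0_Zs] by simp
    next
      case False
      obtain y where y: "y \<in> J0" "y \<notin> PH P" using ZsD(2,3)[OF J0_Zs] by blast
      have yH: "y \<in> H" using y(1) J0L(1) by blast
      have nx: "(y * cj x) * x = s (nrd s x) y" by (simp add: mult.assoc cj_mult_self scalar_mult)
      have "y * cj x \<in> colon x" unfolding colon_def
        using H_mult[OF yH H_cj[OF x(1)]] J0L(5)[OF nrd_integral[OF x(1)] y(1)] nx by simp
      hence "(y * cj x) * x \<in> PH P" unfolding e by (rule PH_rmult[OF PD(1) _ x(1)])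
      hence "s (nrd s x) y \<in> PH P" using nx by simp
      thus False using PH_cancel_scale[OF P nrd_integral[OF x(1)] False yH] y(2) by blast
    qed
  qed
  thus ?thesis unfolding Zs_def using li sub nH by blast
qed

lemma norm_oneD: "u \<in> norm_one s H \<Longrightarrow> u \<in> H \<and> nrd s u = 1 \<and> cj u \<in> norm_one s H \<and> u * cj u = 1 \<and> cj u * u = 1"
  by (auto simp: norm_one_def H_cj mult_cj cj_mult_self)

lemma norm_one_mult: "u \<in> norm_one s H \<Longrightarrow> v \<in> norm_one s H \<Longrightarrow> u * v \<in> norm_one s H"
  by (auto simp: norm_one_def H_mult nrd_mult)

definition act :: "'a \<Rightarrow> 'a set" where "act u = (\<lambda>j. j * u) ` J0"

lemma act_Zs: assumes u: "u \<in> norm_one s H" shows "act u \<in> Zs"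
proof -
  obtain y where y: "y \<in> H" "J0 = lmul y" "P = O_mul (nrd s y)" using Zs_generator[OF J0_Zs] by metis
  have "act u = lmul (y * u)" unfolding act_def y(2) lmul_def by (simp add: image_image mult.assoc)
  moreover have "y * u \<in> H" using y(1) norm_oneD[OF u] H_mult by blast
  moreover have "P = O_mul (nrd s (y * u))" using y(3) norm_oneD[OF u] by (simp add: nrd_mult)
  ultimately show ?thesis using lmul_in_Zs by simp
qed

text \<open>By the idealizer description \<open>u * x \<in> G\<close> means that \<open>J0 u\<close>
  is contained in \<open>colon x\<close>, and an inclusion between members of \<open>Zs\<close> is
  an equality.\<close>

lemma mult_mem_G_iff:
  assumes u: "u \<in> norm_one s H" and x: "x \<in> H" "x \<notin> J0"
  shows "u * x \<in> G \<longleftrightarrow> act u = colon x"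
proof -
  have uH: "u \<in> H" using norm_oneD[OF u] by blast
  have "u * x \<in> G \<longleftrightarrow> (\<forall>j\<in>J0. j * u * x \<in> J0)" using mem_G_iff[OF H_mult[OF uH x(1)]] by (simp add: mult.assoc)
  also have "\<dots> \<longleftrightarrow> act u \<subseteq> colon x" unfolding act_def colon_def using J0L(1) H_mult uH by auto
  also have "\<dots> \<longleftrightarrow> act u = colon x" using Zs_minimal[OF act_Zs[OF u] colon_Zs[OF x]] by blast
  finally show ?thesis .
qed

text \<open>For a generator \<open>y\<close> of \<open>J\<close>, every multiple
  \<open>x = cj y * h\<close> is annihilated by \<open>J\<close> modulo \<open>P\<close>, because
  \<open>y * cj y\<close> is in \<open>P\<close>. Some \<open>h\<close> keeps \<open>x\<close>
  outside \<open>J0\<close>; otherwise the elements \<open>z\<close> with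
  \<open>z H \<subseteq> J0\<close> would form a member of \<open>Zs\<close>, equal to
  \<open>J0\<close>, and \<open>J0\<close> would be two-sided.\<close>

lemma ex_colon: assumes J: "J \<in> Zs" obtains x where "x \<in> H" "x \<notin> J0" "colon x = J"
proof -
  obtain y where y: "y \<in> H" "J = lmul y" "P = O_mul (nrd s y)" using Zs_generator[OF J] by metis
  have nP: "nrd s y \<in> P" using y(3) O_mul_self by blast
  define K where "K = {z \<in> H. \<forall>h\<in>H. z * h \<in> J0}"
  have "cj y \<notin> K"
  proof
    assume yK: "cj y \<in> K"
    have li: "left_ideal K"
      unfolding left_ideal_def K_def using H_0 H_add H_mult J0L(2,3,4) by (auto simp: distrib_right mult.assoc)
    have sub: "PH P \<subseteq> K" unfolding K_def using PH_sub[OF PD(1)] PH_rmult[OF PD(1)] ZsD(6)[OF J0_Zs] by blast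
    have KJ: "K \<subseteq> J0" unfolding K_def using H_1 by (auto dest!: bspec[of _ _ 1])
    have "cj y \<notin> PH P"
    proof
      assume "cj y \<in> PH P"
      hence "y \<in> PH P" using PH_cj[OF PD(1), of "cj y"] by simp
      hence "lmul y \<subseteq> PH P" unfolding lmul_def using PH_lmult[OF PD(1)] by blast
      thus False using ZsD(2,3)[OF J] y(2) by blast
    qed
    hence "K \<noteq> PH P" using yK by blast
    moreover have "K \<noteq> H" using KJ ZsD(5)[OF J0_Zs] H_1 by blast
    ultimately have "K \<in> Zs" unfolding Zs_def using li sub by blast
    hence "K = J0" using Zs_minimal[OF _ J0_Zs KJ] by blast
    hence "j * h \<in> J0" if "j \<in> J0" "h \<in> H" for j h using that unfolding K_def by blast
    thus False using Zs_not_two_sided[OF J0_Zs] by blast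
  qed
  then obtain h where h: "h \<in> H" "cj y * h \<notin> J0" unfolding K_def using H_cj[OF y(1)] by blast
  define x where "x = cj y * h"
  have xH: "x \<in> H" unfolding x_def using y(1) h(1) by (intro H_mult H_cj)
  have xJ: "x \<notin> J0" using h(2) by (simp add: x_def)
  have "J \<subseteq> colon x"
  proof
    fix z assume "z \<in> J"
    then obtain g where g: "g \<in> H" "z = g * y" unfolding y(2) lmul_def by blast
    have "z * x = g * ((y * cj y) * h)" by (simp add: g(2) x_def mult.assoc)
    also have "\<dots> = s (nrd s y) (g * h)" by (simp add: mult_cj scalar_mult scale_mult_right)
    also have "\<dots> \<in> J0" using PH_base[OF nP H_mult[OF g(1) h(1)]] by (rule ZsD(6)[OF J0_Zs])
    finally show "z \<in> colon x" unfolding colon_def using g y(1) H_mult by blast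
  qed
  hence "J = colon x" by (rule Zs_minimal[OF J colon_Zs[OF xH xJ]])
  thus ?thesis using that xH xJ by blast
qed

text \<open>Perceptivity enters here: a norm one element that brings \<open>x\<close> into
  \<open>G\<close> moves \<open>J0\<close> to \<open>colon x\<close>, and every member of
  \<open>Zs\<close> is of that form.\<close>

lemma act_transitive: assumes J: "J \<in> Zs" shows "\<exists>u\<in>norm_one s H. act u = J"
proof -
  obtain x where x: "x \<in> H" "x \<notin> J0" "colon x = J" by (rule ex_colon[OF J])
  obtain u where "u \<in> norm_one s H" "u * x \<in> G" using perc x(1) unfolding perceptive_def by blast
  thus ?thesis using mult_mem_G_iff[OF _ x(1,2)] x(3) by blast
qed

lemma norm_one_G: "norm_one s G = {u \<in> norm_one s H. act u = J0}"
proof -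
  have "u \<in> G \<longleftrightarrow> act u = J0" if u: "u \<in> norm_one s H" for u
  proof -
    have "u \<in> G \<longleftrightarrow> act u \<subseteq> J0" using mem_G_iff[of u] norm_oneD[OF u] unfolding act_def by blast
    thus ?thesis using Zs_minimal[OF act_Zs[OF u] J0_Zs] by blast
  qed
  thus ?thesis using GH unfolding norm_one_def by blast
qed

text \<open>If \<open>w\<close> moves \<open>J0\<close> to \<open>J\<close>, the fibre over
  \<open>J\<close> is the coset of \<open>w\<close> with respect to the stabilizer
  \<open>norm_one s G\<close>.\<close>

lemma card_fiber:
  assumes J: "J \<in> Zs"
  shows "card {u \<in> norm_one s H. act u = J} = card (norm_one s G)"
    "finite (norm_one s G) \<Longrightarrow> finite {u \<in> norm_one s H. act u = J}"
proof -
  obtain w where w: "w \<in> norm_one s H" "act w = J" using act_transitive[OF J] by blast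
  note wD = norm_oneD[OF w(1)]
  have am: "act (g * v) = (\<lambda>z. z * v) ` act g" for g v unfolding act_def by (simp add: image_image mult.assoc)
  have "bij_betw (\<lambda>g. g * w) (norm_one s G) {u \<in> norm_one s H. act u = J}"
  proof (rule bij_betw_byWitness[of _ "\<lambda>u. u * cj w"])
    show "\<forall>a\<in>norm_one s G. a * w * cj w = a" using wD by (simp add: mult.assoc)
    show "\<forall>a\<in>{u \<in> norm_one s H. act u = J}. a * cj w * w = a" using wD by (simp add: mult.assoc)
    show "(\<lambda>g. g * w) ` norm_one s G \<subseteq> {u \<in> norm_one s H. act u = J}"
    proof clarify
      fix g assume "g \<in> norm_one s G"
      hence g: "g \<in> norm_one s H" "act g = J0" unfolding norm_one_G by auto
      have "act (g * w) = J" unfolding am g(2) using w(2) by (simp add: act_def)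
      thus "g * w \<in> norm_one s H \<and> act (g * w) = J" using norm_one_mult[OF g(1) w(1)] by blast
    qed
    show "(\<lambda>u. u * cj w) ` {u \<in> norm_one s H. act u = J} \<subseteq> norm_one s G"
    proof clarify
      fix u assume u: "u \<in> norm_one s H" "J = act u"
      have "act (u * cj w) = (\<lambda>z. z * cj w) ` act w" unfolding am using u(2) w(2) by simp
      also have "\<dots> = J0" unfolding act_def image_image using wD by (simp add: mult.assoc)
      finally show "u * cj w \<in> norm_one s G" unfolding norm_one_G
        using norm_one_mult[OF u(1)] wD by blast
    qed
  qed
  from bij_betw_same_card[OF this] bij_betw_finite[OF this]
  show "card {u \<in> norm_one s H. act u = J} = card (norm_one s G)"
    "finite (norm_one s G) \<Longrightarrow> finite {u \<in> norm_one s H. act u = J}" by auto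
qed

lemma card_norm_one:
  assumes fin: "finite (norm_one s G)"
  shows "finite (norm_one s H)" "card (norm_one s H) = (ideal_norm P + 1) * card (norm_one s G)"
proof -
  have fZ: "finite Zs" by (rule card_Zs_cases(3))
  have un: "norm_one s H = (\<Union>J\<in>Zs. {u \<in> norm_one s H. act u = J})" using act_Zs by blast
  show fH: "finite (norm_one s H)" by (subst un) (use fZ card_fiber(2)[OF _ fin] in blast)
  have "card (norm_one s H) = (\<Sum>J\<in>Zs. card {u \<in> norm_one s H. act u = J})"
    using fZ fH by (subst un, intro card_UN_disjoint) auto
  also have "\<dots> = card Zs * card (norm_one s G)" using card_fiber(1) by simp
  finally show "card (norm_one s H) = (ideal_norm P + 1) * card (norm_one s G)"
    using card_Zs_cases(2)[OF split] by simp
qed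

lemma card_into_G:
  assumes x: "x \<in> H"
  shows "card {u \<in> norm_one s H. u * x \<in> G} = (if x \<in> J0 then card (norm_one s H) else card (norm_one s G))"
proof (cases "x \<in> J0")
  case True
  hence "{u \<in> norm_one s H. u * x \<in> G} = norm_one s H" using J0L(4) J0_sub norm_oneD by blast
  thus ?thesis using True by simp
next
  case False
  have "{u \<in> norm_one s H. u * x \<in> G} = {u \<in> norm_one s H. act u = colon x}" using mult_mem_G_iff[OF _ x False] by blast
  thus ?thesis using False card_fiber(1)[OF colon_Zs[OF x False]] by simp
qed

text \<open>
  Double counting of the pairs \<open>(u, x)\<close> with \<open>u\<close> of norm one, \<open>x \<in> H\<close> of norm \<open>\<alpha>\<close> and \<open>u * x \<in> G\<close>.
\<close>

lemma rep_count_G: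
  assumes fin: "finite (norm_one s G)" and X: "finite {q \<in> H. nrd s q = \<alpha>}"
  shows "(ideal_norm P + 1) * rep_count s G \<alpha> = rep_count s H \<alpha> + ideal_norm P * card {q \<in> J0. nrd s q = \<alpha>}"
proof -
  define X where "X = {q \<in> H. nrd s q = \<alpha>}"
  have fX: "finite X" using X by (simp add: X_def)
  define N where "N = ideal_norm P"
  define g where "g = card (norm_one s G)"
  note cH = card_norm_one[OF fin]
  have "1 \<in> norm_one s G" using G.H_1 by (simp add: norm_one_def)
  hence g0: "g > 0" unfolding g_def using fin by (auto simp: card_gt_0_iff)
  have inner: "card {x \<in> X. u * x \<in> G} = rep_count s G \<alpha>" if u: "u \<in> norm_one s H" for u
  proof -
    note uD = norm_oneD[OF u]
    have "bij_betw (\<lambda>x. u * x) {x \<in> X. u * x \<in> G} {q \<in> G. nrd s q = \<alpha>}"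
    proof (rule bij_betw_byWitness[of _ "\<lambda>q. cj u * q"])
      show "\<forall>a\<in>{x \<in> X. u * x \<in> G}. cj u * (u * a) = a" using uD by (simp add: mult.assoc[symmetric])
      show "\<forall>a\<in>{q \<in> G. nrd s q = \<alpha>}. u * (cj u * a) = a" using uD by (simp add: mult.assoc[symmetric])
      show "(\<lambda>x. u * x) ` {x \<in> X. u * x \<in> G} \<subseteq> {q \<in> G. nrd s q = \<alpha>}" using uD by (auto simp: X_def nrd_mult)
      show "(\<lambda>q. cj u * q) ` {q \<in> G. nrd s q = \<alpha>} \<subseteq> {x \<in> X. u * x \<in> G}"
      proof (rule image_subsetI)
        fix q assume "q \<in> {q \<in> G. nrd s q = \<alpha>}"
        hence q: "q \<in> G" "nrd s q = \<alpha>" by auto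
        have "u * (cj u * q) = q" using uD by (simp add: mult.assoc[symmetric])
        moreover have "cj u * q \<in> H" using uD q(1) GH H_mult by (auto simp: norm_one_def)
        ultimately show "cj u * q \<in> {x \<in> X. u * x \<in> G}" using q uD by (simp add: X_def nrd_mult)
      qed
    qed
    thus ?thesis unfolding rep_count_def by (rule bij_betw_same_card)
  qed
  define A where "A = {q \<in> J0. nrd s q = \<alpha>}"
  have AX: "A \<subseteq> X" unfolding A_def X_def using J0L(1) by blast
  have XA: "x \<in> J0 \<longleftrightarrow> x \<in> A" if "x \<in> X" for x using that by (auto simp: A_def X_def)
  have "card (norm_one s H) * rep_count s G \<alpha> = (\<Sum>u\<in>norm_one s H. card {x \<in> X. u * x \<in> G})" using inner by simp
  also have "\<dots> = (\<Sum>u\<in>norm_one s H. \<Sum>x\<in>X. if u * x \<in> G then 1 else 0)"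
    using fX by (intro sum.cong) (auto simp: sum.If_cases Int_def)
  also have "\<dots> = (\<Sum>x\<in>X. \<Sum>u\<in>norm_one s H. if u * x \<in> G then 1 else 0)" by (rule sum.swap)
  also have "\<dots> = (\<Sum>x\<in>X. card {u \<in> norm_one s H. u * x \<in> G})"
    using cH(1) by (intro sum.cong) (auto simp: sum.If_cases Int_def)
  also have "\<dots> = (\<Sum>x\<in>X. if x \<in> A then card (norm_one s H) else g)"
  proof (rule sum.cong[OF refl])
    fix x assume x: "x \<in> X"
    hence "x \<in> H" by (simp add: X_def)
    from card_into_G[OF this] XA[OF x]
    show "card {u \<in> norm_one s H. u * x \<in> G} = (if x \<in> A then card (norm_one s H) else g)" by (simp add: g_def)
  qed
  also have "\<dots> = card A * card (norm_one s H) + card (X - A) * g"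
  proof -
    have "X \<inter> {x. x \<in> A} = A" "X \<inter> - {x. x \<in> A} = X - A" using AX by blast+
    thus ?thesis using fX by (simp add: sum.If_cases)
  qed
  finally have e: "card (norm_one s H) * rep_count s G \<alpha> = card A * card (norm_one s H) + card (X - A) * g" .
  have cX: "card X = card A + card (X - A)" using AX fX by (metis card_Diff_subset card_mono finite_subset le_add_diff_inverse)
  have "g * ((N + 1) * rep_count s G \<alpha>) = g * (card A * (N + 1) + card (X - A))"
    using e unfolding cH(2) g_def[symmetric] N_def[symmetric] by (simp add: algebra_simps)
  hence "(N + 1) * rep_count s G \<alpha> = card A * (N + 1) + card (X - A)" using g0 by simp
  also have "\<dots> = card X + N * card A" using cX by (simp add: algebra_simps)
  finally show ?thesis by (simp add: N_def A_def X_def rep_count_def)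
qed

section \<open>Combining the counts\<close>

text \<open>Taking for \<pi> the norm of a generator of \<open>J0\<close> itself makes the norms
  match exactly, with no unit left to correct.\<close>

lemma rep_count_J0:
  shows "\<exists>\<pi>. prime_el \<pi> \<and> P = O_mul \<pi> \<and> (\<forall>\<alpha>. card {q \<in> J0. nrd s q = \<alpha>} = rep_count s H (\<alpha> / \<pi>))"
proof -
  obtain y where y: "y \<in> H" "y \<noteq> 0" "J0 = lmul y" "P = O_mul (nrd s y)" by (rule Zs_generator[OF J0_Zs])
  define \<pi> where "\<pi> = nrd s y"
  have p0: "\<pi> \<noteq> 0" unfolding \<pi>_def using y(2) by (simp add: nrd_eq_0_iff)
  have pe: "prime_el \<pi>" unfolding prime_el_def \<pi>_def using y nrd_integral nrd_totally_positive P by simp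
  show ?thesis
  proof (intro exI conjI allI)
    show "prime_el \<pi>" by (rule pe)
    show "P = O_mul \<pi>" using y(4) by (simp add: \<pi>_def)
    show "card {q \<in> J0. nrd s q = \<alpha>} = rep_count s H (\<alpha> / \<pi>)" for \<alpha>
    proof -
      have "{q \<in> J0. nrd s q = \<alpha>} = (\<lambda>h. h * y) ` {h \<in> H. nrd s h = \<alpha> / \<pi>}"
        unfolding y(3) lmul_def using p0 by (auto simp: nrd_mult \<pi>_def[symmetric])
      moreover have "inj_on (\<lambda>h. h * y) {h \<in> H. nrd s h = \<alpha> / \<pi>}"
        by (rule inj_onI) (simp add: quat_mult_cancel_right[OF y(2)])
      ultimately show ?thesis unfolding rep_count_def by (simp add: card_image)
    qed
  qed
qed

text \<open>The representation numbers of \<open>H\<close> are proportional to divisor sums, and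
  \<open>tau\<close> links the sums at \<alpha> and \<open>\<alpha> / \<pi>\<close>. The additive
  form avoids truncated subtraction of natural numbers.\<close>

lemma rep_count_formula:
  assumes E: "O_ideal E" and ED: "\<And>P. O_prime P \<Longrightarrow> E \<subseteq> P \<longleftrightarrow> disc s H \<subseteq> P"
    and a: "algebraic_int \<alpha>" "totally_positive \<alpha>"
  shows "rep_count s G \<alpha> + card (norm_one s G) * ideal_sigma (ideal_prod OK P E) \<alpha>
    = 2 * card (norm_one s G) * ideal_sigma E \<alpha>"
proof (cases "finite (norm_one s G)")
  \<comment> \<open>Cardinalities of infinite sets are 0. If \<open>norm_one s G\<close> is
    infinite, one element of norm \<alpha> yields infinitely many, so both sides vanish.\<close>
  case False
  have "rep_count s G \<alpha> = 0"
  proof (cases "{q \<in> G. nrd s q = \<alpha>} = {}")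
    case True
    show ?thesis unfolding rep_count_def True by simp
  next
    case ne: False
    then obtain q where q: "q \<in> G" "nrd s q = \<alpha>" by blast
    have "q \<noteq> 0" using q(2) totally_positive_nonzero[OF a(2)] by auto
    hence "inj_on (\<lambda>u. u * q) (norm_one s G)" by (intro inj_onI) (simp add: quat_mult_cancel_right)
    moreover have "(\<lambda>u. u * q) ` norm_one s G \<subseteq> {q \<in> G. nrd s q = \<alpha>}"
      using q G.H_mult by (auto simp: norm_one_def nrd_mult)
    ultimately have "infinite {q \<in> G. nrd s q = \<alpha>}" using False inj_on_finite by blast
    thus ?thesis by (simp add: rep_count_def)
  qed
  thus ?thesis using False by simp
next
  case fin: True
  have a0: "\<alpha> \<noteq> 0" by (rule totally_positive_nonzero[OF a(2)])
  define N where "N = ideal_norm P"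
  define g where "g = card (norm_one s G)"
  note cH = card_norm_one[OF fin]
  note cL = card_LI[OF E ED]
  have rH: "rep_count s H \<beta> = (N + 1) * g * ideal_sigma E \<beta>" and fX: "finite {q \<in> H. nrd s q = \<beta>}"
    if "algebraic_int \<beta>" "totally_positive \<beta>" for \<beta>
  proof -
    have "finite (LI \<beta>) \<and> card (LI \<beta>) = ideal_sigma E \<beta>"
      by (rule cL[OF _ that(1) totally_positive_nonzero[OF that(2)]])
    thus "rep_count s H \<beta> = (N + 1) * g * ideal_sigma E \<beta>" "finite {q \<in> H. nrd s q = \<beta>}"
      using rep_count_H[OF that] cH by (auto simp: N_def g_def)
  qed
  obtain \<pi> where \<pi>: "prime_el \<pi>" "P = O_mul \<pi>"
    and J1: "\<forall>\<alpha>. card {q \<in> J0. nrd s q = \<alpha>} = rep_count s H (\<alpha> / \<pi>)" using rep_count_J0 by blast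
  have p0: "\<pi> \<noteq> 0" by (rule prime_el_nonzero[OF \<pi>(1)])
  have EP: "\<not> E \<subseteq> P" using ED[OF P] split by simp
  have sP: "ideal_sigma (ideal_prod OK P E) \<alpha> = tau E P \<alpha>" by (rule sigma_prod_prime[OF \<pi> E a(1) a0])
  note main = rep_count_G[OF fin fX[OF a], folded N_def]
  show ?thesis
  proof (cases "\<alpha> \<in> P")
    \<comment> \<open>Norms from \<open>J0\<close> lie in \<open>P\<close>, so its contribution is
      zero; all divisors of \<alpha> are prime to \<open>P\<close>, so the two divisor sums
      agree.\<close>
    case False
    have "{q \<in> J0. nrd s q = \<alpha>} = {}" using Zs_nrd[OF J0_Zs] False by blast
    hence "card {q \<in> J0. nrd s q = \<alpha>} = 0" by (simp only: card.empty)
    hence "(N + 1) * rep_count s G \<alpha> = (N + 1) * (g * ideal_sigma E \<alpha>)"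
      using main unfolding rH[OF a] by (simp add: algebra_simps)
    hence "rep_count s G \<alpha> = g * ideal_sigma E \<alpha>" by (simp only: mult_cancel1) simp
    thus ?thesis unfolding sP sigma_not_dvd[OF \<pi> E a(1) False] g_def by simp
  next
    case True
    then obtain \<beta> where \<beta>: "algebraic_int \<beta>" "\<alpha> = \<pi> * \<beta>" unfolding \<pi>(2) O_mul_def by auto
    have b0: "\<beta> \<noteq> 0" using \<beta>(2) a0 by auto
    have "totally_positive \<beta>"
      unfolding totally_positive_def
    proof (intro allI impI)
      fix \<sigma> :: "'k \<Rightarrow> real" assume \<sigma>: "field_embedding \<sigma>"
      have "\<sigma> \<pi> > 0" "\<sigma> \<alpha> > 0" using \<pi>(1) a(2) \<sigma> by (auto simp: prime_el_def totally_positive_def)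
      thus "\<sigma> \<beta> > 0" unfolding \<beta>(2) emb_mult[OF \<sigma>] by (simp add: zero_less_mult_iff)
    qed
    note rb = rH[OF \<beta>(1) this]
    have "\<alpha> / \<pi> = \<beta>" using \<beta>(2) p0 by simp
    hence "(N + 1) * rep_count s G \<alpha> = (N + 1) * (g * ideal_sigma E \<alpha> + N * (g * ideal_sigma E \<beta>))"
      using main unfolding J1[rule_format] rH[OF a] by (simp only: rb) (simp add: algebra_simps)
    hence r: "rep_count s G \<alpha> = g * ideal_sigma E \<alpha> + N * (g * ideal_sigma E \<beta>)" by (simp only: mult_cancel1) simp
    have sa: "ideal_sigma E \<alpha> = tau E P \<beta> + N * ideal_sigma E \<beta>"
      unfolding \<beta>(2) N_def by (rule sigma_mult_not_dvd[OF \<pi> E EP \<beta>(1) b0])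
    have ta: "tau E P \<alpha> = tau E P \<beta>" unfolding \<beta>(2) by (rule tau_mult[OF \<pi> E \<beta>(1) b0])
    show ?thesis unfolding sP r ta g_def[symmetric] sa by (simp add: algebra_simps)
  qed
qed

end

theorem theorem3p23:
  fixes s :: "'k::field_char_0 \<Rightarrow> 'a::ring_1 \<Rightarrow> 'a"
    and H G :: "'a set"
    and D Q :: "'k set"
    and Ps :: "'k set list"
    and \<alpha> :: 'k
  assumes "number_field TYPE('k)"
    and "totally_real TYPE('k)"
    and "quaternion_algebra s"
    and "totally_definite s"
    and "maximal_order s H"
    and "class_number s H = 1"
    and "is_discrd s H D"
    and "\<forall>P\<in>set Ps. prime_of_OK P"
    and "D = ideal_list_prod Ps"
    and "quat_order s G"
    and "G \<subseteq> H"
    and "perceptive s H G"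
    and "is_OK_index s H G Q"
    and "prime_of_OK Q"
    and "\<not> ideal_dvd Q D"
    and "\<alpha> \<in> carrier OK"
    and "totally_positive \<alpha>"
  shows "int (rep_count s G \<alpha>) =
           2 * int (card (norm_one s G)) * int (ideal_sigma D \<alpha>)
           - int (card (norm_one s G)) * int (ideal_sigma (ideal_prod OK Q D) \<alpha>)"
proof -
  interpret quaternion_algebra s by fact
  interpret class_one_order s H by unfold_locales fact+
  have D: "O_ideal D" "ideal_prod OK D D = disc s H" using assms(7) unfolding is_discrd_def O_ideal_iff by auto
  \<comment> \<open>The discriminant is the square of \<open>D\<close>, so the same primes contain
    both.\<close>
  have dd: "D \<subseteq> P \<longleftrightarrow> disc s H \<subseteq> P" if P: "O_prime P" for P
  proof
    show "D \<subseteq> P \<Longrightarrow> disc s H \<subseteq> P" using ideal_prod_subset(1)[OF D(1) D(1)] D(2) by blast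
    assume sub: "disc s H \<subseteq> P"
    show "D \<subseteq> P"
    proof
      fix x assume x: "x \<in> D"
      have "x * x \<in> P" using ideal_prod.prod[OF x x, of OK] D(2) sub by auto
      thus "x \<in> P" using O_primeD(3)[OF P] O_idealD(2)[OF D(1) x] by blast
    qed
  qed
  have Q: "O_prime Q" using assms(14) O_prime_iff by blast
  have nd: "\<not> disc s H \<subseteq> Q" using assms(15) dd[OF Q] prime_dvd_iff[OF Q D(1)] by blast
  interpret prime_suborder s H Q G by unfold_locales (fact Q nd assms)+
  have "rep_count s G \<alpha> + card (norm_one s G) * ideal_sigma (ideal_prod OK Q D) \<alpha>
    = 2 * card (norm_one s G) * ideal_sigma D \<alpha>"
    using assms(16,17) by (intro rep_count_formula[OF D(1) dd]) simp_all
  hence "int (rep_count s G \<alpha>) + int (card (norm_one s G)) * int (ideal_sigma (ideal_prod OK Q D) \<alpha>)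
    = 2 * int (card (norm_one s G)) * int (ideal_sigma D \<alpha>)"
    by (metis of_nat_add of_nat_mult of_nat_numeral)
  thus ?thesis by simp
qed

end
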